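(* Let $H$ be a finite-dimensional hereditary algebra over a field and $\mathcal D=D^b(H)$. (a) Let $G:\mathcal D\to\mathcal D$ be a triangle autoequivalence satisfying (g1) and (g2), and let $\widetilde{\mathcal T}$ be an $\operatorname{Ext}$-configuration in $\mathcal D/G$. Then $\mathcal T=\{X\in\operatorname{ind}\mathcal D\mid\widetilde X\in\widetilde{\mathcal T}\}$ is an $\operatorname{Ext}$-configuration in $\mathcal D$. (b) Let $\mathcal T$ be an $\operatorname{Ext}$-configuration in $\mathcal D$. Then $\widetilde{\mathcal T}=\{\widetilde X\mid X\in\mathcal T\}$ is an $\operatorname{Ext}$-configuration in $\mathcal C=D^b(H)/F$.
   Context: $\mathcal D$ is the bounded derived category of finitely generated $H$-modules, with shift $[1]$ and Auslander–Reiten translation $\tau$ (an autoequivalence); $F=\tau^{-1}[1]$. $\operatorname{ind}$ denotes the set of isomorphism classes of indecomposable objects. Conditions: (g1) for each $U\in\operatorname{ind}H$, $G^nU$ lies in $\operatorname{ind}H$ for only finitely many $n\in\mathbb Z$; (g2) there is $N\in\mathbb N$ such that $\{U[n]\mid U\in\operatorname{ind}H,\ n\in[-N,N]\}$ contains a system of representatives of the orbits of $G$ on $\operatorname{ind}\mathcal D$. $F$ satisfies (g1) and (g2). The factor category $\mathcal D/G$ has as objects the $G$-orbits $\widetilde X$ of objects $X$ of $\mathcal D$, and $\operatorname{Hom}_{\mathcal D/G}(\widetilde X,\widetilde Y)=\coprod_{i\in\mathbb Z}\operatorname{Hom}_{\mathcal D}(G^iX,Y)$; it is triangulated with shift induced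 by $[1]$, and $\operatorname{Ext}^1(U,V)=\operatorname{Hom}(U,V[1])$ in both $\mathcal D$ and $\mathcal D/G$. In $\mathcal D$ or $\mathcal D/G$, a set $\mathcal T$ of non-isomorphic indecomposable objects is an $\operatorname{Ext}$-configuration if (E1) $\operatorname{Ext}^1(X,Y)=0$ for all $X,Y\in\mathcal T$, and (E2) for every indecomposable $Z\notin\mathcal T$ there is some $X\in\mathcal T$ with $\operatorname{Ext}^1(X,Z)\ne0$. *)

theory Defs
  imports Complex_Main "HOL-Algebra.FiniteProduct" "HOL-Library.Function_Algebras"
begin

section \<open>Categories with abelian groups of morphisms\<close>

text \<open>
  A category is given by hom-sets. Since the sets \<open>Hom C X Y\<close> need not be disjoint, composition
  and the action of functors on morphisms carry the objects as arguments:
  \<open>Cmp C X Y Z g f\<close> is the composite of \<open>f : X \<rightarrow> Y\<close> and \<open>g : Y \<rightarrow> Z\<close>.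
\<close>

record ('o, 'a) cat =
  Ob  :: "'o set"
  Hom :: "'o \<Rightarrow> 'o \<Rightarrow> 'a set"
  Cmp :: "'o \<Rightarrow> 'o \<Rightarrow> 'o \<Rightarrow> 'a \<Rightarrow> 'a \<Rightarrow> 'a"
  Idn :: "'o \<Rightarrow> 'a"
  Add :: "'o \<Rightarrow> 'o \<Rightarrow> 'a \<Rightarrow> 'a \<Rightarrow> 'a"
  Nul :: "'o \<Rightarrow> 'o \<Rightarrow> 'a"

definition hom_group :: "('o, 'a) cat \<Rightarrow> 'o \<Rightarrow> 'o \<Rightarrow> 'a monoid" where
  "hom_group C X Y = \<lparr>carrier = Hom C X Y, mult = Add C X Y, one = Nul C X Y\<rparr>"

definition is_iso :: "('o, 'a) cat \<Rightarrow> 'o \<Rightarrow> 'o \<Rightarrow> 'a \<Rightarrow> bool" where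
  "is_iso C X Y f \<longleftrightarrow> f \<in> Hom C X Y \<and>
     (\<exists>g \<in> Hom C Y X. Cmp C X Y X g f = Idn C X \<and> Cmp C Y X Y f g = Idn C Y)"

definition isomorphic :: "('o, 'a) cat \<Rightarrow> 'o \<Rightarrow> 'o \<Rightarrow> bool" where
  "isomorphic C X Y \<longleftrightarrow> (\<exists>f. is_iso C X Y f)"

definition iso_class :: "('o, 'a) cat \<Rightarrow> 'o \<Rightarrow> 'o set" where
  "iso_class C X = {Y \<in> Ob C. isomorphic C X Y}"

definition zero_object :: "('o, 'a) cat \<Rightarrow> 'o \<Rightarrow> bool" where
  "zero_object C X \<longleftrightarrow> Idn C X = Nul C X X"

definition is_direct_sum :: "('o, 'a) cat \<Rightarrow> 'o \<Rightarrow> 'o \<Rightarrow> 'o \<Rightarrow> bool" where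
  "is_direct_sum C A B X \<longleftrightarrow>
     (\<exists>i \<in> Hom C A X. \<exists>j \<in> Hom C B X. \<exists>p \<in> Hom C X A. \<exists>q \<in> Hom C X B.
        Cmp C A X A p i = Idn C A \<and> Cmp C B X B q j = Idn C B \<and>
        Cmp C A X B q i = Nul C A B \<and> Cmp C B X A p j = Nul C B A \<and>
        Add C X X (Cmp C X A X i p) (Cmp C X B X j q) = Idn C X)"

definition indecomposable :: "('o, 'a) cat \<Rightarrow> 'o \<Rightarrow> bool" where
  "indecomposable C X \<longleftrightarrow> X \<in> Ob C \<and> \<not> zero_object C X \<and>
     (\<forall>A \<in> Ob C. \<forall>B \<in> Ob C. is_direct_sum C A B X \<longrightarrow> zero_object C A \<or> zero_object C B)"

definition ind :: "('o, 'a) cat \<Rightarrow> 'o set set" where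
  "ind C = iso_class C ` {X. indecomposable C X}"

subsection \<open>Functors\<close>

record ('o, 'a, 'p, 'b) func =
  fobj :: "'o \<Rightarrow> 'p"
  fmap :: "'o \<Rightarrow> 'o \<Rightarrow> 'a \<Rightarrow> 'b"

definition additive_functor ::
    "('o, 'a) cat \<Rightarrow> ('p, 'b) cat \<Rightarrow> ('o, 'a, 'p, 'b) func \<Rightarrow> bool" where
  "additive_functor C D T \<longleftrightarrow>
     (\<forall>X \<in> Ob C. fobj T X \<in> Ob D \<and> fmap T X X (Idn C X) = Idn D (fobj T X)) \<and>
     (\<forall>X \<in> Ob C. \<forall>Y \<in> Ob C. \<forall>f \<in> Hom C X Y. fmap T X Y f \<in> Hom D (fobj T X) (fobj T Y)) \<and>
     (\<forall>X \<in> Ob C. \<forall>Y \<in> Ob C. \<forall>Z \<in> Ob C. \<forall>f \<in> Hom C X Y. \<forall>g \<in> Hom C Y Z.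
        fmap T X Z (Cmp C X Y Z g f) =
          Cmp D (fobj T X) (fobj T Y) (fobj T Z) (fmap T Y Z g) (fmap T X Y f)) \<and>
     (\<forall>X \<in> Ob C. \<forall>Y \<in> Ob C. \<forall>f \<in> Hom C X Y. \<forall>g \<in> Hom C X Y.
        fmap T X Y (Add C X Y f g) =
          Add D (fobj T X) (fobj T Y) (fmap T X Y f) (fmap T X Y g))"

definition id_func :: "('o, 'a, 'o, 'a) func" where
  "id_func = \<lparr>fobj = (\<lambda>X. X), fmap = (\<lambda>X Y f. f)\<rparr>"

definition comp_func ::
    "('p, 'b, 'q, 'c) func \<Rightarrow> ('o, 'a, 'p, 'b) func \<Rightarrow> ('o, 'a, 'q, 'c) func" where
  "comp_func S T = \<lparr>fobj = (\<lambda>X. fobj S (fobj T X)),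
                    fmap = (\<lambda>X Y f. fmap S (fobj T X) (fobj T Y) (fmap T X Y f))\<rparr>"

definition natural_iso :: "('o, 'a) cat \<Rightarrow> ('p, 'b) cat \<Rightarrow>
    ('o, 'a, 'p, 'b) func \<Rightarrow> ('o, 'a, 'p, 'b) func \<Rightarrow> ('o \<Rightarrow> 'b) \<Rightarrow> bool" where
  "natural_iso C D S T \<eta> \<longleftrightarrow>
     (\<forall>X \<in> Ob C. is_iso D (fobj S X) (fobj T X) (\<eta> X)) \<and>
     (\<forall>X \<in> Ob C. \<forall>Y \<in> Ob C. \<forall>f \<in> Hom C X Y.
        Cmp D (fobj S X) (fobj S Y) (fobj T Y) (\<eta> Y) (fmap S X Y f) =
        Cmp D (fobj S X) (fobj T X) (fobj T Y) (fmap T X Y f) (\<eta> X))"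

text \<open>
  An adjoint equivalence; every equivalence can be completed to one. Here
  \<open>\<eta> : 1 \<rightarrow> G'G\<close> is the unit and \<open>\<theta> : 1 \<rightarrow> GG'\<close> is the inverse of the counit, so that the
  triangle identities read \<open>G\<eta> = \<theta>G\<close> and \<open>G'\<theta> = \<eta>G'\<close>.
\<close>

definition quasi_inverse :: "('o, 'a) cat \<Rightarrow> ('o, 'a, 'o, 'a) func \<Rightarrow> ('o, 'a, 'o, 'a) func \<Rightarrow>
    ('o \<Rightarrow> 'a) \<Rightarrow> ('o \<Rightarrow> 'a) \<Rightarrow> bool" where
  "quasi_inverse C G G' \<eta> \<theta> \<longleftrightarrow>
     additive_functor C C G \<and> additive_functor C C G' \<and>
     natural_iso C C id_func (comp_func G' G) \<eta> \<and>
     natural_iso C C id_func (comp_func G G') \<theta> \<and>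
     (\<forall>X \<in> Ob C. fmap G X (fobj G' (fobj G X)) (\<eta> X) = \<theta> (fobj G X)) \<and>
     (\<forall>X \<in> Ob C. fmap G' X (fobj G (fobj G' X)) (\<theta> X) = \<eta> (fobj G' X))"

subsection \<open>The factor category of an autoequivalence\<close>

primrec npow :: "('o, 'a, 'o, 'a) func \<Rightarrow> nat \<Rightarrow> ('o, 'a, 'o, 'a) func" where
  "npow G 0 = id_func"
| "npow G (Suc n) = comp_func G (npow G n)"

definition ipow :: "('o, 'a, 'o, 'a) func \<Rightarrow> ('o, 'a, 'o, 'a) func \<Rightarrow> int \<Rightarrow>
    ('o, 'a, 'o, 'a) func" where
  "ipow G G' i = (if 0 \<le> i then npow G (nat i) else npow G' (nat (- i)))"

text \<open>
  For \<open>\<theta> : 1 \<rightarrow> PQ\<close>, the morphism \<open>expand C P Q \<theta> j m X\<close> is the isomorphism from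
  \<open>P\<^sup>j\<^sup>-\<^sup>m X\<close> (to be read as \<open>Q\<^sup>m\<^sup>-\<^sup>j X\<close> if \<open>j < m\<close>) to \<open>P\<^sup>j Q\<^sup>m X\<close> that inserts the
  missing factors \<open>PQ\<close> one after the other by means of \<open>\<theta>\<close>.
\<close>

fun expand :: "('o, 'a) cat \<Rightarrow> ('o, 'a, 'o, 'a) func \<Rightarrow> ('o, 'a, 'o, 'a) func \<Rightarrow> ('o \<Rightarrow> 'a) \<Rightarrow>
    nat \<Rightarrow> nat \<Rightarrow> 'o \<Rightarrow> 'a" where
  "expand C P Q \<theta> 0 m X = Idn C (fobj (npow Q m) X)"
| "expand C P Q \<theta> (Suc j) 0 X = Idn C (fobj (npow P (Suc j)) X)"
| "expand C P Q \<theta> (Suc j) (Suc m) X =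
     Cmp C (fobj (ipow P Q (int j - int m)) X)
           (fobj (npow P j) (fobj (npow Q m) X))
           (fobj (npow P (Suc j)) (fobj (npow Q (Suc m)) X))
       (fmap (npow P j) (fobj (npow Q m) X) (fobj P (fobj Q (fobj (npow Q m) X)))
          (\<theta> (fobj (npow Q m) X)))
       (expand C P Q \<theta> j m X)"

text \<open>The canonical isomorphism \<open>G\<^sup>j\<^sup>+\<^sup>i X \<rightarrow> G\<^sup>j G\<^sup>i X\<close>.\<close>

definition coherence :: "('o, 'a) cat \<Rightarrow> ('o, 'a, 'o, 'a) func \<Rightarrow> ('o, 'a, 'o, 'a) func \<Rightarrow>
    ('o \<Rightarrow> 'a) \<Rightarrow> ('o \<Rightarrow> 'a) \<Rightarrow> int \<Rightarrow> int \<Rightarrow> 'o \<Rightarrow> 'a" where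
  "coherence C G G' \<eta> \<theta> j i X =
     (if 0 \<le> j \<and> i < 0 then expand C G G' \<theta> (nat j) (nat (- i)) X
      else if j < 0 \<and> 0 \<le> i then expand C G' G \<eta> (nat (- j)) (nat i) X
      else Idn C (fobj (ipow G G' (j + i)) X))"

text \<open>
  The objects of the factor category are represented by objects \<open>X\<close> of \<open>C\<close>, where \<open>X\<close> stands for its
  orbit; all \<open>G\<^sup>i X\<close> become isomorphic. A morphism from \<open>X\<close> to \<open>Y\<close> is an element of the
  coproduct of the groups \<open>Hom C (G\<^sup>i X) Y\<close>, \<open>i \<in> \<int>\<close>, i.e. a family with finite support. The
  composite of \<open>f : G\<^sup>i X \<rightarrow> Y\<close> and \<open>g : G\<^sup>j Y \<rightarrow> Z\<close> is \<open>g \<circ> G\<^sup>j f\<close>, regarded as a morphism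
  \<open>G\<^sup>j\<^sup>+\<^sup>i X \<rightarrow> Z\<close>. The product over the (additively written) hom-group is a finite sum.
\<close>

definition orbit_cat :: "('o, 'a) cat \<Rightarrow> ('o, 'a, 'o, 'a) func \<Rightarrow> ('o, 'a, 'o, 'a) func \<Rightarrow>
    ('o \<Rightarrow> 'a) \<Rightarrow> ('o \<Rightarrow> 'a) \<Rightarrow> ('o, int \<Rightarrow> 'a) cat" where
  "orbit_cat C G G' \<eta> \<theta> =
    (let pw = (\<lambda>i. fobj (ipow G G' i)) in
    \<lparr>Ob = Ob C,
     Hom = (\<lambda>X Y. {f. (\<forall>i. f i \<in> Hom C (pw i X) Y) \<and> finite {i. f i \<noteq> Nul C (pw i X) Y}}),
     Cmp = (\<lambda>X Y Z g f n.
       finprod (hom_group C (pw n X) Z)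
         (\<lambda>j. Cmp C (pw n X) (pw j (pw (n - j) X)) Z
            (Cmp C (pw j (pw (n - j) X)) (pw j Y) Z
               (g j)
               (fmap (ipow G G' j) (pw (n - j) X) Y (f (n - j))))
            (coherence C G G' \<eta> \<theta> j (n - j) X))
         {j. g j \<noteq> Nul C (pw j Y) Z}),
     Idn = (\<lambda>X i. if i = 0 then Idn C X else Nul C (pw i X) X),
     Add = (\<lambda>X Y f g i. Add C (pw i X) Y (f i) (g i)),
     Nul = (\<lambda>X Y i. Nul C (pw i X) Y)\<rparr>)"

subsection \<open>Ext-configurations\<close>

text \<open>
  \<open>s\<close> is the shift on objects, so \<open>Ext\<^sup>1(X,Y)\<close> is \<open>Hom C X (s Y)\<close>. A set of pairwise
  non-isomorphic indecomposables is represented by a set of isomorphism classes.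
\<close>

definition ext1_vanishes :: "('o, 'a) cat \<Rightarrow> ('o \<Rightarrow> 'o) \<Rightarrow> 'o \<Rightarrow> 'o \<Rightarrow> bool" where
  "ext1_vanishes C s X Y \<longleftrightarrow> Hom C X (s Y) = {Nul C X (s Y)}"

definition ext_configuration :: "('o, 'a) cat \<Rightarrow> ('o \<Rightarrow> 'o) \<Rightarrow> 'o set set \<Rightarrow> bool" where
  "ext_configuration C s T \<longleftrightarrow> T \<subseteq> ind C \<and>
     (\<forall>X \<in> Ob C. \<forall>Y \<in> Ob C. iso_class C X \<in> T \<longrightarrow> iso_class C Y \<in> T \<longrightarrow> ext1_vanishes C s X Y) \<and>
     (\<forall>Z. indecomposable C Z \<and> iso_class C Z \<notin> T \<longrightarrow>
        (\<exists>X \<in> Ob C. iso_class C X \<in> T \<and> \<not> ext1_vanishes C s X Z))"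


section \<open>Finitely generated modules over a finite-dimensional algebra\<close>

locale fd_algebra = vector_space sc
  for sc :: "'k::field \<Rightarrow> 'h::ring_1 \<Rightarrow> 'h" +
  assumes sc_mult_left: "sc a (x * y) = sc a x * y"
    and sc_mult_right: "sc a (x * y) = x * sc a y"
    and finite_dim: "\<exists>B. finite B \<and> span B = UNIV"

text \<open>
  A finitely generated (left) module over a finite-dimensional \<open>k\<close>-algebra has finite dimension over
  \<open>k\<close>, so up to isomorphism its underlying vector space is a subspace of the space of sequences in
  \<open>k\<close>. Restricting to such modules makes the category of modules small.
  The action is irrelevant outside the carrier.
\<close>

record ('h, 'k) fmod =
  carr :: "(nat \<Rightarrow> 'k) set"
  act  :: "'h \<Rightarrow> (nat \<Rightarrow> 'k) \<Rightarrow> (nat \<Rightarrow> 'k)"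

definition seq_scale :: "'k::field \<Rightarrow> (nat \<Rightarrow> 'k) \<Rightarrow> (nat \<Rightarrow> 'k)" where
  "seq_scale a v = (\<lambda>n. a * v n)"

definition fg_module :: "('k::field \<Rightarrow> 'h::ring_1 \<Rightarrow> 'h) \<Rightarrow> ('h, 'k) fmod \<Rightarrow> bool" where
  "fg_module sc M \<longleftrightarrow>
     module.subspace seq_scale (carr M) \<and>
     (\<forall>h. \<forall>v \<in> carr M. act M h v \<in> carr M) \<and>
     (\<forall>h. \<forall>v \<in> carr M. \<forall>w \<in> carr M. act M h (v + w) = act M h v + act M h w) \<and>
     (\<forall>h h'. \<forall>v \<in> carr M. act M (h + h') v = act M h v + act M h' v) \<and>
     (\<forall>h h'. \<forall>v \<in> carr M. act M (h * h') v = act M h (act M h' v)) \<and>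
     (\<forall>v \<in> carr M. act M 1 v = v) \<and>
     (\<forall>a. \<forall>v \<in> carr M. act M (sc a 1) v = seq_scale a v) \<and>
     (\<exists>B. finite B \<and> B \<subseteq> carr M \<and> (\<forall>v \<in> carr M. \<exists>c. v = (\<Sum>b\<in>B. act M (c b) b)))"

text \<open>Homomorphisms are extended by \<open>0\<close> outside the carrier, so that equality of homomorphisms,
  their composition and their addition are those of functions.\<close>

definition restr0 :: "(nat \<Rightarrow> 'k::field) set \<Rightarrow> ((nat \<Rightarrow> 'k) \<Rightarrow> (nat \<Rightarrow> 'k)) \<Rightarrow>
    (nat \<Rightarrow> 'k) \<Rightarrow> (nat \<Rightarrow> 'k)" where
  "restr0 W f = (\<lambda>v. if v \<in> W then f v else 0)"

definition mod_hom :: "('h, 'k::field) fmod \<Rightarrow> ('h, 'k) fmod \<Rightarrow> ((nat \<Rightarrow> 'k) \<Rightarrow> (nat \<Rightarrow> 'k)) set" where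
  "mod_hom M N = {f.
     (\<forall>v \<in> carr M. f v \<in> carr N) \<and>
     (\<forall>v \<in> carr M. \<forall>w \<in> carr M. f (v + w) = f v + f w) \<and>
     (\<forall>h. \<forall>v \<in> carr M. f (act M h v) = act N h (f v)) \<and>
     (\<forall>v. v \<notin> carr M \<longrightarrow> f v = 0)}"

definition mod_cat :: "('k::field \<Rightarrow> 'h::ring_1 \<Rightarrow> 'h) \<Rightarrow>
    (('h, 'k) fmod, (nat \<Rightarrow> 'k) \<Rightarrow> (nat \<Rightarrow> 'k)) cat" where
  "mod_cat sc =
    \<lparr>Ob = {M. fg_module sc M},
     Hom = mod_hom,
     Cmp = (\<lambda>L M N g f. g \<circ> f),
     Idn = (\<lambda>M. restr0 (carr M) (\<lambda>v. v)),
     Add = (\<lambda>M N f g. f + g),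
     Nul = (\<lambda>M N. 0)\<rparr>"

definition projective_module :: "('k::field \<Rightarrow> 'h::ring_1 \<Rightarrow> 'h) \<Rightarrow> ('h, 'k) fmod \<Rightarrow> bool" where
  "projective_module sc P \<longleftrightarrow> fg_module sc P \<and>
     (\<forall>M N. fg_module sc M \<and> fg_module sc N \<longrightarrow>
       (\<forall>g \<in> mod_hom M N. \<forall>f \<in> mod_hom P N. g ` carr M = carr N \<longrightarrow>
          (\<exists>h \<in> mod_hom P M. g \<circ> h = f)))"

definition submodule_of :: "('k::field \<Rightarrow> 'h::ring_1 \<Rightarrow> 'h) \<Rightarrow>
    ('h, 'k) fmod \<Rightarrow> ('h, 'k) fmod \<Rightarrow> bool" where
  "submodule_of sc M P \<longleftrightarrow> fg_module sc M \<and> carr M \<subseteq> carr P \<and>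
     (\<forall>h. \<forall>v \<in> carr M. act M h v = act P h v)"

definition hereditary_algebra :: "('k::field \<Rightarrow> 'h::ring_1 \<Rightarrow> 'h) \<Rightarrow> bool" where
  "hereditary_algebra sc \<longleftrightarrow> fd_algebra sc \<and>
     (\<forall>P M. projective_module sc P \<and> submodule_of sc M P \<longrightarrow> projective_module sc M)"

definition zero_module :: "('h, 'k::field) fmod" where
  "zero_module = \<lparr>carr = {0}, act = (\<lambda>h v. 0)\<rparr>"

text \<open>The direct sum of two modules, realised on sequences by interleaving.\<close>

definition interleave :: "(nat \<Rightarrow> 'k) \<Rightarrow> (nat \<Rightarrow> 'k) \<Rightarrow> (nat \<Rightarrow> 'k)" where
  "interleave v w = (\<lambda>n. if even n then v (n div 2) else w (n div 2))"

definition evens :: "(nat \<Rightarrow> 'k) \<Rightarrow> (nat \<Rightarrow> 'k)" where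
  "evens u = (\<lambda>n. u (2 * n))"

definition odds :: "(nat \<Rightarrow> 'k) \<Rightarrow> (nat \<Rightarrow> 'k)" where
  "odds u = (\<lambda>n. u (2 * n + 1))"

definition sum_module :: "('h, 'k) fmod \<Rightarrow> ('h, 'k) fmod \<Rightarrow> ('h, 'k) fmod" where
  "sum_module M N =
    \<lparr>carr = {u. evens u \<in> carr M \<and> odds u \<in> carr N},
     act = (\<lambda>h u. interleave (act M h (evens u)) (act N h (odds u)))\<rparr>"


section \<open>The bounded derived category\<close>

subsection \<open>Bounded cochain complexes\<close>

record ('h, 'k) cpx =
  cmod :: "int \<Rightarrow> ('h, 'k) fmod"
  diff :: "int \<Rightarrow> (nat \<Rightarrow> 'k) \<Rightarrow> (nat \<Rightarrow> 'k)"

type_synonym 'k cmap = "int \<Rightarrow> (nat \<Rightarrow> 'k) \<Rightarrow> (nat \<Rightarrow> 'k)"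

definition bounded_complex :: "('k::field \<Rightarrow> 'h::ring_1 \<Rightarrow> 'h) \<Rightarrow> ('h, 'k) cpx \<Rightarrow> bool" where
  "bounded_complex sc X \<longleftrightarrow>
     (\<forall>i. fg_module sc (cmod X i)) \<and>
     (\<forall>i. diff X i \<in> mod_hom (cmod X i) (cmod X (i + 1))) \<and>
     (\<forall>i. diff X (i + 1) \<circ> diff X i = 0) \<and>
     (\<exists>n. \<forall>i. n < \<bar>i\<bar> \<longrightarrow> carr (cmod X i) = {0})"

definition chain_map :: "('h, 'k::field) cpx \<Rightarrow> ('h, 'k) cpx \<Rightarrow> 'k cmap set" where
  "chain_map X Y = {f. \<forall>i. f i \<in> mod_hom (cmod X i) (cmod Y i) \<and>
                           f (i + 1) \<circ> diff X i = diff Y i \<circ> f i}"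

definition cmap_id :: "('h, 'k::field) cpx \<Rightarrow> 'k cmap" where
  "cmap_id X = (\<lambda>i. restr0 (carr (cmod X i)) (\<lambda>v. v))"

definition cmap_comp :: "'k cmap \<Rightarrow> 'k cmap \<Rightarrow> 'k cmap" where
  "cmap_comp g f = (\<lambda>i. g i \<circ> f i)"

definition homotopic :: "('h, 'k::field) cpx \<Rightarrow> ('h, 'k) cpx \<Rightarrow> 'k cmap \<Rightarrow> 'k cmap \<Rightarrow> bool" where
  "homotopic X Y f g \<longleftrightarrow>
     (\<exists>h. \<forall>i. h i \<in> mod_hom (cmod X i) (cmod Y (i - 1)) \<and>
              f i - g i = (diff Y (i - 1) \<circ> h i) + (h (i + 1) \<circ> diff X i))"

definition cocycles :: "('h, 'k::field) cpx \<Rightarrow> int \<Rightarrow> (nat \<Rightarrow> 'k) set" where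
  "cocycles X i = {v \<in> carr (cmod X i). diff X i v = 0}"

definition coboundaries :: "('h, 'k::field) cpx \<Rightarrow> int \<Rightarrow> (nat \<Rightarrow> 'k) set" where
  "coboundaries X i = diff X (i - 1) ` carr (cmod X (i - 1))"

definition cohomology_class :: "('h, 'k::field) cpx \<Rightarrow> int \<Rightarrow> (nat \<Rightarrow> 'k) \<Rightarrow> (nat \<Rightarrow> 'k) set" where
  "cohomology_class X i v = (\<lambda>b. v + b) ` coboundaries X i"

definition cohomology :: "('h, 'k::field) cpx \<Rightarrow> int \<Rightarrow> (nat \<Rightarrow> 'k) set set" where
  "cohomology X i = cohomology_class X i ` cocycles X i"

definition cohomology_map :: "('h, 'k::field) cpx \<Rightarrow> 'k cmap \<Rightarrow> int \<Rightarrow>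
    (nat \<Rightarrow> 'k) set \<Rightarrow> (nat \<Rightarrow> 'k) set" where
  "cohomology_map Y f i c = (\<Union>v \<in> c. cohomology_class Y i (f i v))"

definition quasi_iso :: "('h, 'k::field) cpx \<Rightarrow> ('h, 'k) cpx \<Rightarrow> 'k cmap \<Rightarrow> bool" where
  "quasi_iso X Y f \<longleftrightarrow> f \<in> chain_map X Y \<and>
     (\<forall>i. bij_betw (cohomology_map Y f i) (cohomology X i) (cohomology Y i))"

definition cshift :: "int \<Rightarrow> ('h, 'k::field) cpx \<Rightarrow> ('h, 'k) cpx" where
  "cshift n X =
    \<lparr>cmod = (\<lambda>i. cmod X (i + n)),
     diff = (\<lambda>i. if even n then diff X (i + n) else - diff X (i + n))\<rparr>"

definition cmap_shift :: "int \<Rightarrow> 'k cmap \<Rightarrow> 'k cmap" where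
  "cmap_shift n f = (\<lambda>i. f (i + n))"

definition stalk :: "('h, 'k::field) fmod \<Rightarrow> ('h, 'k) cpx" where
  "stalk M = \<lparr>cmod = (\<lambda>i. if i = 0 then M else zero_module), diff = (\<lambda>i. 0)\<rparr>"

text \<open>The mapping cone: in degree \<open>i\<close> it is \<open>X\<^bsup>i+1\<^esup> \<oplus> Y\<^bsup>i\<^esup>\<close> with differential
  \<open>(x, y) \<mapsto> (- dx, f x + dy)\<close>.\<close>

definition cone :: "('h, 'k::field) cpx \<Rightarrow> ('h, 'k) cpx \<Rightarrow> 'k cmap \<Rightarrow> ('h, 'k) cpx" where
  "cone X Y f =
    \<lparr>cmod = (\<lambda>i. sum_module (cmod X (i + 1)) (cmod Y i)),
     diff = (\<lambda>i. restr0 (carr (sum_module (cmod X (i + 1)) (cmod Y i)))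
       (\<lambda>u. interleave (- diff X (i + 1) (evens u)) (f (i + 1) (evens u) + diff Y i (odds u))))\<rparr>"

definition cone_in :: "('h, 'k::field) cpx \<Rightarrow> 'k cmap" where
  "cone_in Y = (\<lambda>i. restr0 (carr (cmod Y i)) (\<lambda>v. interleave 0 v))"

definition cone_out :: "('h, 'k::field) cpx \<Rightarrow> ('h, 'k) cpx \<Rightarrow> 'k cmap \<Rightarrow> 'k cmap" where
  "cone_out X Y f = (\<lambda>i. restr0 (carr (cmod (cone X Y f) i)) evens)"

subsection \<open>Localisation at the quasi-isomorphisms\<close>

text \<open>
  A morphism \<open>X \<rightarrow> Y\<close> in the derived category is an equivalence class of roofs
  \<open>(W, s, f)\<close>, where \<open>s : W \<rightarrow> X\<close> is a quasi-isomorphism and \<open>f : W \<rightarrow> Y\<close> is a chain map; this is the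
  calculus of fractions in the homotopy category.
\<close>

type_synonym ('h, 'k) roof = "('h, 'k) cpx \<times> 'k cmap \<times> 'k cmap"

definition roofs :: "('k::field \<Rightarrow> 'h::ring_1 \<Rightarrow> 'h) \<Rightarrow> ('h, 'k) cpx \<Rightarrow> ('h, 'k) cpx \<Rightarrow>
    ('h, 'k) roof set" where
  "roofs sc X Y = {(W, s, f). bounded_complex sc W \<and> quasi_iso W X s \<and> f \<in> chain_map W Y}"

definition roof_eq :: "('k::field \<Rightarrow> 'h::ring_1 \<Rightarrow> 'h) \<Rightarrow> ('h, 'k) cpx \<Rightarrow> ('h, 'k) cpx \<Rightarrow>
    (('h, 'k) roof \<times> ('h, 'k) roof) set" where
  "roof_eq sc X Y = {((W, s, f), (W', s', f')).
     (W, s, f) \<in> roofs sc X Y \<and> (W', s', f') \<in> roofs sc X Y \<and>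
     (\<exists>V. \<exists>u \<in> chain_map V W. \<exists>u' \<in> chain_map V W'. bounded_complex sc V \<and>
        quasi_iso V X (cmap_comp s u) \<and>
        homotopic V X (cmap_comp s u) (cmap_comp s' u') \<and>
        homotopic V Y (cmap_comp f u) (cmap_comp f' u'))}"

definition derived_comp :: "('k::field \<Rightarrow> 'h::ring_1 \<Rightarrow> 'h) \<Rightarrow>
    ('h, 'k) cpx \<Rightarrow> ('h, 'k) cpx \<Rightarrow> ('h, 'k) cpx \<Rightarrow>
    ('h, 'k) roof set \<Rightarrow> ('h, 'k) roof set \<Rightarrow> ('h, 'k) roof set" where
  "derived_comp sc X Y Z \<beta> \<alpha> = {r. \<exists>W s f W' t g V u h.
     (W, s, f) \<in> \<alpha> \<and> (W', t, g) \<in> \<beta> \<and> bounded_complex sc V \<and>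
     quasi_iso V W u \<and> h \<in> chain_map V W' \<and>
     homotopic V Y (cmap_comp t h) (cmap_comp f u) \<and>
     ((V, cmap_comp s u, cmap_comp g h), r) \<in> roof_eq sc X Z}"

definition derived_add :: "('k::field \<Rightarrow> 'h::ring_1 \<Rightarrow> 'h) \<Rightarrow> ('h, 'k) cpx \<Rightarrow> ('h, 'k) cpx \<Rightarrow>
    ('h, 'k) roof set \<Rightarrow> ('h, 'k) roof set \<Rightarrow> ('h, 'k) roof set" where
  "derived_add sc X Y \<alpha> \<beta> = {r. \<exists>W s f g.
     (W, s, f) \<in> \<alpha> \<and> (W, s, g) \<in> \<beta> \<and> ((W, s, f + g), r) \<in> roof_eq sc X Y}"

definition Q_map :: "('k::field \<Rightarrow> 'h::ring_1 \<Rightarrow> 'h) \<Rightarrow> ('h, 'k) cpx \<Rightarrow> ('h, 'k) cpx \<Rightarrow>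
    'k cmap \<Rightarrow> ('h, 'k) roof set" where
  "Q_map sc X Y f = roof_eq sc X Y `` {(X, cmap_id X, f)}"

definition Db :: "('k::field \<Rightarrow> 'h::ring_1 \<Rightarrow> 'h) \<Rightarrow> (('h, 'k) cpx, ('h, 'k) roof set) cat" where
  "Db sc =
    \<lparr>Ob = {X. bounded_complex sc X},
     Hom = (\<lambda>X Y. roofs sc X Y // roof_eq sc X Y),
     Cmp = derived_comp sc,
     Idn = (\<lambda>X. Q_map sc X X (cmap_id X)),
     Add = derived_add sc,
     Nul = (\<lambda>X Y. Q_map sc X Y 0)\<rparr>"

type_synonym ('h, 'k) Db_func =
  "(('h, 'k) cpx, ('h, 'k) roof set, ('h, 'k) cpx, ('h, 'k) roof set) func"

definition shift_func :: "int \<Rightarrow> ('h, 'k::field) Db_func" where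
  "shift_func n =
    \<lparr>fobj = cshift n,
     fmap = (\<lambda>X Y \<alpha>. (\<lambda>(W, s, f). (cshift n W, cmap_shift n s, cmap_shift n f)) ` \<alpha>)\<rparr>"

subsection \<open>Triangles\<close>

text \<open>\<open>distinguished sc X Y Z u v w\<close>: the sequence \<open>X \<rightarrow> Y \<rightarrow> Z \<rightarrow> X[1]\<close> is isomorphic to the
  sequence given by the mapping cone of a chain map.\<close>

definition distinguished :: "('k::field \<Rightarrow> 'h::ring_1 \<Rightarrow> 'h) \<Rightarrow>
    ('h, 'k) cpx \<Rightarrow> ('h, 'k) cpx \<Rightarrow> ('h, 'k) cpx \<Rightarrow>
    ('h, 'k) roof set \<Rightarrow> ('h, 'k) roof set \<Rightarrow> ('h, 'k) roof set \<Rightarrow> bool" where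
  "distinguished sc X Y Z u v w \<longleftrightarrow>
     {X, Y, Z} \<subseteq> Ob (Db sc) \<and>
     u \<in> Hom (Db sc) X Y \<and> v \<in> Hom (Db sc) Y Z \<and> w \<in> Hom (Db sc) Z (cshift 1 X) \<and>
     (\<exists>A B f a b c. bounded_complex sc A \<and> bounded_complex sc B \<and> f \<in> chain_map A B \<and>
        is_iso (Db sc) X A a \<and> is_iso (Db sc) Y B b \<and> is_iso (Db sc) Z (cone A B f) c \<and>
        Cmp (Db sc) X A B (Q_map sc A B f) a = Cmp (Db sc) X Y B b u \<and>
        Cmp (Db sc) Y B (cone A B f) (Q_map sc B (cone A B f) (cone_in B)) b =
          Cmp (Db sc) Y Z (cone A B f) c v \<and>
        Cmp (Db sc) Z (cone A B f) (cshift 1 A)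
            (Q_map sc (cone A B f) (cshift 1 A) (cone_out A B f)) c =
          Cmp (Db sc) Z (cshift 1 X) (cshift 1 A) (fmap (shift_func 1) X A a) w)"

definition triangle_functor :: "('k::field \<Rightarrow> 'h::ring_1 \<Rightarrow> 'h) \<Rightarrow> ('h, 'k) Db_func \<Rightarrow> bool" where
  "triangle_functor sc G \<longleftrightarrow> additive_functor (Db sc) (Db sc) G \<and>
     (\<exists>\<phi>. natural_iso (Db sc) (Db sc) (comp_func G (shift_func 1)) (comp_func (shift_func 1) G) \<phi> \<and>
        (\<forall>X Y Z u v w. distinguished sc X Y Z u v w \<longrightarrow>
           distinguished sc (fobj G X) (fobj G Y) (fobj G Z) (fmap G X Y u) (fmap G Y Z v)
             (Cmp (Db sc) (fobj G Z) (fobj G (cshift 1 X)) (cshift 1 (fobj G X))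
                (\<phi> X) (fmap G Z (cshift 1 X) w))))"

definition triangle_autoequivalence ::
    "('k::field \<Rightarrow> 'h::ring_1 \<Rightarrow> 'h) \<Rightarrow> ('h, 'k) Db_func \<Rightarrow> bool" where
  "triangle_autoequivalence sc G \<longleftrightarrow>
     triangle_functor sc G \<and> (\<exists>G' \<eta> \<theta>. quasi_inverse (Db sc) G G' \<eta> \<theta>)"

subsection \<open>The Auslander-Reiten translation\<close>

definition retraction :: "('o, 'a) cat \<Rightarrow> 'o \<Rightarrow> 'o \<Rightarrow> 'a \<Rightarrow> bool" where
  "retraction C X Y f \<longleftrightarrow> (\<exists>g \<in> Hom C Y X. Cmp C Y X Y f g = Idn C Y)"

definition AR_triangle :: "('k::field \<Rightarrow> 'h::ring_1 \<Rightarrow> 'h) \<Rightarrow>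
    ('h, 'k) cpx \<Rightarrow> ('h, 'k) cpx \<Rightarrow> ('h, 'k) cpx \<Rightarrow>
    ('h, 'k) roof set \<Rightarrow> ('h, 'k) roof set \<Rightarrow> ('h, 'k) roof set \<Rightarrow> bool" where
  "AR_triangle sc X Y Z u v w \<longleftrightarrow> distinguished sc X Y Z u v w \<and>
     indecomposable (Db sc) X \<and> indecomposable (Db sc) Z \<and>
     w \<noteq> Nul (Db sc) Z (cshift 1 X) \<and>
     (\<forall>W \<in> Ob (Db sc). \<forall>f \<in> Hom (Db sc) W Z. \<not> retraction (Db sc) W Z f \<longrightarrow>
        (\<exists>f' \<in> Hom (Db sc) W Y. Cmp (Db sc) W Y Z v f' = f))"

definition AR_translation :: "('k::field \<Rightarrow> 'h::ring_1 \<Rightarrow> 'h) \<Rightarrow> ('h, 'k) Db_func \<Rightarrow> bool" where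
  "AR_translation sc \<tau> \<longleftrightarrow> triangle_autoequivalence sc \<tau> \<and>
     (\<forall>Z. indecomposable (Db sc) Z \<longrightarrow> (\<exists>Y u v w. AR_triangle sc (fobj \<tau> Z) Y Z u v w))"

subsection \<open>The finiteness conditions\<close>

definition cond_g1 :: "('k::field \<Rightarrow> 'h::ring_1 \<Rightarrow> 'h) \<Rightarrow>
    ('h, 'k) Db_func \<Rightarrow> ('h, 'k) Db_func \<Rightarrow> bool" where
  "cond_g1 sc G G' \<longleftrightarrow>
     (\<forall>U. indecomposable (mod_cat sc) U \<longrightarrow>
        finite {n :: int. \<exists>V. indecomposable (mod_cat sc) V \<and>
                  isomorphic (Db sc) (fobj (ipow G G' n) (stalk U)) (stalk V)})"

definition cond_g2 :: "('k::field \<Rightarrow> 'h::ring_1 \<Rightarrow> 'h) \<Rightarrow>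
    ('h, 'k) Db_func \<Rightarrow> ('h, 'k) Db_func \<Rightarrow> bool" where
  "cond_g2 sc G G' \<longleftrightarrow>
     (\<exists>N :: nat. \<forall>X. indecomposable (Db sc) X \<longrightarrow>
        (\<exists>i n U. indecomposable (mod_cat sc) U \<and> n \<in> {- int N..int N} \<and>
           isomorphic (Db sc) (fobj (ipow G G' i) X) (cshift n (stalk U))))"

end

theory Submission
  imports Defs "HOL-Algebra.Ring"
begin

text \<open>
  Let \<open>G\<close> be an autoequivalence of a category in which every endomorphism of an indecomposable object is
  nilpotent or invertible, and suppose that \<open>G\<^sup>kX\<close> is never isomorphic to \<open>X\<close> for \<open>X\<close> indecomposable and
  \<open>k \<noteq> 0\<close>. Comparing homogeneous components one sees that an indecomposable object stays indecomposable in
  the orbit category and that its isomorphism class there is the orbit. A nonzero morphism in the orbit category has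
  a nonzero component \<open>G\<^sup>iX \<rightarrow> Y\<close>, so both conditions of an Ext-configuration transfer between the two
  categories as soon as the configuration is stable under \<open>G\<close>.

  In \<open>D\<^sup>b(H)\<close> the morphisms are homotopy classes of chain maps between projective resolutions, and the
  hypothesis on endomorphisms is Fitting's lemma applied in all degrees at once. In (a), \<open>G\<^sup>kX \<cong> X\<close>
  together with (g2) gives a module \<open>U\<close> fixed by all powers of \<open>G\<^sup>k\<close>, against (g1). In (b), the
  Auslander-Reiten triangles give \<open>Ext(X, Y) \<noteq> 0 \<longleftrightarrow> Ext(FY, X) \<noteq> 0\<close>, which makes the configuration stable under
  \<open>F\<close> and its inverse. Heredity implies that \<open>F\<close> lowers by at least one the degree above which an object
  is exact; an object fixed by a power of \<open>F\<close> would therefore be acyclic.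
\<close>

section \<open>Preadditive categories\<close>

text \<open>\<open>G\<close> is invertible only up to natural isomorphism, so composition in the
  orbit category involves canonical isomorphisms between a power \<open>j + i\<close> and the
  composite of the powers \<open>j\<close> and \<open>i\<close>. Its associativity is a cocycle
  condition that rests on naturality and the triangle identities. A morphism of \<open>Db sc\<close>
  is a set of roofs. Bounded projective resolutions, which exist because the last kernel is
  projective by heredity, turn it into a chain map up to homotopy, and equality of morphisms into
  equations between module homomorphisms. Nilpotent-or-invertible is a convenient condition because
  it passes along isomorphisms, makes a nonzero retract everything, forces an invertible finite sum
  to have an invertible term, and can be verified on the powers of a single chain map. An equation
  in the orbit category is read in degree 0, where freeness of the action leaves one term that can
  be invertible. Duality enters only as nonvanishing of Hom: mapping cones make every morphism a
  weak kernel and a weak cokernel, and this is the exactness that the argument with Auslander-Reiten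
  triangles consumes.\<close>

context ring
begin

text \<open>The inverse is the finite geometric series. For every \<open>m\<close> the induction
  provides a partial sum that works on both sides of 1 - x, the next one being 1 + s x.\<close>

lemma one_minus_nilpotent_Unit:
  assumes x: "x \<in> carrier R" and n: "x [^] (n::nat) = \<zero>"
  shows "\<one> \<ominus> x \<in> Units R"
proof -
  have "\<exists>s \<in> carrier R. (\<one> \<ominus> x) \<otimes> s = \<one> \<ominus> x [^] m \<and> s \<otimes> (\<one> \<ominus> x) = \<one> \<ominus> x [^] m" for m :: nat
  proof (induction m)
    case 0
    then show ?case using x by (intro bexI[of _ \<zero>]) (simp_all add: minus_eq r_neg)
  next
    case (Suc m)
    then obtain s where s: "s \<in> carrier R" "(\<one> \<ominus> x) \<otimes> s = \<one> \<ominus> x [^] m"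
      "s \<otimes> (\<one> \<ominus> x) = \<one> \<ominus> x [^] m" by blast
    let ?y = "x [^] m"
    have y: "?y \<in> carrier R" using x by simp
    have cx: "x \<otimes> ?y = ?y \<otimes> x" using nat_pow_Suc2[OF x, of m] by simp
    have 1: "(\<one> \<ominus> x) \<otimes> (\<one> \<oplus> s \<otimes> x) = \<one> \<ominus> ?y \<otimes> x"
    proof -
      have "(\<one> \<ominus> x) \<otimes> (\<one> \<oplus> s \<otimes> x) = (\<one> \<ominus> x) \<oplus> ((\<one> \<ominus> x) \<otimes> s) \<otimes> x"
        using x s(1) by (simp add: r_distr m_assoc)
      also have "\<dots> = \<one> \<ominus> ?y \<otimes> x" unfolding s(2) using x y by algebra
      finally show ?thesis .
    qed
    have 2: "(\<one> \<oplus> x \<otimes> s) \<otimes> (\<one> \<ominus> x) = \<one> \<ominus> x \<otimes> ?y"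
    proof -
      have "(\<one> \<oplus> x \<otimes> s) \<otimes> (\<one> \<ominus> x) = (\<one> \<ominus> x) \<oplus> x \<otimes> (s \<otimes> (\<one> \<ominus> x))"
        using x s(1) by (simp add: l_distr m_assoc)
      also have "\<dots> = \<one> \<ominus> x \<otimes> ?y"
      proof -
        have "\<one> \<ominus> x \<oplus> (x \<ominus> z) = \<one> \<ominus> z" if "z \<in> carrier R" for z using x that by algebra
        then show ?thesis unfolding s(3) using x y by (simp add: minus_eq r_distr r_minus)
      qed
      finally show ?thesis .
    qed
    \<comment> \<open>The two products of \<open>s\<close> with 1 - x agree, hence \<open>s\<close>
      commutes with \<open>x\<close>, and a single witness serves on both sides.\<close>
    have 3: "s \<otimes> x = x \<otimes> s"
    proof -
      have "s \<otimes> (\<one> \<ominus> x) = (\<one> \<ominus> x) \<otimes> s" using s by simp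
      then have "s \<ominus> s \<otimes> x = s \<ominus> x \<otimes> s" using x s(1)
        by (simp add: minus_eq r_distr l_distr r_minus l_minus)
      then have "\<ominus> (s \<otimes> x) = \<ominus> (x \<otimes> s)" using x s(1) by (simp add: minus_eq)
      then show ?thesis using x s(1) by (metis m_closed minus_minus)
    qed
    show ?case using 1 2 3 x s(1) cx by (intro bexI[of _ "\<one> \<oplus> s \<otimes> x"]) simp_all
  qed
  from this[of n] obtain s where "s \<in> carrier R" "(\<one> \<ominus> x) \<otimes> s = \<one>" "s \<otimes> (\<one> \<ominus> x) = \<one>"
    unfolding n by (auto simp: minus_eq)
  then show ?thesis using x by (auto simp: Units_def)
qed

text \<open>Dividing by the unit a + b makes the sum equal to 1, so each summand is 1 minus the
  other. If one of them is no unit it is nilpotent, and then 1 minus it is a unit.\<close>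

lemma unit_add_cases:
  assumes nu: "\<And>x. x \<in> carrier R \<Longrightarrow> x \<in> Units R \<or> (\<exists>n::nat. x [^] n = \<zero>)"
    and a: "a \<in> carrier R" and b: "b \<in> carrier R" and ab: "a \<oplus> b \<in> Units R"
  shows "a \<in> Units R \<or> b \<in> Units R"
proof -
  let ?v = "inv (a \<oplus> b)"
  have v: "?v \<in> carrier R" "?v \<in> Units R" using ab by auto
  have e: "?v \<otimes> a \<oplus> ?v \<otimes> b = \<one>" using v a b ab by (simp flip: r_distr)
  have cancel: "y \<in> Units R" if "?v \<otimes> y \<in> Units R" "y \<in> carrier R" for y
  proof -
    have "y = (a \<oplus> b) \<otimes> (?v \<otimes> y)" using m_assoc[of "a \<oplus> b" ?v y] Units_r_inv[OF ab] that(2) v(1) a b by simp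
    then show ?thesis using Units_m_closed[OF ab that(1)] by simp
  qed
  show ?thesis
  proof (cases "?v \<otimes> a \<in> Units R")
    case True
    then show ?thesis using cancel a by blast
  next
    case False
    then obtain n :: nat where "(?v \<otimes> a) [^] n = \<zero>" using nu[of "?v \<otimes> a"] v a by auto
    then have "\<one> \<ominus> ?v \<otimes> a \<in> Units R" using one_minus_nilpotent_Unit v a by simp
    moreover have "\<one> \<ominus> ?v \<otimes> a = ?v \<otimes> b"
    proof -
      have "x \<oplus> y \<ominus> x = y" if "x \<in> carrier R" "y \<in> carrier R" for x y using that by algebra
      from this[of "?v \<otimes> a" "?v \<otimes> b"] show ?thesis using e v(1) a b by simp
    qed
    ultimately have "?v \<otimes> b \<in> Units R" by simp
    then show ?thesis using cancel b by blast
  qed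
qed

end

text \<open>The common ground of the derived category and of its orbit category, both of which are
  shown to be instances. Every rule asks for membership of the objects because hom-sets between
  non-objects are unconstrained.\<close>

locale preadd =
  fixes C :: "('o, 'a) cat"
  assumes cmp_in [simp]: "\<lbrakk>f \<in> Hom C X Y; g \<in> Hom C Y Z; X \<in> Ob C; Y \<in> Ob C; Z \<in> Ob C\<rbrakk>
      \<Longrightarrow> Cmp C X Y Z g f \<in> Hom C X Z"
    and idn_in [simp]: "X \<in> Ob C \<Longrightarrow> Idn C X \<in> Hom C X X"
    and assoc: "\<lbrakk>f \<in> Hom C W X; g \<in> Hom C X Y; h \<in> Hom C Y Z;
        W \<in> Ob C; X \<in> Ob C; Y \<in> Ob C; Z \<in> Ob C\<rbrakk>
      \<Longrightarrow> Cmp C W X Z (Cmp C X Y Z h g) f = Cmp C W Y Z h (Cmp C W X Y g f)"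
    and idl [simp]: "\<lbrakk>f \<in> Hom C X Y; X \<in> Ob C; Y \<in> Ob C\<rbrakk> \<Longrightarrow> Cmp C X Y Y (Idn C Y) f = f"
    and idr [simp]: "\<lbrakk>f \<in> Hom C X Y; X \<in> Ob C; Y \<in> Ob C\<rbrakk> \<Longrightarrow> Cmp C X X Y f (Idn C X) = f"
    and grp: "\<lbrakk>X \<in> Ob C; Y \<in> Ob C\<rbrakk> \<Longrightarrow> comm_group (hom_group C X Y)"
    and cmp_add_l: "\<lbrakk>f \<in> Hom C X Y; g \<in> Hom C Y Z; g' \<in> Hom C Y Z;
        X \<in> Ob C; Y \<in> Ob C; Z \<in> Ob C\<rbrakk>
      \<Longrightarrow> Cmp C X Y Z (Add C Y Z g g') f = Add C X Z (Cmp C X Y Z g f) (Cmp C X Y Z g' f)"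
    and cmp_add_r: "\<lbrakk>f \<in> Hom C X Y; f' \<in> Hom C X Y; g \<in> Hom C Y Z;
        X \<in> Ob C; Y \<in> Ob C; Z \<in> Ob C\<rbrakk>
      \<Longrightarrow> Cmp C X Y Z g (Add C X Y f f') = Add C X Z (Cmp C X Y Z g f) (Cmp C X Y Z g f')"
begin

lemma nul_in [simp]: "\<lbrakk>X \<in> Ob C; Y \<in> Ob C\<rbrakk> \<Longrightarrow> Nul C X Y \<in> Hom C X Y"
  using comm_monoid.axioms(1)[OF comm_group.axioms(1)[OF grp], THEN monoid.one_closed]
  by (simp add: hom_group_def)

lemma add_in [simp]: "\<lbrakk>f \<in> Hom C X Y; g \<in> Hom C X Y; X \<in> Ob C; Y \<in> Ob C\<rbrakk>
    \<Longrightarrow> Add C X Y f g \<in> Hom C X Y"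
  using comm_monoid.axioms(1)[OF comm_group.axioms(1)[OF grp], THEN monoid.m_closed, of X Y f g]
  by (simp add: hom_group_def)

lemma add_nul_l [simp]: "\<lbrakk>f \<in> Hom C X Y; X \<in> Ob C; Y \<in> Ob C\<rbrakk> \<Longrightarrow> Add C X Y (Nul C X Y) f = f"
  using comm_monoid.axioms(1)[OF comm_group.axioms(1)[OF grp], THEN monoid.l_one, of X Y f]
  by (simp add: hom_group_def)

lemma add_nul_r [simp]: "\<lbrakk>f \<in> Hom C X Y; X \<in> Ob C; Y \<in> Ob C\<rbrakk> \<Longrightarrow> Add C X Y f (Nul C X Y) = f"
  using comm_monoid.axioms(1)[OF comm_group.axioms(1)[OF grp], THEN monoid.r_one, of X Y f]
  by (simp add: hom_group_def)

lemma add_cancel: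
  assumes "f \<in> Hom C X Y" "g \<in> Hom C X Y" "X \<in> Ob C" "Y \<in> Ob C" "Add C X Y f g = f"
  shows "g = Nul C X Y"
proof -
  interpret g: comm_group "hom_group C X Y" using assms grp by blast
  show ?thesis using g.l_cancel_one[of f g] assms by (simp add: hom_group_def)
qed

lemma cmp_nul_l [simp]:
  assumes "f \<in> Hom C X Y" "X \<in> Ob C" "Y \<in> Ob C" "Z \<in> Ob C"
  shows "Cmp C X Y Z (Nul C Y Z) f = Nul C X Z"
  using assms cmp_add_l[of f X Y "Nul C Y Z" Z "Nul C Y Z"] add_cancel
  by (metis add_nul_l cmp_in nul_in)

lemma cmp_nul_r [simp]:
  assumes "f \<in> Hom C Y Z" "X \<in> Ob C" "Y \<in> Ob C" "Z \<in> Ob C"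
  shows "Cmp C X Y Z f (Nul C X Y) = Nul C X Z"
  using assms cmp_add_r[of "Nul C X Y" X Y "Nul C X Y" f Z] add_cancel
  by (metis add_nul_l cmp_in nul_in)

lemma cancel_l [simp]:
  assumes "Cmp C Y Z Y h g = Idn C Y" "f \<in> Hom C X Y" "g \<in> Hom C Y Z" "h \<in> Hom C Z Y"
    "X \<in> Ob C" "Y \<in> Ob C" "Z \<in> Ob C"
  shows "Cmp C X Z Y h (Cmp C X Y Z g f) = f"
  using assoc[of f X Y g Z h Y] assms by simp

lemma is_isoE:
  assumes "is_iso C X Y f"
  obtains g where "f \<in> Hom C X Y" "g \<in> Hom C Y X" "Cmp C X Y X g f = Idn C X"
    "Cmp C Y X Y f g = Idn C Y" "is_iso C Y X g"
  using assms unfolding is_iso_def by blast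

lemma is_iso_idn [simp]: "X \<in> Ob C \<Longrightarrow> is_iso C X X (Idn C X)"
  unfolding is_iso_def by (metis idl idn_in)

lemma is_iso_cmp:
  assumes "is_iso C X Y f" "is_iso C Y Z g" "X \<in> Ob C" "Y \<in> Ob C" "Z \<in> Ob C"
  shows "is_iso C X Z (Cmp C X Y Z g f)"
proof -
  obtain f' where f: "f \<in> Hom C X Y" "f' \<in> Hom C Y X" "Cmp C X Y X f' f = Idn C X"
    "Cmp C Y X Y f f' = Idn C Y" using assms is_isoE by metis
  obtain g' where g: "g \<in> Hom C Y Z" "g' \<in> Hom C Z Y" "Cmp C Y Z Y g' g = Idn C Y"
    "Cmp C Z Y Z g g' = Idn C Z" using assms is_isoE by metis
  have "Cmp C X Z X (Cmp C Z Y X f' g') (Cmp C X Y Z g f) = Idn C X"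
    "Cmp C Z X Z (Cmp C X Y Z g f) (Cmp C Z Y X f' g') = Idn C Z"
    using f g assms by (simp_all add: assoc)
  then show ?thesis unfolding is_iso_def using f g assms
    by (intro conjI bexI[of _ "Cmp C Z Y X f' g'"]) simp_all
qed

lemma iso_refl [simp]: "X \<in> Ob C \<Longrightarrow> isomorphic C X X"
  unfolding isomorphic_def using is_iso_idn by blast

lemma iso_sym: "isomorphic C X Y \<Longrightarrow> isomorphic C Y X"
  unfolding isomorphic_def using is_isoE by metis

lemma iso_trans: "\<lbrakk>isomorphic C X Y; isomorphic C Y Z; X \<in> Ob C; Y \<in> Ob C; Z \<in> Ob C\<rbrakk>
    \<Longrightarrow> isomorphic C X Z"
  unfolding isomorphic_def using is_iso_cmp by metis

lemma iso_class_eq_iff: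
  assumes "X \<in> Ob C" "Y \<in> Ob C"
  shows "iso_class C X = iso_class C Y \<longleftrightarrow> isomorphic C X Y"
proof
  assume "iso_class C X = iso_class C Y"
  moreover have "Y \<in> iso_class C Y" using assms by (simp add: iso_class_def)
  ultimately show "isomorphic C X Y" by (auto simp: iso_class_def)
next
  assume i: "isomorphic C X Y"
  show "iso_class C X = iso_class C Y"
    using iso_trans[OF i] iso_trans[OF iso_sym[OF i]] assms unfolding iso_class_def by blast
qed

lemma cmp_cancel_iso_l:
  assumes "is_iso C Y Z h" "f \<in> Hom C X Y" "g \<in> Hom C X Y" "X \<in> Ob C" "Y \<in> Ob C" "Z \<in> Ob C"
    "Cmp C X Y Z h f = Cmp C X Y Z h g"
  shows "f = g"
proof -
  obtain k where k: "h \<in> Hom C Y Z" "k \<in> Hom C Z Y" "Cmp C Y Z Y k h = Idn C Y"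
    using assms is_isoE by metis
  have "Cmp C X Z Y k (Cmp C X Y Z h f) = Cmp C X Z Y k (Cmp C X Y Z h g)"
    using assms by simp
  then show ?thesis using k assms(2-6) by simp
qed

lemma cmp_cancel_iso_r:
  assumes "is_iso C X Y h" "f \<in> Hom C Y Z" "g \<in> Hom C Y Z" "X \<in> Ob C" "Y \<in> Ob C" "Z \<in> Ob C"
    "Cmp C X Y Z f h = Cmp C X Y Z g h"
  shows "f = g"
proof -
  obtain k where k: "h \<in> Hom C X Y" "k \<in> Hom C Y X" "Cmp C Y X Y h k = Idn C Y"
    using assms is_isoE by metis
  have "Cmp C Y X Z (Cmp C X Y Z f h) k = Cmp C Y X Z (Cmp C X Y Z g h) k"
    using assms by simp
  then show ?thesis using k assms(2-6) by (simp add: assoc)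
qed

text \<open>All that an Ext-configuration records about Ext is whether it vanishes. The negated form
  is the one carried along isomorphisms, equivalences, adjunctions and Serre duality.\<close>

definition nz :: "'o \<Rightarrow> 'o \<Rightarrow> bool" where
  "nz X Y \<longleftrightarrow> (\<exists>f \<in> Hom C X Y. f \<noteq> Nul C X Y)"

lemma ext1_vanishes_iff: "\<lbrakk>X \<in> Ob C; s Y \<in> Ob C\<rbrakk> \<Longrightarrow> ext1_vanishes C s X Y \<longleftrightarrow> \<not> nz X (s Y)"
  unfolding ext1_vanishes_def nz_def using nul_in by blast

lemma nz_iso1:
  assumes "isomorphic C X X'" "nz X Y" "X \<in> Ob C" "X' \<in> Ob C" "Y \<in> Ob C"
  shows "nz X' Y"
proof -
  obtain a where "is_iso C X' X a" using assms iso_sym isomorphic_def by metis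
  moreover obtain f where "f \<in> Hom C X Y" "f \<noteq> Nul C X Y" using assms nz_def by blast
  ultimately have "Cmp C X' X Y f a \<noteq> Nul C X' Y" "Cmp C X' X Y f a \<in> Hom C X' Y"
    using assms cmp_cancel_iso_r[of X' X a f Y "Nul C X Y"] unfolding is_iso_def by auto
  then show ?thesis unfolding nz_def by blast
qed

lemma nz_iso2:
  assumes "isomorphic C Y Y'" "nz X Y" "X \<in> Ob C" "Y \<in> Ob C" "Y' \<in> Ob C"
  shows "nz X Y'"
proof -
  obtain a where "is_iso C Y Y' a" using assms isomorphic_def by metis
  moreover obtain f where "f \<in> Hom C X Y" "f \<noteq> Nul C X Y" using assms nz_def by blast
  ultimately have "Cmp C X Y Y' a f \<noteq> Nul C X Y'" "Cmp C X Y Y' a f \<in> Hom C X Y'"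
    using assms cmp_cancel_iso_l[of Y Y' a f X "Nul C X Y"] unfolding is_iso_def by auto
  then show ?thesis unfolding nz_def by blast
qed

lemma zero_object_iso:
  assumes "isomorphic C X Y" "zero_object C X" "X \<in> Ob C" "Y \<in> Ob C"
  shows "zero_object C Y"
proof -
  obtain f g where f: "f \<in> Hom C X Y" "g \<in> Hom C Y X" "Cmp C Y X Y f g = Idn C Y"
    using assms unfolding isomorphic_def is_iso_def by blast
  have "Idn C Y = Cmp C Y X Y f (Cmp C Y X X (Idn C X) g)" using f assms by simp
  then show ?thesis using f assms unfolding zero_object_def by simp
qed

lemma not_zero_object_nz: "\<lbrakk>\<not> zero_object C X; X \<in> Ob C\<rbrakk> \<Longrightarrow> nz X X"
  unfolding nz_def zero_object_def using idn_in by blast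

lemma direct_sum_iso:
  assumes "isomorphic C X Y" "is_direct_sum C A B X" "X \<in> Ob C" "Y \<in> Ob C" "A \<in> Ob C" "B \<in> Ob C"
  shows "is_direct_sum C A B Y"
proof -
  obtain f g where f: "f \<in> Hom C X Y" "g \<in> Hom C Y X" "Cmp C Y X Y f g = Idn C Y"
    "Cmp C X Y X g f = Idn C X"
    using assms unfolding isomorphic_def is_iso_def by blast
  obtain i j p q where s: "i \<in> Hom C A X" "j \<in> Hom C B X" "p \<in> Hom C X A" "q \<in> Hom C X B"
    "Cmp C A X A p i = Idn C A" "Cmp C B X B q j = Idn C B"
    "Cmp C A X B q i = Nul C A B" "Cmp C B X A p j = Nul C B A"
    "Add C X X (Cmp C X A X i p) (Cmp C X B X j q) = Idn C X"
    using assms(2) unfolding is_direct_sum_def by blast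
  note o = assms(3-)
  have "Idn C Y = Cmp C Y X Y f (Cmp C Y X X (Idn C X) g)" using f o by simp
  also have "\<dots> = Cmp C Y X Y f (Cmp C Y X X (Add C X X (Cmp C X A X i p) (Cmp C X B X j q)) g)"
    by (simp only: s(9))
  also have "\<dots> = Add C Y Y (Cmp C Y A Y (Cmp C A X Y f i) (Cmp C Y X A p g))
      (Cmp C Y B Y (Cmp C B X Y f j) (Cmp C Y X B q g))"
    using s(1-4) f(1,2) o by (simp add: assoc cmp_add_l cmp_add_r)
  finally have e: "Add C Y Y (Cmp C Y A Y (Cmp C A X Y f i) (Cmp C Y X A p g))
      (Cmp C Y B Y (Cmp C B X Y f j) (Cmp C Y X B q g)) = Idn C Y" ..
  have "Cmp C A Y A (Cmp C Y X A p g) (Cmp C A X Y f i) = Idn C A"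
    "Cmp C B Y B (Cmp C Y X B q g) (Cmp C B X Y f j) = Idn C B"
    "Cmp C A Y B (Cmp C Y X B q g) (Cmp C A X Y f i) = Nul C A B"
    "Cmp C B Y A (Cmp C Y X A p g) (Cmp C B X Y f j) = Nul C B A"
    using s f o by (simp_all add: assoc)
  with e show ?thesis unfolding is_direct_sum_def using s f o
    by (intro bexI[of _ "Cmp C A X Y f i"] bexI[of _ "Cmp C B X Y f j"]
        bexI[of _ "Cmp C Y X A p g"] bexI[of _ "Cmp C Y X B q g"] conjI) simp_all
qed

lemma indecomposable_iso:
  assumes i: "isomorphic C X Y" and X: "indecomposable C X" and Y: "Y \<in> Ob C"
  shows "indecomposable C Y"
proof -
  have Xo: "X \<in> Ob C" using X unfolding indecomposable_def by blast
  have "\<not> zero_object C Y"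
    using zero_object_iso[OF iso_sym[OF i] _ Y Xo] X unfolding indecomposable_def by blast
  moreover have "zero_object C A \<or> zero_object C B"
    if "A \<in> Ob C" "B \<in> Ob C" "is_direct_sum C A B Y" for A B
    using direct_sum_iso[OF iso_sym[OF i] that(3) Y Xo that(1,2)] X that(1,2)
    unfolding indecomposable_def by blast
  ultimately show ?thesis using Y unfolding indecomposable_def by blast
qed

lemma in_ind_iff:
  assumes X: "X \<in> Ob C"
  shows "iso_class C X \<in> ind C \<longleftrightarrow> indecomposable C X"
proof
  assume "iso_class C X \<in> ind C"
  then obtain Y where Y: "indecomposable C Y" "iso_class C Y = iso_class C X"
    unfolding ind_def by auto
  then have "Y \<in> Ob C" unfolding indecomposable_def by blast
  then have "isomorphic C Y X" using iso_class_eq_iff Y(2) X by blast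
  then show "indecomposable C X" using indecomposable_iso Y(1) X by blast
qed (simp add: ind_def)

section \<open>Endomorphism rings and retracts\<close>

definition End :: "'o \<Rightarrow> 'a ring" where
  "End X = \<lparr>carrier = Hom C X X, mult = Cmp C X X X, one = Idn C X, zero = Nul C X X,
     add = Add C X X\<rparr>"

lemma End_simps [simp]: "carrier (End X) = Hom C X X" "mult (End X) = Cmp C X X X"
  "one (End X) = Idn C X" "zero (End X) = Nul C X X" "add (End X) = Add C X X"
  "add_monoid (End X) = hom_group C X X"
  by (simp_all add: End_def hom_group_def)

lemma ring_End: "X \<in> Ob C \<Longrightarrow> ring (End X)"
proof -
  assume X: "X \<in> Ob C"
  interpret g: comm_group "hom_group C X X" using X grp by blast
  have "abelian_group (End X)"
    using g.comm_monoid_axioms g.comm_group_axioms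
    by (intro abelian_group.intro abelian_monoid.intro abelian_group_axioms.intro)
      (simp_all add: hom_group_def)
  moreover have "monoid (End X)" using X by (intro monoidI) (simp_all add: assoc)
  ultimately show ?thesis using X by (intro ringI) (simp_all add: cmp_add_l cmp_add_r)
qed

lemma Units_End: "f \<in> Units (End X) \<longleftrightarrow> is_iso C X X f"
  unfolding Units_def is_iso_def by auto

text \<open>For nonzero \<open>X\<close> this makes the endomorphism ring local and excludes proper nonzero retracts.\<close>

definition nil_or_iso :: "'o \<Rightarrow> bool" where
  "nil_or_iso X \<longleftrightarrow> X \<in> Ob C \<and>
     (\<forall>f \<in> Hom C X X. is_iso C X X f \<or> (\<exists>n::nat. f [^]\<^bsub>End X\<^esub> n = Nul C X X))"

lemma nil_or_isoD:
  "\<lbrakk>nil_or_iso X; f \<in> Hom C X X; \<not> is_iso C X X f\<rbrakk> \<Longrightarrow> \<exists>n::nat. f [^]\<^bsub>End X\<^esub> n = Nul C X X"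
  unfolding nil_or_iso_def by blast

lemma nil_or_iso_Ob: "nil_or_iso X \<Longrightarrow> X \<in> Ob C"
  unfolding nil_or_iso_def by blast

lemma nil_or_iso_add:
  assumes "nil_or_iso X" "f \<in> Hom C X X" "g \<in> Hom C X X" "is_iso C X X (Add C X X f g)"
  shows "is_iso C X X f \<or> is_iso C X X g"
proof -
  interpret ring "End X" using assms ring_End nil_or_iso_Ob by blast
  have "x \<in> Units (End X) \<or> (\<exists>n::nat. x [^]\<^bsub>End X\<^esub> n = \<zero>\<^bsub>End X\<^esub>)" if "x \<in> carrier (End X)" for x
    using that assms(1) unfolding nil_or_iso_def Units_End by simp
  from unit_add_cases[OF this, of f g] show ?thesis using assms(2-4) by (simp add: Units_End)
qed

text \<open>Induction from the case of two summands; the empty sum is zero and would be invertible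
  only on a zero object. It extracts one invertible term from a component of a composite in the
  orbit category, which is a finite sum.\<close>

lemma nil_or_iso_sum:
  assumes X: "nil_or_iso X" "\<not> zero_object C X" and S: "finite S" "\<And>j. j \<in> S \<Longrightarrow> f j \<in> Hom C X X"
    and u: "is_iso C X X (finprod (hom_group C X X) f S)"
  shows "\<exists>j \<in> S. is_iso C X X (f j)"
  using S u
proof (induction S)
  case empty
  interpret g: comm_group "hom_group C X X" using grp X nil_or_iso_Ob by blast
  have "is_iso C X X (Nul C X X)" using empty g.finprod_empty[of f] by (simp add: hom_group_def)
  then obtain g where "g \<in> Hom C X X" "Cmp C X X X g (Nul C X X) = Idn C X" unfolding is_iso_def by blast
  then show ?case using X nil_or_iso_Ob unfolding zero_object_def by simp
next
  case (insert j S)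
  interpret g: comm_group "hom_group C X X" using grp X nil_or_iso_Ob by blast
  have "finprod (hom_group C X X) f (insert j S) = Add C X X (f j) (finprod (hom_group C X X) f S)"
    using insert.hyps insert.prems(1) g.finprod_insert[of S j f] by (force simp: hom_group_def)
  moreover have "f j \<in> Hom C X X" "finprod (hom_group C X X) f S \<in> Hom C X X"
    using g.finprod_closed[of f S] insert.prems(1) by (auto simp: hom_group_def)
  ultimately have "is_iso C X X (f j) \<or> is_iso C X X (finprod (hom_group C X X) f S)"
    using nil_or_iso_add[OF X(1)] insert.prems(2) by metis
  then show ?case using insert.IH insert.prems(1) by blast
qed

lemma End_pow_in [simp]: "\<lbrakk>X \<in> Ob C; f \<in> Hom C X X\<rbrakk> \<Longrightarrow> f [^]\<^bsub>End X\<^esub> (n::nat) \<in> Hom C X X"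
  using monoid.nat_pow_closed[OF ring.is_monoid[OF ring_End], of X f n] by simp

lemma End_pow_Suc: "f [^]\<^bsub>End X\<^esub> (Suc n) = Cmp C X X X (f [^]\<^bsub>End X\<^esub> n) f"
  by (simp add: nat_pow_def)

text \<open>Regrouping of an alternating product; it transports nilpotence between the two
  composites of a pair of opposite morphisms.\<close>

lemma cmp_pow_Suc:
  assumes "p \<in> Hom C X A" "i \<in> Hom C A X" "X \<in> Ob C" "A \<in> Ob C"
  shows "(Cmp C A X A p i) [^]\<^bsub>End A\<^esub> (Suc n) = Cmp C A X A p (Cmp C A X X ((Cmp C X A X i p) [^]\<^bsub>End X\<^esub> n) i)"
proof (induction n)
  case 0
  then show ?case using assms by (simp add: nat_pow_def)
next
  case (Suc n)
  then show ?case using assms End_pow_Suc[of A "Cmp C A X A p i" "Suc n"]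
    End_pow_Suc[of X "Cmp C X A X i p" n] by (simp add: assoc del: nat_pow_Suc)
qed

text \<open>After \<open>b\<close> is normalised to a left inverse \<open>c\<close> of
  \<open>a\<close>, the composite a c is an idempotent of \<open>Y\<close>. It is not nilpotent
  because \<open>X\<close> is nonzero, so it is invertible and therefore the identity.\<close>

lemma nil_or_iso_retract:
  assumes Y: "nil_or_iso Y" and X: "X \<in> Ob C" "\<not> zero_object C X"
    and ab: "a \<in> Hom C X Y" "b \<in> Hom C Y X" "is_iso C X X (Cmp C X Y X b a)"
  shows "is_iso C X Y a" "is_iso C Y X b"
proof -
  have Yo: "Y \<in> Ob C" using Y nil_or_iso_Ob by blast
  obtain v where v: "v \<in> Hom C X X" "Cmp C X X X v (Cmp C X Y X b a) = Idn C X"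
    "Cmp C X X X (Cmp C X Y X b a) v = Idn C X" using ab(3) unfolding is_iso_def by blast
  define c where "c = Cmp C Y X X v b"
  have c: "c \<in> Hom C Y X" "Cmp C X Y X c a = Idn C X"
    using v ab X Yo by (simp_all add: c_def assoc)
  let ?e = "Cmp C Y X Y a c"
  have e: "?e \<in> Hom C Y Y" "Cmp C Y Y Y ?e ?e = ?e" using c ab X Yo by (simp_all add: assoc)
  have "is_iso C Y Y ?e"
  proof (rule ccontr)
    assume "\<not> ?thesis"
    then obtain n :: nat where n: "?e [^]\<^bsub>End Y\<^esub> n = Nul C Y Y" using nil_or_isoD[OF Y e(1)] by blast
    \<comment> \<open>Nilpotence of a c would make a power of c a vanish, but c a is the identity of
      \<open>X\<close>.\<close>
    have "(Cmp C X Y X c a) [^]\<^bsub>End X\<^esub> (Suc n) = Nul C X X"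
      using cmp_pow_Suc[OF c(1) ab(1) Yo X(1)] n c ab X Yo by simp
    moreover have "(Idn C X) [^]\<^bsub>End X\<^esub> m = Idn C X" for m :: nat
      using monoid.nat_pow_one[OF ring.is_monoid[OF ring_End], of X m] X by simp
    ultimately show False using X c unfolding zero_object_def by metis
  qed
  \<comment> \<open>An invertible idempotent is the identity: cancel it from e e = e.\<close>
  then have "?e = Idn C Y" using cmp_cancel_iso_l[of Y Y ?e ?e Y "Idn C Y"] e Yo by simp
  then show a: "is_iso C X Y a" unfolding is_iso_def using ab c by blast
  have "b = Cmp C Y X X (Cmp C X Y X b a) c"
    using \<open>?e = Idn C Y\<close> ab c Yo X by (simp add: assoc)
  moreover have "is_iso C Y X c" unfolding is_iso_def using ab c \<open>?e = Idn C Y\<close> by blast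
  ultimately show "is_iso C Y X b" using is_iso_cmp ab X Yo by metis
qed

text \<open>The exchange argument behind the Krull-Schmidt theorem.\<close>

lemma sum_retract:
  assumes A: "A \<in> Ob C" "\<not> zero_object C A" and S: "finite S"
    and X: "\<And>j. j \<in> S \<Longrightarrow> nil_or_iso (X j)"
    and p: "\<And>j. j \<in> S \<Longrightarrow> p j \<in> Hom C (X j) A" and i: "\<And>j. j \<in> S \<Longrightarrow> i j \<in> Hom C A (X j)"
    and u: "is_iso C A A (finprod (hom_group C A A) (\<lambda>j. Cmp C A (X j) A (p j) (i j)) S)"
  shows "\<exists>j \<in> S. \<exists>c \<in> Hom C (X j) A. \<exists>d \<in> Hom C A (X j). Cmp C (X j) A (X j) d c = Idn C (X j)"
  using S X p i u
proof (induction S arbitrary: p)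
  case empty
  interpret g: comm_group "hom_group C A A" using grp A by blast
  have "is_iso C A A (Nul C A A)" using empty.prems(4) by simp (simp add: hom_group_def)
  then obtain g where "g \<in> Hom C A A" "Cmp C A A A g (Nul C A A) = Idn C A" unfolding is_iso_def by blast
  then show ?case using A unfolding zero_object_def by simp
next
  case (insert j S)
  interpret R: ring "End A" using ring_End A by blast
  interpret g: comm_group "hom_group C A A" using grp A by blast
  have Xo: "X k \<in> Ob C" if "k \<in> insert j S" for k using insert.prems(1) that nil_or_iso_Ob by blast
  let ?s = "\<lambda>p S. finprod (hom_group C A A) (\<lambda>j. Cmp C A (X j) A (p j) (i j)) S"
  obtain v where v: "v \<in> Hom C A A" "Cmp C A A A v (?s p (insert j S)) = Idn C A" "is_iso C A A v"
    using is_isoE[OF insert.prems(4)] by blast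
  note Ap = insert.prems(2) and Ai = insert.prems(3)
  \<comment> \<open>Absorbing the inverse \<open>v\<close> of the sum into the \<open>p k\<close>
    makes the whole sum equal to the identity of \<open>A\<close>.\<close>
  define p' where "p' k = Cmp C (X k) A A v (p k)" for k
  have p': "p' k \<in> Hom C (X k) A" if "k \<in> insert j S" for k
    using that v insert.prems Xo A unfolding p'_def by simp
  have tin: "Cmp C A (X k) A (q k) (i k) \<in> Hom C A A" if "k \<in> insert j S" "q k \<in> Hom C (X k) A" for q k
    using that insert.prems(3)[of k] Xo[OF that(1)] A by simp
  have pin: "(\<lambda>k. Cmp C A (X k) A (q k) (i k)) \<in> T \<rightarrow> carrier (hom_group C A A)"
    if "T \<subseteq> insert j S" "\<And>k. k \<in> insert j S \<Longrightarrow> q k \<in> Hom C (X k) A" for q T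
    using that tin by (auto simp: hom_group_def)
  have sin: "?s q T \<in> Hom C A A" if "T \<subseteq> insert j S" "\<And>k. k \<in> insert j S \<Longrightarrow> q k \<in> Hom C (X k) A" for q T
    using g.finprod_closed[OF pin[OF that]] by (simp add: hom_group_def)
  have ins: "?s q (insert k T) = Add C A A (Cmp C A (X k) A (q k) (i k)) (?s q T)"
    if "finite T" "k \<notin> T" "insert k T \<subseteq> insert j S" "\<And>k. k \<in> insert j S \<Longrightarrow> q k \<in> Hom C (X k) A" for q k T
    using g.finprod_insert[OF that(1,2) pin, of q] pin[OF that(3,4)] that by (simp add: hom_group_def)
  have vs: "Cmp C A A A v (?s p T) = ?s p' T" if "T \<subseteq> insert j S" for T
  proof -
    have "finite T" using finite_subset[OF that] insert.hyps(1) by simp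
    then show ?thesis using that
  proof (induction T)
    case empty
    show ?case using v(1) A by simp (simp add: hom_group_def)
  next
    case (insert k T)
    then have k: "k \<in> insert j S" "T \<subseteq> insert j S" by auto
    have "Cmp C A A A v (?s p (insert k T))
        = Add C A A (Cmp C A A A v (Cmp C A (X k) A (p k) (i k))) (Cmp C A A A v (?s p T))"
      using ins[OF insert.hyps(1,2) insert.prems, of p] sin[OF k(2), of p] tin[OF k(1), of p] Ap[OF k(1)] Ap v(1) A
      by (simp add: cmp_add_r k(1))
    also have "\<dots> = Add C A A (Cmp C A (X k) A (p' k) (i k)) (?s p' T)"
      using insert.IH k Ap[OF k(1)] Ai[OF k(1)] Xo[OF k(1)] v(1) A by (simp add: p'_def assoc)
    also have "\<dots> = ?s p' (insert k T)"
      using ins[OF insert.hyps(1,2) insert.prems, of p'] p' by simp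
    finally show ?case .
  qed
  qed
  show ?case
  proof (cases "is_iso C (X j) (X j) (Cmp C (X j) A (X j) (i j) (p' j))")
    case True
    then obtain w where "w \<in> Hom C (X j) (X j)"
      "Cmp C (X j) (X j) (X j) w (Cmp C (X j) A (X j) (i j) (p' j)) = Idn C (X j)"
      unfolding is_iso_def by blast
    then show ?thesis using p' insert.prems Xo A
      by (intro bexI[of _ j] bexI[of _ "p' j"] bexI[of _ "Cmp C A (X j) (X j) w (i j)"]) (simp_all add: assoc)
  next
    case False
    let ?u = "Cmp C A (X j) A (p' j) (i j)"
    have j: "p' j \<in> Hom C (X j) A" "i j \<in> Hom C A (X j)" "X j \<in> Ob C" using p' insert.prems Xo by auto
    obtain n :: nat where "(Cmp C (X j) A (X j) (i j) (p' j)) [^]\<^bsub>End (X j)\<^esub> n = Nul C (X j) (X j)"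
      using False insert.prems(1)[of j] nil_or_isoD[of "X j"] j A by force
    then have "?u [^]\<^bsub>End A\<^esub> (Suc n) = Nul C A A" using cmp_pow_Suc[OF j(1,2,3) A(1), of n] j A by simp
    then have "Idn C A \<ominus>\<^bsub>End A\<^esub> ?u \<in> Units (End A)"
      using R.one_minus_nilpotent_Unit[of ?u "Suc n"] j A by (simp del: nat_pow_Suc)
    moreover have "Idn C A = Add C A A ?u (?s p' S)"
      using vs[of "insert j S"] v ins[of S j p'] insert.hyps p' by simp
    moreover have sub: "x \<oplus>\<^bsub>End A\<^esub> y \<ominus>\<^bsub>End A\<^esub> x = y" if "x \<in> Hom C A A" "y \<in> Hom C A A" for x y
    proof -
      have "x \<in> carrier (End A)" "y \<in> carrier (End A)" using that by simp_all
      then show ?thesis by (metis R.minus_eq R.a_comm R.add.inv_closed R.r_neg1 R.add.m_closed)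
    qed
    moreover have "?u \<in> Hom C A A" "?s p' S \<in> Hom C A A"
      using tin[of j p'] sin[of S p'] p' by blast+
    ultimately have "is_iso C A A (?s p' S)"
      using sub[of ?u "?s p' S"] by (simp add: Units_End)
    then show ?thesis using insert.IH[of p'] insert.prems p' by blast
  qed
qed

end

section \<open>Functors and orbit categories\<close>

context preadd
begin

lemma zero_object_iff_nz: "X \<in> Ob C \<Longrightarrow> zero_object C X \<longleftrightarrow> \<not> nz X X"
proof
  assume X: "X \<in> Ob C" "zero_object C X"
  have "f = Nul C X X" if "f \<in> Hom C X X" for f
    using X idr[OF that X(1,1)] cmp_nul_r[OF that X(1,1,1)] unfolding zero_object_def by simp
  then show "\<not> nz X X" unfolding nz_def by blast
qed (use not_zero_object_nz in blast)

lemma af_ob [simp]: "\<lbrakk>additive_functor C C T; X \<in> Ob C\<rbrakk> \<Longrightarrow> fobj T X \<in> Ob C"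
  unfolding additive_functor_def by blast

lemma af_idn [simp]: "\<lbrakk>additive_functor C C T; X \<in> Ob C\<rbrakk> \<Longrightarrow> fmap T X X (Idn C X) = Idn C (fobj T X)"
  unfolding additive_functor_def by blast

lemma af_map [simp]: "\<lbrakk>additive_functor C C T; f \<in> Hom C X Y; X \<in> Ob C; Y \<in> Ob C\<rbrakk>
    \<Longrightarrow> fmap T X Y f \<in> Hom C (fobj T X) (fobj T Y)"
  unfolding additive_functor_def by blast

lemma af_cmp [simp]: "\<lbrakk>additive_functor C C T; f \<in> Hom C X Y; g \<in> Hom C Y Z; X \<in> Ob C; Y \<in> Ob C; Z \<in> Ob C\<rbrakk>
    \<Longrightarrow> fmap T X Z (Cmp C X Y Z g f) =
          Cmp C (fobj T X) (fobj T Y) (fobj T Z) (fmap T Y Z g) (fmap T X Y f)"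
  unfolding additive_functor_def by blast

lemma af_add [simp]: "\<lbrakk>additive_functor C C T; f \<in> Hom C X Y; g \<in> Hom C X Y; X \<in> Ob C; Y \<in> Ob C\<rbrakk>
    \<Longrightarrow> fmap T X Y (Add C X Y f g) = Add C (fobj T X) (fobj T Y) (fmap T X Y f) (fmap T X Y g)"
  unfolding additive_functor_def by blast

lemma af_nul [simp]:
  assumes T: "additive_functor C C T" and o: "X \<in> Ob C" "Y \<in> Ob C"
  shows "fmap T X Y (Nul C X Y) = Nul C (fobj T X) (fobj T Y)"
proof -
  have "Add C (fobj T X) (fobj T Y) (fmap T X Y (Nul C X Y)) (fmap T X Y (Nul C X Y)) = fmap T X Y (Nul C X Y)"
    using af_add[OF T nul_in[OF o] nul_in[OF o] o] o by simp
  from add_cancel[OF _ _ _ _ this] show ?thesis using T o by simp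
qed

lemma af_id_func: "additive_functor C C id_func"
  unfolding additive_functor_def id_func_def by simp

lemma af_comp_func:
  "\<lbrakk>additive_functor C C S; additive_functor C C T\<rbrakk> \<Longrightarrow> additive_functor C C (comp_func S T)"
  unfolding additive_functor_def[of C C "comp_func S T"] by (simp add: comp_func_def)

lemma af_is_iso:
  assumes T: "additive_functor C C T" and f: "is_iso C X Y f" and o: "X \<in> Ob C" "Y \<in> Ob C"
  shows "is_iso C (fobj T X) (fobj T Y) (fmap T X Y f)"
proof -
  obtain g where g: "f \<in> Hom C X Y" "g \<in> Hom C Y X" "Cmp C X Y X g f = Idn C X" "Cmp C Y X Y f g = Idn C Y"
    using f unfolding is_iso_def by blast
  have "Cmp C (fobj T X) (fobj T Y) (fobj T X) (fmap T Y X g) (fmap T X Y f) = Idn C (fobj T X)"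
    "Cmp C (fobj T Y) (fobj T X) (fobj T Y) (fmap T X Y f) (fmap T Y X g) = Idn C (fobj T Y)"
    using af_cmp[OF T g(1,2) o o(1)] af_cmp[OF T g(2,1) o(2,1) o(2)] g(3,4) T o by simp_all
  then show ?thesis unfolding is_iso_def using T g o by auto
qed

lemma af_isomorphic:
  "\<lbrakk>additive_functor C C T; isomorphic C X Y; X \<in> Ob C; Y \<in> Ob C\<rbrakk> \<Longrightarrow> isomorphic C (fobj T X) (fobj T Y)"
  unfolding isomorphic_def using af_is_iso by blast

lemma af_direct_sum:
  assumes T: "additive_functor C C T" and s: "is_direct_sum C A B X"
    and o: "A \<in> Ob C" "B \<in> Ob C" "X \<in> Ob C"
  shows "is_direct_sum C (fobj T A) (fobj T B) (fobj T X)"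
proof -
  obtain i j p q where s: "i \<in> Hom C A X" "j \<in> Hom C B X" "p \<in> Hom C X A" "q \<in> Hom C X B"
    "Cmp C A X A p i = Idn C A" "Cmp C B X B q j = Idn C B"
    "Cmp C A X B q i = Nul C A B" "Cmp C B X A p j = Nul C B A"
    "Add C X X (Cmp C X A X i p) (Cmp C X B X j q) = Idn C X"
    using s unfolding is_direct_sum_def by blast
  show ?thesis unfolding is_direct_sum_def
    using s(1-4) arg_cong[OF s(5), of "fmap T A A"] arg_cong[OF s(6), of "fmap T B B"]
      arg_cong[OF s(7), of "fmap T A B"] arg_cong[OF s(8), of "fmap T B A"]
      arg_cong[OF s(9), of "fmap T X X"] T o
    by (intro bexI[of _ "fmap T A X i"] bexI[of _ "fmap T B X j"] bexI[of _ "fmap T X A p"]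
        bexI[of _ "fmap T X B q"] conjI) simp_all
qed

lemma qi_sym: "quasi_inverse C G G' \<eta> \<theta> \<Longrightarrow> quasi_inverse C G' G \<theta> \<eta>"
  unfolding quasi_inverse_def by blast

lemma qi_af: "quasi_inverse C G G' \<eta> \<theta> \<Longrightarrow> additive_functor C C G"
  "quasi_inverse C G G' \<eta> \<theta> \<Longrightarrow> additive_functor C C G'"
  unfolding quasi_inverse_def by blast+

lemma qi_unit:
  assumes "quasi_inverse C G G' \<eta> \<theta>" "X \<in> Ob C"
  shows "is_iso C X (fobj G' (fobj G X)) (\<eta> X)" "is_iso C X (fobj G (fobj G' X)) (\<theta> X)"
  using assms unfolding quasi_inverse_def natural_iso_def by (simp_all add: id_func_def comp_func_def)

lemma qi_natural:
  assumes "quasi_inverse C G G' \<eta> \<theta>" "f \<in> Hom C X Y" "X \<in> Ob C" "Y \<in> Ob C"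
  shows "Cmp C X Y (fobj G' (fobj G Y)) (\<eta> Y) f =
    Cmp C X (fobj G' (fobj G X)) (fobj G' (fobj G Y)) (fmap G' (fobj G X) (fobj G Y) (fmap G X Y f)) (\<eta> X)"
  using assms unfolding quasi_inverse_def natural_iso_def by (simp add: id_func_def comp_func_def)

lemma qi_triangle:
  assumes "quasi_inverse C G G' \<eta> \<theta>" "X \<in> Ob C"
  shows "fmap G X (fobj G' (fobj G X)) (\<eta> X) = \<theta> (fobj G X)"
  using assms unfolding quasi_inverse_def by blast

lemma qi_isomorphic:
  assumes "quasi_inverse C G G' \<eta> \<theta>" "X \<in> Ob C"
  shows "isomorphic C X (fobj G' (fobj G X))" "isomorphic C X (fobj G (fobj G' X))"
  using qi_unit[OF assms] unfolding isomorphic_def by blast+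

text \<open>Faithfulness of \<open>G\<close>: by naturality of the unit, a morphism with zero image
  under \<open>G\<close> becomes zero after composition with the unit at \<open>Y\<close>, which is
  an isomorphism.\<close>

lemma qi_nz_map:
  assumes q: "quasi_inverse C G G' \<eta> \<theta>" and o: "X \<in> Ob C" "Y \<in> Ob C" and n: "nz X Y"
  shows "nz (fobj G X) (fobj G Y)"
proof -
  obtain f where f: "f \<in> Hom C X Y" "f \<noteq> Nul C X Y" using n nz_def by blast
  note T = qi_af[OF q]
  have "fmap G X Y f \<noteq> Nul C (fobj G X) (fobj G Y)"
  proof
    assume "fmap G X Y f = Nul C (fobj G X) (fobj G Y)"
    then have "Cmp C X Y (fobj G' (fobj G Y)) (\<eta> Y) f = Nul C X (fobj G' (fobj G Y))"
      using qi_natural[OF q f(1) o] qi_unit(1)[OF q o(1)] T o unfolding is_iso_def by simp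
    then have "Cmp C X Y (fobj G' (fobj G Y)) (\<eta> Y) f = Cmp C X Y (fobj G' (fobj G Y)) (\<eta> Y) (Nul C X Y)"
      using qi_unit(1)[OF q o(2)] T o unfolding is_iso_def by simp
    then show False using cmp_cancel_iso_l[OF qi_unit(1)[OF q o(2)] f(1)] f(2) T o by simp
  qed
  then show ?thesis unfolding nz_def using f T o by (intro bexI[of _ "fmap G X Y f"]) auto
qed

lemma qi_nz:
  assumes q: "quasi_inverse C G G' \<eta> \<theta>" and o: "X \<in> Ob C" "Y \<in> Ob C"
  shows "nz (fobj G X) (fobj G Y) \<longleftrightarrow> nz X Y"
proof
  note T = qi_af[OF q]
  assume "nz (fobj G X) (fobj G Y)"
  then have "nz (fobj G' (fobj G X)) (fobj G' (fobj G Y))" using qi_nz_map[OF qi_sym[OF q]] T o by simp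
  then have "nz X (fobj G' (fobj G Y))"
    using nz_iso1[OF iso_sym[OF qi_isomorphic(1)[OF q o(1)]]] T o by simp
  then show "nz X Y" using nz_iso2[OF iso_sym[OF qi_isomorphic(1)[OF q o(2)]]] T o by simp
qed (use qi_nz_map[OF q o] in blast)

text \<open>The shadow of the adjunction between \<open>G'\<close> and \<open>G\<close> on
  nonvanishing: apply \<open>G\<close> to a morphism out of \<open>G' X\<close> and replace G G' X
  by the isomorphic \<open>X\<close>.\<close>

lemma qi_adj_nz:
  assumes q: "quasi_inverse C G G' \<eta> \<theta>" and o: "X \<in> Ob C" "Y \<in> Ob C"
  shows "nz X (fobj G Y) \<longleftrightarrow> nz (fobj G' X) Y"
proof -
  note T = qi_af[OF q]
  have "nz (fobj G' X) Y \<longleftrightarrow> nz (fobj G (fobj G' X)) (fobj G Y)" using qi_nz[OF q] T o by simp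
  also have "\<dots> \<longleftrightarrow> nz X (fobj G Y)"
    using nz_iso1[OF qi_isomorphic(2)[OF q o(1)]] nz_iso1[OF iso_sym[OF qi_isomorphic(2)[OF q o(1)]]]
      T o by auto
  finally show ?thesis ..
qed

lemma qi_zero:
  assumes q: "quasi_inverse C G G' \<eta> \<theta>" and o: "X \<in> Ob C"
  shows "zero_object C (fobj G X) \<longleftrightarrow> zero_object C X"
  using qi_nz[OF q o o] zero_object_iff_nz qi_af[OF q] o by simp

text \<open>A decomposition of G X is carried by \<open>G'\<close> to one of G' G X, which is
  isomorphic to \<open>X\<close>; and \<open>G'\<close> reflects zero objects.\<close>

lemma qi_indecomposable:
  assumes q: "quasi_inverse C G G' \<eta> \<theta>" and X: "indecomposable C X"
  shows "indecomposable C (fobj G X)"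
proof -
  note T = qi_af[OF q]
  have Xo: "X \<in> Ob C" using X unfolding indecomposable_def by blast
  have X': "indecomposable C (fobj G' (fobj G X))"
    using indecomposable_iso[OF qi_isomorphic(1)[OF q Xo] X] T Xo by simp
  have "zero_object C A \<or> zero_object C B"
    if "A \<in> Ob C" "B \<in> Ob C" "is_direct_sum C A B (fobj G X)" for A B
  proof -
    have "is_direct_sum C (fobj G' A) (fobj G' B) (fobj G' (fobj G X))"
      using af_direct_sum[OF T(2) that(3,1,2)] T Xo by simp
    then have "zero_object C (fobj G' A) \<or> zero_object C (fobj G' B)"
      using X' that T unfolding indecomposable_def by simp
    then show ?thesis using qi_zero[OF qi_sym[OF q]] that by blast
  qed
  then show ?thesis using X T Xo qi_zero[OF q Xo] unfolding indecomposable_def by simp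
qed

end

section \<open>Powers with integer exponents\<close>

lemma comp_func_assoc: "comp_func (comp_func R S) T = comp_func R (comp_func S T)"
  by (simp add: comp_func_def)

lemma npow_Suc2: "npow T (Suc n) = comp_func (npow T n) T"
proof (induction n)
  case 0
  then show ?case by (simp add: id_func_def comp_func_def)
next
  case (Suc n)
  have "npow T (Suc (Suc n)) = comp_func T (comp_func (npow T n) T)"
    unfolding npow.simps(2)[of T "Suc n"] Suc ..
  then show ?case by (simp add: comp_func_assoc)
qed

lemma npow_add: "npow T (m + n) = comp_func (npow T m) (npow T n)"
  by (induction m) (simp_all add: id_func_def comp_func_def)

lemma ipow_swap: "ipow G' G i = ipow G G' (- i)"
  by (simp add: ipow_def)

lemma ipow_nat [simp]: "ipow G G' (int n) = npow G n"
  by (simp add: ipow_def)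

lemma ipow_neg_nat [simp]: "ipow G G' (- int n) = npow G' n"
  by (simp add: ipow_def)

lemma ipow_1 [simp]: "fobj (ipow G G' 1) X = fobj G X" "fmap (ipow G G' 1) X Y f = fmap G X Y f"
  by (simp_all add: ipow_def comp_func_def id_func_def)

lemma ipow_0 [simp]: "fobj (ipow G G' 0) X = X" "fmap (ipow G G' 0) X Y f = f"
  by (simp_all add: ipow_def id_func_def)

lemma expand_0: "expand C P Q \<theta> a 0 X = Idn C (fobj (npow P a) X)"
  by (cases a) simp_all

lemma coherence_pm: "coherence C G G' \<eta> \<theta> (int a) (- int b) X = expand C G G' \<theta> a b X"
  by (cases "b = 0") (simp_all add: coherence_def expand_0)

lemma coherence_mp: "coherence C G G' \<eta> \<theta> (- int a) (int b) X = expand C G' G \<eta> a b X"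
  by (cases "a = 0") (simp_all add: coherence_def)

lemma coherence_pp: "coherence C G G' \<eta> \<theta> (int a) (int b) X = Idn C (fobj (npow G (a + b)) X)"
  unfolding coherence_def by (simp add: ipow_def nat_add_distrib)

lemma coherence_mm: "coherence C G G' \<eta> \<theta> (- int a) (- int b) X = Idn C (fobj (npow G' (a + b)) X)"
proof -
  have "ipow G G' (- int a - int b) = npow G' (a + b)" using ipow_neg_nat[of G G' "a + b"] by simp
  then show ?thesis by (cases "a = 0"; cases "b = 0") (simp_all add: coherence_def expand_0)
qed

text \<open>Exchanging \<open>G\<close> and \<open>G'\<close> changes the sign of the exponents.
  Since \<open>quasi_inverse\<close> is symmetric, each coherence statement can be proved for one
  sign pattern and transferred to the opposite one.\<close>

lemma coherence_swap: "coherence C G' G \<theta> \<eta> j i X = coherence C G G' \<eta> \<theta> (- j) (- i) X"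
proof -
  obtain a where a: "j = int a \<or> j = - int a" using int_cases2 by blast
  obtain b where b: "i = int b \<or> i = - int b" using int_cases2 by blast
  from a b show ?thesis
    using coherence_pm[of C G' G \<theta> \<eta> a b X] coherence_mp[of C G G' \<eta> \<theta> a b X]
      coherence_mp[of C G' G \<theta> \<eta> a b X] coherence_pm[of C G G' \<eta> \<theta> a b X]
      coherence_pp[of C G' G \<theta> \<eta> a b X] coherence_mm[of C G G' \<eta> \<theta> a b X]
      coherence_mm[of C G' G \<theta> \<eta> a b X] coherence_pp[of C G G' \<eta> \<theta> a b X] by auto
qed

section \<open>Coherence isomorphisms between powers of an autoequivalence\<close>

locale orbit = preadd C for C :: "('o, 'a) cat" +
  fixes G G' :: "('o, 'a, 'o, 'a) func" and \<eta> \<theta> :: "'o \<Rightarrow> 'a"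
  assumes qi: "quasi_inverse C G G' \<eta> \<theta>"
begin

lemma orbit_swap: "orbit C G' G \<theta> \<eta>"
  by unfold_locales (rule qi_sym[OF qi])

abbreviation pw :: "int \<Rightarrow> 'o \<Rightarrow> 'o" where "pw i \<equiv> fobj (ipow G G' i)"
abbreviation pm :: "int \<Rightarrow> 'o \<Rightarrow> 'o \<Rightarrow> 'a \<Rightarrow> 'a" where "pm i \<equiv> fmap (ipow G G' i)"
abbreviation co :: "int \<Rightarrow> int \<Rightarrow> 'o \<Rightarrow> 'a" where "co \<equiv> coherence C G G' \<eta> \<theta>"

lemma af_npow: "additive_functor C C T \<Longrightarrow> additive_functor C C (npow T n)"
  by (induction n) (simp_all add: af_id_func af_comp_func)

lemma af_G [simp]: "additive_functor C C G" "additive_functor C C G'"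
  using qi_af[OF qi] .

lemma af_ipow [simp]: "additive_functor C C (ipow G G' i)"
  unfolding ipow_def by (simp add: af_npow)

lemma pw_Suc: "pw (1 + int n) X = fobj G (fobj (npow G n) X)"
  "pm (1 + int n) X Y f = fmap G (fobj (npow G n) X) (fobj (npow G n) Y) (fmap (npow G n) X Y f)"
  using ipow_nat[of G G' "Suc n"] by (simp_all add: comp_func_def)

text \<open>For \<open>j < 0\<close> the right-hand side contains a factor \<open>GG'\<close> that is missing on the left.\<close>

lemma pw_succ:
  assumes "0 \<le> j"
  shows "pw (1 + j) X = fobj G (pw j X)"
    "pm (1 + j) X Y f = fmap G (pw j X) (pw j Y) (pm j X Y f)"
  using pw_Suc[of "nat j"] assms by (simp_all add: ipow_def)

lemma theta_in [simp]: "X \<in> Ob C \<Longrightarrow> \<theta> X \<in> Hom C X (fobj G (fobj G' X))"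
  and eta_in [simp]: "X \<in> Ob C \<Longrightarrow> \<eta> X \<in> Hom C X (fobj G' (fobj G X))"
  using qi_unit[OF qi] unfolding is_iso_def by blast+

text \<open>Each insertion is the image of a component of \<open>\<theta>\<close>, an isomorphism,
  under a power of \<open>G\<close>.\<close>

lemma expand_iso:
  "X \<in> Ob C \<Longrightarrow> is_iso C (pw (int a - int b) X) (fobj (npow G a) (fobj (npow G' b) X)) (expand C G G' \<theta> a b X)"
proof (induction a arbitrary: b)
  case 0
  have "pw (- int b) X = fobj (npow G' b) X" by simp
  then show ?case using 0 by (simp add: id_func_def af_npow)
next
  case (Suc a)
  show ?case
  proof (cases b)
    case 0
    have "pw (int (Suc a)) X = fobj (npow G (Suc a)) X" by (simp only: ipow_nat)
    then show ?thesis using 0 Suc.prems by (simp add: id_func_def comp_func_def af_npow)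
  next
    case (Suc b')
    let ?Y = "fobj (npow G' b') X"
    have "is_iso C (pw (int a - int b') X) (fobj (npow G a) (fobj G (fobj G' ?Y)))
      (Cmp C (pw (int a - int b') X) (fobj (npow G a) ?Y) (fobj (npow G a) (fobj G (fobj G' ?Y)))
        (fmap (npow G a) ?Y (fobj G (fobj G' ?Y)) (\<theta> ?Y)) (expand C G G' \<theta> a b' X))"
      using is_iso_cmp[OF Suc.IH[OF Suc.prems, of b'] af_is_iso[OF af_npow qi_unit(2)[OF qi]]] Suc.prems
      by (simp add: af_npow)
    moreover have "fobj (npow G a) (fobj G U) = fobj G (fobj (npow G a) U)" for U
      using arg_cong[OF npow_Suc2[of G a], of "\<lambda>T. fobj T U"] by (simp add: comp_func_def)
    ultimately show ?thesis using Suc by (simp add: comp_func_def)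
  qed
qed

lemma npow_af [simp]: "additive_functor C C (npow G n)" "additive_functor C C (npow G' n)"
  by (simp_all add: af_npow)

lemma co_0l: "co 0 i X = Idn C (pw i X)"
proof -
  obtain b where "i = int b \<or> i = - int b" using int_cases2 by blast
  then show ?thesis using coherence_pp[of C G G' \<eta> \<theta> 0 b X] coherence_pm[of C G G' \<eta> \<theta> 0 b X]
    by auto
qed

lemma co_0r: "co j 0 X = Idn C (pw j X)"
  by (simp add: coherence_def expand_0 ipow_def)

lemma co_1_nat: "co 1 (int b) X = Idn C (pw (1 + int b) X)"
  by (simp add: coherence_def)

lemma co_1_neg:
  assumes "X \<in> Ob C"
  shows "co 1 (- int (Suc a)) X = \<theta> (fobj (npow G' a) X)"
proof -
  have "co (int 1) (- int (Suc a)) X = expand C G G' \<theta> (Suc 0) (Suc a) X"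
    unfolding coherence_pm by simp
  also have "\<dots> = \<theta> (fobj (npow G' a) X)"
    using assms by (simp add: id_func_def comp_func_def)
  finally show ?thesis by simp
qed

lemma npow_fobj_shift: "fobj (npow T a) (fobj T U) = fobj T (fobj (npow T a) U)"
  using arg_cong[OF npow_Suc2[of T a], of "\<lambda>T. fobj T U"] by (simp add: comp_func_def)

text \<open>The pair inserted last is the innermost one, standing between the powers of
  \<open>G\<close> and those of \<open>G'\<close>; all inductions on coherence isomorphisms peel it
  off.\<close>

lemma co_pSuc: "co (int (Suc a)) (- int (Suc b)) X =
  Cmp C (pw (int a - int b) X) (fobj (npow G a) (fobj (npow G' b) X))
    (fobj (npow G (Suc a)) (fobj (npow G' (Suc b)) X))
    (fmap (npow G a) (fobj (npow G' b) X) (fobj G (fobj G' (fobj (npow G' b) X))) (\<theta> (fobj (npow G' b) X)))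
    (co (int a) (- int b) X)"
  unfolding coherence_pm by simp

lemma co_mSuc: "co (- int (Suc a)) (int (Suc b)) X =
  Cmp C (pw (int b - int a) X) (fobj (npow G' a) (fobj (npow G b) X))
    (fobj (npow G' (Suc a)) (fobj (npow G (Suc b)) X))
    (fmap (npow G' a) (fobj (npow G b) X) (fobj G' (fobj G (fobj (npow G b) X))) (\<eta> (fobj (npow G b) X)))
    (co (- int a) (int b) X)"
  unfolding coherence_mp by (simp add: ipow_swap[of G' G])

lemma co_iso:
  assumes "X \<in> Ob C"
  shows "is_iso C (pw (j + i) X) (pw j (pw i X)) (co j i X)"
proof -
  obtain a where "j = int a \<or> j = - int a" using int_cases2 by blast
  moreover obtain b where "i = int b \<or> i = - int b" using int_cases2 by blast
  moreover have "is_iso C (pw (int a + - int b) X) (pw (int a) (pw (- int b) X)) (co (int a) (- int b) X)"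
    using expand_iso[OF assms, of a b] unfolding coherence_pm by simp
  moreover have "is_iso C (pw (- int a + int b) X) (pw (- int a) (pw (int b) X)) (co (- int a) (int b) X)"
    using orbit.expand_iso[OF orbit_swap assms, of a b] unfolding coherence_mp ipow_swap[of G' G] by simp
  moreover have "is_iso C (pw (int a + int b) X) (pw (int a) (pw (int b) X)) (co (int a) (int b) X)"
    unfolding coherence_pp of_nat_add[symmetric] ipow_nat npow_add using assms by (simp add: comp_func_def)
  moreover have "is_iso C (pw (- int a + - int b) X) (pw (- int a) (pw (- int b) X)) (co (- int a) (- int b) X)"
  proof -
    have "- int a + - int b = - int (a + b)" by simp
    then show ?thesis
      unfolding coherence_mm ipow_neg_nat npow_add using assms by (simp only: ipow_neg_nat npow_add) (simp add: comp_func_def)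
  qed
  ultimately show ?thesis by blast
qed

lemma co_in [simp]: "X \<in> Ob C \<Longrightarrow> co j i X \<in> Hom C (pw (j + i) X) (pw j (pw i X))"
  using co_iso unfolding is_iso_def by blast

text \<open>Induction on \<open>a\<close>: the innermost pair is inserted by
  \<open>\<theta>\<close>, whose naturality is transported by the power of \<open>G\<close> in front
  of it.\<close>

lemma co_natural_pm:
  assumes f: "f \<in> Hom C X Y" and o: "X \<in> Ob C" "Y \<in> Ob C"
  shows "Cmp C (pw (int a - int b) X) (pw (int a - int b) Y) (fobj (npow G a) (fobj (npow G' b) Y))
     (co (int a) (- int b) Y) (pm (int a - int b) X Y f) =
    Cmp C (pw (int a - int b) X) (fobj (npow G a) (fobj (npow G' b) X)) (fobj (npow G a) (fobj (npow G' b) Y))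
     (fmap (npow G a) (fobj (npow G' b) X) (fobj (npow G' b) Y) (fmap (npow G' b) X Y f)) (co (int a) (- int b) X)"
proof (induction a arbitrary: b)
  case 0
  have "co (int 0) (- int b) Z = Idn C (fobj (npow G' b) Z)" for Z using co_0l[of "- int b" Z] by simp
  then show ?case using f o by (simp add: id_func_def)
next
  case (Suc a)
  show ?case
  proof (cases b)
    case 0
    have "co (int (Suc a)) (- int b) Z = Idn C (fobj (npow G (Suc a)) Z)" for Z
      using co_0r[of "int (Suc a)" Z] 0 by (simp only: ipow_nat) simp
    moreover have "int (Suc a) - int b = int (Suc a)" using 0 by simp
    then have "ipow G G' (int (Suc a) - int b) = npow G (Suc a)" by (simp only: ipow_nat)
    ultimately show ?thesis using f o 0 af_comp_func[OF af_G(1) npow_af(1), of a]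
      by (simp only: npow.simps(1) id_func_def func.simps) simp
  next
    case (Suc b')
    let ?Q = "fobj (npow G' b')" and ?P = "fobj (npow G a)" and ?d = "int a - int b'"
    have e: "int (Suc a) - int b = ?d" using Suc by simp
    have oQ: "?Q X \<in> Ob C" "?Q Y \<in> Ob C" using o by auto
    have Qf: "fmap (npow G' b') X Y f \<in> Hom C (?Q X) (?Q Y)" using f o by simp
    have PS: "fobj (npow G (Suc a)) (fobj (npow G' (Suc b')) Z) = ?P (fobj G (fobj G' (?Q Z)))" for Z
      by (simp add: comp_func_def npow_fobj_shift)
    have PSf: "fmap (npow G (Suc a)) (fobj (npow G' (Suc b')) X) (fobj (npow G' (Suc b')) Y) (fmap (npow G' (Suc b')) X Y f)
      = fmap (npow G a) (fobj G (fobj G' (?Q X))) (fobj G (fobj G' (?Q Y)))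
         (fmap G (fobj G' (?Q X)) (fobj G' (?Q Y)) (fmap G' (?Q X) (?Q Y) (fmap (npow G' b') X Y f)))"
      using arg_cong[OF npow_Suc2[of G a], of "\<lambda>T. fmap T (fobj G' (?Q X)) (fobj G' (?Q Y)) (fmap G' (?Q X) (?Q Y) (fmap (npow G' b') X Y f))"]
      by (simp add: comp_func_def)
    have in1: "co (int a) (- int b') Z \<in> Hom C (pw ?d Z) (?P (?Q Z))" if "Z \<in> Ob C" for Z
      using co_in[OF that, of "int a" "- int b'"] by simp
    have "Cmp C (pw ?d X) (pw ?d Y) (?P (fobj G (fobj G' (?Q Y)))) (co (int (Suc a)) (- int (Suc b')) Y) (pm ?d X Y f)
      = Cmp C (pw ?d X) (?P (?Q Y)) (?P (fobj G (fobj G' (?Q Y)))) (fmap (npow G a) (?Q Y) (fobj G (fobj G' (?Q Y))) (\<theta> (?Q Y)))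
         (Cmp C (pw ?d X) (pw ?d Y) (?P (?Q Y)) (co (int a) (- int b') Y) (pm ?d X Y f))"
      unfolding co_pSuc PS using f o in1[OF o(2)] oQ by (simp add: assoc)
    also have "\<dots> = Cmp C (pw ?d X) (?P (?Q X)) (?P (fobj G (fobj G' (?Q Y))))
      (fmap (npow G a) (?Q X) (fobj G (fobj G' (?Q Y)))
        (Cmp C (?Q X) (?Q Y) (fobj G (fobj G' (?Q Y))) (\<theta> (?Q Y)) (fmap (npow G' b') X Y f)))
      (co (int a) (- int b') X)"
      unfolding Suc.IH using o oQ Qf in1[OF o(1)] by (simp add: assoc)
    also have "\<dots> = Cmp C (pw ?d X) (?P (fobj G (fobj G' (?Q X)))) (?P (fobj G (fobj G' (?Q Y))))
       (fmap (npow G a) (fobj G (fobj G' (?Q X))) (fobj G (fobj G' (?Q Y)))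
         (fmap G (fobj G' (?Q X)) (fobj G' (?Q Y)) (fmap G' (?Q X) (?Q Y) (fmap (npow G' b') X Y f))))
       (co (int (Suc a)) (- int (Suc b')) X)"
      unfolding co_pSuc PS qi_natural[OF qi_sym[OF qi] Qf oQ] using o oQ Qf in1[OF o(1)] by (simp add: assoc)
    finally show ?thesis unfolding e unfolding Suc PS PSf .
  qed
qed

lemma co_natural:
  assumes f: "f \<in> Hom C X Y" and o: "X \<in> Ob C" "Y \<in> Ob C"
  shows "Cmp C (pw (j + i) X) (pw (j + i) Y) (pw j (pw i Y)) (co j i Y) (pm (j + i) X Y f) =
    Cmp C (pw (j + i) X) (pw j (pw i X)) (pw j (pw i Y)) (pm j (pw i X) (pw i Y) (pm i X Y f)) (co j i X)"
proof -
  obtain a where "j = int a \<or> j = - int a" using int_cases2 by blast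
  moreover obtain b where "i = int b \<or> i = - int b" using int_cases2 by blast
  moreover have ?thesis if "j = int a" "i = - int b"
    using co_natural_pm[OF f o, of a b] that by simp
  moreover have ?thesis if "j = - int a" "i = int b"
    using orbit.co_natural_pm[OF orbit_swap f o, of a b] that
    unfolding coherence_swap[of C G' G \<theta> \<eta>] ipow_swap[of G' G] by simp
  moreover have ?thesis if ij: "j = int a" "i = int b"
  proof -
    have "ipow G G' (j + i) = comp_func (npow G a) (npow G b)"
      unfolding ij of_nat_add[symmetric] ipow_nat npow_add ..
    then show ?thesis unfolding ij coherence_pp npow_add using f o by (simp add: comp_func_def)
  qed
  moreover have ?thesis if ij: "j = - int a" "i = - int b"
  proof -
    have "- int a + - int b = - int (a + b)" by simp
    then have "ipow G G' (j + i) = comp_func (npow G' a) (npow G' b)"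
      unfolding ij by (simp only: ipow_neg_nat npow_add)
    then show ?thesis unfolding ij coherence_mm npow_add using f o by (simp add: comp_func_def)
  qed
  ultimately show ?thesis by blast
qed

text \<open>The cocycle condition for the canonical isomorphisms \<open>G\<^sup>j\<^sup>+\<^sup>i \<rightarrow> G\<^sup>jG\<^sup>i\<close>.\<close>

definition coc :: "int \<Rightarrow> int \<Rightarrow> int \<Rightarrow> 'o \<Rightarrow> bool" where
  "coc k j i X \<longleftrightarrow>
    Cmp C (pw (k + j + i) X) (pw (k + j) (pw i X)) (pw k (pw j (pw i X))) (co k j (pw i X)) (co (k + j) i X) =
    Cmp C (pw (k + j + i) X) (pw k (pw (j + i) X)) (pw k (pw j (pw i X)))
      (pm k (pw (j + i) X) (pw j (pw i X)) (co j i X)) (co k (j + i) X)"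

lemma pw_int: "pw (int a) X = fobj (npow G a) X" "pw (- int a) X = fobj (npow G' a) X"
  by simp_all

lemma npow_comp: "fobj (npow T a) (fobj (npow T b) X) = fobj (npow T (a + b)) X"
  by (simp add: npow_add comp_func_def)

lemma coc_1_pp:
  assumes X: "X \<in> Ob C"
  shows "coc 1 (int a) (int b) X"
proof -
  have e: "1 + int a = int (Suc a)" "int (Suc a) + int b = int (Suc a + b)" "int a + int b = int (a + b)"
    "1 + int (a + b) = int (Suc a + b)"
    by simp_all
  have "co 1 (int n) Y = Idn C (fobj (npow G (Suc n)) Y)" for n Y
    using co_1_nat[of n Y] ipow_nat[of G G' "Suc n"] by simp
  then show ?thesis unfolding coc_def e coherence_pp ipow_nat npow_comp using X
    by (simp add: comp_func_def npow_comp del: of_nat_Suc of_nat_add)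
qed

text \<open>This is the cocycle condition for the exponents 1, a, -b with its identity
  \<open>co 1 (int a)\<close> removed. Both sides insert the same innermost \<open>\<theta>\<close>
  last, so the induction on \<open>a\<close> keeps \<open>b\<close> free.\<close>

lemma coc_1_pm:
  assumes X: "X \<in> Ob C"
  shows "co (int (Suc a)) (- int b) X = Cmp C (pw (1 + int a - int b) X) (fobj G (pw (int a - int b) X))
     (fobj (npow G (Suc a)) (fobj (npow G' b) X))
     (fmap G (pw (int a - int b) X) (fobj (npow G a) (fobj (npow G' b) X)) (co (int a) (- int b) X))
     (co 1 (int a - int b) X)"
proof (induction a arbitrary: b)
  case 0
  have "co (int 0) (- int b) X = Idn C (fobj (npow G' b) X)" using co_0l[of "- int b" X] by simp
  then show ?case using co_in[OF X, of 1 "- int b"] X by (simp add: id_func_def comp_func_def)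
next
  case (Suc a)
  show ?case
  proof (cases b)
    case 0
    have "co (int n) 0 X = Idn C (fobj (npow G n) X)" for n using co_0r[of "int n" X] by simp
    moreover have "co 1 (int n) X = Idn C (fobj (npow G (Suc n)) X)" "1 + int n = int (Suc n)" for n
      using co_1_nat[of n X] ipow_nat[of G G' "Suc n"] by simp_all
    ultimately show ?thesis unfolding 0 using X
      by (simp add: id_func_def comp_func_def pw_Suc del: of_nat_Suc)
  next
    case (Suc b')
    let ?Q = "fobj (npow G' b') X" and ?d = "int a - int b'"
    have e: "int (Suc a) - int b = ?d" "1 + int (Suc a) - int b = 1 + ?d" "int (Suc a) - int b' = 1 + ?d"
      "1 + int a - int b' = 1 + ?d"
      using Suc by simp_all
    have i: "co (int a) (- int b') X \<in> Hom C (pw ?d X) (fobj (npow G a) ?Q)"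
      "co 1 ?d X \<in> Hom C (pw (1 + ?d) X) (fobj G (pw ?d X))"
      using co_in[OF X, of "int a" "- int b'"] co_in[OF X, of 1 ?d] by simp_all
    have s: "fobj (npow G a) (fobj G U) = fobj G (fobj (npow G a) U)" for U by (rule npow_fobj_shift)
    have "fmap (npow G a) ?Q (fobj G (fobj G' ?Q)) (\<theta> ?Q) \<in> Hom C (fobj (npow G a) ?Q) (fobj (npow G a) (fobj G (fobj G' ?Q)))"
      using X by simp
    then have t: "fmap (npow G a) ?Q (fobj G (fobj G' ?Q)) (\<theta> ?Q) \<in> Hom C (fobj (npow G a) ?Q) (fobj G (fobj (npow G a) (fobj G' ?Q)))"
      unfolding s .
    have c: "fobj (comp_func S T) U = fobj S (fobj T U)" for S T :: "('o, 'a, 'o, 'a) func" and U by (simp add: comp_func_def)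
    have f: "fmap (comp_func S T) U V g = fmap S (fobj T U) (fobj T V) (fmap T U V g)" for S T :: "('o, 'a, 'o, 'a) func" and U V g by (simp add: comp_func_def)
    show ?thesis
      unfolding Suc co_pSuc[of "Suc a"] e(3) Suc.IH[of b'] e(4) unfolding e[unfolded Suc] co_pSuc[of a]
      using i t X by (simp add: c f s assoc)
  qed
qed

text \<open>Coherence maps between negative powers are identities, and for positive \<open>a\<close>
  the two remaining maps \<open>co 1\<close> are both \<open>\<theta>\<close> at the same
  object.\<close>

lemma coc_1_mm:
  assumes X: "X \<in> Ob C"
  shows "coc 1 (- int a) (- int b) X"
proof (cases a)
  case 0
  have "co 1 (- int b) X \<in> Hom C (pw (1 + - int b) X) (fobj G (fobj (npow G' b) X))"
    using co_in[OF X, of 1 "- int b"] by simp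
  then show ?thesis unfolding coc_def 0 using X by (simp add: co_0l co_0r)
next
  case (Suc a')
  have e: "1 + - int (Suc a') = - int a'" "- int a' + - int b = - int (a' + b)"
    "- int (Suc a') + - int b = - int (Suc (a' + b))" by simp_all
  have o: "fobj (npow G' n) X \<in> Ob C" for n using X by simp
  have "\<theta> (fobj (npow G' (a' + b)) X) \<in> Hom C (fobj (npow G' (a' + b)) X) (fobj G (fobj (npow G' (Suc (a' + b))) X))"
    using theta_in[OF o] by (simp add: comp_func_def)
  then show ?thesis unfolding coc_def Suc e coherence_mm pw_int npow_comp co_1_neg[OF o] co_1_neg[OF X] using o
    by (simp add: comp_func_def npow_comp del: of_nat_Suc of_nat_add)
qed

text \<open>The mixed case: pairs G' G inserted by \<open>\<eta>\<close> meet a pair G G' inserted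
  by \<open>\<theta>\<close>. The triangle identity compares the two where no further power of
  \<open>G'\<close> is present; otherwise naturality of \<open>\<theta>\<close> moves one past the
  other.\<close>

lemma coc_1_mp:
  assumes X: "X \<in> Ob C"
  shows "coc 1 (- int a) (int b) X"
proof (induction a arbitrary: b)
  case 0
  have "co 1 (int b) X \<in> Hom C (pw (1 + int b) X) (fobj G (fobj (npow G b) X))"
    using co_in[OF X, of 1 "int b"] by simp
  moreover have "co 1 0 (fobj (npow G b) X) = Idn C (fobj G (fobj (npow G b) X))"
    using co_0r[of 1] by simp
  ultimately show ?case unfolding coc_def using X by (simp add: co_0l co_0r co_1_nat)
next
  case (Suc a)
  let ?P = "\<lambda>b. fobj (npow G b) X" and ?Q = "\<lambda>a U. fobj (npow G' a) U"
  have e1: "1 + - int (Suc a) = - int a" by simp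
  have o: "?P n \<in> Ob C" "?Q m (?P n) \<in> Ob C" for n m using X by auto
  show ?case
  proof (cases b)
    case 0
    show ?thesis unfolding coc_def e1 0 using X o co_1_neg[OF X, of a]
      by (simp add: co_0r comp_func_def del: of_nat_Suc)
  next
    case (Suc b')
    have e2: "- int (Suc a) + int b = int b' - int a" "- int a + int b = 1 + (int b' - int a)" using Suc by simp_all
    have m1: "co (- int a) (int b') X \<in> Hom C (pw (int b' - int a) X) (?Q a (?P b'))"
      using co_in[OF X, of "- int a" "int b'"] by simp
    have m2: "co 1 (int b' - int a) X \<in> Hom C (pw (1 + (int b' - int a)) X) (fobj G (pw (int b' - int a) X))"
      using co_in[OF X, of 1 "int b' - int a"] by simp
    have m3: "\<eta> (?P b') \<in> Hom C (?P b') (fobj G' (fobj G (?P b')))" using o by simp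
    have PS: "fobj (npow G (Suc n)) U = fobj G (fobj (npow G n) U)" "fobj (npow G' (Suc n)) U = fobj G' (fobj (npow G' n) U)" for n U
      by (simp_all add: comp_func_def)
    have QS: "?Q n (fobj G' U) = fobj G' (?Q n U)" for n U by (rule npow_fobj_shift)
    have m4: "fmap (npow G' n) (?P b') (fobj G' (fobj G (?P b'))) (\<eta> (?P b')) \<in> Hom C (?Q n (?P b')) (fobj G' (?Q n (fobj G (?P b'))))" for n
      using af_map[OF npow_af(2) m3, of n] o unfolding QS by simp
    have IH: "Cmp C (pw (1 + (int b' - int a)) X) (pw (1 - int a) (?P b')) (fobj G (?Q a (?P b'))) (co 1 (- int a) (?P b')) (co (1 - int a) (int b') X)
      = Cmp C (pw (1 + (int b' - int a)) X) (fobj G (pw (int b' - int a) X)) (fobj G (?Q a (?P b')))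
         (fmap G (pw (int b' - int a) X) (?Q a (?P b')) (co (- int a) (int b') X)) (co 1 (int b' - int a) X)"
    proof -
      have x: "1 + - int a + int b' = 1 + (int b' - int a)" "- int a + int b' = int b' - int a" by simp_all
      show ?thesis using Suc.IH[of b', unfolded coc_def x] by simp
    qed
    \<comment> \<open>The innermost \<open>\<eta>\<close> is pulled out in front of a composite at
      smaller exponents, to which the induction hypothesis \<open>IH\<close> applies.\<close>
    have lhs: "Cmp C (pw (- int a + int b) X) (?Q a (?P b)) (fobj G (fobj G' (?Q a (?P b)))) (\<theta> (?Q a (?P b))) (co (- int a) (int b) X)
      = Cmp C (pw (1 + (int b' - int a)) X) (fobj G (?Q a (?P b'))) (fobj G (fobj G' (?Q a (fobj G (?P b')))))
          (fmap G (?Q a (?P b')) (fobj G' (?Q a (fobj G (?P b')))) (fmap (npow G' a) (?P b') (fobj G' (fobj G (?P b'))) (\<eta> (?P b'))))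
          (Cmp C (pw (1 + (int b' - int a)) X) (pw (1 - int a) (?P b')) (fobj G (?Q a (?P b'))) (co 1 (- int a) (?P b')) (co (1 - int a) (int b') X))"
    proof (cases a)
      case 0
      have "co 0 (int b) X = Idn C (?P b)" "co 1 (int b') X = Idn C (?P b)" "co 1 0 (?P b') = Idn C (?P b)" "pw (1 + int b') X = ?P b"
        using co_0l[of "int b" X] co_1_nat[of b' X] co_0r[of 1 "?P b'"] ipow_nat[of G G' "Suc b'"] Suc by (simp_all add: comp_func_def)
      \<comment> \<open>The remaining coherence maps are identities, and the claim is the triangle
        identity saying that \<open>G\<close> applied to the unit is \<open>\<theta>\<close> at an
        image of \<open>G\<close>.\<close>
      then show ?thesis using 0 Suc o qi_triangle[OF qi o(1)[of b']]
        by (simp add: id_func_def PS del: npow.simps(2))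
    next
      case (Suc a')
      note b = \<open>b = Suc b'\<close>
      have m5: "co (- int a') (int b') X \<in> Hom C (pw (int b' - int a') X) (?Q a' (?P b'))"
        using co_in[OF X, of "- int a'" "int b'"] by simp
      have x: "1 - int (Suc a') = - int a'" "1 + (int b' - int (Suc a')) = int b' - int a'" "- int (Suc a') + int (Suc b') = int b' - int a'"
        by simp_all
      have fm: "fmap (npow G' (Suc a')) (?P b') (fobj G' (fobj G (?P b'))) (\<eta> (?P b'))
         = fmap G' (?Q a' (?P b')) (fobj G' (?Q a' (fobj G (?P b')))) (fmap (npow G' a') (?P b') (fobj G' (fobj G (?P b'))) (\<eta> (?P b')))"
        by (simp add: comp_func_def QS)
      have "Cmp C (?Q a' (?P b')) (?Q (Suc a') (?P (Suc b'))) (fobj G (fobj G' (?Q (Suc a') (?P (Suc b'))))) (\<theta> (?Q (Suc a') (?P (Suc b'))))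
          (fmap (npow G' a') (?P b') (fobj G' (fobj G (?P b'))) (\<eta> (?P b')))
        = Cmp C (?Q a' (?P b')) (fobj G (fobj G' (?Q a' (?P b')))) (fobj G (fobj G' (?Q (Suc a') (?P (Suc b')))))
         (fmap G (fobj G' (?Q a' (?P b'))) (fobj G' (?Q (Suc a') (?P (Suc b')))) (fmap (npow G' (Suc a')) (?P b') (fobj G' (fobj G (?P b'))) (\<eta> (?P b'))))
         (\<theta> (?Q a' (?P b')))"
        unfolding fm using qi_natural[OF qi_sym[OF qi] m4[of a']] o X by (simp add: PS del: npow.simps(2))
      note n = this
      have th: "\<theta> (?Q (Suc a') (?P (Suc b'))) \<in> Hom C (fobj G' (?Q a' (fobj G (?P b')))) (fobj G (fobj G' (fobj G' (?Q a' (fobj G (?P b'))))))"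
        using theta_in[OF o(2), of "Suc a'" "Suc b'"] by (simp add: PS del: npow.simps(2))
      have m6: "fmap G (fobj G' (?Q a' (?P b'))) (fobj G' (?Q (Suc a') (?P (Suc b')))) (fmap (npow G' (Suc a')) (?P b') (fobj G' (fobj G (?P b'))) (\<eta> (?P b')))
         \<in> Hom C (fobj G (fobj G' (?Q a' (?P b')))) (fobj G (fobj G' (fobj G' (?Q a' (fobj G (?P b'))))))"
        using af_map[OF af_G(1) m4[of "Suc a'"]] o X by (simp add: PS del: npow.simps(2))
      show ?thesis unfolding Suc b x co_mSuc co_1_neg[OF o(1)]
        using assoc[OF m5 m4 th] n assoc[OF m5 theta_in m6] o X by (simp add: PS del: npow.simps(2) of_nat_Suc)
    qed
    have e3: "1 + - int (Suc a) + int b = - int a + int b" by simp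
    have "co 1 (- int (Suc a)) (?P b) = \<theta> (?Q a (?P b))" using co_1_neg[OF o(1)] .
    moreover have "co (- int (Suc a)) (int b) X = Cmp C (pw (int b' - int a) X) (?Q a (?P b')) (fobj G' (?Q a (fobj G (?P b'))))
       (fmap (npow G' a) (?P b') (fobj G' (fobj G (?P b'))) (\<eta> (?P b'))) (co (- int a) (int b') X)"
      unfolding Suc co_mSuc by (simp add: PS del: npow.simps(2))
    ultimately show ?thesis unfolding coc_def e3 e1 e2 pw_int
      using lhs[unfolded e2 IH] m1 m2 m4[of a] o X Suc
      by (simp add: PS assoc del: npow.simps(2) of_nat_Suc)
  qed
qed

lemma coc_1: "X \<in> Ob C \<Longrightarrow> coc 1 j i X"
proof -
  assume X: "X \<in> Ob C"
  obtain a where "j = int a \<or> j = - int a" using int_cases2 by blast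
  moreover obtain b where "i = int b \<or> i = - int b" using int_cases2 by blast
  moreover have "coc 1 (int a) (- int b) X"
  proof -
    have e: "1 + int a = int (Suc a)" "int (Suc a) + - int b = 1 + int a - int b" "int a + - int b = int a - int b"
      by simp_all
    have "co 1 (int a) Y = Idn C (pw (int (Suc a)) Y)" for Y using co_1_nat[of a Y] by simp
    moreover have "co (int (Suc a)) (- int b) X \<in> Hom C (pw (1 + int a - int b) X) (pw (int (Suc a)) (pw (- int b) X))"
      using co_in[OF X, of "int (Suc a)" "- int b"] unfolding e .
    moreover have "pw 1 (pw (int a) U) = pw (int (Suc a)) U" for U using pw_succ(1)[of "int a" U] by simp
    ultimately show ?thesis unfolding coc_def using coc_1_pm[OF X, of a b] X unfolding e
      by (simp add: comp_func_def del: of_nat_Suc)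
  qed
  ultimately show ?thesis using coc_1_pp[OF X] coc_1_mm[OF X] coc_1_mp[OF X] by blast
qed

text \<open>The cocycle condition with first exponent 1, solved for \<open>co (1 + k)\<close>: for
  nonnegative \<open>k\<close> the map \<open>co 1 k\<close> is an identity. It is the recursion for
  the induction on the first exponent.\<close>

lemma co_succ:
  assumes X: "X \<in> Ob C" and k: "0 \<le> k"
  shows "co (1 + k) j X = Cmp C (pw (1 + k + j) X) (fobj G (pw (k + j) X)) (fobj G (pw k (pw j X)))
    (fmap G (pw (k + j) X) (pw k (pw j X)) (co k j X)) (co 1 (k + j) X)"
proof -
  have "co 1 k (pw j X) = Idn C (pw (1 + k) (pw j X))" using co_1_nat[of "nat k"] k by simp
  moreover have "pw 1 (pw k U) = pw (1 + k) U" for U using pw_succ(1)[OF k] by simp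
  moreover have "co (1 + k) j X \<in> Hom C (pw (1 + k + j) X) (pw (1 + k) (pw j X))"
    using co_in[OF X] by blast
  ultimately show ?thesis using coc_1[OF X, of k j] X unfolding coc_def by (simp add: pw_succ[OF k])
qed

text \<open>Pasting of squares: \<open>co_succ\<close> opens and closes the computation, the
  condition for first exponent 1 is used in the middle, and the induction hypothesis is applied
  under \<open>G\<close>.\<close>

lemma coc_nonneg:
  assumes X: "X \<in> Ob C"
  shows "coc (int k) j i X"
proof (induction k)
  case 0
  show ?case unfolding coc_def using X co_in[OF X, of j i] by (simp add: co_0l)
next
  case (Suc k)
  let ?k = "int k" and ?Y = "pw i X"
  have k: "0 \<le> ?k" by simp
  have Y: "?Y \<in> Ob C" using X by simp
  have e: "int (Suc k) = 1 + ?k" "1 + ?k + j = 1 + (?k + j)" "1 + ?k + j + i = 1 + (?k + j + i)"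
    "?k + (j + i) = ?k + j + i" "1 + (?k + j) + i = 1 + (?k + j + i)" "1 + ?k + (j + i) = 1 + (?k + j + i)"
    "1 + (?k + (j + i)) = 1 + (?k + j + i)"
    by simp_all
  have i1: "co ?k j ?Y \<in> Hom C (pw (?k + j) ?Y) (pw ?k (pw j ?Y))"
    "co (?k + j) i X \<in> Hom C (pw (?k + j + i) X) (pw (?k + j) ?Y)"
    "co ?k (j + i) X \<in> Hom C (pw (?k + j + i) X) (pw ?k (pw (j + i) X))"
    "co j i X \<in> Hom C (pw (j + i) X) (pw j ?Y)"
    "co 1 (?k + j + i) X \<in> Hom C (pw (1 + (?k + j + i)) X) (fobj G (pw (?k + j + i) X))"
    "co 1 (?k + j) ?Y \<in> Hom C (pw (1 + (?k + j)) ?Y) (fobj G (pw (?k + j) ?Y))"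
    "co (1 + (?k + j)) i X \<in> Hom C (pw (1 + (?k + j + i)) X) (pw (1 + (?k + j)) ?Y)"
    using co_in[OF Y, of ?k j] co_in[OF X, of "?k + j" i] co_in[OF X, of ?k "j + i"] co_in[OF X, of j i]
      co_in[OF X, of 1 "?k + j + i"] co_in[OF Y, of 1 "?k + j"] co_in[OF X, of "1 + (?k + j)" i]
    by (simp_all only: e ipow_1)
  have o: "pw m ?Y \<in> Ob C" "pw m X \<in> Ob C" "pw n (pw m ?Y) \<in> Ob C" "pw n (pw m X) \<in> Ob C" for m n
    using X by simp_all
  let ?s = "1 + (?k + j + i)"
  have "Cmp C (pw ?s X) (pw (1 + (?k + j)) ?Y) (fobj G (pw ?k (pw j ?Y))) (co (1 + ?k) j ?Y) (co (1 + (?k + j)) i X)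
    = Cmp C (pw ?s X) (fobj G (pw (?k + j) ?Y)) (fobj G (pw ?k (pw j ?Y))) (fmap G (pw (?k + j) ?Y) (pw ?k (pw j ?Y)) (co ?k j ?Y))
       (Cmp C (pw ?s X) (pw (1 + (?k + j)) ?Y) (fobj G (pw (?k + j) ?Y)) (co 1 (?k + j) ?Y) (co (1 + (?k + j)) i X))"
    unfolding co_succ[OF Y k] e using i1 o by (simp add: assoc)
  also have "\<dots> = Cmp C (pw ?s X) (fobj G (pw (?k + j) ?Y)) (fobj G (pw ?k (pw j ?Y))) (fmap G (pw (?k + j) ?Y) (pw ?k (pw j ?Y)) (co ?k j ?Y))
       (Cmp C (pw ?s X) (fobj G (pw (?k + j + i) X)) (fobj G (pw (?k + j) ?Y))
         (fmap G (pw (?k + j + i) X) (pw (?k + j) ?Y) (co (?k + j) i X)) (co 1 (?k + j + i) X))"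
    using coc_1[OF X, of "?k + j" i] unfolding coc_def e ipow_1 by simp
  also have "\<dots> = Cmp C (pw ?s X) (fobj G (pw (?k + j + i) X)) (fobj G (pw ?k (pw j ?Y)))
     (fmap G (pw (?k + j + i) X) (pw ?k (pw j ?Y))
       (Cmp C (pw (?k + j + i) X) (pw (?k + j) ?Y) (pw ?k (pw j ?Y)) (co ?k j ?Y) (co (?k + j) i X))) (co 1 (?k + j + i) X)"
    using i1 o by (simp add: assoc)
  also have "\<dots> = Cmp C (pw ?s X) (fobj G (pw (?k + j + i) X)) (fobj G (pw ?k (pw j ?Y)))
     (fmap G (pw (?k + j + i) X) (pw ?k (pw j ?Y))
       (Cmp C (pw (?k + j + i) X) (pw ?k (pw (j + i) X)) (pw ?k (pw j ?Y)) (pm ?k (pw (j + i) X) (pw j ?Y) (co j i X)) (co ?k (j + i) X))) (co 1 (?k + j + i) X)"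
    using Suc.IH unfolding coc_def by simp
  also have "\<dots> = Cmp C (pw ?s X) (fobj G (pw ?k (pw (j + i) X))) (fobj G (pw ?k (pw j ?Y)))
       (fmap G (pw ?k (pw (j + i) X)) (pw ?k (pw j ?Y)) (pm ?k (pw (j + i) X) (pw j ?Y) (co j i X)))
       (co (1 + ?k) (j + i) X)"
    unfolding co_succ[OF X k] e using i1 o af_map[OF af_ipow[of ?k] i1(4) o(2,1)] by (simp add: assoc)
  finally show ?case unfolding coc_def e pw_succ[OF k] .
qed

text \<open>A negative first exponent is a positive one for the pair in which \<open>G\<close> and
  \<open>G'\<close> are exchanged.\<close>

lemma coc:
  assumes X: "X \<in> Ob C"
  shows "coc k j i X"
proof -
  obtain n where "k = int n \<or> k = - int n" using int_cases2 by blast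
  moreover have "coc (- int n) j i X"
  proof -
    have "orbit.coc C G' G \<theta> \<eta> (int n) (- j) (- i) X" using orbit.coc_nonneg[OF orbit_swap X] .
    moreover have "- (int n + - j) = - int n + j" "- (int n + - j + - i) = - int n + j + i" "- (- j + - i) = j + i"
      "- (- j) = j" "- (- i) = i" by simp_all
    ultimately show ?thesis
      unfolding orbit.coc_def[OF orbit_swap] coherence_swap[of C G' G \<theta> \<eta>] ipow_swap[of G' G] coc_def
      by (simp add: algebra_simps)
  qed
  ultimately show ?thesis using coc_nonneg[OF X] by blast
qed

section \<open>Composition in the orbit category\<close>

text \<open>What a component of degree \<open>j\<close> and one of degree \<open>i\<close>
  contribute to degree \<open>j + i\<close> of a composite.\<close>

definition hc :: "int \<Rightarrow> int \<Rightarrow> 'o \<Rightarrow> 'o \<Rightarrow> 'o \<Rightarrow> 'a \<Rightarrow> 'a \<Rightarrow> 'a" where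
  "hc j i X Y Z g f = Cmp C (pw (j + i) X) (pw j (pw i X)) Z
     (Cmp C (pw j (pw i X)) (pw j Y) Z g (pm j (pw i X) Y f)) (co j i X)"

lemma hc_in [simp]:
  "\<lbrakk>f \<in> Hom C (pw i X) Y; g \<in> Hom C (pw j Y) Z; X \<in> Ob C; Y \<in> Ob C; Z \<in> Ob C\<rbrakk>
   \<Longrightarrow> hc j i X Y Z g f \<in> Hom C (pw (j + i) X) Z"
  unfolding hc_def by simp

lemma hc_add_l:
  "\<lbrakk>f \<in> Hom C (pw i X) Y; g \<in> Hom C (pw j Y) Z; g' \<in> Hom C (pw j Y) Z; X \<in> Ob C; Y \<in> Ob C; Z \<in> Ob C\<rbrakk>
   \<Longrightarrow> hc j i X Y Z (Add C (pw j Y) Z g g') f = Add C (pw (j + i) X) Z (hc j i X Y Z g f) (hc j i X Y Z g' f)"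
  unfolding hc_def by (simp add: cmp_add_l)

lemma hc_add_r:
  "\<lbrakk>f \<in> Hom C (pw i X) Y; f' \<in> Hom C (pw i X) Y; g \<in> Hom C (pw j Y) Z; X \<in> Ob C; Y \<in> Ob C; Z \<in> Ob C\<rbrakk>
   \<Longrightarrow> hc j i X Y Z g (Add C (pw i X) Y f f') = Add C (pw (j + i) X) Z (hc j i X Y Z g f) (hc j i X Y Z g f')"
  unfolding hc_def by (simp add: cmp_add_l cmp_add_r)

lemma hc_nul_l [simp]:
  "\<lbrakk>f \<in> Hom C (pw i X) Y; X \<in> Ob C; Y \<in> Ob C; Z \<in> Ob C\<rbrakk>
   \<Longrightarrow> hc j i X Y Z (Nul C (pw j Y) Z) f = Nul C (pw (j + i) X) Z"
  unfolding hc_def by simp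

lemma hc_nul_r [simp]:
  "\<lbrakk>g \<in> Hom C (pw j Y) Z; X \<in> Ob C; Y \<in> Ob C; Z \<in> Ob C\<rbrakk>
   \<Longrightarrow> hc j i X Y Z g (Nul C (pw i X) Y) = Nul C (pw (j + i) X) Z"
  unfolding hc_def by simp

text \<open>Naturality of \<open>co k j\<close> moves \<open>f\<close> past it. What then remains
  are the two ways of splitting the exponent k + j + i into three successive powers, and they agree
  by the cocycle condition.\<close>

lemma hc_assoc:
  assumes f: "f \<in> Hom C (pw i X) Y" and g: "g \<in> Hom C (pw j Y) Z" and h: "h \<in> Hom C (pw k Z) W"
    and o: "X \<in> Ob C" "Y \<in> Ob C" "Z \<in> Ob C" "W \<in> Ob C"
  shows "hc (k + j) i X Y W (hc k j Y Z W h g) f = hc k (j + i) X Z W h (hc j i X Y Z g f)"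
proof -
  let ?s = "k + j + i"
  have e: "k + (j + i) = ?s" by simp
  have op [simp]: "pw m X \<in> Ob C" "pw n (pw m X) \<in> Ob C" "pw n Y \<in> Ob C" "pw m (pw n Y) \<in> Ob C" "pw m Z \<in> Ob C"
    "pw l (pw n (pw m X)) \<in> Ob C" for l m n
    using o by simp_all
  have kf: "pm j (pw i X) Y f \<in> Hom C (pw j (pw i X)) (pw j Y)"
    "pm (k + j) (pw i X) Y f \<in> Hom C (pw (k + j) (pw i X)) (pw (k + j) Y)"
    "pm k (pw j Y) Z g \<in> Hom C (pw k (pw j Y)) (pw k Z)"
    using f g o by simp_all
  have kff: "pm k (pw j (pw i X)) (pw j Y) (pm j (pw i X) Y f) \<in> Hom C (pw k (pw j (pw i X))) (pw k (pw j Y))"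
    using kf(1) by simp
  have c: "co k j Y \<in> Hom C (pw (k + j) Y) (pw k (pw j Y))"
    "co (k + j) i X \<in> Hom C (pw ?s X) (pw (k + j) (pw i X))"
    "co k j (pw i X) \<in> Hom C (pw (k + j) (pw i X)) (pw k (pw j (pw i X)))"
    "co j i X \<in> Hom C (pw (j + i) X) (pw j (pw i X))"
    "co k (j + i) X \<in> Hom C (pw ?s X) (pw k (pw (j + i) X))"
    using co_in[OF o(2), of k j] co_in[OF o(1), of "k + j" i] co_in[of "pw i X" k j] co_in[OF o(1), of j i]
      co_in[OF o(1), of k "j + i"] by (simp_all add: e)
  have kc: "pm k (pw (j + i) X) (pw j (pw i X)) (co j i X) \<in> Hom C (pw k (pw (j + i) X)) (pw k (pw j (pw i X)))"
    using c by simp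
  let ?hg = "Cmp C (pw k (pw j Y)) (pw k Z) W h (pm k (pw j Y) Z g)"
  let ?hgf = "Cmp C (pw k (pw j (pw i X))) (pw k (pw j Y)) W ?hg (pm k (pw j (pw i X)) (pw j Y) (pm j (pw i X) Y f))"
  have hg: "?hg \<in> Hom C (pw k (pw j Y)) W" and hgf: "?hgf \<in> Hom C (pw k (pw j (pw i X))) W"
    using h kf kff o by simp_all
  have "hc (k + j) i X Y W (hc k j Y Z W h g) f
    = Cmp C (pw ?s X) (pw (k + j) (pw i X)) W (Cmp C (pw (k + j) (pw i X)) (pw k (pw j Y)) W ?hg
       (Cmp C (pw (k + j) (pw i X)) (pw (k + j) Y) (pw k (pw j Y)) (co k j Y) (pm (k + j) (pw i X) Y f))) (co (k + j) i X)"
    unfolding hc_def using hg c kf o by (simp add: assoc)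
  also have "\<dots> = Cmp C (pw ?s X) (pw k (pw j (pw i X))) W ?hgf
      (Cmp C (pw ?s X) (pw (k + j) (pw i X)) (pw k (pw j (pw i X))) (co k j (pw i X)) (co (k + j) i X))"
    using hg c kf kff o co_natural[OF f, of k j] by (simp add: assoc)
  also have "\<dots> = Cmp C (pw ?s X) (pw k (pw j (pw i X))) W ?hgf
      (Cmp C (pw ?s X) (pw k (pw (j + i) X)) (pw k (pw j (pw i X))) (pm k (pw (j + i) X) (pw j (pw i X)) (co j i X)) (co k (j + i) X))"
    using coc[OF o(1), of k j i] unfolding coc_def by simp
  also have "\<dots> = hc k (j + i) X Z W h (hc j i X Y Z g f)"
    unfolding hc_def e using h g kf kff kc c hg o by (simp add: assoc)
  finally show ?thesis .
qed

abbreviation OC :: "('o, int \<Rightarrow> 'a) cat" where "OC \<equiv> orbit_cat C G G' \<eta> \<theta>"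

abbreviation (input) supp :: "'o \<Rightarrow> 'o \<Rightarrow> (int \<Rightarrow> 'a) \<Rightarrow> int set" where
  "supp X Y f \<equiv> {i. f i \<noteq> Nul C (pw i X) Y}"

lemma O_simps [simp]: "Ob OC = Ob C"
  "Idn OC X = (\<lambda>i. if i = 0 then Idn C X else Nul C (pw i X) X)"
  "Add OC X Y f g = (\<lambda>i. Add C (pw i X) Y (f i) (g i))"
  "Nul OC X Y = (\<lambda>i. Nul C (pw i X) Y)"
  by (simp_all add: orbit_cat_def)

lemma in_Hom_O: "f \<in> Hom OC X Y \<longleftrightarrow> (\<forall>i. f i \<in> Hom C (pw i X) Y) \<and> finite (supp X Y f)"
  by (simp add: orbit_cat_def)

lemma Hom_OD [simp]: "f \<in> Hom OC X Y \<Longrightarrow> f i \<in> Hom C (pw i X) Y"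
  by (simp add: in_Hom_O)

lemma Cmp_O_raw: "Cmp OC X Y Z g f n =
   finprod (hom_group C (pw n X) Z) (\<lambda>j. hc j (n - j) X Y Z (g j) (f (n - j))) (supp Y Z g)"
proof -
  have "j + (n - j) = n" for j by simp
  then show ?thesis unfolding orbit_cat_def Let_def hc_def by (simp only: cat.simps)
qed

lemma hom_group_simps [simp]: "carrier (hom_group C X Y) = Hom C X Y" "mult (hom_group C X Y) = Add C X Y"
  "one (hom_group C X Y) = Nul C X Y"
  by (simp_all add: hom_group_def)

lemma hc_in': "\<lbrakk>f \<in> Hom C (pw (n - j) X) Y; g \<in> Hom C (pw j Y) Z; X \<in> Ob C; Y \<in> Ob C; Z \<in> Ob C\<rbrakk>
   \<Longrightarrow> hc j (n - j) X Y Z g f \<in> Hom C (pw n X) Z"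
  using hc_in[of f "n - j" X Y g j Z] by simp

text \<open>Outside the support of \<open>g\<close> the terms are zero, so any finite superset may
  serve as index set. A sum g + g' needs this, since it must be compared with two composites over
  different supports.\<close>

lemma Cmp_O:
  assumes f: "f \<in> Hom OC X Y" and g: "g \<in> Hom OC Y Z" and o: "X \<in> Ob C" "Y \<in> Ob C" "Z \<in> Ob C"
    and S: "finite S" "supp Y Z g \<subseteq> S"
  shows "Cmp OC X Y Z g f n = finprod (hom_group C (pw n X) Z) (\<lambda>j. hc j (n - j) X Y Z (g j) (f (n - j))) S"
proof -
  interpret g: comm_group "hom_group C (pw n X) Z" using grp o by simp
  have "hc j (n - j) X Y Z (g j) (f (n - j)) \<in> Hom C (pw n X) Z" for j
    using hc_in'[OF Hom_OD[OF f] Hom_OD[OF g] o] .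
  moreover have "hc j (n - j) X Y Z (Nul C (pw j Y) Z) (f (n - j)) = Nul C (pw n X) Z" for j
    using hc_nul_l[OF Hom_OD[OF f] o, of j "n - j"] by simp
  ultimately show ?thesis unfolding Cmp_O_raw
    using S by (intro g.finprod_mono_neutral_cong_left) auto
qed

lemma Cmp_O_in:
  assumes f: "f \<in> Hom OC X Y" and g: "g \<in> Hom OC Y Z" and o: "X \<in> Ob C" "Y \<in> Ob C" "Z \<in> Ob C"
  shows "Cmp OC X Y Z g f \<in> Hom OC X Z"
  unfolding in_Hom_O
proof (intro conjI allI)
  fix n
  interpret g: comm_group "hom_group C (pw n X) Z" using grp o by simp
  show "Cmp OC X Y Z g f n \<in> Hom C (pw n X) Z"
    unfolding Cmp_O_raw
    by (intro g.finprod_closed[unfolded hom_group_simps] Pi_I hc_in'[OF Hom_OD[OF f] Hom_OD[OF g] o])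
next
  have "supp X Z (Cmp OC X Y Z g f) \<subseteq> (\<lambda>(j, i). j + i) ` (supp Y Z g \<times> supp X Y f)"
  proof
    fix n assume n: "n \<in> supp X Z (Cmp OC X Y Z g f)"
    interpret g: comm_group "hom_group C (pw n X) Z" using grp o by simp
    have "\<exists>j \<in> supp Y Z g. hc j (n - j) X Y Z (g j) (f (n - j)) \<noteq> Nul C (pw n X) Z"
      using n g.finprod_one_eqI[of "supp Y Z g" "\<lambda>j. hc j (n - j) X Y Z (g j) (f (n - j))"]
      unfolding Cmp_O_raw by auto
    then obtain j where j: "j \<in> supp Y Z g" "hc j (n - j) X Y Z (g j) (f (n - j)) \<noteq> Nul C (pw n X) Z"
      by blast
    have "n - j \<in> supp X Y f"
      using j(2) hc_nul_r[OF Hom_OD[OF g] o, of j "n - j"] by auto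
    then show "n \<in> (\<lambda>(j, i). j + i) ` (supp Y Z g \<times> supp X Y f)"
      using j(1) by (intro image_eqI[of _ _ "(j, n - j)"]) auto
  qed
  then show "finite (supp X Z (Cmp OC X Y Z g f))"
    using f g unfolding in_Hom_O by (meson finite_SigmaI finite_imageI finite_subset)
qed

lemma Nul_O_in: "\<lbrakk>X \<in> Ob C; Y \<in> Ob C\<rbrakk> \<Longrightarrow> Nul OC X Y \<in> Hom OC X Y"
  unfolding in_Hom_O by simp

lemma Idn_O_in: "X \<in> Ob C \<Longrightarrow> Idn OC X \<in> Hom OC X X"
  unfolding in_Hom_O by (auto intro: finite_subset[of _ "{0}"])

lemma Add_O_in:
  assumes "f \<in> Hom OC X Y" "g \<in> Hom OC X Y" "X \<in> Ob C" "Y \<in> Ob C"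
  shows "Add OC X Y f g \<in> Hom OC X Y"
proof -
  have "supp X Y (Add OC X Y f g) \<subseteq> supp X Y f \<union> supp X Y g"
    using assms(3,4) by auto
  then show ?thesis using assms unfolding in_Hom_O by (auto intro: finite_subset)
qed

lemma grp_O:
  assumes o: "X \<in> Ob C" "Y \<in> Ob C"
  shows "comm_group (hom_group OC X Y)"
proof (rule comm_groupI)
  have g: "comm_group (hom_group C (pw i X) Y)" for i using o grp by simp
  note m = comm_group.axioms(1)[OF g]
  have cs: "carrier (hom_group OC X Y) = Hom OC X Y" "mult (hom_group OC X Y) = Add OC X Y"
    "one (hom_group OC X Y) = Nul OC X Y" by (simp_all only: hom_group_def monoid.simps partial_object.simps)
  show "x \<otimes>\<^bsub>hom_group OC X Y\<^esub> y \<in> carrier (hom_group OC X Y)"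
    if "x \<in> carrier (hom_group OC X Y)" "y \<in> carrier (hom_group OC X Y)" for x y
    using that Add_O_in[of x X Y y] o unfolding cs by blast
  show "\<one>\<^bsub>hom_group OC X Y\<^esub> \<in> carrier (hom_group OC X Y)" using Nul_O_in o unfolding cs by blast
  show "x \<otimes>\<^bsub>hom_group OC X Y\<^esub> y \<otimes>\<^bsub>hom_group OC X Y\<^esub> z = x \<otimes>\<^bsub>hom_group OC X Y\<^esub> (y \<otimes>\<^bsub>hom_group OC X Y\<^esub> z)"
    if "x \<in> carrier (hom_group OC X Y)" "y \<in> carrier (hom_group OC X Y)" "z \<in> carrier (hom_group OC X Y)" for x y z
    using that monoid.m_assoc[OF comm_monoid.axioms(1)[OF m]] unfolding cs by simp
  show "x \<otimes>\<^bsub>hom_group OC X Y\<^esub> y = y \<otimes>\<^bsub>hom_group OC X Y\<^esub> x"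
    if "x \<in> carrier (hom_group OC X Y)" "y \<in> carrier (hom_group OC X Y)" for x y
    using that comm_monoid.m_comm[OF m] unfolding cs by simp
  show "\<one>\<^bsub>hom_group OC X Y\<^esub> \<otimes>\<^bsub>hom_group OC X Y\<^esub> x = x" if "x \<in> carrier (hom_group OC X Y)" for x
    using that o unfolding cs by simp
  show "\<exists>y \<in> carrier (hom_group OC X Y). y \<otimes>\<^bsub>hom_group OC X Y\<^esub> x = \<one>\<^bsub>hom_group OC X Y\<^esub>"
    if x: "x \<in> carrier (hom_group OC X Y)" for x
  proof -
    let ?y = "\<lambda>i. inv\<^bsub>hom_group C (pw i X) Y\<^esub> (x i)"
    note gi = comm_group.axioms(2)[OF g]
    have xi: "x i \<in> Hom C (pw i X) Y" for i using x unfolding cs by simp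
    have "supp X Y ?y \<subseteq> supp X Y x" using monoid.inv_one[OF group.is_monoid[OF gi]] by auto
    then have "?y \<in> Hom OC X Y"
      using x group.inv_closed[OF gi] xi unfolding cs in_Hom_O by (auto intro: finite_subset)
    moreover have "Add OC X Y ?y x = Nul OC X Y"
      using group.l_inv[OF gi] xi by simp
    ultimately show ?thesis unfolding cs by blast
  qed
qed

lemma Cmp_O_add_l:
  assumes f: "f \<in> Hom OC X Y" and g: "g \<in> Hom OC Y Z" "g' \<in> Hom OC Y Z" and o: "X \<in> Ob C" "Y \<in> Ob C" "Z \<in> Ob C"
  shows "Cmp OC X Y Z (Add OC Y Z g g') f = Add OC X Z (Cmp OC X Y Z g f) (Cmp OC X Y Z g' f)"
proof
  fix n
  interpret g: comm_group "hom_group C (pw n X) Z" using grp o by simp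
  let ?S = "supp Y Z g \<union> supp Y Z g'"
  have S: "finite ?S" "supp Y Z g \<subseteq> ?S" "supp Y Z g' \<subseteq> ?S" using g unfolding in_Hom_O by auto
  have S': "supp Y Z (Add OC Y Z g g') \<subseteq> ?S" using o by auto
  have "hc j (n - j) X Y Z (Add OC Y Z g g' j) (f (n - j))
     = hc j (n - j) X Y Z (g j) (f (n - j)) \<otimes>\<^bsub>hom_group C (pw n X) Z\<^esub> hc j (n - j) X Y Z (g' j) (f (n - j))" for j
    using hc_add_l[OF Hom_OD[OF f, of "n - j"] Hom_OD[OF g(1), of j] Hom_OD[OF g(2), of j] o] by simp
  then show "Cmp OC X Y Z (Add OC Y Z g g') f n = Add OC X Z (Cmp OC X Y Z g f) (Cmp OC X Y Z g' f) n"
    using g.finprod_multf[of "\<lambda>j. hc j (n - j) X Y Z (g j) (f (n - j))" ?S "\<lambda>j. hc j (n - j) X Y Z (g' j) (f (n - j))"]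
      hc_in'[OF Hom_OD[OF f] Hom_OD[OF g(1)] o] hc_in'[OF Hom_OD[OF f] Hom_OD[OF g(2)] o]
      Cmp_O[OF f Add_O_in[OF g o(2,3)] o S(1) S', of n] Cmp_O[OF f g(1) o S(1,2), of n] Cmp_O[OF f g(2) o S(1,3), of n]
    by (simp add: Pi_def)
qed

lemma Cmp_O_add_r:
  assumes f: "f \<in> Hom OC X Y" "f' \<in> Hom OC X Y" and g: "g \<in> Hom OC Y Z" and o: "X \<in> Ob C" "Y \<in> Ob C" "Z \<in> Ob C"
  shows "Cmp OC X Y Z g (Add OC X Y f f') = Add OC X Z (Cmp OC X Y Z g f) (Cmp OC X Y Z g f')"
proof
  fix n
  interpret g: comm_group "hom_group C (pw n X) Z" using grp o by simp
  let ?S = "supp Y Z g"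
  have "hc j (n - j) X Y Z (g j) (Add OC X Y f f' (n - j))
     = hc j (n - j) X Y Z (g j) (f (n - j)) \<otimes>\<^bsub>hom_group C (pw n X) Z\<^esub> hc j (n - j) X Y Z (g j) (f' (n - j))" for j
    using hc_add_r[OF Hom_OD[OF f(1), of "n - j"] Hom_OD[OF f(2), of "n - j"] Hom_OD[OF g, of j] o] by simp
  then show "Cmp OC X Y Z g (Add OC X Y f f') n = Add OC X Z (Cmp OC X Y Z g f) (Cmp OC X Y Z g f') n"
    using g.finprod_multf[of "\<lambda>j. hc j (n - j) X Y Z (g j) (f (n - j))" ?S "\<lambda>j. hc j (n - j) X Y Z (g j) (f' (n - j))"]
      hc_in'[OF Hom_OD[OF f(1)] Hom_OD[OF g] o] hc_in'[OF Hom_OD[OF f(2)] Hom_OD[OF g] o]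
    by (simp add: Pi_def Cmp_O_raw)
qed

definition sg :: "int \<Rightarrow> 'o \<Rightarrow> 'o \<Rightarrow> 'a \<Rightarrow> int \<Rightarrow> 'a" where
  "sg i X Y a = (\<lambda>n. if n = i then a else Nul C (pw n X) Y)"

lemma sg_in [simp]: "\<lbrakk>a \<in> Hom C (pw i X) Y; X \<in> Ob C; Y \<in> Ob C\<rbrakk> \<Longrightarrow> sg i X Y a \<in> Hom OC X Y"
  unfolding in_Hom_O sg_def by (auto intro: finite_subset[of _ "{i}"])

lemma Cmp_O_sg:
  assumes a: "a \<in> Hom C (pw i X) Y" and b: "b \<in> Hom C (pw j Y) Z" and o: "X \<in> Ob C" "Y \<in> Ob C" "Z \<in> Ob C"
  shows "Cmp OC X Y Z (sg j Y Z b) (sg i X Y a) = sg (j + i) X Z (hc j i X Y Z b a)"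
proof
  fix n
  interpret g: comm_group "hom_group C (pw n X) Z" using grp o by simp
  have "Cmp OC X Y Z (sg j Y Z b) (sg i X Y a) n
    = finprod (hom_group C (pw n X) Z) (\<lambda>l. hc l (n - l) X Y Z (sg j Y Z b l) (sg i X Y a (n - l))) {j}"
    using a b o by (intro Cmp_O sg_in) (auto simp: sg_def)
  also have "\<dots> = hc j (n - j) X Y Z b (sg i X Y a (n - j))"
  proof -
    have "sg j Y Z b j = b" by (simp add: sg_def)
    then show ?thesis using hc_in'[OF Hom_OD[OF sg_in[OF a o(1,2)]] b o, of n] o by simp
  qed
  also have "\<dots> = sg (j + i) X Z (hc j i X Y Z b a) n"
    using hc_nul_r[OF b o, of "n - j"] by (auto simp: sg_def)
  finally show "Cmp OC X Y Z (sg j Y Z b) (sg i X Y a) n = sg (j + i) X Z (hc j i X Y Z b a) n" .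
qed

text \<open>Every morphism is a finite sum of homogeneous ones; the induction is on the size of the
  support, one component being cut off at a time. It reduces additive identities to homogeneous
  morphisms.\<close>

lemma Hom_O_induct [consumes 3, case_names nul add]:
  assumes f: "f \<in> Hom OC X Y" and o: "X \<in> Ob C" "Y \<in> Ob C"
    and nul: "P (Nul OC X Y)"
    and add: "\<And>i a f. \<lbrakk>a \<in> Hom C (pw i X) Y; f \<in> Hom OC X Y; P f\<rbrakk> \<Longrightarrow> P (Add OC X Y (sg i X Y a) f)"
  shows "P f"
proof -
  have "finite S \<Longrightarrow> f \<in> Hom OC X Y \<Longrightarrow> supp X Y f = S \<Longrightarrow> P f" for S f
  proof (induction S arbitrary: f rule: finite_induct)
    case empty
    then have "f = Nul OC X Y" by auto
    then show ?case using nul by simp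
  next
    case (insert i S)
    let ?f = "f(i := Nul C (pw i X) Y)"
    have s: "supp X Y ?f = S" using insert by auto
    then have f: "?f \<in> Hom OC X Y" using insert.prems(1) insert.hyps o unfolding in_Hom_O by auto
    have "f = Add OC X Y (sg i X Y (f i)) ?f"
      using insert.prems(1) o by (auto simp: sg_def)
    then show ?case using add[OF Hom_OD[OF insert.prems(1), of i] f insert.IH[OF f s]] by simp
  qed
  then show ?thesis using f unfolding in_Hom_O by blast
qed

lemma Cmp_O_nul_l:
  assumes f: "f \<in> Hom OC X Y" and o: "X \<in> Ob C" "Y \<in> Ob C" "Z \<in> Ob C"
  shows "Cmp OC X Y Z (Nul OC Y Z) f = Nul OC X Z"
proof
  fix n
  interpret g: comm_group "hom_group C (pw n X) Z" using grp o by simp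
  show "Cmp OC X Y Z (Nul OC Y Z) f n = Nul OC X Z n" by (simp add: Cmp_O_raw)
qed

lemma Cmp_O_nul_r:
  assumes g: "g \<in> Hom OC Y Z" and o: "X \<in> Ob C" "Y \<in> Ob C" "Z \<in> Ob C"
  shows "Cmp OC X Y Z g (Nul OC X Y) = Nul OC X Z"
proof
  fix n
  interpret g: comm_group "hom_group C (pw n X) Z" using grp o by simp
  have "hc j (n - j) X Y Z (g j) (Nul C (pw (n - j) X) Y) = Nul C (pw n X) Z" for j
    using hc_nul_r[OF Hom_OD[OF g] o, of j "n - j"] by simp
  then show "Cmp OC X Y Z g (Nul OC X Y) n = Nul OC X Z n"
    by (simp add: Cmp_O_raw g.finprod_one_eqI)
qed

text \<open>Both sides are additive in each of the three morphisms, so three nested inductions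
  reduce the claim to homogeneous ones, where it is \<open>hc_assoc\<close>.\<close>

lemma Cmp_O_assoc:
  assumes f: "f \<in> Hom OC W X" and g: "g \<in> Hom OC X Y" and h: "h \<in> Hom OC Y Z"
    and o: "W \<in> Ob C" "X \<in> Ob C" "Y \<in> Ob C" "Z \<in> Ob C"
  shows "Cmp OC W X Z (Cmp OC X Y Z h g) f = Cmp OC W Y Z h (Cmp OC W X Y g f)"
proof -
  have sgs: "Cmp OC W X Z (Cmp OC X Y Z (sg k Y Z c) (sg j X Y b)) (sg i W X a)
      = Cmp OC W Y Z (sg k Y Z c) (Cmp OC W X Y (sg j X Y b) (sg i W X a))"
    if "a \<in> Hom C (pw i W) X" "b \<in> Hom C (pw j X) Y" "c \<in> Hom C (pw k Y) Z" for a b c i j k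
    using that o hc_assoc[OF that o] by (simp add: Cmp_O_sg add.assoc)
  have sgh: "Cmp OC W X Z (Cmp OC X Y Z h (sg j X Y b)) (sg i W X a)
      = Cmp OC W Y Z h (Cmp OC W X Y (sg j X Y b) (sg i W X a))"
    if ab: "a \<in> Hom C (pw i W) X" "b \<in> Hom C (pw j X) Y" for a b i j
    using h o(3,4)
  proof (induction rule: Hom_O_induct)
    case nul
    show ?case using ab o by (simp only: Cmp_O_nul_l Cmp_O_in sg_in)
  next
    case (add k c h)
    then show ?case using ab o sgs[OF ab add(1)] by (simp only: Cmp_O_add_l Cmp_O_in sg_in)
  qed
  have sgg: "Cmp OC W X Z (Cmp OC X Y Z h g) (sg i W X a) = Cmp OC W Y Z h (Cmp OC W X Y g (sg i W X a))"
    if a: "a \<in> Hom C (pw i W) X" for a i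
    using g o(2,3)
  proof (induction rule: Hom_O_induct)
    case nul
    show ?case using a o h by (simp only: Cmp_O_nul_l Cmp_O_nul_r Cmp_O_in sg_in)
  next
    case (add j b g)
    then show ?case using a o h sgh[OF a add(1)] by (simp only: Cmp_O_add_l Cmp_O_add_r Cmp_O_in sg_in)
  qed
  show ?thesis using f o(1,2)
  proof (induction rule: Hom_O_induct)
    case nul
    show ?case using g h o by (simp only: Cmp_O_nul_r Cmp_O_in)
  next
    case (add i a f)
    then show ?case using g o h sgg[OF add(1)] by (simp only: Cmp_O_add_r Cmp_O_in sg_in)
  qed
qed

lemma Idn_O_sg: "Idn OC X = sg 0 X X (Idn C X)"
  by (auto simp: sg_def)

lemma hc_idn_l: "\<lbrakk>a \<in> Hom C (pw i X) Y; X \<in> Ob C; Y \<in> Ob C\<rbrakk> \<Longrightarrow> hc 0 i X Y Y (Idn C Y) a = a"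
  unfolding hc_def by (simp add: co_0l)

lemma hc_idn_r: "\<lbrakk>a \<in> Hom C (pw i X) Y; X \<in> Ob C; Y \<in> Ob C\<rbrakk> \<Longrightarrow> hc i 0 X X Y a (Idn C X) = a"
  unfolding hc_def by (simp add: co_0r)

lemma Cmp_O_idl:
  assumes "f \<in> Hom OC X Y" "X \<in> Ob C" "Y \<in> Ob C"
  shows "Cmp OC X Y Y (Idn OC Y) f = f"
  using assms
proof (induction rule: Hom_O_induct)
  case nul
  show ?case using assms Cmp_O_nul_r Idn_O_in by blast
next
  case (add i a f)
  have "Cmp OC X Y Y (Idn OC Y) (Add OC X Y (sg i X Y a) f)
    = Add OC X Y (Cmp OC X Y Y (Idn OC Y) (sg i X Y a)) (Cmp OC X Y Y (Idn OC Y) f)"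
    using Cmp_O_add_r add assms Idn_O_in sg_in by metis
  also have "Cmp OC X Y Y (Idn OC Y) (sg i X Y a) = sg i X Y a"
    unfolding Idn_O_sg using add assms by (simp add: Cmp_O_sg hc_idn_l)
  finally show ?case using add by simp
qed

lemma Cmp_O_idr:
  assumes "f \<in> Hom OC X Y" "X \<in> Ob C" "Y \<in> Ob C"
  shows "Cmp OC X X Y f (Idn OC X) = f"
  using assms
proof (induction rule: Hom_O_induct)
  case nul
  show ?case using assms Cmp_O_nul_l Idn_O_in by blast
next
  case (add i a f)
  have "Cmp OC X X Y (Add OC X Y (sg i X Y a) f) (Idn OC X)
    = Add OC X Y (Cmp OC X X Y (sg i X Y a) (Idn OC X)) (Cmp OC X X Y f (Idn OC X))"
    using Cmp_O_add_l add assms Idn_O_in sg_in by metis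
  also have "Cmp OC X X Y (sg i X Y a) (Idn OC X) = sg i X Y a"
    unfolding Idn_O_sg using add assms by (simp add: Cmp_O_sg hc_idn_r)
  finally show ?case using add by simp
qed

lemma preadd_O: "preadd OC"
  by (rule preadd.intro; unfold O_simps(1))
    (rule Cmp_O_in Idn_O_in Cmp_O_assoc Cmp_O_idl Cmp_O_idr grp_O Cmp_O_add_l Cmp_O_add_r; assumption)+

end

lemma (in ring) Unit_of_sum_zero:
  assumes a: "a \<in> Units R" and b: "b \<in> carrier R" and s: "a \<oplus> b = \<zero>"
  shows "b \<in> Units R"
proof -
  have a': "a \<in> carrier R" using a by blast
  have "b = \<ominus> a" using minus_equality[of b a] a_comm[of a b] s b a' by simp
  also have "\<dots> = (\<ominus> \<one>) \<otimes> a" using a' by (simp add: l_minus)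
  finally show ?thesis using Units_m_closed[OF Units_minus_one_closed a] by simp
qed

lemma (in preadd) is_iso_negative:
  assumes "is_iso C X X f" "g \<in> Hom C X X" "Add C X X f g = Nul C X X" "X \<in> Ob C"
  shows "is_iso C X X g"
  using ring.Unit_of_sum_zero[OF ring_End, of X f g] assms by (simp add: Units_End)

section \<open>Comparison of a category with its orbit category\<close>

context orbit
begin

sublocale O: preadd OC
  by (rule preadd_O)

lemma hc_0: "\<lbrakk>f \<in> Hom C X Y; g \<in> Hom C Y Z; X \<in> Ob C; Y \<in> Ob C; Z \<in> Ob C\<rbrakk> \<Longrightarrow> hc 0 0 X Y Z g f = Cmp C X Y Z g f"
  unfolding hc_def by (simp add: co_0l)

abbreviation emb :: "'o \<Rightarrow> 'o \<Rightarrow> 'a \<Rightarrow> int \<Rightarrow> 'a" where "emb \<equiv> sg 0"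

lemma emb_in: "\<lbrakk>f \<in> Hom C X Y; X \<in> Ob C; Y \<in> Ob C\<rbrakk> \<Longrightarrow> emb X Y f \<in> Hom OC X Y"
  by simp

lemma emb_cmp: "\<lbrakk>f \<in> Hom C X Y; g \<in> Hom C Y Z; X \<in> Ob C; Y \<in> Ob C; Z \<in> Ob C\<rbrakk>
  \<Longrightarrow> Cmp OC X Y Z (emb Y Z g) (emb X Y f) = emb X Z (Cmp C X Y Z g f)"
  using Cmp_O_sg[of f 0 X Y g 0 Z] by (simp add: hc_0)

lemma emb_idn: "emb X X (Idn C X) = Idn OC X"
  by (simp only: Idn_O_sg)

lemma emb_nul: "emb X Y (Nul C X Y) = Nul OC X Y"
  by (auto simp: sg_def)

lemma emb_add: "\<lbrakk>f \<in> Hom C X Y; g \<in> Hom C X Y; X \<in> Ob C; Y \<in> Ob C\<rbrakk>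
  \<Longrightarrow> Add OC X Y (emb X Y f) (emb X Y g) = emb X Y (Add C X Y f g)"
  by (auto simp: sg_def)

lemma O_isomorphic:
  assumes "isomorphic C X Y" "X \<in> Ob C" "Y \<in> Ob C"
  shows "isomorphic OC X Y"
proof -
  obtain f g where f: "f \<in> Hom C X Y" "g \<in> Hom C Y X" "Cmp C X Y X g f = Idn C X" "Cmp C Y X Y f g = Idn C Y"
    using assms unfolding isomorphic_def is_iso_def by blast
  have "Cmp OC X Y X (emb Y X g) (emb X Y f) = Idn OC X" "Cmp OC Y X Y (emb X Y f) (emb Y X g) = Idn OC Y"
    using emb_cmp[OF f(1,2)] emb_cmp[OF f(2,1)] f(3,4) assms(2,3) by (simp_all only: emb_idn)
  then show ?thesis unfolding isomorphic_def is_iso_def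
    using emb_in[OF f(1)] emb_in[OF f(2)] assms(2,3) by blast
qed

lemma O_zero_object: "zero_object OC X \<longleftrightarrow> zero_object C X"
  unfolding zero_object_def O_simps by (auto simp: fun_eq_iff)

lemma O_direct_sum:
  assumes "is_direct_sum C A B X" and o: "A \<in> Ob C" "B \<in> Ob C" "X \<in> Ob C"
  shows "is_direct_sum OC A B X"
proof -
  obtain i j p q where s: "i \<in> Hom C A X" "j \<in> Hom C B X" "p \<in> Hom C X A" "q \<in> Hom C X B"
    "Cmp C A X A p i = Idn C A" "Cmp C B X B q j = Idn C B"
    "Cmp C A X B q i = Nul C A B" "Cmp C B X A p j = Nul C B A"
    "Add C X X (Cmp C X A X i p) (Cmp C X B X j q) = Idn C X"
    using assms(1) unfolding is_direct_sum_def by blast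
  have "Add OC X X (Cmp OC X A X (emb A X i) (emb X A p)) (Cmp OC X B X (emb B X j) (emb X B q)) = Idn OC X"
    using s emb_cmp[OF s(3,1)] emb_cmp[OF s(4,2)] emb_add[of "Cmp C X A X i p" X X "Cmp C X B X j q"] o
    by (simp only: emb_idn cmp_in)
  then show ?thesis unfolding is_direct_sum_def
    using emb_in[OF s(1)] emb_in[OF s(2)] emb_in[OF s(3)] emb_in[OF s(4)] o
      emb_cmp[OF s(1,3)] emb_cmp[OF s(2,4)] emb_cmp[OF s(1,4)] emb_cmp[OF s(2,3)] s(5-8)
    by (intro bexI[of _ "emb A X i"] bexI[of _ "emb B X j"] bexI[of _ "emb X A p"] bexI[of _ "emb X B q"] conjI)
      (simp_all only: emb_idn emb_nul)
qed

lemma O_indecomposableD: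
  assumes "indecomposable OC X"
  shows "indecomposable C X"
  using assms O_direct_sum unfolding indecomposable_def O_zero_object O_simps(1) by blast

text \<open>The isomorphism is the identity of \<open>pw k X\<close> placed in degree
  \<open>k\<close>; its inverse is the inverse of \<open>co (-k) k X\<close> placed in degree
  -k.\<close>

lemma O_iso_pw:
  assumes X: "X \<in> Ob C"
  shows "isomorphic OC X (pw k X)"
proof -
  let ?Y = "pw k X"
  have Y: "?Y \<in> Ob C" using X by simp
  have c: "co (-k) k X \<in> Hom C X (pw (-k) ?Y)" using co_in[OF X, of "-k" k] by simp
  have "is_iso C X (pw (-k) ?Y) (co (-k) k X)" using co_iso[OF X, of "-k" k] by simp
  then obtain b where b: "b \<in> Hom C (pw (-k) ?Y) X" "Cmp C X (pw (-k) ?Y) X b (co (-k) k X) = Idn C X"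
    "Cmp C (pw (-k) ?Y) X (pw (-k) ?Y) (co (-k) k X) b = Idn C (pw (-k) ?Y)"
    unfolding is_iso_def by blast
  have f: "Idn C ?Y \<in> Hom C ?Y ?Y" using Y by simp
  have "hc (-k) k X ?Y X b (Idn C ?Y) = Idn C X" unfolding hc_def using X Y b by simp
  then have 1: "Cmp OC X ?Y X (sg (-k) ?Y X b) (sg k X ?Y (Idn C ?Y)) = Idn OC X"
    using Cmp_O_sg[OF f b(1) X Y X] Idn_O_sg by simp
  \<comment> \<open>The first composite is the identity by the choice of \<open>b\<close>. For the
    second one, the cocycle condition with exponents k, -k, k identifies this coherence map with the
    k-th power applied to the one inverted by \<open>b\<close>.\<close>
  have "co k (-k) ?Y = pm k X (pw (-k) ?Y) (co (-k) k X)"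
    using coc[OF X, of k "-k" k] co_in[OF Y, of k "-k"] af_map[OF af_ipow c] X Y
    unfolding coc_def by (simp add: co_0l co_0r)
  moreover have "Cmp C ?Y (pw k (pw (-k) ?Y)) ?Y (pm k (pw (-k) ?Y) X b) (pm k X (pw (-k) ?Y) (co (-k) k X)) = Idn C ?Y"
    using af_cmp[OF af_ipow[of k] c b(1)] b(2) X Y by simp
  ultimately have "hc k (-k) ?Y X ?Y (Idn C ?Y) b = Idn C ?Y"
    unfolding hc_def using X Y b(1) by simp
  then have 2: "Cmp OC ?Y X ?Y (sg k X ?Y (Idn C ?Y)) (sg (-k) ?Y X b) = Idn OC ?Y"
    using Cmp_O_sg[OF b(1) f Y X Y] Idn_O_sg by simp
  show ?thesis unfolding isomorphic_def is_iso_def using 1 2 sg_in[OF f X Y] sg_in[OF b(1) Y X] by blast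
qed

lemma O_nz:
  assumes o: "X \<in> Ob C" "Y \<in> Ob C"
  shows "O.nz X Y \<longleftrightarrow> (\<exists>i. nz (pw i X) Y)"
proof
  assume "O.nz X Y"
  then obtain f where f: "f \<in> Hom OC X Y" "f \<noteq> Nul OC X Y" unfolding O.nz_def by blast
  then obtain i where "f i \<noteq> Nul C (pw i X) Y" by auto
  then show "\<exists>i. nz (pw i X) Y" unfolding nz_def using Hom_OD[OF f(1)] by blast
next
  assume "\<exists>i. nz (pw i X) Y"
  then obtain i f where f: "f \<in> Hom C (pw i X) Y" "f \<noteq> Nul C (pw i X) Y" unfolding nz_def by blast
  then have "sg i X Y f \<noteq> Nul OC X Y" by (auto simp: sg_def fun_eq_iff)
  then show "O.nz X Y" unfolding O.nz_def using sg_in[OF f(1) o] by blast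
qed

text \<open>In degree 0 the coherence maps can be absorbed into \<open>f\<close>, and a composite
  becomes a finite sum of ordinary composites through the objects \<open>pw j X\<close>. All later
  arguments on the orbit category work with this sum.\<close>

lemma Cmp_O_0:
  assumes f: "f \<in> Hom OC A X" and g: "g \<in> Hom OC X B" and o: "A \<in> Ob C" "X \<in> Ob C" "B \<in> Ob C"
  shows "\<exists>e. (\<forall>j. e j \<in> Hom C A (pw j X)) \<and> e 0 = f 0 \<and>
    Cmp OC A X B g f 0 = finprod (hom_group C A B) (\<lambda>j. Cmp C A (pw j X) B (g j) (e j)) (supp X B g)"
proof -
  let ?e = "\<lambda>j. Cmp C A (pw j (pw (-j) A)) (pw j X) (pm j (pw (-j) A) X (f (-j))) (co j (-j) A)"
  have c: "co j (-j) A \<in> Hom C A (pw j (pw (-j) A))" for j using co_in[OF o(1), of j "-j"] by simp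
  have e: "?e j \<in> Hom C A (pw j X)" for j using c Hom_OD[OF f] o by simp
  have "hc j (-j) A X B (g j) (f (-j)) = Cmp C A (pw j X) B (g j) (?e j)" for j
    unfolding hc_def using c[of j] Hom_OD[OF f, of "-j"] Hom_OD[OF g, of j] o by (simp add: assoc)
  then have "Cmp OC A X B g f 0 = finprod (hom_group C A B) (\<lambda>j. Cmp C A (pw j X) B (g j) (?e j)) (supp X B g)"
    by (simp add: Cmp_O_raw)
  moreover have "?e 0 = f 0" using Hom_OD[OF f, of 0] o by (simp add: co_0l)
  ultimately show ?thesis using e by (intro exI[of _ ?e]) simp
qed

text \<open>The identity of \<open>A\<close> is, in degree 0, a finite sum of composites through the
  objects \<open>pw j X\<close>, so the exchange argument makes some \<open>pw j X\<close> a retract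
  of \<open>A\<close> in the original category. There \<open>A\<close> is arbitrary, as it must be
  for a hypothetical direct summand.\<close>

lemma O_retract:
  assumes i: "i \<in> Hom OC A X" and p: "p \<in> Hom OC X A" and pi: "Cmp OC A X A p i = Idn OC A"
    and o: "A \<in> Ob C" "X \<in> Ob C" and A: "\<not> zero_object C A" and X: "\<And>j. nil_or_iso (pw j X)"
  shows "\<exists>j. \<exists>c \<in> Hom C (pw j X) A. \<exists>d \<in> Hom C A (pw j X). Cmp C (pw j X) A (pw j X) d c = Idn C (pw j X)"
proof -
  obtain e where e: "\<And>j. e j \<in> Hom C A (pw j X)"
    "Cmp OC A X A p i 0 = finprod (hom_group C A A) (\<lambda>j. Cmp C A (pw j X) A (p j) (e j)) (supp X A p)"
    using Cmp_O_0[OF i p o o(1)] by blast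
  have "is_iso C A A (finprod (hom_group C A A) (\<lambda>j. Cmp C A (pw j X) A (p j) (e j)) (supp X A p))"
    unfolding e(2)[symmetric] pi using o by simp
  moreover have "finite (supp X A p)" using p unfolding in_Hom_O by blast
  ultimately show ?thesis
    using sum_retract[of A "supp X A p" "\<lambda>j. pw j X" p e] o(1) A X Hom_OD[OF p] e(1) by blast
qed

lemma pw_indecomposable: "indecomposable C X \<Longrightarrow> indecomposable C (pw k X)"
proof -
  assume X: "indecomposable C X"
  have "indecomposable C (fobj (npow G n) X)" "indecomposable C (fobj (npow G' n) X)" for n
    by (induction n) (simp_all add: X id_func_def comp_func_def qi_indecomposable[OF qi] qi_indecomposable[OF qi_sym[OF qi]])
  then show ?thesis unfolding ipow_def by simp
qed

end

section \<open>Indecomposable objects of the orbit category\<close>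

locale orbit_ks = orbit +
  assumes NI: "indecomposable C X \<Longrightarrow> nil_or_iso X"
begin

text \<open>By \<open>O_retract\<close> some \<open>pw j X'\<close> is a retract of
  \<open>X\<close>, and a nonzero retract of an indecomposable \<open>X\<close> is
  everything.\<close>

lemma O_iso_imp:
  assumes X: "indecomposable C X" and X': "indecomposable C X'" and i: "isomorphic OC X X'"
  shows "\<exists>k. isomorphic C (pw k X') X"
proof -
  have o: "X \<in> Ob C" "X' \<in> Ob C" and nz: "\<not> zero_object C X" using X X' unfolding indecomposable_def by blast+
  obtain f g where f: "f \<in> Hom OC X X'" "g \<in> Hom OC X' X" "Cmp OC X X' X g f = Idn OC X"
    using i unfolding isomorphic_def is_iso_def by blast
  obtain j c d where j: "c \<in> Hom C (pw j X') X" "d \<in> Hom C X (pw j X')" "Cmp C (pw j X') X (pw j X') d c = Idn C (pw j X')"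
    using O_retract[OF f o nz NI[OF pw_indecomposable[OF X']]] by blast
  have "\<not> zero_object C (pw j X')" using pw_indecomposable[OF X', of j] unfolding indecomposable_def by blast
  then have "is_iso C (pw j X') X c"
    using nil_or_iso_retract(1)[OF NI[OF X] _ _ j(1,2)] j(3) o by simp
  then show ?thesis unfolding isomorphic_def by blast
qed

end

locale orbit_free = orbit_ks +
  assumes free: "\<lbrakk>indecomposable C X; k \<noteq> 0\<rbrakk> \<Longrightarrow> \<not> isomorphic C (pw k X) X"
begin

text \<open>An invertible composite through \<open>pw j X\<close> makes \<open>pw j X\<close>
  isomorphic to \<open>X\<close>, which freeness permits for j = 0 only. This excludes the terms of
  all other degrees.\<close>

lemma hc_iso_0:
  assumes X: "indecomposable C X" and g: "g \<in> Hom C (pw j X) X" "e \<in> Hom C X (pw j X)"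
    and i: "is_iso C X X (Cmp C X (pw j X) X g e)"
  shows "j = 0" "is_iso C X (pw j X) e" "is_iso C (pw j X) X g"
proof -
  have o: "X \<in> Ob C" "\<not> zero_object C X" using X unfolding indecomposable_def by blast+
  show "is_iso C X (pw j X) e" "is_iso C (pw j X) X g"
    using nil_or_iso_retract[OF NI[OF pw_indecomposable[OF X]] o g(2,1) i] by blast+
  then show "j = 0" using free[OF X, of j] unfolding isomorphic_def by blast
qed

text \<open>In degree 0 the equation x y = 1 is a finite sum equal to the identity. Some term is
  invertible, and it can only be the one with j = 0.\<close>

lemma O_unit_0:
  assumes X: "indecomposable C X" and xy: "x \<in> Hom OC X X" "y \<in> Hom OC X X" "Cmp OC X X X x y = Idn OC X"
  shows "is_iso C X X (x 0)" "is_iso C X X (y 0)"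
proof -
  have o: "X \<in> Ob C" "\<not> zero_object C X" using X unfolding indecomposable_def by blast+
  obtain e where e: "\<And>j. e j \<in> Hom C X (pw j X)" "e 0 = y 0"
    "Cmp OC X X X x y 0 = finprod (hom_group C X X) (\<lambda>j. Cmp C X (pw j X) X (x j) (e j)) (supp X X x)"
    using Cmp_O_0[OF xy(2,1) o(1) o(1) o(1)] by blast
  have t: "Cmp C X (pw j X) X (x j) (e j) \<in> Hom C X X" for j using e(1) Hom_OD[OF xy(1)] o by simp
  have "is_iso C X X (finprod (hom_group C X X) (\<lambda>j. Cmp C X (pw j X) X (x j) (e j)) (supp X X x))"
    unfolding e(3)[symmetric] xy(3) using o by simp
  moreover have S: "finite (supp X X x)" using xy(1) unfolding in_Hom_O by blast
  ultimately have "\<exists>j \<in> supp X X x. is_iso C X X (Cmp C X (pw j X) X (x j) (e j))"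
    using nil_or_iso_sum[where f = "\<lambda>j. Cmp C X (pw j X) X (x j) (e j)", OF NI[OF X] o(2) S t] by blast
  then obtain j where j: "is_iso C X X (Cmp C X (pw j X) X (x j) (e j))" by blast
  show "is_iso C X X (x 0)" "is_iso C X X (y 0)"
    using hc_iso_0[OF X Hom_OD[OF xy(1)] e(1) j] e(2) by auto
qed

text \<open>If x y vanished in degree 0, the terms with j distinct from 0 would add up to the
  negative of an invertible endomorphism, and one of them would be invertible.\<close>

lemma O_mult_nonzero:
  assumes X: "indecomposable C X" and xy: "x \<in> Hom OC X X" "y \<in> Hom OC X X"
    and i: "is_iso C X X (x 0)" "is_iso C X X (y 0)"
  shows "Cmp OC X X X x y \<noteq> Nul OC X X"
proof
  assume z: "Cmp OC X X X x y = Nul OC X X"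
  have o: "X \<in> Ob C" "\<not> zero_object C X" using X unfolding indecomposable_def by blast+
  interpret g: comm_group "hom_group C X X" using o grp by blast
  obtain e where e: "\<And>j. e j \<in> Hom C X (pw j X)" "e 0 = y 0"
    "Cmp OC X X X x y 0 = finprod (hom_group C X X) (\<lambda>j. Cmp C X (pw j X) X (x j) (e j)) (supp X X x)"
    using Cmp_O_0[OF xy(2,1) o(1) o(1) o(1)] by blast
  let ?t = "\<lambda>j. Cmp C X (pw j X) X (x j) (e j)" and ?S = "supp X X x - {0}"
  let ?r = "finprod (hom_group C X X) ?t ?S"
  have t: "?t j \<in> Hom C X X" for j using e(1) Hom_OD[OF xy(1)] o by simp
  have S: "finite ?S" using xy(1) unfolding in_Hom_O by simp
  have nu: "\<not> is_iso C X X (Nul C X X)"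
  proof
    assume "is_iso C X X (Nul C X X)"
    then obtain g where "g \<in> Hom C X X" "Cmp C X X X g (Nul C X X) = Idn C X" unfolding is_iso_def by blast
    then show False using o unfolding zero_object_def by simp
  qed
  then have z0: "0 \<in> supp X X x" using i(1) by auto
  have "finprod (hom_group C X X) ?t (insert 0 ?S) = Add C X X (?t 0) ?r"
    using g.finprod_insert[OF S, of 0 ?t] t t[of 0] by (simp add: Pi_def)
  then have fs: "finprod (hom_group C X X) ?t (supp X X x) = Add C X X (?t 0) ?r"
    unfolding insert_Diff[OF z0] .
  have z': "Cmp OC X X X x y 0 = Nul C X X" unfolding z by simp
  have s: "Add C X X (?t 0) ?r = Nul C X X" by (rule trans[OF fs[symmetric] trans[OF e(3)[symmetric] z']])
  have r: "?r \<in> Hom C X X" using g.finprod_closed[of ?t ?S] t by (simp add: Pi_def)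
  have t0: "is_iso C X X (?t 0)" using is_iso_cmp[OF i(2,1)] o e(2) by simp
  then have "is_iso C X X (Cmp C X X X (x 0) (e 0))" by simp
  then have "is_iso C X X ?r" using is_iso_negative[OF _ r _ o(1)] s by simp
  then have "\<exists>j \<in> ?S. is_iso C X X (?t j)" using nil_or_iso_sum[where f = ?t, OF NI[OF X] o(2) S t] by blast
  then show False using hc_iso_0(1)[OF X Hom_OD[OF xy(1)] e(1)] by blast
qed

text \<open>Some \<open>pw j X\<close> is a retract of \<open>A\<close> and isomorphic to
  \<open>X\<close> in the orbit category. Hence the identity of \<open>X\<close> factors through
  \<open>A\<close>, and inserting p i = 1 in the middle splits it into b p and i a.\<close>

lemma O_summand:
  assumes X: "indecomposable C X" and i: "i \<in> Hom OC A X" and p: "p \<in> Hom OC X A"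
    and pi: "Cmp OC A X A p i = Idn OC A" and A: "A \<in> Ob C" "\<not> zero_object C A"
  shows "\<exists>a \<in> Hom OC X A. \<exists>b \<in> Hom OC A X. Cmp OC X X X (Cmp OC X A X b p) (Cmp OC X A X i a) = Idn OC X"
proof -
  have o: "X \<in> Ob C" using X unfolding indecomposable_def by blast
  note oo = o A(1)
  obtain j c d where j: "c \<in> Hom C (pw j X) A" "d \<in> Hom C A (pw j X)" "Cmp C (pw j X) A (pw j X) d c = Idn C (pw j X)"
    using O_retract[OF i p pi A(1) o A(2) NI[OF pw_indecomposable[OF X]]] by blast
  have P: "pw j X \<in> Ob C" using o by simp
  obtain u v where u: "u \<in> Hom OC X (pw j X)" "v \<in> Hom OC (pw j X) X" "Cmp OC X (pw j X) X v u = Idn OC X"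
    using O_iso_pw[OF o, of j] unfolding isomorphic_def is_iso_def by blast
  let ?c = "emb (pw j X) A c" and ?d = "emb A (pw j X) d"
  have e: "?c \<in> Hom OC (pw j X) A" "?d \<in> Hom OC A (pw j X)" "Cmp OC (pw j X) A (pw j X) ?d ?c = Idn OC (pw j X)"
    using emb_in[OF j(1)] emb_in[OF j(2)] emb_cmp[OF j(1,2)] j(3) emb_idn P A by simp_all
  let ?a = "Cmp OC X (pw j X) A ?c u" and ?b = "Cmp OC A (pw j X) X v ?d"
  have ab: "?a \<in> Hom OC X A" "?b \<in> Hom OC A X" using e u P oo O.cmp_in O_simps(1) by metis+
  have "Cmp OC X X X (Cmp OC X A X ?b p) (Cmp OC X A X i ?a) = Cmp OC X A X ?b (Cmp OC X X A p (Cmp OC X A X i ?a))"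
    using O.assoc[OF O.cmp_in[OF ab(1) i] p ab(2)] oo by simp
  also have "\<dots> = Cmp OC X A X ?b ?a" using O.cancel_l[OF pi ab(1) i p] oo by simp
  also have "\<dots> = Cmp OC X (pw j X) X v (Cmp OC X A (pw j X) ?d ?a)" using O.assoc[OF ab(1) e(2) u(2)] oo P by simp
  also have "\<dots> = Idn OC X" using O.cancel_l[OF e(3) u(1) e(1,2)] u(3) oo P by simp
  finally show ?thesis using ab by blast
qed

text \<open>Two nonzero summands \<open>A\<close> and \<open>B\<close> would give endomorphisms b p
  and j c of \<open>X\<close>, both invertible in degree 0. Their product contains p j = 0, which
  contradicts \<open>O_mult_nonzero\<close>.\<close>

theorem O_indecomposable:
  assumes X: "indecomposable C X"
  shows "indecomposable OC X"
proof -
  have o: "X \<in> Ob C" "\<not> zero_object C X" using X unfolding indecomposable_def by blast+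
  have "zero_object C A \<or> zero_object C B" if AB: "A \<in> Ob C" "B \<in> Ob C" "is_direct_sum OC A B X" for A B
  proof (rule ccontr)
    assume "\<not> ?thesis"
    then have nz: "\<not> zero_object C A" "\<not> zero_object C B" by auto
    obtain i j p q where s: "i \<in> Hom OC A X" "j \<in> Hom OC B X" "p \<in> Hom OC X A" "q \<in> Hom OC X B"
      "Cmp OC A X A p i = Idn OC A" "Cmp OC B X B q j = Idn OC B"
      "Cmp OC A X B q i = Nul OC A B" "Cmp OC B X A p j = Nul OC B A"
      using AB(3) unfolding is_direct_sum_def by blast
    obtain a b where a: "a \<in> Hom OC X A" "b \<in> Hom OC A X" "Cmp OC X X X (Cmp OC X A X b p) (Cmp OC X A X i a) = Idn OC X"
      using O_summand[OF X s(1,3,5) AB(1) nz(1)] by blast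
    obtain c d where c: "c \<in> Hom OC X B" "d \<in> Hom OC B X" "Cmp OC X X X (Cmp OC X B X d q) (Cmp OC X B X j c) = Idn OC X"
      using O_summand[OF X s(2,4,6) AB(2) nz(2)] by blast
    let ?x = "Cmp OC X A X b p" and ?y = "Cmp OC X B X j c"
    have xy: "?x \<in> Hom OC X X" "?y \<in> Hom OC X X" "Cmp OC X A X i a \<in> Hom OC X X" "Cmp OC X B X d q \<in> Hom OC X X"
      using O.cmp_in a c s AB o O_simps(1) by metis+
    have "Cmp OC X X X ?x ?y = Cmp OC X A X b (Cmp OC X X A p ?y)"
      using O.assoc[OF xy(2) s(3) a(2)] AB o by simp
    also have "Cmp OC X X A p ?y = Cmp OC X B A (Cmp OC B X A p j) c"
      using O.assoc[OF c(1) s(2,3)] AB o by simp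
    also have "\<dots> = Nul OC X A" unfolding s(8) using O.cmp_nul_l[OF c(1)] AB o unfolding O_simps(1) by blast
    also have "Cmp OC X A X b (Nul OC X A) = Nul OC X X" using O.cmp_nul_r[OF a(2)] AB o unfolding O_simps(1) by blast
    finally show False
      using O_mult_nonzero[OF X xy(1,2)] O_unit_0(1)[OF X xy(1,3) a(3)] O_unit_0(2)[OF X xy(4,2) c(3)] by blast
  qed
  then show ?thesis using o unfolding indecomposable_def O_zero_object O_simps(1) by blast
qed

section \<open>Transfer of Ext-configurations\<close>

text \<open>Vanishing in the orbit category is vanishing in all degrees, of which (E1) uses degree
  0. For (E2), a nonzero component of degree \<open>i\<close> starts at \<open>pw i X\<close>, which
  has the same class as \<open>X\<close> in the orbit category.\<close>

theorem ext_configuration_orbitD: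
  assumes s: "\<And>X. X \<in> Ob C \<Longrightarrow> s X \<in> Ob C" and T: "ext_configuration OC s T'"
  shows "ext_configuration C s {iso_class C X | X. indecomposable C X \<and> iso_class OC X \<in> T'}"
    (is "ext_configuration C s ?T")
proof -
  have E1: "\<And>X Y. \<lbrakk>X \<in> Ob C; Y \<in> Ob C; iso_class OC X \<in> T'; iso_class OC Y \<in> T'\<rbrakk> \<Longrightarrow> ext1_vanishes OC s X Y"
    and E2: "\<And>Z. \<lbrakk>indecomposable OC Z; iso_class OC Z \<notin> T'\<rbrakk> \<Longrightarrow>
      \<exists>X \<in> Ob C. iso_class OC X \<in> T' \<and> \<not> ext1_vanishes OC s X Z"
    using T unfolding ext_configuration_def O_simps(1) by blast+
  have mem: "iso_class OC X \<in> T'" if X: "X \<in> Ob C" "iso_class C X \<in> ?T" for X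
  proof -
    obtain Y where Y: "indecomposable C Y" "iso_class OC Y \<in> T'" "iso_class C X = iso_class C Y" using X by blast
    then have "Y \<in> Ob C" unfolding indecomposable_def by blast
    then have "isomorphic OC X Y" using O_isomorphic iso_class_eq_iff X Y(3) by blast
    then show ?thesis using O.iso_class_eq_iff X \<open>Y \<in> Ob C\<close> Y(2) O_simps(1) by metis
  qed
  show ?thesis unfolding ext_configuration_def
  proof (intro conjI ballI allI impI)
    show "?T \<subseteq> ind C" unfolding ind_def by blast
  next
    fix X Y assume XY: "X \<in> Ob C" "Y \<in> Ob C" "iso_class C X \<in> ?T" "iso_class C Y \<in> ?T"
    then have "ext1_vanishes OC s X Y" using E1 mem by blast
    then have "\<not> O.nz X (s Y)" using O.ext1_vanishes_iff[where s = s] XY s O_simps(1) by metis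
    then have "\<not> nz (pw 0 X) (s Y)" using O_nz[OF XY(1) s[OF XY(2)]] by blast
    then show "ext1_vanishes C s X Y" using ext1_vanishes_iff[where s = s] XY s by simp
  next
    fix Z assume Z: "indecomposable C Z \<and> iso_class C Z \<notin> ?T"
    then have Zo: "Z \<in> Ob C" unfolding indecomposable_def by blast
    have "iso_class OC Z \<notin> T'" using Z by blast
    then obtain X where X: "X \<in> Ob C" "iso_class OC X \<in> T'" "\<not> ext1_vanishes OC s X Z"
      using E2 O_indecomposable Z by blast
    then have "O.nz X (s Z)" using O.ext1_vanishes_iff[where s = s] Zo s O_simps(1) by metis
    then obtain i where i: "nz (pw i X) (s Z)" using O_nz[OF X(1) s[OF Zo]] by blast
    have P: "pw i X \<in> Ob C" using X by simp
    have c: "iso_class OC (pw i X) \<in> T'"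
      using O.iso_class_eq_iff[of X "pw i X"] O_iso_pw[OF X(1)] X P O_simps(1) by metis
    then have "iso_class OC (pw i X) \<in> ind OC" using T unfolding ext_configuration_def by blast
    then have "indecomposable C (pw i X)" using O.in_ind_iff[of "pw i X"] O_indecomposableD P O_simps(1) by metis
    then have "iso_class C (pw i X) \<in> ?T" using c by blast
    then show "\<exists>X \<in> Ob C. iso_class C X \<in> ?T \<and> \<not> ext1_vanishes C s X Z"
      using P i ext1_vanishes_iff[where s = s, OF P s[OF Zo]] by blast
  qed
qed

text \<open>Stability under the powers enters twice: every representative of a class in the new
  configuration already lies in \<open>T\<close>, and (E1) then holds with \<open>pw i X\<close> for
  every \<open>i\<close> in place of \<open>X\<close>.\<close>

theorem ext_configuration_orbitI:
  assumes s: "\<And>X. X \<in> Ob C \<Longrightarrow> s X \<in> Ob C" and T: "ext_configuration C s T"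
    and closed: "\<And>X k. \<lbrakk>X \<in> Ob C; iso_class C X \<in> T\<rbrakk> \<Longrightarrow> iso_class C (pw k X) \<in> T"
  shows "ext_configuration OC s {iso_class OC X | X. X \<in> Ob C \<and> iso_class C X \<in> T}"
    (is "ext_configuration OC s ?T")
proof -
  have E1: "\<And>X Y. \<lbrakk>X \<in> Ob C; Y \<in> Ob C; iso_class C X \<in> T; iso_class C Y \<in> T\<rbrakk> \<Longrightarrow> ext1_vanishes C s X Y"
    and E2: "\<And>Z. \<lbrakk>indecomposable C Z; iso_class C Z \<notin> T\<rbrakk> \<Longrightarrow>
      \<exists>X \<in> Ob C. iso_class C X \<in> T \<and> \<not> ext1_vanishes C s X Z" and sub: "T \<subseteq> ind C"
    using T unfolding ext_configuration_def by blast+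
  have ind: "indecomposable C X" if "X \<in> Ob C" "iso_class C X \<in> T" for X
    using in_ind_iff that sub by blast
  have mem: "iso_class C X \<in> T" if X: "X \<in> Ob C" "iso_class OC X \<in> ?T" for X
  proof -
    obtain Y where Y: "Y \<in> Ob C" "iso_class C Y \<in> T" "iso_class OC X = iso_class OC Y" using X by blast
    have i: "isomorphic OC X Y" using O.iso_class_eq_iff X Y O_simps(1) by metis
    have YI: "indecomposable C Y" using ind Y by blast
    have "indecomposable OC X" using O.indecomposable_iso[OF O.iso_sym[OF i] O_indecomposable[OF YI]] X O_simps(1) by metis
    then have XI: "indecomposable C X" by (rule O_indecomposableD)
    obtain k where k: "isomorphic C (pw k Y) X" using O_iso_imp[OF XI YI i] by blast
    have "pw k Y \<in> Ob C" using Y by simp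
    then show ?thesis using iso_class_eq_iff[of "pw k Y" X] k X closed[OF Y(1,2), of k] by simp
  qed
  show ?thesis unfolding ext_configuration_def
  proof (intro conjI ballI allI impI)
    show "?T \<subseteq> ind OC" using ind O_indecomposable unfolding ind_def by blast
  next
    fix X Y assume XY: "X \<in> Ob OC" "Y \<in> Ob OC" "iso_class OC X \<in> ?T" "iso_class OC Y \<in> ?T"
    then have o: "X \<in> Ob C" "Y \<in> Ob C" by simp_all
    have "\<not> nz (pw i X) (s Y)" for i
    proof -
      have P: "pw i X \<in> Ob C" using o by simp
      have "ext1_vanishes C s (pw i X) Y" using E1[OF P o(2)] closed mem o XY by blast
      then show ?thesis using ext1_vanishes_iff[where s = s, OF P s[OF o(2)]] by blast
    qed
    then have "\<not> O.nz X (s Y)" using O_nz[OF o(1) s[OF o(2)]] by blast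
    then show "ext1_vanishes OC s X Y" using O.ext1_vanishes_iff[where s = s] o s O_simps(1) by metis
  next
    fix Z assume Z: "indecomposable OC Z \<and> iso_class OC Z \<notin> ?T"
    then have ZI: "indecomposable C Z" using O_indecomposableD by blast
    then have Zo: "Z \<in> Ob C" unfolding indecomposable_def by blast
    then have "iso_class C Z \<notin> T" using Z by blast
    then obtain X where X: "X \<in> Ob C" "iso_class C X \<in> T" "\<not> ext1_vanishes C s X Z"
      using E2 ZI by blast
    then have "nz (pw 0 X) (s Z)" using ext1_vanishes_iff[where s = s, OF X(1) s[OF Zo]] by simp
    then have "O.nz X (s Z)" using O_nz[OF X(1) s[OF Zo]] by blast
    then have "\<not> ext1_vanishes OC s X Z" using O.ext1_vanishes_iff[where s = s] X Zo s O_simps(1) by metis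
    then show "\<exists>X \<in> Ob OC. iso_class OC X \<in> ?T \<and> \<not> ext1_vanishes OC s X Z" using X by auto
  qed
qed

end

section \<open>Modules\<close>

interpretation sq: vector_space seq_scale
  by unfold_locales (simp_all add: seq_scale_def fun_eq_iff algebra_simps)

lemma evens_interleave [simp]: "evens (interleave v w) = v"
  and odds_interleave [simp]: "odds (interleave v w) = w"
  and interleave_evens_odds [simp]: "interleave (evens u) (odds u) = u"
  by (auto simp: evens_def odds_def interleave_def fun_eq_iff)

lemma evens_simps [simp]: "evens 0 = 0" "evens (u + v) = evens u + evens v" "evens (- u) = - evens u"
  "evens (u - v) = evens u - evens v" "evens (seq_scale a u) = seq_scale a (evens u)"
  for u v :: "nat \<Rightarrow> 'k::field"
  by (simp_all add: evens_def seq_scale_def fun_eq_iff)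

lemma odds_simps [simp]: "odds 0 = 0" "odds (u + v) = odds u + odds v" "odds (- u) = - odds u"
  "odds (u - v) = odds u - odds v" "odds (seq_scale a u) = seq_scale a (odds u)"
  for u v :: "nat \<Rightarrow> 'k::field"
  by (simp_all add: odds_def seq_scale_def fun_eq_iff)

lemma interleave_eq_iff: "interleave v w = u \<longleftrightarrow> v = evens u \<and> w = odds u"
  by (metis evens_interleave odds_interleave interleave_evens_odds)

lemma seq_eqI: "\<lbrakk>evens u = evens v; odds u = odds v\<rbrakk> \<Longrightarrow> u = v"
  by (metis interleave_evens_odds)

lemma interleave_0 [simp]: "interleave 0 0 = (0 :: nat \<Rightarrow> 'k::field)"
  by (simp add: interleave_eq_iff)

lemma interleave_add: "interleave v w + interleave v' w' = interleave (v + v') (w + w')"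
  for v w :: "nat \<Rightarrow> 'k::field"
  by (rule seq_eqI) simp_all

lemma interleave_scale: "interleave (seq_scale a v) (seq_scale a w) = seq_scale a (interleave v w)"
  by (rule seq_eqI) simp_all

section \<open>Finite-dimensional subspaces and modules\<close>

text \<open>The space of sequences is infinite-dimensional, while \<open>sq.dim\<close> is a
  cardinality. Dimension arguments are therefore confined to sets with this property.\<close>

definition fd :: "(nat \<Rightarrow> 'k::field) set \<Rightarrow> bool" where
  "fd V \<longleftrightarrow> (\<exists>B. finite B \<and> V \<subseteq> sq.span B)"

lemma fd_subset: "\<lbrakk>fd W; V \<subseteq> W\<rbrakk> \<Longrightarrow> fd V"
  unfolding fd_def by blast

lemma fd_finite_basis:
  assumes "fd V"
  obtains B where "finite B" "B \<subseteq> V" "sq.independent B" "V \<subseteq> sq.span B" "card B = sq.dim V"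
proof -
  obtain S where S: "finite S" "V \<subseteq> sq.span S" using assms fd_def by blast
  obtain B where B: "B \<subseteq> V" "sq.independent B" "V \<subseteq> sq.span B" "card B = sq.dim V"
    using sq.basis_exists by blast
  have "finite B" using sq.independent_span_bound[OF S(1) B(2)] B(1) S(2) by blast
  then show ?thesis using that B by blast
qed

lemma fd_dim_mono:
  assumes W: "fd W" and s: "V \<subseteq> W" "sq.subspace V" "sq.subspace W"
  shows "sq.dim V \<le> sq.dim W" "sq.dim V = sq.dim W \<Longrightarrow> V = W"
proof -
  obtain B where B: "finite B" "B \<subseteq> V" "sq.independent B" "V \<subseteq> sq.span B" "card B = sq.dim V"
    using fd_finite_basis[OF fd_subset[OF W s(1)]] .
  obtain B' where B': "finite B'" "B' \<subseteq> W" "sq.independent B'" "W \<subseteq> sq.span B'" "card B' = sq.dim W"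
    using fd_finite_basis[OF W] .
  have "B \<subseteq> W" using B s by blast
  then obtain D where D: "B \<subseteq> D" "D \<subseteq> W" "sq.independent D" "W \<subseteq> sq.span D"
    using sq.maximal_independent_subset_extend[OF _ B(3)] by metis
  have fin: "finite D" and c: "card D \<le> card B'"
    using sq.independent_span_bound[OF B'(1) D(3)] D(2) B'(4) by blast+
  have cD: "card D = sq.dim W" using sq.basis_card_eq_dim[OF D(2,4,3)] .
  show "sq.dim V \<le> sq.dim W" using card_mono[OF fin D(1)] B(5) cD by simp
  assume "sq.dim V = sq.dim W"
  then have "B = D" using card_subset_eq[OF fin D(1)] B(5) cD by simp
  then have "W \<subseteq> sq.span B" using D by simp
  also have "\<dots> \<subseteq> V" using sq.span_minimal[OF B(2) s(2)] .
  finally show "V = W" using s by blast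
qed

context fd_algebra
begin

text \<open>The module axioms separated from finite generation, which is not visibly inherited by
  submodules and is handled through \<open>fd\<close> instead.\<close>

definition modl :: "('h, 'k) fmod \<Rightarrow> bool" where
  "modl M \<longleftrightarrow> sq.subspace (carr M) \<and>
     (\<forall>h. \<forall>v \<in> carr M. act M h v \<in> carr M) \<and>
     (\<forall>h. \<forall>v \<in> carr M. \<forall>w \<in> carr M. act M h (v + w) = act M h v + act M h w) \<and>
     (\<forall>h h'. \<forall>v \<in> carr M. act M (h + h') v = act M h v + act M h' v) \<and>
     (\<forall>h h'. \<forall>v \<in> carr M. act M (h * h') v = act M h (act M h' v)) \<and>
     (\<forall>v \<in> carr M. act M 1 v = v) \<and>
     (\<forall>a. \<forall>v \<in> carr M. act M (sc a 1) v = seq_scale a v)"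

lemma fg_module_modl: "fg_module sc M \<Longrightarrow> modl M"
  unfolding fg_module_def modl_def by blast

lemma modlD:
  assumes "modl M"
  shows modl_subspace: "sq.subspace (carr M)"
    and modl_act [simp]: "v \<in> carr M \<Longrightarrow> act M h v \<in> carr M"
    and modl_act_add: "\<lbrakk>v \<in> carr M; w \<in> carr M\<rbrakk> \<Longrightarrow> act M h (v + w) = act M h v + act M h w"
    and modl_add_act: "v \<in> carr M \<Longrightarrow> act M (h + h') v = act M h v + act M h' v"
    and modl_mult_act: "v \<in> carr M \<Longrightarrow> act M (h * h') v = act M h (act M h' v)"
    and modl_one [simp]: "v \<in> carr M \<Longrightarrow> act M 1 v = v"
    and modl_sc_one: "v \<in> carr M \<Longrightarrow> act M (sc a 1) v = seq_scale a v"
  using assms unfolding modl_def by blast+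

lemma modl_0 [simp]: "modl M \<Longrightarrow> 0 \<in> carr M"
  and modl_add [simp]: "\<lbrakk>modl M; v \<in> carr M; w \<in> carr M\<rbrakk> \<Longrightarrow> v + w \<in> carr M"
  and modl_scale [simp]: "\<lbrakk>modl M; v \<in> carr M\<rbrakk> \<Longrightarrow> seq_scale a v \<in> carr M"
  and modl_neg [simp]: "\<lbrakk>modl M; v \<in> carr M\<rbrakk> \<Longrightarrow> - v \<in> carr M"
  and modl_diff [simp]: "\<lbrakk>modl M; v \<in> carr M; w \<in> carr M\<rbrakk> \<Longrightarrow> v - w \<in> carr M"
  using modl_subspace sq.subspace_0 sq.subspace_add sq.subspace_scale sq.subspace_neg sq.subspace_diff by blast+

lemma modl_sc_act: "\<lbrakk>modl M; v \<in> carr M\<rbrakk> \<Longrightarrow> act M (sc a h) v = seq_scale a (act M h v)"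
  using modl_mult_act[of M v "sc a 1" h] modl_sc_one[of M "act M h v" a] sc_mult_left[of a 1 h]
  by simp

lemma modl_act_0 [simp]: "modl M \<Longrightarrow> act M h 0 = 0"
  using modl_act_add[of M 0 0 h] by simp

lemma modl_0_act [simp]: "\<lbrakk>modl M; v \<in> carr M\<rbrakk> \<Longrightarrow> act M 0 v = 0"
  using modl_add_act[of M v 0 0] by simp

lemma modl_act_neg: "\<lbrakk>modl M; v \<in> carr M\<rbrakk> \<Longrightarrow> act M h (- v) = - act M h v"
  using modl_act_add[of M v "- v" h] by (simp add: eq_neg_iff_add_eq_0 add.commute)

text \<open>Multiplying the generators by a finite spanning set of the algebra spans the module over
  the field; conversely a basis over the field generates, with scalars acting through
  \<open>sc a 1\<close>.\<close>

lemma fg_module_iff: "fg_module sc M \<longleftrightarrow> modl M \<and> fd (carr M)"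
proof
  assume fg: "fg_module sc M"
  then have M: "modl M" by (rule fg_module_modl)
  obtain B where B: "finite B" "B \<subseteq> carr M" "\<And>v. v \<in> carr M \<Longrightarrow> \<exists>c. v = (\<Sum>b\<in>B. act M (c b) b)"
    using fg unfolding fg_module_def by blast
  obtain E where E: "finite E" "span E = UNIV" using finite_dim by blast
  let ?S = "(\<lambda>(e, b). act M e b) ` (E \<times> B)"
  have "act M h b \<in> sq.span ?S" if b: "b \<in> B" for h b
  proof -
    have "h \<in> span E" using E by simp
    then show ?thesis
    proof (induction rule: span_induct_alt)
      case base
      have "act M 0 b = 0" using M B(2) b by (intro modl_0_act) auto
      then show ?case using sq.span_zero by metis
    next
      case (step c x y)
      have "act M (sc c x + y) b = seq_scale c (act M x b) + act M y b"
        using M B b modl_add_act[of M b] modl_sc_act[of M b] by auto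
      moreover have "act M x b \<in> sq.span ?S" using step b by (intro sq.span_base) auto
      ultimately show ?case using step sq.span_add sq.span_scale by metis
    qed
  qed
  then have "(\<Sum>b\<in>B. act M (c b) b) \<in> sq.span ?S" for c by (intro sq.span_sum)
  then have "carr M \<subseteq> sq.span ?S" using B(3) by force
  moreover have "finite ?S" using E(1) B(1) by simp
  ultimately have "fd (carr M)" unfolding fd_def by (intro exI[of _ ?S] conjI)
  with M show "modl M \<and> fd (carr M)" by (rule conjI)
next
  assume M: "modl M \<and> fd (carr M)"
  obtain B where B: "finite B" "B \<subseteq> carr M" "carr M \<subseteq> sq.span B" using fd_finite_basis M by metis
  have "\<exists>c. v = (\<Sum>b\<in>B. act M (c b) b)" if "v \<in> carr M" for v
  proof -
    have "v \<in> sq.span B" using B that by blast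
    then obtain u where "v = (\<Sum>b\<in>B. seq_scale (u b) b)"
      unfolding sq.span_finite[OF B(1)] by auto
    also have "\<dots> = (\<Sum>b\<in>B. act M (sc (u b) 1) b)"
      using M B(2) modl_sc_one by (intro sum.cong) auto
    finally show ?thesis by (rule exI[of _ "\<lambda>b. sc (u b) 1"])
  qed
  then show "fg_module sc M" using M B(1,2) unfolding fg_module_def modl_def by blast
qed

definition sub :: "('h, 'k) fmod \<Rightarrow> (nat \<Rightarrow> 'k) set \<Rightarrow> ('h, 'k) fmod" where
  "sub M W = \<lparr>carr = W, act = act M\<rparr>"

lemma sub_simps [simp]: "carr (sub M W) = W" "act (sub M W) = act M"
  by (simp_all add: sub_def)

lemma fg_sub:
  assumes M: "fg_module sc M" and W: "W \<subseteq> carr M" "sq.subspace W" "\<And>h v. v \<in> W \<Longrightarrow> act M h v \<in> W"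
  shows "fg_module sc (sub M W)"
proof -
  have m: "modl M" "fd (carr M)" using M fg_module_iff by blast+
  then have "fd W" using fd_subset W by blast
  moreover have "modl (sub M W)" unfolding modl_def[of "sub M W"] sub_simps
    using W modlD[OF m(1)] by (simp add: subset_iff)
  ultimately show ?thesis unfolding fg_module_iff by simp
qed

lemma fg_zero_module: "fg_module sc zero_module"
proof -
  have "modl zero_module" unfolding modl_def zero_module_def by (simp add: sq.subspace_0 sq.subspace_single_0)
  moreover have "fd (carr zero_module)" unfolding fd_def zero_module_def
    by (intro exI[of _ "{0}"]) (simp add: sq.span_zero)
  ultimately show ?thesis unfolding fg_module_iff by blast
qed

lemma sum_module_simps: "carr (sum_module M N) = {u. evens u \<in> carr M \<and> odds u \<in> carr N}"
  "act (sum_module M N) h u = interleave (act M h (evens u)) (act N h (odds u))"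
  by (simp_all add: sum_module_def)

lemma fg_sum_module:
  assumes "fg_module sc M" "fg_module sc N"
  shows "fg_module sc (sum_module M N)"
proof -
  have m: "modl M" "fd (carr M)" "modl N" "fd (carr N)" using assms fg_module_iff by blast+
  have "modl (sum_module M N)"
    using m(1,3) unfolding modl_def[of "sum_module M N"] sum_module_simps sq.subspace_def
    by (intro conjI ballI allI)
      (simp_all add: modl_act_add modl_add_act modl_mult_act modl_sc_one interleave_add interleave_scale)
  moreover have "fd (carr (sum_module M N))"
  proof -
    obtain B where B: "finite B" "carr M \<subseteq> sq.span B" using m(2) fd_def by blast
    obtain D where D: "finite D" "carr N \<subseteq> sq.span D" using m(4) fd_def by blast
    let ?S = "(\<lambda>v. interleave v 0) ` B \<union> (\<lambda>v. interleave 0 v) ` D"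
    have 1: "interleave v 0 \<in> sq.span ?S" if "v \<in> sq.span B" for v
      using that
    proof (induction rule: sq.span_induct_alt)
      case base
      show ?case unfolding interleave_0 by (rule sq.span_zero)
    next
      case (step c x y)
      have "interleave (seq_scale c x + y) 0 = seq_scale c (interleave x 0) + interleave y 0"
        by (rule seq_eqI) simp_all
      moreover have "interleave x 0 \<in> sq.span ?S" using step by (intro sq.span_base) auto
      ultimately show ?case using step sq.span_add sq.span_scale by metis
    qed
    have 2: "interleave 0 v \<in> sq.span ?S" if "v \<in> sq.span D" for v
      using that
    proof (induction rule: sq.span_induct_alt)
      case base
      show ?case unfolding interleave_0 by (rule sq.span_zero)
    next
      case (step c x y)
      have "interleave 0 (seq_scale c x + y) = seq_scale c (interleave 0 x) + interleave 0 y"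
        by (rule seq_eqI) simp_all
      moreover have "interleave 0 x \<in> sq.span ?S" using step by (intro sq.span_base) auto
      ultimately show ?case using step sq.span_add sq.span_scale by metis
    qed
    have "u \<in> sq.span ?S" if "u \<in> carr (sum_module M N)" for u
    proof -
      have "u = interleave (evens u) 0 + interleave 0 (odds u)" by (rule seq_eqI) simp_all
      then show ?thesis using 1[of "evens u"] 2[of "odds u"] that B D sq.span_add
        unfolding sum_module_simps by (metis (no_types, lifting) mem_Collect_eq subsetD)
    qed
    then show ?thesis unfolding fd_def using B(1) D(1) by (intro exI[of _ ?S]) auto
  qed
  ultimately show ?thesis unfolding fg_module_iff by blast
qed

lemma mod_homI:
  assumes "\<And>v. v \<in> carr M \<Longrightarrow> f v \<in> carr N"
    and "\<And>v w. \<lbrakk>v \<in> carr M; w \<in> carr M\<rbrakk> \<Longrightarrow> f (v + w) = f v + f w"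
    and "\<And>h v. v \<in> carr M \<Longrightarrow> f (act M h v) = act N h (f v)"
    and "\<And>v. v \<notin> carr M \<Longrightarrow> f v = 0"
  shows "f \<in> mod_hom M N"
  using assms unfolding mod_hom_def by blast

lemma mod_homD:
  assumes "f \<in> mod_hom M N"
  shows hom_in: "v \<in> carr M \<Longrightarrow> f v \<in> carr N"
    and hom_add: "\<lbrakk>v \<in> carr M; w \<in> carr M\<rbrakk> \<Longrightarrow> f (v + w) = f v + f w"
    and hom_act: "v \<in> carr M \<Longrightarrow> f (act M h v) = act N h (f v)"
    and hom_out: "v \<notin> carr M \<Longrightarrow> f v = 0"
  using assms unfolding mod_hom_def by blast+

lemma hom_0: "f \<in> mod_hom M N \<Longrightarrow> modl M \<Longrightarrow> f 0 = 0"
  using hom_add[of f M N 0 0] by simp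

lemma hom_neg: "\<lbrakk>f \<in> mod_hom M N; modl M; v \<in> carr M\<rbrakk> \<Longrightarrow> f (- v) = - f v"
  using hom_add[of f M N v "- v"] hom_0[of f M N] by (simp add: eq_neg_iff_add_eq_0 add.commute)

lemma hom_diff: "\<lbrakk>f \<in> mod_hom M N; modl M; v \<in> carr M; w \<in> carr M\<rbrakk> \<Longrightarrow> f (v - w) = f v - f w"
  using hom_add[of f M N v "- w"] hom_neg[of f M N w] by simp

lemma hom_in': "\<lbrakk>f \<in> mod_hom M N; modl N\<rbrakk> \<Longrightarrow> f v \<in> carr N"
  using hom_in hom_out modl_0 by metis

lemma hom_scale: "\<lbrakk>f \<in> mod_hom M N; modl M; modl N; v \<in> carr M\<rbrakk> \<Longrightarrow> f (seq_scale a v) = seq_scale a (f v)"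
  using hom_act[of f M N v "sc a 1"] modl_sc_one[of M v a] modl_sc_one[of N "f v" a] hom_in[of f M N v] by simp

lemma hom_comp: "\<lbrakk>f \<in> mod_hom L M; g \<in> mod_hom M N; modl M\<rbrakk> \<Longrightarrow> g \<circ> f \<in> mod_hom L N"
  using hom_0[of g M N] unfolding mod_hom_def by auto

lemma hom_zero: "\<lbrakk>modl M; modl N\<rbrakk> \<Longrightarrow> 0 \<in> mod_hom M N"
  unfolding mod_hom_def by simp

lemma hom_plus: "\<lbrakk>f \<in> mod_hom M N; g \<in> mod_hom M N; modl N\<rbrakk> \<Longrightarrow> f + g \<in> mod_hom M N"
  by (rule mod_homI)
    (auto simp: mod_homD[of f M N] mod_homD[of g M N] modl_act_add add_ac)

lemma hom_uminus: "\<lbrakk>f \<in> mod_hom M N; modl N\<rbrakk> \<Longrightarrow> - f \<in> mod_hom M N"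
  by (rule mod_homI) (auto simp: mod_homD[of f M N] modl_act_neg)

lemma hom_minus: "\<lbrakk>f \<in> mod_hom M N; g \<in> mod_hom M N; modl N\<rbrakk> \<Longrightarrow> f - g \<in> mod_hom M N"
  using hom_plus[of f M N "- g"] hom_uminus[of g M N] by simp

lemma hom_id: "modl M \<Longrightarrow> restr0 (carr M) (\<lambda>v. v) \<in> mod_hom M M"
  unfolding mod_hom_def restr0_def by simp

lemma hom_id_comp: "f \<in> mod_hom M N \<Longrightarrow> restr0 (carr N) (\<lambda>v. v) \<circ> f = f"
  and hom_comp_id: "\<lbrakk>f \<in> mod_hom M N; modl M\<rbrakk> \<Longrightarrow> f \<circ> restr0 (carr M) (\<lambda>v. v) = f"
  using hom_0[of f M N] by (auto simp: restr0_def fun_eq_iff mod_hom_def)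

lemma hom_comp_plus: "\<lbrakk>f \<in> mod_hom L M; f' \<in> mod_hom L M; g \<in> mod_hom M N; modl M\<rbrakk> \<Longrightarrow> g \<circ> (f + f') = (g \<circ> f) + (g \<circ> f')"
  by (rule ext) (simp add: hom_add[of g M N] hom_in')

lemma hom_comp_zero: "\<lbrakk>g \<in> mod_hom M N; modl M\<rbrakk> \<Longrightarrow> g \<circ> 0 = 0"
  by (rule ext) (simp add: hom_0[of g M N])

lemma subspace_image:
  assumes f: "f \<in> mod_hom M N" and M: "modl M" "modl N"
  shows "sq.subspace (f ` carr M)" "v \<in> f ` carr M \<Longrightarrow> act N h v \<in> f ` carr M"
proof -
  show "sq.subspace (f ` carr M)" unfolding sq.subspace_def
  proof (intro conjI ballI allI)
    show "0 \<in> f ` carr M" using hom_0[OF f M(1)] M(1) by (metis imageI modl_0)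
    show "x + y \<in> f ` carr M" if "x \<in> f ` carr M" "y \<in> f ` carr M" for x y
    proof -
      from that obtain v w where "v \<in> carr M" "w \<in> carr M" "x = f v" "y = f w" by blast
      then show ?thesis using hom_add[OF f] M(1) by (intro image_eqI[of _ _ "v + w"]) simp_all
    qed
    show "seq_scale c x \<in> f ` carr M" if "x \<in> f ` carr M" for x c
    proof -
      from that obtain v where "v \<in> carr M" "x = f v" by blast
      then show ?thesis using hom_scale[OF f M] M(1) by (intro image_eqI[of _ _ "seq_scale c v"]) simp_all
    qed
  qed
  show "v \<in> f ` carr M \<Longrightarrow> act N h v \<in> f ` carr M"
  proof -
    assume "v \<in> f ` carr M"
    then obtain w where "w \<in> carr M" "v = f w" by blast
    then show ?thesis using hom_act[OF f] M(1) by (intro image_eqI[of _ _ "act M h w"]) simp_all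
  qed
qed

lemma subspace_kernel:
  assumes f: "f \<in> mod_hom M N" and M: "modl M" "modl N"
  shows "sq.subspace {v \<in> carr M. f v = 0}" "v \<in> carr M \<Longrightarrow> f v = 0 \<Longrightarrow> f (act M h v) = 0"
proof -
  show "sq.subspace {v \<in> carr M. f v = 0}" unfolding sq.subspace_def
    using hom_add[OF f] hom_scale[OF f M] hom_0[OF f M(1)] M(1) by auto
  show "v \<in> carr M \<Longrightarrow> f v = 0 \<Longrightarrow> f (act M h v) = 0" using hom_act[OF f] M(2) by simp
qed

lemma fg_image: "\<lbrakk>f \<in> mod_hom M N; fg_module sc M; fg_module sc N\<rbrakk> \<Longrightarrow> fg_module sc (sub N (f ` carr M))"
  using fg_sub[of N "f ` carr M"] subspace_image[of f M N] hom_in[of f M N] fg_module_modl by blast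

lemma hom_sub_codomain: "\<lbrakk>f \<in> mod_hom M N; f ` carr M \<subseteq> W\<rbrakk> \<Longrightarrow> f \<in> mod_hom M (sub N W)"
  unfolding mod_hom_def by auto

lemma hom_sub_codomainD: "\<lbrakk>f \<in> mod_hom M (sub N W); W \<subseteq> carr N\<rbrakk> \<Longrightarrow> f \<in> mod_hom M N"
  unfolding mod_hom_def by auto

section \<open>Projective modules\<close>

lemma projective_fg: "projective_module sc P \<Longrightarrow> fg_module sc P"
  unfolding projective_module_def by blast

text \<open>The definition lifts along surjections only, so the codomain is first cut down to the
  image of \<open>g\<close>.\<close>

lemma projective_lift:
  assumes P: "projective_module sc P" and f: "f \<in> mod_hom P N" and g: "g \<in> mod_hom M N"
    and MN: "fg_module sc M" "fg_module sc N" and im: "\<And>v. v \<in> carr P \<Longrightarrow> \<exists>w \<in> carr M. g w = f v"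
  obtains h where "h \<in> mod_hom P M" "g \<circ> h = f"
proof -
  let ?N = "sub N (g ` carr M)"
  have "f ` carr P \<subseteq> g ` carr M" using im by force
  then have "f \<in> mod_hom P ?N" "g \<in> mod_hom M ?N"
    using f g hom_sub_codomain by blast+
  moreover have "fg_module sc ?N" using fg_image[OF g MN] .
  ultimately show ?thesis using P MN(1) that unfolding projective_module_def by force
qed

lemma projective_zero: "carr P = {0} \<Longrightarrow> fg_module sc P \<Longrightarrow> projective_module sc P"
  unfolding projective_module_def
proof (intro conjI allI impI ballI)
  fix M N :: "('h, 'k) fmod" and g f
  assume P: "carr P = {0}" "fg_module sc P" and MN: "fg_module sc M \<and> fg_module sc N"
    and g: "g \<in> mod_hom M N" and f: "f \<in> mod_hom P N"
  note m = fg_module_modl[OF P(2)] fg_module_modl[OF conjunct1[OF MN]]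
  have "f v = 0" for v using hom_0[OF f m(1)] hom_out[OF f] P(1) by (cases "v = 0") auto
  then have "f = 0" by auto
  then show "\<exists>h \<in> mod_hom P M. g \<circ> h = f"
    using hom_zero[OF m] hom_comp_zero[OF g m(2)] by (intro bexI[of _ 0]) simp_all
qed simp

lemma projective_sum:
  assumes P: "projective_module sc P" and Q: "projective_module sc Q"
  shows "projective_module sc (sum_module P Q)"
  unfolding projective_module_def
proof (intro conjI allI impI ballI)
  show "fg_module sc (sum_module P Q)" using assms projective_fg fg_sum_module by blast
next
  fix M N :: "('h, 'k) fmod" and g f
  assume MN: "fg_module sc M \<and> fg_module sc N" and g: "g \<in> mod_hom M N" and f: "f \<in> mod_hom (sum_module P Q) N"
    and s: "g ` carr M = carr N"
  have m: "modl M" "modl N" "modl P" "modl Q" using MN assms projective_fg fg_module_modl by blast+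
  let ?f1 = "restr0 (carr P) (\<lambda>v. f (interleave v 0))" and ?f2 = "restr0 (carr Q) (\<lambda>v. f (interleave 0 v))"
  have c: "interleave v w \<in> carr (sum_module P Q) \<longleftrightarrow> v \<in> carr P \<and> w \<in> carr Q" for v w
    by (simp add: sum_module_simps)
  have f1: "?f1 \<in> mod_hom P N"
  proof (rule mod_homI)
    fix v w assume v: "v \<in> carr P" "w \<in> carr P"
    show "?f1 (v + w) = ?f1 v + ?f1 w"
      using hom_add[OF f, of "interleave v 0" "interleave w 0"] v m by (simp add: c restr0_def interleave_add)
  next
    fix h v assume v: "v \<in> carr P"
    show "?f1 (act P h v) = act N h (?f1 v)"
      using hom_act[OF f, of "interleave v 0" h] v m by (simp add: c restr0_def sum_module_simps)
  qed (use hom_in[OF f] m in \<open>auto simp: restr0_def c\<close>)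
  have f2: "?f2 \<in> mod_hom Q N"
  proof (rule mod_homI)
    fix v w assume v: "v \<in> carr Q" "w \<in> carr Q"
    show "?f2 (v + w) = ?f2 v + ?f2 w"
      using hom_add[OF f, of "interleave 0 v" "interleave 0 w"] v m by (simp add: c restr0_def interleave_add)
  next
    fix h v assume v: "v \<in> carr Q"
    show "?f2 (act Q h v) = act N h (?f2 v)"
      using hom_act[OF f, of "interleave 0 v" h] v m by (simp add: c restr0_def sum_module_simps)
  qed (use hom_in[OF f] m in \<open>auto simp: restr0_def c\<close>)
  obtain h1 where h1: "h1 \<in> mod_hom P M" "g \<circ> h1 = ?f1"
    using P MN g f1 s unfolding projective_module_def by blast
  obtain h2 where h2: "h2 \<in> mod_hom Q M" "g \<circ> h2 = ?f2"
    using Q MN g f2 s unfolding projective_module_def by blast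
  let ?h = "restr0 (carr (sum_module P Q)) (\<lambda>u. h1 (evens u) + h2 (odds u))"
  have "?h \<in> mod_hom (sum_module P Q) M"
    using fg_module_modl[OF fg_sum_module[OF projective_fg[OF P] projective_fg[OF Q]]] m
    by (intro mod_homI) (auto simp: restr0_def sum_module_simps hom_in[OF h1(1)] hom_in[OF h2(1)] hom_add[OF h1(1)]
        hom_add[OF h2(1)] hom_act[OF h1(1)] hom_act[OF h2(1)] modl_act_add add_ac)
  moreover have "g \<circ> ?h = f"
  proof
    fix u
    show "(g \<circ> ?h) u = f u"
    proof (cases "u \<in> carr (sum_module P Q)")
      case True
      then have u: "evens u \<in> carr P" "odds u \<in> carr Q" by (simp_all add: sum_module_simps)
      have "g (h1 (evens u) + h2 (odds u)) = f (interleave (evens u) 0) + f (interleave 0 (odds u))"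
        using hom_add[OF g hom_in[OF h1(1) u(1)] hom_in[OF h2(1) u(2)]] fun_cong[OF h1(2), of "evens u"]
          fun_cong[OF h2(2), of "odds u"] u by (simp add: restr0_def)
      also have "\<dots> = f u"
        using hom_add[OF f, of "interleave (evens u) 0" "interleave 0 (odds u)"] u m by (simp add: c interleave_add)
      finally show ?thesis using True by (simp add: restr0_def)
    qed (use hom_out[OF f] hom_0[OF g m(1)] in \<open>simp add: restr0_def\<close>)
  qed
  ultimately show "\<exists>h \<in> mod_hom (sum_module P Q) M. g \<circ> h = f" by blast
qed

text \<open>Carriers of modules consist of sequences, so the regular module needs a linear embedding
  of the algebra into the sequence space: coordinates in a finite basis, continued by zeros.\<close>

lemma ex_coordinates:
  "\<exists>e :: 'h \<Rightarrow> nat \<Rightarrow> 'k. inj e \<and> (\<forall>x y. e (x + y) = e x + e y) \<and> (\<forall>a x. e (sc a x) = seq_scale a (e x))"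
proof -
  obtain B where B: "independent B" "UNIV \<subseteq> span B" using basis_exists[of UNIV] by blast
  obtain E where E: "finite E" "span E = UNIV" using finite_dim by blast
  have "finite B" using independent_span_bound[OF E(1) B(1)] E(2) by blast
  then obtain f where f: "bij_betw f {0..<card B} B" using ex_bij_betw_nat_finite by blast
  let ?e = "\<lambda>x n. if n < card B then representation B x (f n) else 0"
  have s: "x \<in> span B" for x using B by blast
  have "inj ?e"
  proof (rule injI)
    fix x y assume e: "?e x = ?e y"
    have "representation B x b = representation B y b" for b
    proof (cases "b \<in> B")
      case True
      then obtain n where "n < card B" "b = f n" using bij_betw_imp_surj_on[OF f] by (metis atLeastLessThan_iff imageE)
      then show ?thesis using fun_cong[OF e, of n] by simp
    next
      case False
      then show ?thesis using representation_ne_zero[of B] by metis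
    qed
    then have "representation B x = representation B y" by blast
    then show "x = y" using sum_nonzero_representation_eq[OF B(1) s] by metis
  qed
  moreover have "?e (x + y) = ?e x + ?e y" for x y
    using representation_add[OF B(1) s s] by (auto simp: fun_eq_iff)
  moreover have "?e (sc a x) = seq_scale a (?e x)" for a x
    using representation_scale[OF B(1) s] by (auto simp: fun_eq_iff seq_scale_def)
  ultimately show ?thesis by (intro exI[of _ ?e]) blast
qed

definition enc :: "'h \<Rightarrow> nat \<Rightarrow> 'k" where
  "enc = (SOME e. inj e \<and> (\<forall>x y. e (x + y) = e x + e y) \<and> (\<forall>a x. e (sc a x) = seq_scale a (e x)))"

lemma enc: "inj enc" "enc (x + y) = enc x + enc y" "enc (sc a x) = seq_scale a (enc x)"
  using someI_ex[OF ex_coordinates, folded enc_def] by blast+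

lemma enc_0: "enc 0 = 0"
  using enc(2)[of 0 0] by simp

text \<open>The algebra as a left module over itself, moved into the sequence space along
  \<open>enc\<close>.\<close>

definition reg :: "('h, 'k) fmod" where
  "reg = \<lparr>carr = range enc, act = (\<lambda>h v. enc (h * inv_into UNIV enc v))\<rparr>"

lemma reg_simps: "carr reg = range enc" "act reg h v = enc (h * inv_into UNIV enc v)"
  by (simp_all add: reg_def)

lemma inv_enc: "inv_into UNIV enc (enc x) = x"
  by (rule inv_into_f_f[OF enc(1) UNIV_I])

lemma modl_reg: "modl reg"
  unfolding modl_def reg_simps sq.subspace_def
proof (intro conjI ballI allI)
  show "0 \<in> range enc" by (subst enc_0[symmetric]) (rule rangeI)
  show "x + y \<in> range enc" if xy: "x \<in> range enc" "y \<in> range enc" for x y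
  proof -
    obtain a b where "x = enc a" "y = enc b" using xy by blast
    then show ?thesis by (simp only: enc(2)[symmetric]) (rule rangeI)
  qed
  show "seq_scale c x \<in> range enc" if x: "x \<in> range enc" for x c
  proof -
    obtain a where "x = enc a" using x by blast
    then show ?thesis by (simp only: enc(3)[symmetric]) (rule rangeI)
  qed
next
  fix v w :: "nat \<Rightarrow> 'k" and h h' :: 'h and a :: 'k
  assume "v \<in> range enc"
  then obtain x where x: "v = enc x" by blast
  show "enc (h * inv_into UNIV enc v) \<in> range enc" by blast
  show "enc ((h + h') * inv_into UNIV enc v) = enc (h * inv_into UNIV enc v) + enc (h' * inv_into UNIV enc v)"
    unfolding x inv_enc distrib_right enc(2) ..
  show "enc (h * h' * inv_into UNIV enc v) = enc (h * inv_into UNIV enc (enc (h' * inv_into UNIV enc v)))"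
    unfolding x inv_enc mult.assoc ..
  show "enc (1 * inv_into UNIV enc v) = v" unfolding x inv_enc mult_1_left ..
  show "enc (sc a 1 * inv_into UNIV enc v) = seq_scale a v"
    unfolding x inv_enc sc_mult_left[symmetric] enc(3) mult_1_left ..
  assume "w \<in> range enc"
  then obtain y where y: "w = enc y" by blast
  have e: "enc x + enc y = enc (x + y)" unfolding enc(2) ..
  show "enc (h * inv_into UNIV enc (v + w)) = enc (h * inv_into UNIV enc v) + enc (h * inv_into UNIV enc w)"
    unfolding x y e inv_enc distrib_left by (rule enc(2))
qed

lemma fg_reg: "fg_module sc reg"
proof -
  obtain E where E: "finite E" "span E = UNIV" using finite_dim by blast
  have "enc x \<in> sq.span (enc ` E)" for x
  proof -
    have "x \<in> span E" using E by simp
    then show ?thesis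
    proof (induction rule: span_induct_alt)
      case base
      show ?case unfolding enc_0 by (rule sq.span_zero)
    next
      case (step c x y)
      have "enc x \<in> sq.span (enc ` E)" using step by (intro sq.span_base) auto
      then show ?case unfolding enc using step sq.span_add sq.span_scale by metis
    qed
  qed
  then have "fd (carr reg)" unfolding fd_def reg_simps using E(1) by (intro exI[of _ "enc ` E"]) auto
  then show ?thesis using modl_reg fg_module_iff by blast
qed

text \<open>The homomorphism from the regular module to \<open>M\<close> that takes 1 to
  \<open>m\<close>.\<close>

definition rhom :: "('h, 'k) fmod \<Rightarrow> (nat \<Rightarrow> 'k) \<Rightarrow> (nat \<Rightarrow> 'k) \<Rightarrow> nat \<Rightarrow> 'k" where
  "rhom M m = restr0 (range enc) (\<lambda>v. act M (inv_into UNIV enc v) m)"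

lemma rhom_enc: "rhom M m (enc h) = act M h m"
  by (simp add: rhom_def restr0_def inv_enc)

lemma rhom_in: "\<lbrakk>modl M; m \<in> carr M\<rbrakk> \<Longrightarrow> rhom M m \<in> mod_hom reg M"
proof (rule mod_homI)
  assume M: "modl M" "m \<in> carr M"
  show "rhom M m v \<in> carr M" if "v \<in> carr reg" for v
    using that M by (auto simp: reg_simps rhom_enc)
  show "rhom M m (v + w) = rhom M m v + rhom M m w" if "v \<in> carr reg" "w \<in> carr reg" for v w
  proof -
    obtain x y where xy: "v = enc x" "w = enc y" using \<open>v \<in> carr reg\<close> \<open>w \<in> carr reg\<close> by (auto simp: reg_simps)
    have "v + w = enc (x + y)" unfolding xy enc(2) ..
    then show ?thesis unfolding xy by (simp only: rhom_enc modl_add_act[OF M])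
  qed
  show "rhom M m (act reg h v) = act M h (rhom M m v)" if "v \<in> carr reg" for h v
    using that M by (auto simp: reg_simps rhom_enc modl_mult_act inv_enc)
  show "rhom M m v = 0" if "v \<notin> carr reg" for v
    using that by (simp add: rhom_def restr0_def reg_simps)
qed

lemma reg_hom_eqI:
  assumes f: "f \<in> mod_hom reg M" and g: "g \<in> mod_hom reg M" and e: "f (enc 1) = g (enc 1)"
  shows "f = g"
proof
  fix v
  show "f v = g v"
  proof (cases "v \<in> carr reg")
    case True
    then obtain h where "v = enc h" by (auto simp: reg_simps)
    then have "v = act reg h (enc 1)" by (simp add: reg_simps inv_enc)
    moreover have "enc 1 \<in> carr reg" by (simp add: reg_simps)
    ultimately show ?thesis using hom_act[OF f] hom_act[OF g] e by simp
  next
    case False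
    then show ?thesis using hom_out[OF f] hom_out[OF g] by simp
  qed
qed

lemma projective_reg: "projective_module sc reg"
  unfolding projective_module_def
proof (intro conjI allI impI ballI)
  show "fg_module sc reg" by (rule fg_reg)
  fix M N :: "('h, 'k) fmod" and g f
  assume MN: "fg_module sc M \<and> fg_module sc N" and g: "g \<in> mod_hom M N" and f: "f \<in> mod_hom reg N"
    and s: "g ` carr M = carr N"
  have M: "modl M" using MN fg_module_modl by blast
  have "f (enc 1) \<in> g ` carr M" using hom_in[OF f, of "enc 1"] s by (simp add: reg_simps)
  then obtain m where "f (enc 1) = g m" and m1: "m \<in> carr M" by (rule imageE)
  then have m: "m \<in> carr M" "g m = f (enc 1)" by simp_all
  have "g \<circ> rhom M m \<in> mod_hom reg N" using hom_comp[OF rhom_in[OF M m(1)] g M] .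
  moreover have "(g \<circ> rhom M m) (enc 1) = f (enc 1)" using m M by (simp add: rhom_enc)
  ultimately show "\<exists>h \<in> mod_hom reg M. g \<circ> h = f"
    using reg_hom_eqI f rhom_in[OF M m(1)] by blast
qed

text \<open>A surjection from an iterated sum of regular modules rather than a minimal cover: one
  copy of \<open>reg\<close> is added for each generator.\<close>

lemma projective_cover:
  assumes M: "fg_module sc M"
  obtains P p where "projective_module sc P" "p \<in> mod_hom P M" "p ` carr P = carr M"
proof -
  have m: "modl M" using M fg_module_modl by blast
  obtain B where B: "finite B" "B \<subseteq> carr M" "\<And>v. v \<in> carr M \<Longrightarrow> \<exists>c. v = (\<Sum>b\<in>B. act M (c b) b)"
    using M unfolding fg_module_def by blast
  have "\<exists>P p. projective_module sc P \<and> p \<in> mod_hom P M \<and> (\<forall>c. (\<Sum>b\<in>B. act M (c b) b) \<in> p ` carr P)"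
    using B(1,2)
  proof (induction B)
    case empty
    have "projective_module sc zero_module" using projective_zero fg_zero_module by (simp add: zero_module_def)
    moreover have "0 \<in> mod_hom zero_module M" using hom_zero m fg_module_modl[OF fg_zero_module] by blast
    moreover have "(\<Sum>b\<in>{}. act M (c b) b) \<in> (0 :: (nat \<Rightarrow> 'k) \<Rightarrow> nat \<Rightarrow> 'k) ` carr zero_module" for c
    proof -
      have "(0 :: nat \<Rightarrow> 'k) \<in> carr zero_module" by (simp add: zero_module_def)
      then show ?thesis by (intro image_eqI[of _ _ 0]) simp_all
    qed
    ultimately show ?case by blast
  next
    case (insert b B)
    then obtain P p where P: "projective_module sc P" "p \<in> mod_hom P M"
      "\<And>c. (\<Sum>b\<in>B. act M (c b) b) \<in> p ` carr P" by blast
    have b: "b \<in> carr M" using insert by blast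
    have mP: "modl P" using P(1) projective_fg fg_module_modl by blast
    note rh = rhom_in[OF m b]
    let ?S = "sum_module reg P"
    let ?p = "restr0 (carr ?S) (\<lambda>u. rhom M b (evens u) + p (odds u))"
    have mS: "modl ?S" using fg_module_modl fg_sum_module fg_reg projective_fg[OF P(1)] by blast
    have "?p \<in> mod_hom ?S M"
      using mS m by (intro mod_homI) (auto simp: restr0_def sum_module_simps hom_in[OF rh] hom_in[OF P(2)]
          hom_add[OF rh] hom_add[OF P(2)] hom_act[OF rh] hom_act[OF P(2)] modl_act_add add_ac modl_reg mP)
    moreover have "(\<Sum>b\<in>insert b B. act M (c b) b) \<in> ?p ` carr ?S" for c
    proof -
      from P(3)[of c] obtain v where v: "(\<Sum>b\<in>B. act M (c b) b) = p v" "v \<in> carr P" by (rule imageE)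
      have "interleave (enc (c b)) v \<in> carr ?S" using v by (simp add: sum_module_simps reg_simps)
      then have "?p (interleave (enc (c b)) v) = (\<Sum>b\<in>insert b B. act M (c b) b)"
        using v insert.hyps by (simp add: restr0_def rhom_enc)
      then show ?thesis using \<open>interleave (enc (c b)) v \<in> carr ?S\<close>
        by (rule image_eqI[OF sym])
    qed
    ultimately show ?case using projective_sum[OF projective_reg P(1)] by blast
  qed
  then obtain P p where P: "projective_module sc P" "p \<in> mod_hom P M" "\<And>c. (\<Sum>b\<in>B. act M (c b) b) \<in> p ` carr P"
    by blast
  have "p ` carr P = carr M"
  proof
    show "p ` carr P \<subseteq> carr M" using hom_in[OF P(2)] by blast
    show "carr M \<subseteq> p ` carr P"
    proof
      fix v assume "v \<in> carr M"
      then obtain c where "v = (\<Sum>b\<in>B. act M (c b) b)" using B(3) by blast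
      then show "v \<in> p ` carr P" using P(3)[of c] by simp
    qed
  qed
  then show ?thesis using that P by blast
qed

end

section \<open>Fitting's lemma\<close>

lemma nat_bounded_mono_stable:
  fixes d :: "nat \<Rightarrow> nat"
  assumes "\<And>n. d n \<le> d (Suc n)" "\<And>n. d n \<le> K"
  shows "\<exists>n. \<forall>m \<ge> n. d m = d n"
proof -
  have "range d \<subseteq> {..K}" using assms(2) by blast
  then have fin: "finite (range d)" by (rule finite_subset) simp
  have "Max (range d) \<in> range d" using fin by (intro Max_in) simp_all
  then obtain n where n: "Max (range d) = d n" by (rule rangeE)
  have "d m \<le> d n" for m unfolding n[symmetric] using fin by (intro Max_ge rangeI)
  moreover have "d n \<le> d m" if "n \<le> m" for m using lift_Suc_mono_le[of d, OF assms(1) that] .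
  ultimately show ?thesis by (intro exI[of _ n]) (simp add: le_antisym)
qed

context fd_algebra
begin

lemma funpow_hom: "\<lbrakk>f \<in> mod_hom M M; modl M\<rbrakk> \<Longrightarrow> f ^^ Suc n \<in> mod_hom M M"
  by (induction n) (simp_all add: hom_comp)

text \<open>Kernels increase and images decrease with the exponent, and their dimensions are
  bounded, so both become stationary. The claim covers all large \<open>m\<close> because a common
  exponent is later chosen for finitely many modules.\<close>

lemma fitting:
  assumes M: "fg_module sc M" and f: "f \<in> mod_hom M M"
  shows "\<exists>n. \<forall>m \<ge> n. (\<forall>v \<in> carr M. (f ^^ (m + m)) v = 0 \<longrightarrow> (f ^^ m) v = 0) \<and>
    (\<forall>v \<in> carr M. \<exists>w \<in> carr M. (f ^^ m) v = (f ^^ (m + m)) w)"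
proof -
  have m: "modl M" "fd (carr M)" using M fg_module_iff by blast+
  \<comment> \<open>The exponent starts at 1: the power 0 is the identity on all sequences, which
    does not vanish off the carrier and so is no member of \<open>mod_hom M M\<close> in
    general.\<close>
  let ?f = "\<lambda>n. f ^^ Suc n"
  have fn: "?f n \<in> mod_hom M M" for n using funpow_hom[OF f m(1)] .
  let ?K = "\<lambda>n. {v \<in> carr M. ?f n v = 0}" and ?I = "\<lambda>n. ?f n ` carr M"
  have K: "sq.subspace (?K n)" "?K n \<subseteq> carr M" "?K n \<subseteq> ?K (Suc n)" for n
    using subspace_kernel(1)[OF fn m(1) m(1)] hom_0[OF f m(1)] by auto
  have I: "sq.subspace (?I n)" "?I n \<subseteq> carr M" for n
    using subspace_image(1)[OF fn m(1) m(1)] hom_in[OF fn] by auto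
  have I': "?I (Suc n) \<subseteq> ?I n" for n
  proof
    fix x assume "x \<in> ?I (Suc n)"
    then obtain v where "v \<in> carr M" "x = (f ^^ Suc (Suc n)) v" by blast
    then show "x \<in> ?I n" using hom_in[OF f, of v]
      by (intro image_eqI[of _ _ "f v"]) (simp_all add: funpow_swap1)
  qed
  have fdK: "fd (?K n)" and fdI: "fd (?I n)" for n using fd_subset[OF m(2)] K(2) I(2) by blast+
  have sM: "sq.subspace (carr M)" using modl_subspace[OF m(1)] .
  have dM: "sq.dim (?K n) \<le> sq.dim (carr M)" "sq.dim (?I n) \<le> sq.dim (carr M)" for n
    using fd_dim_mono(1)[OF m(2) K(2) K(1) sM] fd_dim_mono(1)[OF m(2) I(2) I(1) sM] by blast+
  obtain n1 where n1: "\<And>l. n1 \<le> l \<Longrightarrow> sq.dim (?K l) = sq.dim (?K n1)"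
    using nat_bounded_mono_stable[of "\<lambda>n. sq.dim (?K n)" "sq.dim (carr M)"] dM(1)
      fd_dim_mono(1)[OF fdK K(3) K(1) K(1)] by blast
  \<comment> \<open>The images decrease, so codimensions are used to have an increasing bounded
    sequence.\<close>
  obtain n2 where n2: "\<And>l. n2 \<le> l \<Longrightarrow> sq.dim (carr M) - sq.dim (?I l) = sq.dim (carr M) - sq.dim (?I n2)"
    using nat_bounded_mono_stable[of "\<lambda>n. sq.dim (carr M) - sq.dim (?I n)" "sq.dim (carr M)"]
      diff_le_mono2[OF fd_dim_mono(1)[OF fdI I' I(1) I(1)], of "sq.dim (carr M)"] diff_le_self by blast
  have Km: "?K l \<subseteq> ?K k" if "l \<le> k" for l k using lift_Suc_mono_le[of ?K, OF K(3) that] .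
  have Im: "?I k \<subseteq> ?I l" if "l \<le> k" for l k using lift_Suc_antimono_le[of ?I, OF I' that] .
  have Keq: "?K l = ?K k" if "n1 \<le> l" "l \<le> k" for l k
    using fd_dim_mono(2)[OF fdK Km[OF that(2)] K(1) K(1)] n1[of l] n1[of k] that by simp
  have Ieq: "?I k = ?I l" if "n2 \<le> l" "l \<le> k" for l k
  proof (rule fd_dim_mono(2)[OF fdI Im[OF that(2)] I(1) I(1)])
    show "sq.dim (?I k) = sq.dim (?I l)" using n2[of l] n2[of k] that dM(2)[of l] dM(2)[of k] by simp
  qed
  show ?thesis
  proof (intro exI[of _ "Suc (n1 + n2)"] allI impI conjI ballI)
    fix k v assume k: "Suc (n1 + n2) \<le> k" and v: "v \<in> carr M"
    then obtain l where l: "k = Suc l" "n1 \<le> l" "n2 \<le> l" by (cases k) auto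
    have kk: "k + k = Suc (l + k)" "l \<le> l + k" using l by simp_all
    { assume "(f ^^ (k + k)) v = 0"
      then have "v \<in> ?K (l + k)" using v kk by simp
      then have "v \<in> ?K l" using Keq[OF l(2) kk(2)] by blast
      then show "(f ^^ k) v = 0" using l by simp }
    have "(f ^^ k) v \<in> ?I l" using v l by simp
    then have "(f ^^ k) v \<in> ?I (l + k)" using Ieq[OF l(3) kk(2)] by blast
    then show "\<exists>w \<in> carr M. (f ^^ k) v = (f ^^ (k + k)) w" unfolding kk(1) by blast
  qed
qed

end

section \<open>Complexes\<close>

context fd_algebra
begin

abbreviation cx :: "('h, 'k) cpx \<Rightarrow> bool" where "cx \<equiv> bounded_complex sc"

lemma cx_fg: "cx X \<Longrightarrow> fg_module sc (cmod X i)"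
  and cx_diff: "cx X \<Longrightarrow> diff X i \<in> mod_hom (cmod X i) (cmod X (i + 1))"
  unfolding bounded_complex_def by blast+

lemma cx_modl: "cx X \<Longrightarrow> modl (cmod X i)"
  using cx_fg fg_module_modl by blast

lemma cx_diff': "cx X \<Longrightarrow> diff X (i - 1) \<in> mod_hom (cmod X (i - 1)) (cmod X i)"
  using cx_diff[of X "i - 1"] by simp

lemma cx_dd: "cx X \<Longrightarrow> diff X (i + 1) (diff X i v) = 0"
  unfolding bounded_complex_def by (metis comp_apply zero_fun_apply)

lemma cx_dd': "cx X \<Longrightarrow> diff X i (diff X (i - 1) v) = 0"
  using cx_dd[of X "i - 1" v] by simp

lemma cx_bound:
  assumes "cx X"
  obtains n where "0 \<le> n" "\<And>i. n < \<bar>i\<bar> \<Longrightarrow> carr (cmod X i) = {0}"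
proof -
  obtain n where n: "\<And>i. n < \<bar>i\<bar> \<Longrightarrow> carr (cmod X i) = {0}"
    using assms unfolding bounded_complex_def by blast
  have "carr (cmod X i) = {0}" if "max n 0 < \<bar>i\<bar>" for i using n that by simp
  then show ?thesis using that[of "max n 0"] by simp
qed

text \<open>Homomorphisms vanish off the carrier, so equations between composites need checking only
  on elements; \<open>chain_mapI\<close> and \<open>homotopicI\<close> rest on the same
  observation.\<close>

lemma cxI:
  assumes "\<And>i. fg_module sc (cmod X i)" "\<And>i. diff X i \<in> mod_hom (cmod X i) (cmod X (i + 1))"
    and "\<And>i v. v \<in> carr (cmod X i) \<Longrightarrow> diff X (i + 1) (diff X i v) = 0"
    and "\<And>i. n < \<bar>i\<bar> \<Longrightarrow> carr (cmod X i) = {0}"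
  shows "cx X"
proof -
  have "diff X (i + 1) \<circ> diff X i = 0" for i
  proof
    fix v
    show "(diff X (i + 1) \<circ> diff X i) v = 0 v"
    proof (cases "v \<in> carr (cmod X i)")
      case False
      then show ?thesis
        using hom_out[OF assms(2)] hom_0[OF assms(2) fg_module_modl[OF assms(1)]] by simp
    qed (use assms(3) in simp)
  qed
  then show ?thesis unfolding bounded_complex_def using assms(1,2,4) by blast
qed

lemma cm_hom: "f \<in> chain_map X Y \<Longrightarrow> f i \<in> mod_hom (cmod X i) (cmod Y i)"
  unfolding chain_map_def by blast

lemma cm_comm: "f \<in> chain_map X Y \<Longrightarrow> f (i + 1) (diff X i v) = diff Y i (f i v)"
proof -
  assume "f \<in> chain_map X Y"
  then have "f (i + 1) \<circ> diff X i = diff Y i \<circ> f i" unfolding chain_map_def by blast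
  from fun_cong[OF this, of v] show ?thesis by simp
qed

lemma cm_comm': "f \<in> chain_map X Y \<Longrightarrow> f i (diff X (i - 1) v) = diff Y (i - 1) (f (i - 1) v)"
  using cm_comm[of f X Y "i - 1" v] by simp

lemma chain_mapI:
  assumes X: "cx X" and Y: "cx Y" and f: "\<And>i. f i \<in> mod_hom (cmod X i) (cmod Y i)"
    and c: "\<And>i v. v \<in> carr (cmod X i) \<Longrightarrow> f (i + 1) (diff X i v) = diff Y i (f i v)"
  shows "f \<in> chain_map X Y"
proof -
  have "f (i + 1) \<circ> diff X i = diff Y i \<circ> f i" for i
  proof
    fix v
    show "(f (i + 1) \<circ> diff X i) v = (diff Y i \<circ> f i) v"
    proof (cases "v \<in> carr (cmod X i)")
      case False
      then show ?thesis
        using hom_out[OF cx_diff[OF X]] hom_out[OF f] hom_0[OF f cx_modl[OF X]]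
          hom_0[OF cx_diff[OF Y] cx_modl[OF Y]] by simp
    qed (use c in simp)
  qed
  then show ?thesis unfolding chain_map_def using f by blast
qed

lemma cm_comp: "\<lbrakk>f \<in> chain_map X Y; g \<in> chain_map Y Z; cx Y\<rbrakk> \<Longrightarrow> cmap_comp g f \<in> chain_map X Z"
proof -
  assume f: "f \<in> chain_map X Y" and g: "g \<in> chain_map Y Z" and Y: "cx Y"
  have "g i \<circ> f i \<in> mod_hom (cmod X i) (cmod Z i)" for i
    using hom_comp[OF cm_hom[OF f] cm_hom[OF g] cx_modl[OF Y]] .
  moreover have "(g (i + 1) \<circ> f (i + 1)) \<circ> diff X i = diff Z i \<circ> (g i \<circ> f i)" for i
    by (rule ext) (simp add: cm_comm[OF f] cm_comm[OF g])
  ultimately show ?thesis unfolding chain_map_def cmap_comp_def by blast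
qed

lemma cm_zero: "\<lbrakk>cx X; cx Y\<rbrakk> \<Longrightarrow> 0 \<in> chain_map X Y"
  by (rule chain_mapI) (simp_all add: hom_zero cx_modl hom_0[OF cx_diff cx_modl])

lemma cm_plus: "\<lbrakk>f \<in> chain_map X Y; g \<in> chain_map X Y; cx X; cx Y\<rbrakk> \<Longrightarrow> f + g \<in> chain_map X Y"
  by (rule chain_mapI)
    (simp_all add: hom_plus cm_hom cx_modl cm_comm[of f X Y] cm_comm[of g X Y]
      hom_add[OF cx_diff[of Y], OF _ hom_in'[OF cm_hom[of f X Y]] hom_in'[OF cm_hom[of g X Y]]])

lemma cm_uminus: "\<lbrakk>f \<in> chain_map X Y; cx X; cx Y\<rbrakk> \<Longrightarrow> - f \<in> chain_map X Y"
  by (rule chain_mapI)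
    (simp_all add: hom_uminus cm_hom cx_modl cm_comm[of f X Y] hom_neg[OF cx_diff[of Y], OF _ _ hom_in'[OF cm_hom[of f X Y]]])

lemma cm_minus: "\<lbrakk>f \<in> chain_map X Y; g \<in> chain_map X Y; cx X; cx Y\<rbrakk> \<Longrightarrow> f - g \<in> chain_map X Y"
  using cm_plus[of f X Y "- g"] cm_uminus[of g X Y] by simp

lemma cm_id: "cx X \<Longrightarrow> cmap_id X \<in> chain_map X X"
  unfolding cmap_id_def
proof (rule chain_mapI)
  fix i v assume "cx X" "v \<in> carr (cmod X i)"
  then show "restr0 (carr (cmod X (i + 1))) (\<lambda>v. v) (diff X i v) = diff X i (restr0 (carr (cmod X i)) (\<lambda>v. v) v)"
    using hom_in[OF cx_diff] by (simp add: restr0_def)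
qed (simp_all add: hom_id cx_modl)

lemma cm_id_comp: "f \<in> chain_map X (Y :: ('h, 'k) cpx) \<Longrightarrow> cmap_comp (cmap_id Y) f = f"
  unfolding cmap_comp_def cmap_id_def by (rule ext) (simp only: hom_id_comp[OF cm_hom[of f X Y]])

lemma cm_comp_id: "\<lbrakk>f \<in> chain_map X Y; cx X\<rbrakk> \<Longrightarrow> cmap_comp f (cmap_id X) = f"
  unfolding cmap_comp_def cmap_id_def by (rule ext) (simp only: hom_comp_id[OF cm_hom[of f X Y] cx_modl[of X]])

lemma cmap_comp_assoc: "cmap_comp (cmap_comp h g) f = cmap_comp h (cmap_comp g f)"
  by (simp add: cmap_comp_def o_assoc)

lemma cm_comp_plus_l: "cmap_comp (g + g') f = cmap_comp g f + cmap_comp g' f"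
  by (auto simp: cmap_comp_def fun_eq_iff)

lemma cm_comp_plus_r:
  "\<lbrakk>f \<in> chain_map X Y; f' \<in> chain_map X Y; g \<in> chain_map Y Z; cx Y\<rbrakk>
   \<Longrightarrow> cmap_comp g (f + f') = cmap_comp g f + cmap_comp g f'"
  unfolding cmap_comp_def
  using hom_comp_plus[OF cm_hom[of f X Y] cm_hom[of f' X Y] cm_hom[of g Y Z] cx_modl[of Y]]
  by (auto simp: fun_eq_iff)

lemma cm_comp_zero: "\<lbrakk>g \<in> chain_map Y Z; cx Y\<rbrakk> \<Longrightarrow> cmap_comp g 0 = 0"
  unfolding cmap_comp_def using hom_comp_zero[OF cm_hom[of g Y Z] cx_modl[of Y]] by (auto simp: fun_eq_iff)

lemma zero_cm_comp: "cmap_comp 0 f = 0"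
  by (auto simp: cmap_comp_def fun_eq_iff)

lemma homotopicI:
  assumes f: "f \<in> chain_map X Y" and g: "g \<in> chain_map X Y" and X: "cx X" and Y: "cx Y"
    and h: "\<And>i. h i \<in> mod_hom (cmod X i) (cmod Y (i - 1))"
    and e: "\<And>i v. v \<in> carr (cmod X i) \<Longrightarrow> f i v - g i v = diff Y (i - 1) (h i v) + h (i + 1) (diff X i v)"
  shows "homotopic X Y f g"
  unfolding homotopic_def
proof (intro exI[of _ h] allI conjI h)
  fix i
  show "f i - g i = (diff Y (i - 1) \<circ> h i) + (h (i + 1) \<circ> diff X i)"
  proof
    fix v
    show "(f i - g i) v = ((diff Y (i - 1) \<circ> h i) + (h (i + 1) \<circ> diff X i)) v"
    proof (cases "v \<in> carr (cmod X i)")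
      case False
      then show ?thesis
        using hom_out[OF cm_hom[OF f]] hom_out[OF cm_hom[OF g]] hom_out[OF h] hom_out[OF cx_diff[OF X]]
          hom_0[OF h cx_modl[OF X]] hom_0[OF cx_diff[OF Y] cx_modl[OF Y]] by simp
    qed (use e in simp)
  qed
qed

lemma homotopicE:
  assumes "homotopic X Y f g"
  obtains h where "\<And>i. h i \<in> mod_hom (cmod X i) (cmod Y (i - 1))"
    "\<And>i v. f i v - g i v = diff Y (i - 1) (h i v) + h (i + 1) (diff X i v)"
proof -
  obtain h where h: "\<And>i. h i \<in> mod_hom (cmod X i) (cmod Y (i - 1))"
    "\<And>i. f i - g i = (diff Y (i - 1) \<circ> h i) + (h (i + 1) \<circ> diff X i)"
    using assms unfolding homotopic_def by blast
  have "f i v - g i v = diff Y (i - 1) (h i v) + h (i + 1) (diff X i v)" for i v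
    using fun_cong[OF h(2)[of i], of v] by simp
  then show ?thesis using that h(1) by blast
qed

lemma homotopic_0: "homotopic X Y f g \<longleftrightarrow> homotopic X Y (f - g) 0"
  unfolding homotopic_def by simp

lemma homotopic_refl: "\<lbrakk>f \<in> chain_map X Y; cx X; cx Y\<rbrakk> \<Longrightarrow> homotopic X Y f f"
  by (rule homotopicI[where h = "\<lambda>i. 0"]) (simp_all add: hom_zero cx_modl hom_0[OF cx_diff' cx_modl])

lemma homotopic_plus:
  assumes X: "cx X" and Y: "cx Y" and 1: "homotopic X Y f f'" and 2: "homotopic X Y g g'"
    and m: "f \<in> chain_map X Y" "f' \<in> chain_map X Y" "g \<in> chain_map X Y" "g' \<in> chain_map X Y"
  shows "homotopic X Y (f + g) (f' + g')"
proof -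
  obtain h where h: "\<And>i. h i \<in> mod_hom (cmod X i) (cmod Y (i - 1))"
    "\<And>i v. f i v - f' i v = diff Y (i - 1) (h i v) + h (i + 1) (diff X i v)" using homotopicE[OF 1] by blast
  obtain k where k: "\<And>i. k i \<in> mod_hom (cmod X i) (cmod Y (i - 1))"
    "\<And>i v. g i v - g' i v = diff Y (i - 1) (k i v) + k (i + 1) (diff X i v)" using homotopicE[OF 2] by blast
  show ?thesis
  proof (rule homotopicI[where h = "\<lambda>i. h i + k i"])
    fix i v assume v: "v \<in> carr (cmod X i)"
    have "diff Y (i - 1) (h i v + k i v) = diff Y (i - 1) (h i v) + diff Y (i - 1) (k i v)"
      using hom_add[OF cx_diff'[OF Y]] hom_in[OF h(1) v] hom_in[OF k(1) v] by blast
    then show "(f + g) i v - (f' + g') i v = diff Y (i - 1) ((h i + k i) v) + (h (i + 1) + k (i + 1)) (diff X i v)"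
      using h(2)[of i v] k(2)[of i v] by (simp add: algebra_simps)
  qed (use h k m X Y cm_plus hom_plus cx_modl in blast)+
qed

lemma homotopic_uminus:
  assumes X: "cx X" and Y: "cx Y" and 1: "homotopic X Y f f'" and m: "f \<in> chain_map X Y" "f' \<in> chain_map X Y"
  shows "homotopic X Y (- f) (- f')"
proof -
  obtain h where h: "\<And>i. h i \<in> mod_hom (cmod X i) (cmod Y (i - 1))"
    "\<And>i v. f i v - f' i v = diff Y (i - 1) (h i v) + h (i + 1) (diff X i v)" using homotopicE[OF 1] by blast
  show ?thesis
  proof (rule homotopicI[where h = "\<lambda>i. - h i"])
    fix i v assume v: "v \<in> carr (cmod X i)"
    have "diff Y (i - 1) (- h i v) = - diff Y (i - 1) (h i v)"
      using hom_neg[OF cx_diff'[OF Y] cx_modl[OF Y]] hom_in[OF h(1) v] by blast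
    then show "(- f) i v - (- f') i v = diff Y (i - 1) ((- h i) v) + (- h (i + 1)) (diff X i v)"
      using h(2)[of i v] by (simp add: algebra_simps)
  qed (use h m X Y cm_uminus hom_uminus cx_modl in blast)+
qed

lemma homotopic_sym:
  assumes "homotopic X Y f g" "f \<in> chain_map X Y" "g \<in> chain_map X Y" "cx X" "cx Y"
  shows "homotopic X Y g f"
proof -
  have "homotopic X Y (- (f - g)) (- 0)"
    using homotopic_uminus[OF assms(4,5) assms(1)[unfolded homotopic_0[of _ _ f]] cm_minus[OF assms(2-5)] cm_zero[OF assms(4,5)]] .
  then show ?thesis unfolding homotopic_0[of _ _ g] by simp
qed

lemma homotopic_trans:
  assumes "homotopic X Y f g" "homotopic X Y g h" "f \<in> chain_map X Y" "g \<in> chain_map X Y" "h \<in> chain_map X Y" "cx X" "cx Y"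
  shows "homotopic X Y f h"
proof -
  have "homotopic X Y ((f - g) + (g - h)) (0 + 0)"
    using homotopic_plus[OF assms(6,7) assms(1)[unfolded homotopic_0[of _ _ f]] assms(2)[unfolded homotopic_0[of _ _ g]]]
      cm_minus[OF assms(3,4,6,7)] cm_minus[OF assms(4,5,6,7)] cm_zero[OF assms(6,7)] by blast
  then show ?thesis unfolding homotopic_0[of _ _ f h] by simp
qed

lemma homotopic_comp_l:
  assumes "homotopic X Y f f'" and m: "f \<in> chain_map X Y" "f' \<in> chain_map X Y" "g \<in> chain_map Y Z"
    and X: "cx X" and Y: "cx Y" and Z: "cx Z"
  shows "homotopic X Z (cmap_comp g f) (cmap_comp g f')"
proof -
  obtain h where h: "\<And>i. h i \<in> mod_hom (cmod X i) (cmod Y (i - 1))"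
    "\<And>i v. f i v - f' i v = diff Y (i - 1) (h i v) + h (i + 1) (diff X i v)" using homotopicE[OF assms(1)] by blast
  have hS: "h (i + 1) \<in> mod_hom (cmod X (i + 1)) (cmod Y i)" for i using h(1)[of "i + 1"] by simp
  show ?thesis
  proof (rule homotopicI[where h = "\<lambda>i. g (i - 1) \<circ> h i"])
    fix i v assume v: "v \<in> carr (cmod X i)"
    have "g i (f i v) - g i (f' i v) = g i (f i v - f' i v)"
      using hom_diff[OF cm_hom[OF m(3)] cx_modl[OF Y] hom_in[OF cm_hom[OF m(1)] v] hom_in[OF cm_hom[OF m(2)] v]] by simp
    also have "\<dots> = g i (diff Y (i - 1) (h i v)) + g i (h (i + 1) (diff X i v))"
      unfolding h(2) using hom_add[OF cm_hom[OF m(3)] hom_in[OF cx_diff'[OF Y] hom_in[OF h(1) v]] hom_in[OF hS hom_in[OF cx_diff[OF X] v]]] .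
    finally show "cmap_comp g f i v - cmap_comp g f' i v = diff Z (i - 1) ((g (i - 1) \<circ> h i) v) + (g (i + 1 - 1) \<circ> h (i + 1)) (diff X i v)"
      using cm_comm'[OF m(3)] by (simp add: cmap_comp_def)
  next
    fix i show "g (i - 1) \<circ> h i \<in> mod_hom (cmod X i) (cmod Z (i - 1))"
      using hom_comp[OF h(1) cm_hom[OF m(3)] cx_modl[OF Y]] .
  qed (use m X Y Z cm_comp in blast)+
qed

lemma homotopic_comp_r:
  assumes "homotopic Y Z g g'" and m: "f \<in> chain_map X Y" "g \<in> chain_map Y Z" "g' \<in> chain_map Y Z"
    and X: "cx X" and Y: "cx Y" and Z: "cx Z"
  shows "homotopic X Z (cmap_comp g f) (cmap_comp g' f)"
proof -
  obtain h where h: "\<And>i. h i \<in> mod_hom (cmod Y i) (cmod Z (i - 1))"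
    "\<And>i v. g i v - g' i v = diff Z (i - 1) (h i v) + h (i + 1) (diff Y i v)" using homotopicE[OF assms(1)] by blast
  show ?thesis
  proof (rule homotopicI[where h = "\<lambda>i. h i \<circ> f i"])
    fix i v assume v: "v \<in> carr (cmod X i)"
    show "cmap_comp g f i v - cmap_comp g' f i v = diff Z (i - 1) ((h i \<circ> f i) v) + (h (i + 1) \<circ> f (i + 1)) (diff X i v)"
      using h(2)[of i "f i v"] cm_comm[OF m(1)] by (simp add: cmap_comp_def)
  next
    fix i show "h i \<circ> f i \<in> mod_hom (cmod X i) (cmod Z (i - 1))"
      using hom_comp[OF cm_hom[OF m(1)] h(1) cx_modl[OF Y]] .
  qed (use m X Y Z cm_comp in blast)+
qed

section \<open>Maps from bounded complexes of projectives\<close>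

definition exact_at :: "('h, 'k) cpx \<Rightarrow> int \<Rightarrow> bool" where
  "exact_at X i \<longleftrightarrow> cocycles X i \<subseteq> coboundaries X i"

definition perf :: "('h, 'k) cpx \<Rightarrow> bool" where
  "perf P \<longleftrightarrow> cx P \<and> (\<forall>i. projective_module sc (cmod P i))"

lemma perf_cx: "perf P \<Longrightarrow> cx P"
  unfolding perf_def by blast

text \<open>By \<open>da\<close> the map f - a d takes values in cocycles, hence in coboundaries by
  exactness, and it lifts along the differential of \<open>Y\<close> by projectivity. The first
  clause of the conclusion is \<open>da\<close> for the next lower degree.\<close>

lemma null_homotopic_step:
  assumes P: "perf P" and Y: "cx Y" and f: "f \<in> chain_map P Y"
    and ex: "carr (cmod P i) \<noteq> {0} \<Longrightarrow> exact_at Y i"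
    and a: "a \<in> mod_hom (cmod P (i + 1)) (cmod Y i)"
    and da: "\<And>v. v \<in> carr (cmod P i) \<Longrightarrow> diff Y i (a (diff P i v)) = diff Y i (f i v)"
  shows "\<exists>b \<in> mod_hom (cmod P i) (cmod Y (i - 1)).
    (\<forall>v \<in> carr (cmod P (i - 1)). diff Y (i - 1) (b (diff P (i - 1) v)) = diff Y (i - 1) (f (i - 1) v)) \<and>
    (\<forall>v \<in> carr (cmod P i). f i v = diff Y (i - 1) (b v) + a (diff P i v))"
proof -
  note cP = perf_cx[OF P]
  have fd: "diff Y (i - 1) (f (i - 1) v) = f i (diff P (i - 1) v)" for v using cm_comm'[OF f] by simp
  have dP: "v \<in> carr (cmod P (i - 1)) \<Longrightarrow> diff P (i - 1) v \<in> carr (cmod P i)" for v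
    using hom_in[OF cx_diff'[OF cP]] .
  show ?thesis
  proof (cases "carr (cmod P i) = {0}")
    case True
    have "f i 0 = 0" "diff P i 0 = 0" "a 0 = 0" "diff Y (i - 1) 0 = 0"
      using hom_0[OF cm_hom[OF f] cx_modl[OF cP]] hom_0[OF cx_diff[OF cP] cx_modl[OF cP]]
        hom_0[OF a cx_modl[OF cP]] hom_0[OF cx_diff'[OF Y] cx_modl[OF Y]] by blast+
    moreover have "diff P (i - 1) v = 0" if "v \<in> carr (cmod P (i - 1))" for v using dP[OF that] True by simp
    ultimately show ?thesis using True hom_zero[OF cx_modl[OF cP] cx_modl[OF Y]]
      by (intro bexI[of _ 0]) (simp_all add: fd)
  next
    case False
    let ?g = "f i - (a \<circ> diff P i)"
    have ad: "a \<circ> diff P i \<in> mod_hom (cmod P i) (cmod Y i)"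
      using hom_comp[OF cx_diff[OF cP] a cx_modl[OF cP]] .
    have g: "?g \<in> mod_hom (cmod P i) (cmod Y i)" using hom_minus[OF cm_hom[OF f] ad cx_modl[OF Y]] .
    have "\<exists>w \<in> carr (cmod Y (i - 1)). diff Y (i - 1) w = ?g v" if v: "v \<in> carr (cmod P i)" for v
    proof -
      have "diff Y i (?g v) = 0"
        using hom_diff[OF cx_diff[OF Y] cx_modl[OF Y] hom_in[OF cm_hom[OF f] v] hom_in[OF ad v]] da[OF v] by simp
      then have "?g v \<in> coboundaries Y i"
        using ex[OF False] hom_in[OF g v] unfolding exact_at_def cocycles_def by blast
      then show ?thesis unfolding coboundaries_def by force
    qed
    then obtain b where b: "b \<in> mod_hom (cmod P i) (cmod Y (i - 1))" "diff Y (i - 1) \<circ> b = ?g"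
      using projective_lift[OF _ g cx_diff'[OF Y] cx_fg[OF Y] cx_fg[OF Y]] P unfolding perf_def by metis
    have bv: "diff Y (i - 1) (b v) = f i v - a (diff P i v)" for v using fun_cong[OF b(2), of v] by simp
    have "diff Y (i - 1) (b (diff P (i - 1) v)) = diff Y (i - 1) (f (i - 1) v)" for v
      unfolding bv fd cx_dd'[OF cP] using hom_0[OF a cx_modl[OF cP]] by simp
    then show ?thesis using b(1) bv by (intro bexI[of _ b]) simp_all
  qed
qed

text \<open>The homotopy is constructed downwards, degree by degree. Exactness of \<open>Y\<close>
  is required just where \<open>P\<close> is nonzero, so that the lemma also compares a complex of
  projectives with a complex that is exact in part.\<close>

lemma null_homotopic:
  assumes P: "perf P" and Y: "cx Y" and f: "f \<in> chain_map P Y"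
    and ex: "\<And>i. carr (cmod P i) \<noteq> {0} \<Longrightarrow> exact_at Y i"
  shows "homotopic P Y f 0"
proof -
  note cP = perf_cx[OF P]
  obtain n where n: "0 \<le> n" "\<And>i. n < \<bar>i\<bar> \<Longrightarrow> carr (cmod P i) = {0}" using cx_bound[OF cP] by blast
  let ?R = "\<lambda>i a. a \<in> mod_hom (cmod P i) (cmod Y (i - 1)) \<and>
    (\<forall>v \<in> carr (cmod P (i - 1)). diff Y (i - 1) (a (diff P (i - 1) v)) = diff Y (i - 1) (f (i - 1) v))"
  \<comment> \<open>Step \<open>k\<close> of the recursion treats degree n + 1 - k. It starts with
    the zero map in degree n + 1, where \<open>P\<close> vanishes.\<close>
  let ?N = "\<lambda>k. n + 1 - int k"
  have "\<exists>x. \<forall>k. ?R (?N k) (x k) \<and> (\<forall>v \<in> carr (cmod P (?N (Suc k))).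
      f (?N (Suc k)) v = diff Y (?N (Suc k) - 1) (x (Suc k) v) + x k (diff P (?N (Suc k)) v))"
  proof (rule dependent_nat_choice)
    have z: "carr (cmod P (n + 1)) = {0}" using n by simp
    have f0: "f (n + 1) 0 = 0" and d0: "diff Y n 0 = 0"
      using hom_0[OF cm_hom[OF f] cx_modl[OF cP]] hom_0[OF cx_diff[OF Y] cx_modl[OF Y]] by blast+
    have "diff Y n (f n v) = 0" if "v \<in> carr (cmod P n)" for v
    proof -
      have "diff P n v = 0" using hom_in[OF cx_diff[OF cP] that] z by simp
      then show ?thesis using cm_comm[OF f, of n v] f0 by simp
    qed
    then have "?R (?N 0) 0" using hom_zero[OF cx_modl[OF cP] cx_modl[OF Y]] d0 by simp
    then show "\<exists>x. ?R (?N 0) x" by blast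
  next
    fix a k assume a: "?R (?N k) a"
    let ?i = "?N (Suc k)"
    have e: "?N k = ?i + 1" "?i + 1 - 1 = ?i" by simp_all
    obtain b where "b \<in> mod_hom (cmod P ?i) (cmod Y (?i - 1))"
      "\<forall>v \<in> carr (cmod P (?i - 1)). diff Y (?i - 1) (b (diff P (?i - 1) v)) = diff Y (?i - 1) (f (?i - 1) v)"
      "\<forall>v \<in> carr (cmod P ?i). f ?i v = diff Y (?i - 1) (b v) + a (diff P ?i v)"
      using null_homotopic_step[OF P Y f ex, of ?i a] a unfolding e by blast
    then show "\<exists>y. ?R ?i y \<and> (\<forall>v \<in> carr (cmod P ?i). f ?i v = diff Y (?i - 1) (y v) + a (diff P ?i v))" by blast
  qed
  then obtain x where x: "\<And>k. x k \<in> mod_hom (cmod P (?N k)) (cmod Y (?N k - 1))"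
    "\<And>k v. v \<in> carr (cmod P (?N (Suc k))) \<Longrightarrow>
      f (?N (Suc k)) v = diff Y (?N (Suc k) - 1) (x (Suc k) v) + x k (diff P (?N (Suc k)) v)" by blast
  let ?h = "\<lambda>i. if n + 1 < i then 0 else x (nat (n + 1 - i))"
  have h: "?h i \<in> mod_hom (cmod P i) (cmod Y (i - 1))" for i
  proof (cases "n + 1 < i")
    case False
    then have "?N (nat (n + 1 - i)) = i" by simp
    then show ?thesis using x(1)[of "nat (n + 1 - i)"] False by simp
  qed (use hom_zero[OF cx_modl[OF cP] cx_modl[OF Y]] in simp)
  show ?thesis
  proof (rule homotopicI[OF f cm_zero[OF cP Y] cP Y h])
    fix i v assume v: "v \<in> carr (cmod P i)"
    show "f i v - 0 i v = diff Y (i - 1) (?h i v) + ?h (i + 1) (diff P i v)"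
    proof (cases "n < i")
      case True
      then have "v = 0" using n v by simp
      moreover have "f i 0 = 0" "diff P i 0 = 0" "?h i 0 = 0" "?h (i + 1) 0 = 0" "diff Y (i - 1) 0 = 0"
        using hom_0[OF cm_hom[OF f] cx_modl[OF cP]] hom_0[OF cx_diff[OF cP] cx_modl[OF cP]]
          hom_0[OF h cx_modl[OF cP]] hom_0[OF cx_diff'[OF Y] cx_modl[OF Y]] by blast+
      ultimately show ?thesis by (simp only: zero_fun_apply) simp
    next
      case False
      let ?k = "nat (n - i)"
      have e: "?N (Suc ?k) = i" "nat (n + 1 - i) = Suc ?k" "nat (n + 1 - (i + 1)) = ?k" using False by simp_all
      show ?thesis using x(2)[of v ?k] v False unfolding e by simp
    qed
  qed
qed

section \<open>Cohomology and quasi-isomorphisms\<close>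

lemma coboundaries_subspace: "cx X \<Longrightarrow> sq.subspace (coboundaries X i)"
  unfolding coboundaries_def using subspace_image(1)[OF cx_diff' cx_modl cx_modl] .

lemma coboundary_0: "cx X \<Longrightarrow> 0 \<in> coboundaries X i"
  and coboundary_add: "\<lbrakk>cx X; v \<in> coboundaries X i; w \<in> coboundaries X i\<rbrakk> \<Longrightarrow> v + w \<in> coboundaries X i"
  and coboundary_diff: "\<lbrakk>cx X; v \<in> coboundaries X i; w \<in> coboundaries X i\<rbrakk> \<Longrightarrow> v - w \<in> coboundaries X i"
  and coboundary_neg: "\<lbrakk>cx X; v \<in> coboundaries X i\<rbrakk> \<Longrightarrow> - v \<in> coboundaries X i"
  using coboundaries_subspace sq.subspace_0 sq.subspace_add sq.subspace_diff sq.subspace_neg by blast+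

lemma coboundary_in_cocycles: "\<lbrakk>cx X; v \<in> coboundaries X i\<rbrakk> \<Longrightarrow> v \<in> cocycles X i"
  unfolding coboundaries_def cocycles_def using hom_in[OF cx_diff'] cx_dd' by blast

lemma cocyclesI: "\<lbrakk>v \<in> carr (cmod X i); diff X i v = 0\<rbrakk> \<Longrightarrow> v \<in> cocycles X i"
  and cocyclesD: "v \<in> cocycles X i \<Longrightarrow> v \<in> carr (cmod X i)" "v \<in> cocycles X i \<Longrightarrow> diff X i v = 0"
  unfolding cocycles_def by blast+

lemma coboundariesI: "w \<in> carr (cmod X (i - 1)) \<Longrightarrow> diff X (i - 1) w \<in> coboundaries X i"
  unfolding coboundaries_def by blast

lemma coboundariesE:
  assumes "v \<in> coboundaries X i"
  obtains w where "w \<in> carr (cmod X (i - 1))" "v = diff X (i - 1) w"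
  using assms unfolding coboundaries_def by blast

lemma cm_cocycle: "\<lbrakk>f \<in> chain_map X Y; cx X; cx Y; v \<in> cocycles X i\<rbrakk> \<Longrightarrow> f i v \<in> cocycles Y i"
proof -
  assume f: "f \<in> chain_map X Y" and X: "cx X" and Y: "cx Y" and v: "v \<in> cocycles X i"
  have "diff Y i (f i v) = f (i + 1) 0" using cm_comm[OF f, of i v] cocyclesD(2)[OF v] by simp
  then show ?thesis using hom_0[OF cm_hom[OF f] cx_modl[OF X]] hom_in[OF cm_hom[OF f] cocyclesD(1)[OF v]]
    by (intro cocyclesI) simp_all
qed

lemma cm_coboundary: "\<lbrakk>f \<in> chain_map X Y; v \<in> coboundaries X i\<rbrakk> \<Longrightarrow> f i v \<in> coboundaries Y i"
proof -
  assume f: "f \<in> chain_map X Y" and v: "v \<in> coboundaries X i"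
  obtain w where w: "w \<in> carr (cmod X (i - 1))" "v = diff X (i - 1) w" using v by (rule coboundariesE)
  show ?thesis unfolding w(2) cm_comm'[OF f] using hom_in[OF cm_hom[OF f] w(1)] by (rule coboundariesI)
qed

lemma cohomology_class_eq:
  assumes X: "cx X"
  shows "cohomology_class X i v = cohomology_class X i w \<longleftrightarrow> v - w \<in> coboundaries X i"
proof
  assume e: "cohomology_class X i v = cohomology_class X i w"
  have "v + 0 \<in> cohomology_class X i v" unfolding cohomology_class_def using coboundary_0[OF X] by (rule imageI)
  then have "v + 0 \<in> (\<lambda>b. w + b) ` coboundaries X i" unfolding e by (simp only: cohomology_class_def)
  then obtain b where "v + 0 = w + b" "b \<in> coboundaries X i" by (rule imageE)
  then show "v - w \<in> coboundaries X i" by simp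
next
  have sub: "cohomology_class X i v \<subseteq> cohomology_class X i w" if d: "v - w \<in> coboundaries X i" for v w
  proof
    fix x assume "x \<in> cohomology_class X i v"
    then obtain b where b: "x = v + b" "b \<in> coboundaries X i" unfolding cohomology_class_def by (rule imageE)
    have "x = w + ((v - w) + b)" unfolding b(1) by simp
    then show "x \<in> cohomology_class X i w" unfolding cohomology_class_def using coboundary_add[OF X d b(2)] by (rule image_eqI)
  qed
  assume d: "v - w \<in> coboundaries X i"
  have "w - v \<in> coboundaries X i" using coboundary_neg[OF X d] by simp
  then show "cohomology_class X i v = cohomology_class X i w" using sub[OF d] sub[of w v] by blast
qed

lemma cohomology_map_class:
  assumes f: "f \<in> chain_map X Y" and X: "cx X" and Y: "cx Y" and v: "v \<in> cocycles X i"
  shows "cohomology_map Y f i (cohomology_class X i v) = cohomology_class Y i (f i v)"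
proof -
  have "cohomology_class Y i (f i w) = cohomology_class Y i (f i v)" if w: "w \<in> cohomology_class X i v" for w
  proof -
    obtain b where b: "w = v + b" "b \<in> coboundaries X i" using w unfolding cohomology_class_def by (rule imageE)
    have "f i w = f i v + f i b"
      unfolding b(1) using hom_add[OF cm_hom[OF f] cocyclesD(1)[OF v] cocyclesD(1)[OF coboundary_in_cocycles[OF X b(2)]]] .
    then show ?thesis unfolding cohomology_class_eq[OF Y] using cm_coboundary[OF f b(2)] by simp
  qed
  moreover have "v + 0 \<in> cohomology_class X i v" unfolding cohomology_class_def using coboundary_0[OF X] by (rule imageI)
  ultimately show ?thesis unfolding cohomology_map_def by blast
qed

text \<open>Bijectivity on cohomology unfolded into statements about elements: triviality of the
  kernel by additivity, surjectivity up to coboundaries. Quasi-isomorphisms are manipulated in this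
  form.\<close>

lemma quasi_iso_iff:
  assumes X: "cx X" and Y: "cx Y"
  shows "quasi_iso X Y f \<longleftrightarrow> f \<in> chain_map X Y \<and>
    (\<forall>i. \<forall>x \<in> cocycles X i. f i x \<in> coboundaries Y i \<longrightarrow> x \<in> coboundaries X i) \<and>
    (\<forall>i. \<forall>y \<in> cocycles Y i. \<exists>x \<in> cocycles X i. y - f i x \<in> coboundaries Y i)"
proof (cases "f \<in> chain_map X Y")
  case f: True
  have inj: "inj_on (cohomology_map Y f i) (cohomology X i) \<longleftrightarrow>
    (\<forall>x \<in> cocycles X i. f i x \<in> coboundaries Y i \<longrightarrow> x \<in> coboundaries X i)" for i
  proof
    assume inj: "inj_on (cohomology_map Y f i) (cohomology X i)"
    show "\<forall>x \<in> cocycles X i. f i x \<in> coboundaries Y i \<longrightarrow> x \<in> coboundaries X i"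
    proof (intro ballI impI)
      fix x assume x: "x \<in> cocycles X i" "f i x \<in> coboundaries Y i"
      have z: "0 \<in> cocycles X i" using coboundary_in_cocycles[OF X coboundary_0[OF X]] .
      have "f i 0 = 0" using hom_0[OF cm_hom[OF f] cx_modl[OF X]] .
      then have "cohomology_map Y f i (cohomology_class X i x) = cohomology_map Y f i (cohomology_class X i 0)"
        unfolding cohomology_map_class[OF f X Y x(1)] cohomology_map_class[OF f X Y z] cohomology_class_eq[OF Y]
        using x(2) by simp
      then have "cohomology_class X i x = cohomology_class X i 0"
        using inj x(1) z unfolding inj_on_def cohomology_def by blast
      then show "x \<in> coboundaries X i" unfolding cohomology_class_eq[OF X] by simp
    qed
  next
    assume r: "\<forall>x \<in> cocycles X i. f i x \<in> coboundaries Y i \<longrightarrow> x \<in> coboundaries X i"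
    show "inj_on (cohomology_map Y f i) (cohomology X i)"
    proof (rule inj_onI)
      fix c c' assume c: "c \<in> cohomology X i" "c' \<in> cohomology X i" and e: "cohomology_map Y f i c = cohomology_map Y f i c'"
      obtain v w where v: "v \<in> cocycles X i" "c = cohomology_class X i v" and w: "w \<in> cocycles X i" "c' = cohomology_class X i w"
        using c unfolding cohomology_def by blast
      have vw: "v - w \<in> cocycles X i"
        using cocyclesD[OF v(1)] cocyclesD[OF w(1)] hom_diff[OF cx_diff[OF X] cx_modl[OF X]] cx_modl[OF X]
        by (intro cocyclesI) simp_all
      have "f i v - f i w \<in> coboundaries Y i"
        using e unfolding v(2) w(2) cohomology_map_class[OF f X Y v(1)] cohomology_map_class[OF f X Y w(1)] cohomology_class_eq[OF Y] .
      then have "f i (v - w) \<in> coboundaries Y i"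
        using hom_diff[OF cm_hom[OF f] cx_modl[OF X] cocyclesD(1)[OF v(1)] cocyclesD(1)[OF w(1)]] by simp
      then show "c = c'" unfolding v(2) w(2) cohomology_class_eq[OF X] using r vw by blast
    qed
  qed
  have surj: "cohomology_map Y f i ` cohomology X i = cohomology Y i \<longleftrightarrow>
    (\<forall>y \<in> cocycles Y i. \<exists>x \<in> cocycles X i. y - f i x \<in> coboundaries Y i)" for i
  proof -
    have im: "cohomology_map Y f i ` cohomology X i = (\<lambda>x. cohomology_class Y i (f i x)) ` cocycles X i"
      unfolding cohomology_def image_image using cohomology_map_class[OF f X Y] by (intro image_cong) auto
    have sub: "(\<lambda>x. cohomology_class Y i (f i x)) ` cocycles X i \<subseteq> cohomology Y i"
      unfolding cohomology_def using cm_cocycle[OF f X Y] by blast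
    show ?thesis
    proof
      assume e: "cohomology_map Y f i ` cohomology X i = cohomology Y i"
      show "\<forall>y \<in> cocycles Y i. \<exists>x \<in> cocycles X i. y - f i x \<in> coboundaries Y i"
      proof
        fix y assume "y \<in> cocycles Y i"
        then have "cohomology_class Y i y \<in> cohomology Y i" unfolding cohomology_def by (rule imageI)
        then have "cohomology_class Y i y \<in> (\<lambda>x. cohomology_class Y i (f i x)) ` cocycles X i"
          unfolding im[symmetric] e .
        then obtain x where x: "cohomology_class Y i y = cohomology_class Y i (f i x)" "x \<in> cocycles X i"
          by (rule imageE)
        show "\<exists>x \<in> cocycles X i. y - f i x \<in> coboundaries Y i"
          using x(2) x(1)[unfolded cohomology_class_eq[OF Y]] by (intro bexI[of _ x])
      qed
    next
      assume r: "\<forall>y \<in> cocycles Y i. \<exists>x \<in> cocycles X i. y - f i x \<in> coboundaries Y i"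
      have "cohomology Y i \<subseteq> (\<lambda>x. cohomology_class Y i (f i x)) ` cocycles X i"
      proof
        fix c assume "c \<in> cohomology Y i"
        then obtain y where y: "c = cohomology_class Y i y" "y \<in> cocycles Y i" unfolding cohomology_def by (rule imageE)
        then obtain x where x: "x \<in> cocycles X i" "y - f i x \<in> coboundaries Y i" using r by blast
        have "c = cohomology_class Y i (f i x)" unfolding y(1) cohomology_class_eq[OF Y] by (rule x(2))
        then show "c \<in> (\<lambda>x. cohomology_class Y i (f i x)) ` cocycles X i" using x(1) by (rule image_eqI)
      qed
      then show "cohomology_map Y f i ` cohomology X i = cohomology Y i" unfolding im using sub by blast
    qed
  qed
  show ?thesis unfolding quasi_iso_def bij_betw_def inj surj by blast
qed (simp add: quasi_iso_def)

lemma quasi_iso_cm: "quasi_iso X Y f \<Longrightarrow> f \<in> chain_map X Y"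
  unfolding quasi_iso_def by blast

lemma quasi_iso_id: "cx X \<Longrightarrow> quasi_iso X X (cmap_id X)"
proof -
  assume X: "cx X"
  have e: "cmap_id X i v = v" if "v \<in> carr (cmod X i)" for i v using that by (simp add: cmap_id_def restr0_def)
  show ?thesis unfolding quasi_iso_iff[OF X X]
  proof (intro conjI allI ballI impI)
    show "cmap_id X \<in> chain_map X X" using cm_id[OF X] .
    show "x \<in> coboundaries X i" if "x \<in> cocycles X i" "cmap_id X i x \<in> coboundaries X i" for i x
      using that e[OF cocyclesD(1)[OF that(1)]] by simp
    show "\<exists>x \<in> cocycles X i. y - cmap_id X i x \<in> coboundaries X i" if "y \<in> cocycles X i" for i y
      using that e[OF cocyclesD(1)[OF that]] coboundary_0[OF X] by (intro bexI[of _ y]) simp_all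
  qed
qed

lemma quasi_iso_comp:
  assumes f: "quasi_iso X Y f" and g: "quasi_iso Y Z g" and o: "cx X" "cx Y" "cx Z"
  shows "quasi_iso X Z (cmap_comp g f)"
proof -
  note F = f[unfolded quasi_iso_iff[OF o(1,2)]] and G = g[unfolded quasi_iso_iff[OF o(2,3)]]
  have fm: "f \<in> chain_map X Y" and gm: "g \<in> chain_map Y Z" using F G by blast+
  show ?thesis unfolding quasi_iso_iff[OF o(1,3)]
  proof (intro conjI allI ballI impI)
    show "cmap_comp g f \<in> chain_map X Z" using cm_comp fm gm o by blast
    show "x \<in> coboundaries X i" if "x \<in> cocycles X i" "cmap_comp g f i x \<in> coboundaries Z i" for i x
      using that F G cm_cocycle[OF fm o(1,2) that(1)] by (simp add: cmap_comp_def)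
    show "\<exists>x \<in> cocycles X i. z - cmap_comp g f i x \<in> coboundaries Z i" if z: "z \<in> cocycles Z i" for i z
    proof -
      obtain y where y: "y \<in> cocycles Y i" "z - g i y \<in> coboundaries Z i" using G z by blast
      obtain x where x: "x \<in> cocycles X i" "y - f i x \<in> coboundaries Y i" using F y by blast
      have "g i (y - f i x) = g i y - g i (f i x)"
        using hom_diff[OF cm_hom[OF gm] cx_modl[OF o(2)] cocyclesD(1)[OF y(1)] hom_in[OF cm_hom[OF fm] cocyclesD(1)[OF x(1)]]] .
      then have "z - cmap_comp g f i x = (z - g i y) + g i (y - f i x)" by (simp add: cmap_comp_def)
      then have "z - cmap_comp g f i x \<in> coboundaries Z i"
        using coboundary_add[OF o(3) y(2) cm_coboundary[OF gm x(2)]] by metis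
      then show ?thesis using x(1) by (intro bexI[of _ x])
    qed
  qed
qed

text \<open>On cocycles, homotopic maps differ by coboundaries.\<close>

lemma quasi_iso_homotopic:
  assumes f: "quasi_iso X Y f" and h: "homotopic X Y f g" and g: "g \<in> chain_map X Y" and o: "cx X" "cx Y"
  shows "quasi_iso X Y g"
proof -
  note F = f[unfolded quasi_iso_iff[OF o(1,2)]]
  have fm: "f \<in> chain_map X Y" using F by blast
  obtain h where h: "\<And>i. h i \<in> mod_hom (cmod X i) (cmod Y (i - 1))"
    "\<And>i v. f i v - g i v = diff Y (i - 1) (h i v) + h (i + 1) (diff X i v)" using homotopicE[OF h] by blast
  have b: "f i x - g i x \<in> coboundaries Y i" if x: "x \<in> cocycles X i" for i x
  proof -
    have "h (i + 1) 0 = 0" using hom_0[OF h(1) cx_modl[OF o(1)]] .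
    then have "f i x - g i x = diff Y (i - 1) (h i x)" unfolding h(2) cocyclesD(2)[OF x] by simp
    then show ?thesis using coboundariesI[OF hom_in[OF h(1) cocyclesD(1)[OF x]]] by simp
  qed
  show ?thesis unfolding quasi_iso_iff[OF o]
  proof (intro conjI allI ballI impI g)
    fix i x assume x: "x \<in> cocycles X i" "g i x \<in> coboundaries Y i"
    have "f i x = (f i x - g i x) + g i x" by simp
    then have "f i x \<in> coboundaries Y i" using coboundary_add[OF o(2) b[OF x(1)] x(2)] by metis
    then show "x \<in> coboundaries X i" using F x(1) by blast
  next
    fix i y assume "y \<in> cocycles Y i"
    then obtain x where x: "x \<in> cocycles X i" "y - f i x \<in> coboundaries Y i" using F by blast
    have "y - g i x = (y - f i x) + (f i x - g i x)" by simp
    then have "y - g i x \<in> coboundaries Y i"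
      using coboundary_add[OF o(2) x(2) b[OF x(1)]] by metis
    then show "\<exists>x \<in> cocycles X i. y - g i x \<in> coboundaries Y i" using x(1) by (intro bexI[of _ x])
  qed
qed

section \<open>Shifts and mapping cones\<close>

lemma cshift_simps [simp]: "cmod (cshift n X) i = cmod X (i + n)"
  "diff (cshift n X) i = (if even n then diff X (i + n) else - diff X (i + n))"
  by (simp_all add: cshift_def)

lemma cx_cshift:
  assumes X: "cx X"
  shows "cx (cshift n X)"
proof -
  obtain m where m: "0 \<le> m" "\<And>i. m < \<bar>i\<bar> \<Longrightarrow> carr (cmod X i) = {0}" using cx_bound[OF X] by blast
  have e: "i + 1 + n = i + n + 1" for i by simp
  show ?thesis
  proof (rule cxI[where n = "m + \<bar>n\<bar>"])
    show "diff (cshift n X) i \<in> mod_hom (cmod (cshift n X) i) (cmod (cshift n X) (i + 1))" for i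
      unfolding cshift_simps e using cx_diff[OF X] hom_uminus[OF cx_diff[OF X] cx_modl[OF X]] by simp
    show "diff (cshift n X) (i + 1) (diff (cshift n X) i v) = 0" if "v \<in> carr (cmod (cshift n X) i)" for i v
    proof -
      have "diff X (i + n + 1) (- diff X (i + n) v) = - diff X (i + n + 1) (diff X (i + n) v)"
        using hom_neg[OF cx_diff[OF X] cx_modl[OF X] hom_in'[OF cx_diff[OF X] cx_modl[OF X]]] .
      then show ?thesis unfolding cshift_simps e using cx_dd[OF X] by simp
    qed
    show "carr (cmod (cshift n X) i) = {0}" if "m + \<bar>n\<bar> < \<bar>i\<bar>" for i using m that by simp
  qed (use cx_fg[OF X] in simp)
qed

lemma cocycles_cshift: "cocycles (cshift n X) i = cocycles X (i + n)"
  unfolding cocycles_def cshift_simps by (auto simp: fun_eq_iff)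

lemma coboundaries_cshift:
  assumes X: "cx X"
  shows "coboundaries (cshift n X) i = coboundaries X (i + n)"
proof -
  have e: "i - 1 + n = i + n - 1" by simp
  have "(- diff X (i + n - 1)) ` carr (cmod X (i + n - 1)) = diff X (i + n - 1) ` carr (cmod X (i + n - 1))"
    (is "?L = ?R")
  proof
    show "?L \<subseteq> ?R"
    proof
      fix x assume "x \<in> ?L"
      then obtain v where "v \<in> carr (cmod X (i + n - 1))" "x = - diff X (i + n - 1) v" by auto
      then show "x \<in> ?R" using hom_neg[OF cx_diff[OF X] cx_modl[OF X]] cx_modl[OF X]
        by (intro image_eqI[of _ _ "- v"]) simp_all
    qed
    show "?R \<subseteq> ?L"
    proof
      fix x assume "x \<in> ?R"
      then obtain v where "v \<in> carr (cmod X (i + n - 1))" "x = diff X (i + n - 1) v" by blast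
      then show "x \<in> ?L" using hom_neg[OF cx_diff[OF X] cx_modl[OF X]] cx_modl[OF X]
        by (intro image_eqI[of _ _ "- v"]) simp_all
    qed
  qed
  then show ?thesis unfolding coboundaries_def cshift_simps e by simp
qed

lemma exact_at_cshift: "cx X \<Longrightarrow> exact_at (cshift n X) i \<longleftrightarrow> exact_at X (i + n)"
  unfolding exact_at_def cocycles_cshift by (simp add: coboundaries_cshift)

lemma hom_evens: "k \<in> mod_hom M (sum_module A B) \<Longrightarrow> (\<lambda>v. evens (k v)) \<in> mod_hom M A"
  and hom_odds: "k \<in> mod_hom M (sum_module A B) \<Longrightarrow> (\<lambda>v. odds (k v)) \<in> mod_hom M B"
  for A B :: "('h, 'k) fmod"
  unfolding mod_hom_def sum_module_simps by simp_all

lemma hom_pair: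
  assumes a: "a \<in> mod_hom M A" and b: "b \<in> mod_hom M B"
  shows "(\<lambda>v. interleave (a v) (b v)) \<in> mod_hom M (sum_module A B)"
  using mod_homD[OF a] mod_homD[OF b] by (intro mod_homI) (simp_all add: sum_module_simps interleave_add)

lemma cone_simps:
  "carr (cmod (cone X Y f) i) = {u. evens u \<in> carr (cmod X (i + 1)) \<and> odds u \<in> carr (cmod Y i)}"
  "cmod (cone X Y f) i = sum_module (cmod X (i + 1)) (cmod Y i)"
  "\<lbrakk>evens u \<in> carr (cmod X (i + 1)); odds u \<in> carr (cmod Y i)\<rbrakk> \<Longrightarrow> diff (cone X Y f) i u =
     interleave (- diff X (i + 1) (evens u)) (f (i + 1) (evens u) + diff Y i (odds u))"
  by (simp_all add: cone_def sum_module_simps restr0_def)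

lemma cx_cone:
  assumes X: "cx X" and Y: "cx Y" and f: "f \<in> chain_map X Y"
  shows "cx (cone X Y f)"
proof -
  obtain m where m: "0 \<le> m" "\<And>i. m < \<bar>i\<bar> \<Longrightarrow> carr (cmod X i) = {0}" using cx_bound[OF X] by blast
  obtain n where n: "0 \<le> n" "\<And>i. n < \<bar>i\<bar> \<Longrightarrow> carr (cmod Y i) = {0}" using cx_bound[OF Y] by blast
  note mX = cx_modl[OF X] and mY = cx_modl[OF Y]
  have dX: "v \<in> carr (cmod X i) \<Longrightarrow> diff X i v \<in> carr (cmod X (i + 1))" for i v using hom_in[OF cx_diff[OF X]] .
  have dY: "v \<in> carr (cmod Y i) \<Longrightarrow> diff Y i v \<in> carr (cmod Y (i + 1))" for i v using hom_in[OF cx_diff[OF Y]] .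
  have fi: "v \<in> carr (cmod X i) \<Longrightarrow> f i v \<in> carr (cmod Y i)" for i v using hom_in[OF cm_hom[OF f]] .
  show ?thesis
  proof (rule cxI[where n = "m + n + 1"])
    fix i
    show "fg_module sc (cmod (cone X Y f) i)" unfolding cone_simps using fg_sum_module cx_fg X Y by blast
    show "diff (cone X Y f) i \<in> mod_hom (cmod (cone X Y f) i) (cmod (cone X Y f) (i + 1))"
    proof (rule mod_homI)
      fix u w assume u: "u \<in> carr (cmod (cone X Y f) i)"
      then have u': "evens u \<in> carr (cmod X (i + 1))" "odds u \<in> carr (cmod Y i)" by (auto simp: cone_simps sum_module_simps)
      show "diff (cone X Y f) i u \<in> carr (cmod (cone X Y f) (i + 1))"
        using u' dX[OF u'(1)] dY[OF u'(2)] fi[OF u'(1)] mX mY by (simp add: cone_simps sum_module_simps)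
      fix h
      show "diff (cone X Y f) i (act (cmod (cone X Y f) i) h u) = act (cmod (cone X Y f) (i + 1)) h (diff (cone X Y f) i u)"
        using u' dX[OF u'(1)] dY[OF u'(2)] fi[OF u'(1)] mX mY hom_act[OF cx_diff[OF X]] hom_act[OF cx_diff[OF Y]] hom_act[OF cm_hom[OF f]]
        by (simp add: cone_simps sum_module_simps modl_act_neg modl_act_add)
      assume "w \<in> carr (cmod (cone X Y f) i)"
      then have w': "evens w \<in> carr (cmod X (i + 1))" "odds w \<in> carr (cmod Y i)" by (auto simp: cone_simps sum_module_simps)
      show "diff (cone X Y f) i (u + w) = diff (cone X Y f) i u + diff (cone X Y f) i w"
        using u' w' mX mY hom_add[OF cx_diff[OF X] u'(1) w'(1)] hom_add[OF cx_diff[OF Y] u'(2) w'(2)]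
          hom_add[OF cm_hom[OF f] u'(1) w'(1)]
        by (simp add: cone_simps interleave_add add_ac)
    next
      show "diff (cone X Y f) i v = 0" if "v \<notin> carr (cmod (cone X Y f) i)" for v
        using that by (simp add: cone_def restr0_def)
    qed
    show "carr (cmod (cone X Y f) i) = {0}" if i: "m + n + 1 < \<bar>i\<bar>"
    proof -
      have z: "carr (cmod X (i + 1)) = {0}" "carr (cmod Y i) = {0}" using m n i by auto
      show ?thesis
      proof
        show "carr (cmod (cone X Y f) i) \<subseteq> {0}"
        proof
          fix u assume "u \<in> carr (cmod (cone X Y f) i)"
          then have "evens u = 0" "odds u = 0" by (auto simp: cone_simps sum_module_simps z)
          then have "u = 0" by (intro seq_eqI[of u 0]) (simp_all only: evens_simps odds_simps)
          then show "u \<in> {0}" by simp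
        qed
        show "{0} \<subseteq> carr (cmod (cone X Y f) i)" by (simp add: cone_simps sum_module_simps z)
      qed
    qed
  next
    fix i u assume u: "u \<in> carr (cmod (cone X Y f) i)"
    then have u': "evens u \<in> carr (cmod X (i + 1))" "odds u \<in> carr (cmod Y i)" by (auto simp: cone_simps sum_module_simps)
    let ?e = "evens u" and ?o = "odds u"
    have 1: "diff X (i + 1 + 1) (- diff X (i + 1) ?e) = 0"
      using hom_neg[OF cx_diff[OF X] mX dX[OF u'(1)]] cx_dd[OF X, of "i + 1" ?e] by simp
    have "f (i + 1 + 1) (- diff X (i + 1) ?e) = - diff Y (i + 1) (f (i + 1) ?e)"
      using hom_neg[OF cm_hom[OF f] mX dX[OF u'(1)]] cm_comm[OF f, of "i + 1" ?e] by simp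
    moreover have "diff Y (i + 1) (f (i + 1) ?e + diff Y i ?o) = diff Y (i + 1) (f (i + 1) ?e)"
      using hom_add[OF cx_diff[OF Y] fi[OF u'(1)] dY[OF u'(2)]] cx_dd[OF Y, of i ?o] by simp
    ultimately have 2: "f (i + 1 + 1) (- diff X (i + 1) ?e) + diff Y (i + 1) (f (i + 1) ?e + diff Y i ?o) = 0" by simp
    have w: "- diff X (i + 1) ?e \<in> carr (cmod X (i + 1 + 1))" "f (i + 1) ?e + diff Y i ?o \<in> carr (cmod Y (i + 1))"
      using dX[OF u'(1)] dY[OF u'(2)] fi[OF u'(1)] mX mY by simp_all
    have "diff (cone X Y f) (i + 1) (diff (cone X Y f) i u) =
      interleave (- diff X (i + 1 + 1) (- diff X (i + 1) ?e)) (f (i + 1 + 1) (- diff X (i + 1) ?e) + diff Y (i + 1) (f (i + 1) ?e + diff Y i ?o))"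
      unfolding cone_simps(3)[OF u'] using cone_simps(3)[of "interleave (- diff X (i + 1) ?e) (f (i + 1) ?e + diff Y i ?o)" X "i + 1" Y f] w by simp
    then show "diff (cone X Y f) (i + 1) (diff (cone X Y f) i u) = 0" unfolding 1 2 by simp
  qed
qed

lemma perf_cone: "\<lbrakk>perf X; perf Y; f \<in> chain_map X Y\<rbrakk> \<Longrightarrow> perf (cone X Y f)"
  unfolding perf_def cone_simps using cx_cone projective_sum by blast

lemma perf_cshift: "perf X \<Longrightarrow> perf (cshift n X)"
  unfolding perf_def cshift_simps using cx_cshift by blast

lemma cone_in_apply: "v \<in> carr (cmod Y i) \<Longrightarrow> cone_in Y i v = interleave 0 v"
  by (simp add: cone_in_def restr0_def)

lemma cone_in_cm:
  assumes X: "cx X" and Y: "cx Y" and f: "f \<in> chain_map X Y"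
  shows "cone_in Y \<in> chain_map Y (cone X Y f)"
proof (rule chain_mapI[OF Y cx_cone[OF assms]])
  note mX = cx_modl[OF X] and mY = cx_modl[OF Y]
  fix i
  show "cone_in Y i \<in> mod_hom (cmod Y i) (cmod (cone X Y f) i)"
  proof (rule mod_homI)
    show "cone_in Y i v = 0" if "v \<notin> carr (cmod Y i)" for v using that by (simp add: cone_in_def restr0_def)
  qed (simp_all add: cone_in_apply cone_simps mX mY sum_module_simps interleave_add)
  fix v assume v: "v \<in> carr (cmod Y i)"
  have "f (i + 1) 0 = 0" "diff X (i + 1) 0 = 0" using hom_0[OF cm_hom[OF f] mX] hom_0[OF cx_diff[OF X] mX] by blast+
  then show "cone_in Y (i + 1) (diff Y i v) = diff (cone X Y f) i (cone_in Y i v)"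
    using v hom_in[OF cx_diff[OF Y] v] mX by (simp add: cone_in_apply cone_simps)
qed

lemma cone_out_apply: "u \<in> carr (cmod (cone X Y f) i) \<Longrightarrow> cone_out X Y f i u = evens u"
  by (simp add: cone_out_def restr0_def)

lemma cone_out_cm:
  assumes X: "cx X" and Y: "cx Y" and f: "f \<in> chain_map X Y"
  shows "cone_out X Y f \<in> chain_map (cone X Y f) (cshift 1 X)"
proof (rule chain_mapI[OF cx_cone[OF assms] cx_cshift[OF X]])
  fix i
  note mC = cx_modl[OF cx_cone[OF assms]]
  show "cone_out X Y f i \<in> mod_hom (cmod (cone X Y f) i) (cmod (cshift 1 X) i)"
  proof (rule mod_homI)
    show "cone_out X Y f i v = 0" if "v \<notin> carr (cmod (cone X Y f) i)" for v using that by (simp add: cone_out_def restr0_def)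
    show "cone_out X Y f i v \<in> carr (cmod (cshift 1 X) i)" if "v \<in> carr (cmod (cone X Y f) i)" for v
      using that unfolding cone_out_apply[OF that] by (simp add: cone_simps sum_module_simps)
    show "cone_out X Y f i (act (cmod (cone X Y f) i) h v) = act (cmod (cshift 1 X) i) h (cone_out X Y f i v)"
      if "v \<in> carr (cmod (cone X Y f) i)" for h v
      unfolding cone_out_apply[OF that] cone_out_apply[OF modl_act[OF mC that]]
      by (simp add: cone_simps sum_module_simps)
    show "cone_out X Y f i (v + w) = cone_out X Y f i v + cone_out X Y f i w"
      if "v \<in> carr (cmod (cone X Y f) i)" "w \<in> carr (cmod (cone X Y f) i)" for v w
      unfolding cone_out_apply[OF that(1)] cone_out_apply[OF that(2)] cone_out_apply[OF modl_add[OF mC that]] by simp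
  qed
  fix u assume u: "u \<in> carr (cmod (cone X Y f) i)"
  then have u': "evens u \<in> carr (cmod X (i + 1))" "odds u \<in> carr (cmod Y i)" by (auto simp: cone_simps sum_module_simps)
  show "cone_out X Y f (i + 1) (diff (cone X Y f) i u) = diff (cshift 1 X) i (cone_out X Y f i u)"
    unfolding cone_out_apply[OF u] cone_out_apply[OF hom_in[OF cx_diff[OF cx_cone[OF assms]] u]]
    unfolding cone_simps(3)[OF u'] by simp
qed

lemma cone_out_in:
  assumes X: "cx X" and Y: "cx Y" and f: "f \<in> chain_map X Y"
  shows "cmap_comp (cone_out X Y f) (cone_in Y) = 0"
  unfolding cmap_comp_def
proof (rule ext, rule ext)
  fix i v
  show "(cone_out X Y f i \<circ> cone_in Y i) v = 0 i v"
  proof (cases "v \<in> carr (cmod Y i)")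
    case True
    then have "interleave 0 v \<in> carr (cmod (cone X Y f) i)" using cx_modl[OF X] by (simp add: cone_simps sum_module_simps)
    from cone_out_apply[OF this] show ?thesis using True by (simp add: cone_in_apply)
  next
    case False
    then show ?thesis using hom_0[OF cm_hom[OF cone_out_cm[OF assms]] cx_modl[OF cx_cone[OF assms]], of i]
      by (simp add: cone_in_def restr0_def)
  qed
qed

text \<open>A diagram chase: injectivity on cohomology bounds the first component of a cocycle of
  the cone, surjectivity repairs the second.\<close>

lemma cone_acyclic:
  assumes X: "cx X" and Y: "cx Y" and q: "quasi_iso X Y f"
  shows "exact_at (cone X Y f) i"
  unfolding exact_at_def
proof
  note Q = q[unfolded quasi_iso_iff[OF X Y]]
  have f: "f \<in> chain_map X Y" using Q by blast
  note mX = cx_modl[OF X] and mY = cx_modl[OF Y]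
  fix u assume u: "u \<in> cocycles (cone X Y f) i"
  let ?x = "evens u" and ?y = "odds u"
  have u': "?x \<in> carr (cmod X (i + 1))" "?y \<in> carr (cmod Y i)" using cocyclesD(1)[OF u] by (auto simp: cone_simps sum_module_simps)
  have z: "- diff X (i + 1) ?x = 0" "f (i + 1) ?x + diff Y i ?y = 0"
    using arg_cong[OF cocyclesD(2)[OF u], of evens] arg_cong[OF cocyclesD(2)[OF u], of odds] unfolding cone_simps(3)[OF u'] by simp_all
  have xZ: "?x \<in> cocycles X (i + 1)" using z(1) u'(1) by (intro cocyclesI) simp_all
  have "f (i + 1) ?x = - diff Y i ?y" using z(2) by (simp add: eq_neg_iff_add_eq_0)
  also have "\<dots> = diff Y i (- ?y)" using hom_neg[OF cx_diff[OF Y] mY u'(2)] by simp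
  finally have "f (i + 1) ?x \<in> coboundaries Y (i + 1)" using coboundariesI[of "- ?y" Y "i + 1"] u'(2) mY by simp
  then have "?x \<in> coboundaries X (i + 1)" using Q xZ by blast
  then obtain w where w: "w \<in> carr (cmod X i)" "?x = diff X i w" by (rule coboundariesE) simp
  have fw: "f i w \<in> carr (cmod Y i)" using hom_in[OF cm_hom[OF f] w(1)] .
  have "diff Y i (?y + f i w) = diff Y i ?y + f (i + 1) ?x"
    unfolding w(2) cm_comm[OF f] using hom_add[OF cx_diff[OF Y] u'(2) fw] .
  then have "?y + f i w \<in> cocycles Y i" using z(2) u'(2) fw mY by (intro cocyclesI) (simp_all add: add.commute)
  \<comment> \<open>The bound \<open>w\<close> is determined only up to cocycles. The cocycle
    \<open>x'\<close> is chosen so that with x' - w in the first place the defect in the second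
    place is a coboundary.\<close>
  then obtain x' where x': "x' \<in> cocycles X i" "?y + f i w - f i x' \<in> coboundaries Y i" using Q by blast
  obtain y' where y': "y' \<in> carr (cmod Y (i - 1))" "?y + f i w - f i x' = diff Y (i - 1) y'"
    using x'(2) by (rule coboundariesE)
  let ?a = "x' - w"
  have a: "?a \<in> carr (cmod X i)" using cocyclesD(1)[OF x'(1)] w mX by simp
  have "diff X i ?a = - ?x"
    using hom_diff[OF cx_diff[OF X] mX cocyclesD(1)[OF x'(1)] w(1)] cocyclesD(2)[OF x'(1)] w(2) by simp
  moreover have "f i ?a + diff Y (i - 1) y' = ?y"
    using hom_diff[OF cm_hom[OF f] mX cocyclesD(1)[OF x'(1)] w(1)] y'(2)[symmetric] by simp
  ultimately have "diff (cone X Y f) (i - 1) (interleave ?a y') = u"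
    using cone_simps(3)[of "interleave ?a y'" X "i - 1" Y f] a y'(1) by simp
  moreover have "interleave ?a y' \<in> carr (cmod (cone X Y f) (i - 1))" using a y'(1) by (simp add: cone_simps sum_module_simps)
  ultimately show "u \<in> coboundaries (cone X Y f) i" using coboundariesI by blast
qed

text \<open>A null homotopy into the cone is a pair of families. Its even part is a chain map to
  \<open>X\<close>, and its odd part is a homotopy between \<open>w\<close> and the composite of
  \<open>f\<close> with that chain map.\<close>

lemma cone_factor:
  assumes X: "cx X" and Y: "cx Y" and P: "cx P" and f: "f \<in> chain_map X Y" and w: "w \<in> chain_map P Y"
    and h: "homotopic P (cone X Y f) (cmap_comp (cone_in Y) w) 0"
  shows "\<exists>a \<in> chain_map P X. homotopic P Y (cmap_comp f a) w"
proof -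
  obtain k where k: "\<And>i. k i \<in> mod_hom (cmod P i) (cmod (cone X Y f) (i - 1))"
    "\<And>i v. cmap_comp (cone_in Y) w i v - 0 i v = diff (cone X Y f) (i - 1) (k i v) + k (i + 1) (diff P i v)"
    using homotopicE[OF h] by blast
  let ?a = "\<lambda>i v. evens (k i v)" and ?b = "\<lambda>i v. odds (k i v)"
  have a: "?a i \<in> mod_hom (cmod P i) (cmod X i)" and b: "?b i \<in> mod_hom (cmod P i) (cmod Y (i - 1))" for i
    using hom_evens[OF k(1)[of i, unfolded cone_simps(2)]] hom_odds[OF k(1)[of i, unfolded cone_simps(2)]] by simp_all
  have e: "interleave 0 (w i v) = interleave (- diff X i (?a i v)) (f i (?a i v) + diff Y (i - 1) (?b i v)) + k (i + 1) (diff P i v)"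
    if v: "v \<in> carr (cmod P i)" for i v
    using k(2)[of i v] cone_simps(3)[of "k i v" X "i - 1" Y f] hom_in[OF a v] hom_in[OF b v] hom_in[OF cm_hom[OF w] v]
    by (simp add: cmap_comp_def cone_in_apply)
  have e1: "0 = - diff X i (?a i v) + ?a (i + 1) (diff P i v)"
    and e2: "w i v = f i (?a i v) + diff Y (i - 1) (?b i v) + ?b (i + 1) (diff P i v)" if v: "v \<in> carr (cmod P i)" for i v
    using arg_cong[OF e[OF v], of evens] arg_cong[OF e[OF v], of odds] by simp_all
  have ac: "?a \<in> chain_map P X"
  proof (rule chain_mapI[OF P X a])
    fix i v assume "v \<in> carr (cmod P i)"
    from e1[OF this] show "?a (i + 1) (diff P i v) = diff X i (?a i v)" by (metis add.commute diff_add_cancel diff_conv_add_uminus add_0)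
  qed
  have "homotopic P Y w (cmap_comp f ?a)"
  proof (rule homotopicI[OF w cm_comp[OF ac f X] P Y b])
    fix i v assume "v \<in> carr (cmod P i)"
    from e2[OF this] show "w i v - cmap_comp f ?a i v = diff Y (i - 1) (?b i v) + ?b (i + 1) (diff P i v)"
      by (simp add: cmap_comp_def)
  qed
  then show ?thesis using ac homotopic_sym[OF _ w cm_comp[OF ac f X] P Y] by blast
qed

section \<open>Lifting through quasi-isomorphisms\<close>

text \<open>The cone of \<open>t\<close> is acyclic, so every map from \<open>P\<close> into it is
  null-homotopic; for \<open>w\<close> followed by the inclusion, \<open>cone_factor\<close> reads
  this as a lift.\<close>

lemma lift:
  assumes P: "perf P" and X: "cx X" and Y: "cx Y" and t: "quasi_iso X Y t" and w: "w \<in> chain_map P Y"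
  obtains a where "a \<in> chain_map P X" "homotopic P Y (cmap_comp t a) w"
proof -
  note tm = quasi_iso_cm[OF t] and cP = perf_cx[OF P]
  have "homotopic P (cone X Y t) (cmap_comp (cone_in Y) w) 0"
    using null_homotopic[OF P cx_cone[OF X Y tm] cm_comp[OF w cone_in_cm[OF X Y tm] Y]] cone_acyclic[OF X Y t] by blast
  then show ?thesis using cone_factor[OF X Y cP tm w] that by blast
qed

text \<open>The map \<open>a\<close> and a null homotopy \<open>b\<close> of its composite with
  \<open>t\<close> fit together to a chain map (a, -b) into the cone shifted by -1. That complex is
  acyclic, and the even part of a null homotopy is the one sought.\<close>

lemma lift_unique0:
  assumes P: "perf P" and X: "cx X" and Y: "cx Y" and t: "quasi_iso X Y t" and a: "a \<in> chain_map P X"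
    and h: "homotopic P Y (cmap_comp t a) 0"
  shows "homotopic P X a 0"
proof -
  note tm = quasi_iso_cm[OF t] and cP = perf_cx[OF P]
  obtain b where b: "\<And>i. b i \<in> mod_hom (cmod P i) (cmod Y (i - 1))"
    "\<And>i v. cmap_comp t a i v - 0 i v = diff Y (i - 1) (b i v) + b (i + 1) (diff P i v)"
    using homotopicE[OF h] by blast
  let ?C = "cshift (-1) (cone X Y t)" and ?c = "\<lambda>i v. interleave (a i v) (- b i v)"
  have C: "cx ?C" using cx_cshift[OF cx_cone[OF X Y tm]] .
  have nb: "(\<lambda>v. - b i v) \<in> mod_hom (cmod P i) (cmod Y (i - 1))" for i
    using hom_uminus[OF b(1)[of i] cx_modl[OF Y]] unfolding fun_Compl_def .
  have Cm: "cmod ?C i = sum_module (cmod X i) (cmod Y (i - 1))" for i by (simp add: cone_simps sum_module_simps)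
  have c: "?c i \<in> mod_hom (cmod P i) (cmod ?C i)" for i
    unfolding Cm using hom_pair[OF cm_hom[OF a] nb] .
  have cC: "?c \<in> chain_map P ?C"
  proof (rule chain_mapI[OF cP C c])
    fix i v assume v: "v \<in> carr (cmod P i)"
    have av: "a i v \<in> carr (cmod X i)" and bv: "- b i v \<in> carr (cmod Y (i - 1))"
      using hom_in[OF cm_hom[OF a] v] hom_in[OF nb v] .
    have "diff (cone X Y t) (i - 1) (?c i v) = interleave (- diff X i (a i v)) (t i (a i v) + diff Y (i - 1) (- b i v))"
      using cone_simps(3)[of "?c i v" X "i - 1" Y t] av bv by simp
    also have "diff Y (i - 1) (- b i v) = - diff Y (i - 1) (b i v)"
      using hom_neg[OF cx_diff[OF Y] cx_modl[OF Y] hom_in[OF b(1) v]] .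
    also have "t i (a i v) + - diff Y (i - 1) (b i v) = b (i + 1) (diff P i v)"
      using b(2)[of i v] by (simp add: cmap_comp_def)
    finally have D: "diff (cone X Y t) (i - 1) (?c i v) = interleave (- diff X i (a i v)) (b (i + 1) (diff P i v))" .
    have E: "diff ?C i = - diff (cone X Y t) (i - 1)" by simp
    have EE: "diff ?C i (?c i v) = - diff (cone X Y t) (i - 1) (?c i v)" unfolding E by (rule uminus_apply)
    have "diff ?C i (?c i v) = interleave (diff X i (a i v)) (- b (i + 1) (diff P i v))"
      unfolding EE D
      by (rule seq_eqI) (simp_all only: evens_interleave odds_interleave evens_simps odds_simps minus_minus)
    then show "?c (i + 1) (diff P i v) = diff ?C i (?c i v)" using cm_comm[OF a] by simp
  qed
  have H: "homotopic P ?C ?c 0"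
    using null_homotopic[OF P C cC] cone_acyclic[OF X Y t] exact_at_cshift[OF cx_cone[OF X Y tm]] by blast
  obtain k where k: "\<And>i. k i \<in> mod_hom (cmod P i) (cmod ?C (i - 1))"
    "\<And>i v. ?c i v - 0 i v = diff ?C (i - 1) (k i v) + k (i + 1) (diff P i v)" using homotopicE[OF H] by blast
  let ?e = "\<lambda>i v. evens (k i v)" and ?o = "\<lambda>i v. odds (k i v)"
  have e: "?e i \<in> mod_hom (cmod P i) (cmod X (i - 1))" and o: "?o i \<in> mod_hom (cmod P i) (cmod Y (i - 1 - 1))" for i
    using hom_evens[OF k(1)[of i, unfolded Cm]] hom_odds[OF k(1)[of i, unfolded Cm]] .
  show ?thesis
  proof (rule homotopicI[OF a cm_zero[OF cP X] cP X e])
    fix i v assume v: "v \<in> carr (cmod P i)"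
    have "diff ?C (i - 1) (k i v) = - diff (cone X Y t) (i - 1 - 1) (k i v)" by simp
    also have "\<dots> = - interleave (- diff X (i - 1) (?e i v)) (t (i - 1) (?e i v) + diff Y (i - 1 - 1) (?o i v))"
      using cone_simps(3)[of "k i v" X "i - 1 - 1" Y t] hom_in[OF e v] hom_in[OF o v] by simp
    finally have "evens (diff ?C (i - 1) (k i v)) = diff X (i - 1) (?e i v)" by simp
    then show "a i v - 0 i v = diff X (i - 1) (?e i v) + ?e (i + 1) (diff P i v)"
      using arg_cong[OF k(2)[of i v], of evens] by simp
  qed
qed

lemma lift_unique:
  assumes P: "perf P" and X: "cx X" and Y: "cx Y" and t: "quasi_iso X Y t"
    and a: "a \<in> chain_map P X" "a' \<in> chain_map P X"
    and h: "homotopic P Y (cmap_comp t a) (cmap_comp t a')"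
  shows "homotopic P X a a'"
proof -
  note tm = quasi_iso_cm[OF t] and cP = perf_cx[OF P]
  have d: "a - a' \<in> chain_map P X" using cm_minus[OF a cP X] .
  have "cmap_comp t (a - a') + cmap_comp t a' = cmap_comp t a"
    using cm_comp_plus_r[OF d a(2) tm X] by simp
  then have "cmap_comp t (a - a') = cmap_comp t a - cmap_comp t a'" by (metis add_diff_cancel_right')
  then have "homotopic P Y (cmap_comp t (a - a')) 0" using h unfolding homotopic_0[of _ _ "cmap_comp t a"] by simp
  from lift_unique0[OF P X Y t d this] show ?thesis unfolding homotopic_0[of _ _ a] .
qed

end

section \<open>The derived category\<close>

locale hered =
  fixes sc :: "'k::field \<Rightarrow> 'h::ring_1 \<Rightarrow> 'h"
  assumes hereditary: "hereditary_algebra sc"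

sublocale hered \<subseteq> fd_algebra sc
  using hereditary unfolding hereditary_algebra_def by blast

section \<open>Bounded projective resolutions\<close>

context hered
begin

lemma projective_sub:
  assumes P: "projective_module sc P" and W: "W \<subseteq> carr P" "fg_module sc (sub P W)"
  shows "projective_module sc (sub P W)"
proof -
  have "submodule_of sc (sub P W) P" unfolding submodule_of_def using W by simp
  then show ?thesis using hereditary P unfolding hereditary_algebra_def by blast
qed

text \<open>\<open>P\<close> resolves \<open>X\<close> in degrees above \<open>m\<close>; it is extended downwards degree by degree.\<close>

definition partial_res :: "('h, 'k) cpx \<Rightarrow> int \<Rightarrow> ('h, 'k) cpx \<Rightarrow> 'k cmap \<Rightarrow> bool" where
  "partial_res X m P f \<longleftrightarrow> perf P \<and> f \<in> chain_map P X \<and> (\<forall>i<m. carr (cmod P i) = {0}) \<and>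
     (\<forall>i>m. \<forall>p \<in> cocycles P i. f i p \<in> coboundaries X i \<longrightarrow> p \<in> coboundaries P i) \<and>
     (\<forall>i\<ge>m. \<forall>x \<in> cocycles X i. \<exists>p \<in> cocycles P i. f i p = x)"

text \<open>The common core of the generic and of the last step. By \<open>s\<close>, the module
  \<open>Q\<close> maps onto the pairs (x, p) with dx = f p and dp = 0. The pairs with p a given
  cocycle whose image bounds give exactness in degree \<open>m\<close>; the pairs (x, 0) give
  surjectivity in degree m - 1.\<close>

lemma partial_res_extend:
  assumes X: "cx X" and R: "partial_res X m P f" and Q: "projective_module sc Q"
    and e: "e \<in> mod_hom Q (cmod X (m - 1))" and \<delta>: "\<delta> \<in> mod_hom Q (cmod P m)"
    and ed: "\<And>q. q \<in> carr Q \<Longrightarrow> diff X (m - 1) (e q) = f m (\<delta> q)" "\<And>q. q \<in> carr Q \<Longrightarrow> diff P m (\<delta> q) = 0"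
    and s: "\<And>x p. \<lbrakk>x \<in> carr (cmod X (m - 1)); p \<in> carr (cmod P m); diff X (m - 1) x = f m p; diff P m p = 0\<rbrakk>
      \<Longrightarrow> \<exists>q \<in> carr Q. e q = x \<and> \<delta> q = p"
  shows "\<exists>P' f'. partial_res X (m - 1) P' f' \<and> cmod P' (m - 1) = Q \<and> diff P' (m - 1) = \<delta>"
proof -
  have P: "perf P" and f: "f \<in> chain_map P X" and z: "\<And>i. i < m \<Longrightarrow> carr (cmod P i) = {0}"
    and inj: "\<And>i p. \<lbrakk>m < i; p \<in> cocycles P i; f i p \<in> coboundaries X i\<rbrakk> \<Longrightarrow> p \<in> coboundaries P i"
    and surj: "\<And>i x. \<lbrakk>m \<le> i; x \<in> cocycles X i\<rbrakk> \<Longrightarrow> \<exists>p \<in> cocycles P i. f i p = x"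
    using R unfolding partial_res_def by blast+
  note cP = perf_cx[OF P]
  have Qm: "modl Q" using Q projective_fg fg_module_modl by blast
  let ?P = "\<lparr>cmod = (cmod P)(m - 1 := Q), diff = (diff P)(m - 1 := \<delta>)\<rparr>" and ?f = "f(m - 1 := e)"
  have dz: "diff P i = 0" if "i < m" for i
  proof
    fix v show "diff P i v = 0 v"
      using hom_out[OF cx_diff[OF cP], of v i] hom_0[OF cx_diff[OF cP] cx_modl[OF cP], of i] z[OF that] by (cases "v = 0") auto
  qed
  obtain n where n: "0 \<le> n" "\<And>i. n < \<bar>i\<bar> \<Longrightarrow> carr (cmod P i) = {0}" using cx_bound[OF cP] by blast
  have dP: "diff ?P i \<in> mod_hom (cmod ?P i) (cmod ?P (i + 1))" for i
  proof -
    consider "i = m - 1" | "i = m - 2" | "i \<noteq> m - 1" "i + 1 \<noteq> m - 1" by linarith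
    then show ?thesis
    proof cases
      case 1
      then show ?thesis using \<delta> by simp
    next
      case 2
      then show ?thesis using dz[of "m - 2"] hom_zero[OF cx_modl[OF cP] Qm, of "m - 2"] by simp
    next
      case 3
      then show ?thesis using cx_diff[OF cP] by simp
    qed
  qed
  have C: "cx ?P"
  proof (rule cxI[where n = "max n \<bar>m - 1\<bar>"])
    show "fg_module sc (cmod ?P i)" for i using cx_fg[OF cP] projective_fg[OF Q] by simp
    show "diff ?P i \<in> mod_hom (cmod ?P i) (cmod ?P (i + 1))" for i by (rule dP)
    show "carr (cmod ?P i) = {0}" if "max n \<bar>m - 1\<bar> < \<bar>i\<bar>" for i using n that by auto
    fix i v assume v: "v \<in> carr (cmod ?P i)"
    consider "i = m - 1" | "i = m - 2" | "i \<noteq> m - 1" "i + 1 \<noteq> m - 1" by linarith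
    then show "diff ?P (i + 1) (diff ?P i v) = 0"
    proof cases
      case 1
      then show ?thesis using ed(2) v by simp
    next
      case 2
      then show ?thesis using dz[of "m - 2"] hom_0[OF \<delta> Qm] by simp
    next
      case 3
      then show ?thesis using cx_dd[OF cP] by simp
    qed
  qed
  have F: "?f \<in> chain_map ?P X"
  proof (rule chain_mapI[OF C X])
    show "?f i \<in> mod_hom (cmod ?P i) (cmod X i)" for i using cm_hom[OF f] e by simp
    fix i v assume v: "v \<in> carr (cmod ?P i)"
    consider "i = m - 1" | "i = m - 2" | "i \<noteq> m - 1" "i + 1 \<noteq> m - 1" by linarith
    then show "?f (i + 1) (diff ?P i v) = diff X i (?f i v)"
    proof cases
      case 1
      then show ?thesis using ed(1) v by simp
    next
      case 2
      then have "v = 0" using z[of "m - 2"] v by simp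
      moreover have "f (m - 2) 0 = 0" "diff X (m - 2) 0 = 0" "e 0 = 0"
        using hom_0[OF cm_hom[OF f] cx_modl[OF cP]] hom_0[OF cx_diff[OF X] cx_modl[OF X]] hom_0[OF e Qm] by blast+
      ultimately show ?thesis using 2 dz[of "m - 2"] by simp
    next
      case 3
      then show ?thesis using cm_comm[OF f] by simp
    qed
  qed
  have "projective_module sc (cmod ?P i)" for i using P Q unfolding perf_def by simp
  then have pP: "perf ?P" unfolding perf_def using C by blast
  have Zm: "cocycles ?P i = cocycles P i" if "m \<le> i" for i using that unfolding cocycles_def by simp
  have Bm: "coboundaries ?P i = coboundaries P i" if "m < i" for i using that unfolding coboundaries_def by simp
  have "partial_res X (m - 1) ?P ?f" unfolding partial_res_def
  proof (intro conjI allI impI ballI pP F)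
    show "carr (cmod ?P i) = {0}" if "i < m - 1" for i using z that by simp
  next
    fix i p assume i: "m - 1 < i" and p: "p \<in> cocycles ?P i" "?f i p \<in> coboundaries X i"
    show "p \<in> coboundaries ?P i"
    proof (cases "i = m")
      case True
      obtain x where x: "x \<in> carr (cmod X (m - 1))" "f m p = diff X (m - 1) x"
        using p(2) True by (auto elim: coboundariesE)
      have "p \<in> cocycles P m" using p(1) True Zm by simp
      then obtain q where "q \<in> carr Q" "\<delta> q = p"
        using s[OF x(1) _ x(2)[symmetric]] cocyclesD[of p P m] by blast
      then show ?thesis using True coboundariesI[of q ?P m] by simp
    next
      case False
      then show ?thesis using inj[of i p] i p Zm[of i] Bm[of i] by simp
    qed
  next
    fix i x assume i: "m - 1 \<le> i" and x: "x \<in> cocycles X i"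
    show "\<exists>p \<in> cocycles ?P i. ?f i p = x"
    proof (cases "i = m - 1")
      case True
      have "f m 0 = 0" "diff P m 0 = 0" "0 \<in> carr (cmod P m)"
        using hom_0[OF cm_hom[OF f] cx_modl[OF cP]] hom_0[OF cx_diff[OF cP] cx_modl[OF cP]] modl_0[OF cx_modl[OF cP]] by blast+
      then obtain q where "q \<in> carr Q" "e q = x" "\<delta> q = 0"
        using s[of x 0] cocyclesD[OF x] True by auto
      then show ?thesis using True by (intro bexI[of _ q] cocyclesI) simp_all
    next
      case False
      then show ?thesis using surj[of i x] i x Zm[of i] by simp
    qed
  qed
  then show ?thesis by (intro exI[of _ ?P] exI[of _ ?f]) simp
qed

text \<open>The compatible pairs form a finitely generated module \<open>?W\<close>, a pullback, and
  any projective module mapping onto it serves as the new term.\<close>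

lemma partial_res_step:
  assumes X: "cx X" and R: "partial_res X m P f"
  shows "\<exists>P' f'. partial_res X (m - 1) P' f'"
proof -
  have P: "perf P" and f: "f \<in> chain_map P X" using R unfolding partial_res_def by blast+
  note cP = perf_cx[OF P]
  let ?S = "sum_module (cmod X (m - 1)) (cmod P m)"
  let ?W = "{u. evens u \<in> carr (cmod X (m - 1)) \<and> odds u \<in> carr (cmod P m) \<and>
    diff X (m - 1) (evens u) = f m (odds u) \<and> diff P m (odds u) = 0}"
  note mX = cx_modl[OF X] and mP = cx_modl[OF cP]
  note dX = cx_diff'[OF X, of m] and dP = cx_diff[OF cP, of m] and fm = cm_hom[OF f, of m]
  have K: "fg_module sc (sub ?S ?W)"
  proof (rule fg_sub)
    show "fg_module sc ?S" using fg_sum_module cx_fg X cP by blast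
    show "?W \<subseteq> carr ?S" by (auto simp: sum_module_simps)
    show "sq.subspace ?W" unfolding sq.subspace_def
    proof (intro conjI ballI allI)
      show "0 \<in> ?W" using hom_0[OF dX mX] hom_0[OF dP mP] hom_0[OF fm mP] mX mP by simp
      show "x + y \<in> ?W" if "x \<in> ?W" "y \<in> ?W" for x y
        using that hom_add[OF dX, of "evens x" "evens y"] hom_add[OF dP, of "odds x" "odds y"]
          hom_add[OF fm, of "odds x" "odds y"] mX mP by simp
      show "seq_scale c x \<in> ?W" if "x \<in> ?W" for c x
        using that hom_scale[OF dX mX mX, of "evens x" c] hom_scale[OF dP mP mP, of "odds x" c]
          hom_scale[OF fm mP mX, of "odds x" c] mX mP by simp
    qed
    show "act ?S h v \<in> ?W" if "v \<in> ?W" for h v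
      using that hom_act[OF dX, of "evens v" h] hom_act[OF dP, of "odds v" h]
          hom_act[OF fm, of "odds v" h] mX mP by (simp add: sum_module_simps)
  qed
  obtain Q q where Q: "projective_module sc Q" "q \<in> mod_hom Q (sub ?S ?W)" "q ` carr Q = carr (sub ?S ?W)"
    using projective_cover[OF K] by blast
  have qS: "q \<in> mod_hom Q ?S" using hom_sub_codomainD[OF Q(2)] by (auto simp: sum_module_simps)
  have qW: "q v \<in> ?W" if "v \<in> carr Q" for v using hom_in[OF Q(2) that] by simp
  have "\<exists>P' f'. partial_res X (m - 1) P' f' \<and> cmod P' (m - 1) = Q \<and> diff P' (m - 1) = (\<lambda>v. odds (q v))"
  proof (rule partial_res_extend[OF X R Q(1) hom_evens[OF qS] hom_odds[OF qS]])
    show "diff X (m - 1) (evens (q v)) = f m (odds (q v))" if "v \<in> carr Q" for v using qW[OF that] by blast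
    show "diff P m (odds (q v)) = 0" if "v \<in> carr Q" for v using qW[OF that] by blast
    fix x p assume xp: "x \<in> carr (cmod X (m - 1))" "p \<in> carr (cmod P m)" "diff X (m - 1) x = f m p" "diff P m p = 0"
    then have "interleave x p \<in> q ` carr Q" unfolding Q(3) by simp
    then obtain v where "interleave x p = q v" "v \<in> carr Q" by (rule imageE)
    then show "\<exists>v \<in> carr Q. evens (q v) = x \<and> odds (q v) = p"
      by (intro bexI[of _ v]) (simp_all flip: \<open>interleave x p = q v\<close>)
  qed
  then show ?thesis by blast
qed

text \<open>Once \<open>X\<close> vanishes below \<open>m\<close>, the compatible pairs reduce to a
  submodule of the projective module in degree \<open>m\<close>. It is projective by heredity, so it
  can be added itself; its map to degree \<open>m\<close> is injective and the resolution
  stops.\<close>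

lemma partial_res_last:
  assumes X: "cx X" and R: "partial_res X m P f" and z: "\<And>i. i < m \<Longrightarrow> carr (cmod X i) = {0}"
  shows "\<exists>P' f'. perf P' \<and> quasi_iso P' X f'"
proof -
  have P: "perf P" and f: "f \<in> chain_map P X" using R unfolding partial_res_def by blast+
  note cP = perf_cx[OF P]
  note mX = cx_modl[OF X] and mP = cx_modl[OF cP]
  note dP = cx_diff[OF cP, of m] and fm = cm_hom[OF f, of m]
  let ?W = "{p \<in> carr (cmod P m). diff P m p = 0} \<inter> {p \<in> carr (cmod P m). f m p = 0}"
  let ?Q = "sub (cmod P m) ?W"
  have Q: "fg_module sc ?Q"
  proof (rule fg_sub[OF cx_fg[OF cP]])
    show "sq.subspace ?W" using subspace_kernel(1)[OF dP mP mP] subspace_kernel(1)[OF fm mP mX] by (rule sq.subspace_inter)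
    show "act (cmod P m) h v \<in> ?W" if "v \<in> ?W" for h v
      using that subspace_kernel(2)[OF dP mP mP, of v h] subspace_kernel(2)[OF fm mP mX, of v h] mP by simp
  qed blast
  have pQ: "projective_module sc ?Q" using projective_sub[OF _ _ Q] P unfolding perf_def by blast
  let ?i = "restr0 ?W (\<lambda>v. v)"
  have i: "?i \<in> mod_hom ?Q (cmod P m)"
    using hom_sub_codomainD[of ?i ?Q "cmod P m" ?W] hom_id[OF fg_module_modl[OF Q]] by auto
  have ex: "\<exists>P' f'. partial_res X (m - 1) P' f' \<and> cmod P' (m - 1) = ?Q \<and> diff P' (m - 1) = ?i"
  proof (rule partial_res_extend[OF X R pQ hom_zero[OF fg_module_modl[OF Q] mX] i])
    have d0: "diff X (m - 1) 0 = 0" using hom_0[OF cx_diff[OF X] mX] .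
    show "diff X (m - 1) (0 q) = f m (?i q)" if "q \<in> carr ?Q" for q using that d0 by (simp add: restr0_def)
    show "diff P m (?i q) = 0" if "q \<in> carr ?Q" for q using that by (simp add: restr0_def)
    fix x p assume xp: "x \<in> carr (cmod X (m - 1))" "p \<in> carr (cmod P m)" "diff X (m - 1) x = f m p" "diff P m p = 0"
    then have "x = 0" using z[of "m - 1"] by simp
    then show "\<exists>q \<in> carr ?Q. 0 q = x \<and> ?i q = p" using xp d0 by (intro bexI[of _ p]) (simp_all add: restr0_def)
  qed
  then obtain P' f' where R': "partial_res X (m - 1) P' f'" and c: "cmod P' (m - 1) = ?Q" "diff P' (m - 1) = ?i" by blast
  have P': "perf P'" and f': "f' \<in> chain_map P' X" and z': "\<And>i. i < m - 1 \<Longrightarrow> carr (cmod P' i) = {0}"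
    and inj: "\<And>i p. \<lbrakk>m - 1 < i; p \<in> cocycles P' i; f' i p \<in> coboundaries X i\<rbrakk> \<Longrightarrow> p \<in> coboundaries P' i"
    and surj: "\<And>i x. \<lbrakk>m - 1 \<le> i; x \<in> cocycles X i\<rbrakk> \<Longrightarrow> \<exists>p \<in> cocycles P' i. f' i p = x"
    using R' unfolding partial_res_def by blast+
  note cP' = perf_cx[OF P']
  have "quasi_iso P' X f'" unfolding quasi_iso_iff[OF cP' X]
  proof (intro conjI allI ballI impI f')
    fix i p assume p: "p \<in> cocycles P' i" "f' i p \<in> coboundaries X i"
    show "p \<in> coboundaries P' i"
    proof (cases "m - 1 < i")
      case False
      have "p = 0"
      proof (cases "i = m - 1")
        case True
        then show ?thesis using cocyclesD[OF p(1)] c by (simp add: restr0_def)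
      next
        case F: False
        then show ?thesis using cocyclesD(1)[OF p(1)] z'[of i] False by simp
      qed
      then show ?thesis using coboundary_0[OF cP'] by simp
    qed (use inj p in blast)
  next
    fix i x assume x: "x \<in> cocycles X i"
    show "\<exists>p \<in> cocycles P' i. x - f' i p \<in> coboundaries X i"
    proof (cases "m - 1 \<le> i")
      case True
      then obtain p where "p \<in> cocycles P' i" "f' i p = x" using surj x by blast
      then show ?thesis using coboundary_0[OF X] by (intro bexI[of _ p]) simp_all
    next
      case False
      then have "x = 0" using cocyclesD(1)[OF x] z[of i] by simp
      moreover have "f' i 0 = 0" using hom_0[OF cm_hom[OF f'] cx_modl[OF cP']] .
      ultimately show ?thesis using coboundary_0[OF X] coboundary_in_cocycles[OF cP' coboundary_0[OF cP']]
        by (intro bexI[of _ 0]) simp_all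
    qed
  qed
  then show ?thesis using P' by blast
qed

theorem ex_resolution:
  assumes X: "cx X"
  shows "\<exists>P f. perf P \<and> quasi_iso P X f"
proof -
  obtain n where n: "0 \<le> n" "\<And>i. n < \<bar>i\<bar> \<Longrightarrow> carr (cmod X i) = {0}" using cx_bound[OF X] by blast
  have "\<exists>P f. partial_res X (n + 1 - int k) P f" for k
  proof (induction k)
    case 0
    let ?P = "stalk zero_module :: ('h, 'k) cpx"
    have c: "cmod ?P i = zero_module" for i by (simp add: stalk_def)
    have zc: "carr (zero_module :: ('h, 'k) fmod) = {0}" by (simp add: zero_module_def)
    have m: "modl zero_module" using fg_module_modl[OF fg_zero_module] .
    have d: "diff ?P i = 0" for i by (simp add: stalk_def)
    have C: "cx ?P" by (rule cxI) (simp_all add: c d fg_zero_module hom_zero[OF m m] zc)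
    have P: "perf ?P" unfolding perf_def c using C projective_zero[OF zc fg_zero_module] by blast
    have "partial_res X (n + 1) ?P 0" unfolding partial_res_def
    proof (intro conjI allI impI ballI P cm_zero[OF C X])
      show "carr (cmod ?P i) = {0}" for i unfolding c zc ..
      show "p \<in> coboundaries ?P i" if "p \<in> cocycles ?P i" for i p
      proof -
        have "p = 0" using cocyclesD(1)[OF that] unfolding c zc by blast
        then show ?thesis using coboundary_0[OF C] by simp
      qed
      show "\<exists>p \<in> cocycles ?P i. 0 i p = x" if "n + 1 \<le> i" "x \<in> cocycles X i" for i x
      proof -
        have "x = 0" using cocyclesD(1)[OF that(2)] n that(1) by simp
        then show ?thesis using coboundary_in_cocycles[OF C coboundary_0[OF C]] by (intro bexI[of _ 0]) simp_all
      qed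
    qed
    moreover have "n + 1 - int 0 = n + 1" by simp
    ultimately show ?case by metis
  next
    case (Suc k)
    have e: "n + 1 - int (Suc k) = n + 1 - int k - 1" by simp
    show ?case unfolding e using Suc partial_res_step[OF X] by blast
  qed
  \<comment> \<open>After 2 n + 1 steps down from n + 1 the lower end is -n, below which
    \<open>X\<close> vanishes.\<close>
  then obtain P f where R: "partial_res X (n + 1 - int (nat (2 * n + 1))) P f" by blast
  have "carr (cmod X i) = {0}" if "i < n + 1 - int (nat (2 * n + 1))" for i using n that by simp
  then show ?thesis using partial_res_last[OF X R] by blast
qed

end

section \<open>Roofs as chain maps from a projective resolution\<close>

context fd_algebra
begin

text \<open>Homotopy bundled with the typing of its data, so that it can be chained in
  calculations.\<close>

definition hq :: "('h, 'k) cpx \<Rightarrow> ('h, 'k) cpx \<Rightarrow> 'k cmap \<Rightarrow> 'k cmap \<Rightarrow> bool" where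
  "hq X Y f g \<longleftrightarrow> cx X \<and> cx Y \<and> f \<in> chain_map X Y \<and> g \<in> chain_map X Y \<and> homotopic X Y f g"

lemma hqD: "hq X Y f g \<Longrightarrow> f \<in> chain_map X Y" "hq X Y f g \<Longrightarrow> g \<in> chain_map X Y" "hq X Y f g \<Longrightarrow> homotopic X Y f g"
  unfolding hq_def by blast+

lemma hq_refl: "\<lbrakk>f \<in> chain_map X Y; cx X; cx Y\<rbrakk> \<Longrightarrow> hq X Y f f"
  unfolding hq_def using homotopic_refl by blast

lemma hq_sym: "hq X Y f g \<Longrightarrow> hq X Y g f"
  unfolding hq_def using homotopic_sym by blast

lemma hq_trans [trans]: "\<lbrakk>hq X Y f g; hq X Y g h\<rbrakk> \<Longrightarrow> hq X Y f h"
  unfolding hq_def using homotopic_trans[of X Y f g h] by blast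

lemma hq_l: "\<lbrakk>hq X Y f f'; g \<in> chain_map Y Z; cx Z\<rbrakk> \<Longrightarrow> hq X Z (cmap_comp g f) (cmap_comp g f')"
  unfolding hq_def using homotopic_comp_l[of X Y f f' g Z] cm_comp[of _ X Y g Z] by blast

lemma hq_r: "\<lbrakk>hq Y Z g g'; f \<in> chain_map X Y; cx X\<rbrakk> \<Longrightarrow> hq X Z (cmap_comp g f) (cmap_comp g' f)"
  unfolding hq_def using homotopic_comp_r[of Y Z g g' f X] cm_comp[of f X Y _ Z] by blast

lemma hq_plus: "\<lbrakk>hq X Y f f'; hq X Y g g'\<rbrakk> \<Longrightarrow> hq X Y (f + g) (f' + g')"
  unfolding hq_def using homotopic_plus[of X Y f f' g g'] cm_plus by blast

lemma lift_hq:
  assumes "perf P" "cx X" "cx Y" "quasi_iso X Y t" "w \<in> chain_map P Y"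
  obtains a where "a \<in> chain_map P X" "hq P Y (cmap_comp t a) w"
proof -
  obtain a where a: "a \<in> chain_map P X" "homotopic P Y (cmap_comp t a) w" using lift[OF assms] by blast
  then have "hq P Y (cmap_comp t a) w"
    unfolding hq_def using assms perf_cx cm_comp[OF a(1) quasi_iso_cm[OF assms(4)]] by blast
  then show ?thesis using that a(1) by blast
qed

lemma lift_unique_hq:
  assumes "perf P" "cx X" "quasi_iso X Y t" "a \<in> chain_map P X" "a' \<in> chain_map P X"
    "hq P Y (cmap_comp t a) (cmap_comp t a')"
  shows "hq P X a a'"
proof -
  have "cx Y" "homotopic P Y (cmap_comp t a) (cmap_comp t a')" using assms(6) unfolding hq_def by blast+
  then show ?thesis unfolding hq_def using lift_unique[OF assms(1,2) _ assms(3-5)] assms perf_cx by blast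
qed

lemma quasi_iso_hq: "\<lbrakk>quasi_iso X Y f; hq X Y f g\<rbrakk> \<Longrightarrow> quasi_iso X Y g"
  unfolding hq_def using quasi_iso_homotopic[of X Y f g] by blast

lemma in_roofs: "(W, s, f) \<in> roofs sc X Y \<longleftrightarrow> cx W \<and> quasi_iso W X s \<and> f \<in> chain_map W Y"
  unfolding roofs_def by blast

lemma roof_eq_def': "((W, s, f), (W', s', f')) \<in> roof_eq sc X Y \<longleftrightarrow>
     (W, s, f) \<in> roofs sc X Y \<and> (W', s', f') \<in> roofs sc X Y \<and>
     (\<exists>V. \<exists>u \<in> chain_map V W. \<exists>u' \<in> chain_map V W'. cx V \<and>
        quasi_iso V X (cmap_comp s u) \<and>
        homotopic V X (cmap_comp s u) (cmap_comp s' u') \<and>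
        homotopic V Y (cmap_comp f u) (cmap_comp f' u'))"
  unfolding roof_eq_def by simp

end

context hered
begin

definition res :: "('h, 'k) cpx \<Rightarrow> ('h, 'k) cpx" where
  "res X = (SOME P. perf P \<and> (\<exists>f. quasi_iso P X f))"

definition rp :: "('h, 'k) cpx \<Rightarrow> 'k cmap" where
  "rp X = (SOME f. quasi_iso (res X) X f)"

lemma res:
  assumes "cx X"
  shows perf_res: "perf (res X)" and quasi_iso_rp: "quasi_iso (res X) X (rp X)"
proof -
  have r: "perf (res X) \<and> (\<exists>f. quasi_iso (res X) X f)"
    using someI_ex[of "\<lambda>P. perf P \<and> (\<exists>f. quasi_iso P X f)"] ex_resolution[OF assms] unfolding res_def by blast
  then show "perf (res X)" by blast
  show "quasi_iso (res X) X (rp X)" using someI_ex[of "\<lambda>f. quasi_iso (res X) X f"] r unfolding rp_def by blast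
qed

lemma cx_res: "cx X \<Longrightarrow> cx (res X)"
  and rp_cm: "cx X \<Longrightarrow> rp X \<in> chain_map (res X) X"
  using res perf_cx quasi_iso_cm by blast+

text \<open>The value of a roof: \<open>a\<close> lifts the resolution through \<open>s\<close>,
  unique up to homotopy, and \<open>p\<close> is homotopic to f a. It represents f times the inverse
  of \<open>s\<close>, read on the resolution of \<open>X\<close>.\<close>

definition rv :: "('h, 'k) cpx \<Rightarrow> ('h, 'k) cpx \<Rightarrow> ('h, 'k) roof \<Rightarrow> 'k cmap \<Rightarrow> bool" where
  "rv X Y r p \<longleftrightarrow> (case r of (W, s, f) \<Rightarrow>
     (W, s, f) \<in> roofs sc X Y \<and> (\<exists>a \<in> chain_map (res X) W. hq (res X) X (cmap_comp s a) (rp X) \<and> hq (res X) Y (cmap_comp f a) p))"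

lemma rvE:
  assumes "rv X Y (W, s, f) p"
  obtains a where "a \<in> chain_map (res X) W" "hq (res X) X (cmap_comp s a) (rp X)" "hq (res X) Y (cmap_comp f a) p"
    "cx W" "quasi_iso W X s" "f \<in> chain_map W Y"
  using assms unfolding rv_def in_roofs by auto

lemma rvI:
  "\<lbrakk>cx W; quasi_iso W X s; f \<in> chain_map W Y; a \<in> chain_map (res X) W; hq (res X) X (cmap_comp s a) (rp X);
    hq (res X) Y (cmap_comp f a) p\<rbrakk> \<Longrightarrow> rv X Y (W, s, f) p"
  unfolding rv_def in_roofs by auto

lemma rv_ex:
  assumes X: "cx X" and Y: "cx Y" and r: "r \<in> roofs sc X Y"
  shows "\<exists>p \<in> chain_map (res X) Y. rv X Y r p"
proof -
  obtain W s f where rr: "r = (W, s, f)" by (cases r) auto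
  have W: "cx W" "quasi_iso W X s" "f \<in> chain_map W Y" using r unfolding rr in_roofs by blast+
  obtain a where a: "a \<in> chain_map (res X) W" "hq (res X) X (cmap_comp s a) (rp X)"
    using lift_hq[OF perf_res[OF X] W(1) X W(2) rp_cm[OF X]] by blast
  have "cmap_comp f a \<in> chain_map (res X) Y" using cm_comp[OF a(1) W(3,1)] .
  then show ?thesis unfolding rr using rvI[OF W a hq_refl] cx_res[OF X] Y by blast
qed

lemma rv_roofs: "rv X Y r p \<Longrightarrow> r \<in> roofs sc X Y"
  unfolding rv_def by auto

lemma rv_hq: "\<lbrakk>rv X Y r p; hq (res X) Y p p'\<rbrakk> \<Longrightarrow> rv X Y r p'"
  unfolding rv_def using hq_trans by (auto split: prod.splits)

lemma rv_unique:
  assumes X: "cx X" and Y: "cx Y" and 1: "rv X Y r p" and 2: "rv X Y r p'"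
  shows "hq (res X) Y p p'"
proof -
  obtain W s f where rr: "r = (W, s, f)" by (cases r) auto
  obtain a where a: "a \<in> chain_map (res X) W" "hq (res X) X (cmap_comp s a) (rp X)" "hq (res X) Y (cmap_comp f a) p"
    "cx W" "quasi_iso W X s" "f \<in> chain_map W Y" using rvE[OF 1[unfolded rr]] by blast
  obtain b where b: "b \<in> chain_map (res X) W" "hq (res X) X (cmap_comp s b) (rp X)" "hq (res X) Y (cmap_comp f b) p'"
    using rvE[OF 2[unfolded rr]] by blast
  have "hq (res X) W a b"
    using lift_unique_hq[OF perf_res[OF X] a(4,5) a(1) b(1) hq_trans[OF a(2) hq_sym[OF b(2)]]] .
  then have "hq (res X) Y (cmap_comp f a) (cmap_comp f b)" using hq_l a(6) Y by blast
  then show ?thesis using hq_trans[OF hq_sym[OF a(3)]] hq_trans[OF _ b(3)] by blast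
qed

text \<open>Equivalent roofs are those with a common value, since the lift of the resolution to the
  common denominator gives lifts to both sides. Hence the relation behaves as an equivalence and its
  classes are homotopy classes of chain maps.\<close>

lemma roof_eq_iff:
  assumes X: "cx X" and Y: "cx Y"
  shows "(r, r') \<in> roof_eq sc X Y \<longleftrightarrow> (\<exists>p. rv X Y r p \<and> rv X Y r' p)"
proof -
  obtain W s f where r: "r = (W, s, f)" by (cases r) auto
  obtain W' s' f' where r': "r' = (W', s', f')" by (cases r') auto
  note R = cx_res[OF X]
  show ?thesis
  proof
    assume "(r, r') \<in> roof_eq sc X Y"
    then obtain V u u' where V: "(W, s, f) \<in> roofs sc X Y" "(W', s', f') \<in> roofs sc X Y"
      "u \<in> chain_map V W" "u' \<in> chain_map V W'" "cx V" "quasi_iso V X (cmap_comp s u)"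
      "homotopic V X (cmap_comp s u) (cmap_comp s' u')" "homotopic V Y (cmap_comp f u) (cmap_comp f' u')"
      unfolding r r' roof_eq_def' by blast
    have W: "cx W" "quasi_iso W X s" "f \<in> chain_map W Y" "cx W'" "quasi_iso W' X s'" "f' \<in> chain_map W' Y"
      using V(1,2) unfolding in_roofs by blast+
    note sm = quasi_iso_cm[OF W(2)] quasi_iso_cm[OF W(5)]
    have h: "hq V X (cmap_comp s u) (cmap_comp s' u')" "hq V Y (cmap_comp f u) (cmap_comp f' u')"
      unfolding hq_def using V W X Y sm cm_comp by blast+
    obtain v where v: "v \<in> chain_map (res X) V" "hq (res X) X (cmap_comp (cmap_comp s u) v) (rp X)"
      using lift_hq[OF perf_res[OF X] V(5) X V(6) rp_cm[OF X]] by blast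
    have uv: "cmap_comp u v \<in> chain_map (res X) W" "cmap_comp u' v \<in> chain_map (res X) W'"
      using cm_comp[OF v(1) V(3) V(5)] cm_comp[OF v(1) V(4) V(5)] .
    have 1: "hq (res X) X (cmap_comp s (cmap_comp u v)) (rp X)" using v(2) unfolding cmap_comp_assoc .
    have 2: "hq (res X) X (cmap_comp s' (cmap_comp u' v)) (rp X)"
      using hq_trans[OF hq_sym[OF hq_r[OF h(1) v(1) R]] v(2)] unfolding cmap_comp_assoc .
    have 3: "hq (res X) Y (cmap_comp f' (cmap_comp u' v)) (cmap_comp f (cmap_comp u v))"
      using hq_sym[OF hq_r[OF h(2) v(1) R]] unfolding cmap_comp_assoc .
    have "rv X Y r (cmap_comp f (cmap_comp u v))"
      unfolding r using rvI[OF W(1-3) uv(1) 1 hq_refl[OF cm_comp[OF uv(1) W(3,1)] R Y]] .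
    moreover have "rv X Y r' (cmap_comp f (cmap_comp u v))" unfolding r' using rvI[OF W(4-6) uv(2) 2 3] .
    ultimately show "\<exists>p. rv X Y r p \<and> rv X Y r' p" by blast
  next
    assume "\<exists>p. rv X Y r p \<and> rv X Y r' p"
    then obtain p where p: "rv X Y r p" "rv X Y r' p" by blast
    obtain a where a: "a \<in> chain_map (res X) W" "hq (res X) X (cmap_comp s a) (rp X)" "hq (res X) Y (cmap_comp f a) p"
      using rvE[OF p(1)[unfolded r]] by blast
    obtain b where b: "b \<in> chain_map (res X) W'" "hq (res X) X (cmap_comp s' b) (rp X)" "hq (res X) Y (cmap_comp f' b) p"
      using rvE[OF p(2)[unfolded r']] by blast
    \<comment> \<open>The resolution itself is the common denominator; s a is homotopic to the
      quasi-isomorphism \<open>rp X\<close>.\<close>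
    have "quasi_iso (res X) X (cmap_comp s a)" using quasi_iso_hq[OF quasi_iso_rp[OF X] hq_sym[OF a(2)]] .
    then show "(r, r') \<in> roof_eq sc X Y"
      using rv_roofs[OF p(1)] rv_roofs[OF p(2)] a(1) b(1) R hqD(3)[OF hq_trans[OF a(2) hq_sym[OF b(2)]]]
        hqD(3)[OF hq_trans[OF a(3) hq_sym[OF b(3)]]]
      unfolding r r' roof_eq_def' by blast
  qed
qed

definition hcl :: "('h, 'k) cpx \<Rightarrow> ('h, 'k) cpx \<Rightarrow> 'k cmap \<Rightarrow> ('h, 'k) roof set" where
  "hcl X Y p = {r. rv X Y r p}"

lemma hcl_base: "\<lbrakk>cx X; cx Y; p \<in> chain_map (res X) Y\<rbrakk> \<Longrightarrow> (res X, rp X, p) \<in> hcl X Y p"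
proof -
  assume X: "cx X" and Y: "cx Y" and p: "p \<in> chain_map (res X) Y"
  note R = cx_res[OF X]
  show ?thesis unfolding hcl_def
    using rvI[OF R quasi_iso_rp[OF X] p cm_id[OF R]] hq_refl[OF rp_cm[OF X] R X] hq_refl[OF p R Y]
    by (simp add: cm_comp_id[OF rp_cm[OF X] R] cm_comp_id[OF p R])
qed

lemma roof_class: "\<lbrakk>cx X; cx Y; rv X Y r p\<rbrakk> \<Longrightarrow> roof_eq sc X Y `` {r} = hcl X Y p"
  unfolding hcl_def Image_singleton using roof_eq_iff rv_unique rv_hq by blast

lemma hcl_eq_iff: "\<lbrakk>cx X; cx Y; p \<in> chain_map (res X) Y; p' \<in> chain_map (res X) Y\<rbrakk> \<Longrightarrow> hcl X Y p = hcl X Y p' \<longleftrightarrow> hq (res X) Y p p'"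
proof
  assume o: "cx X" "cx Y" and p: "p \<in> chain_map (res X) Y" "p' \<in> chain_map (res X) Y" and e: "hcl X Y p = hcl X Y p'"
  have "(res X, rp X, p) \<in> hcl X Y p'" using hcl_base[OF o p(1)] unfolding e .
  then show "hq (res X) Y p p'" using rv_unique[OF o] hcl_base[OF o p(1)] unfolding hcl_def by blast
next
  assume "hq (res X) Y p p'"
  then show "hcl X Y p = hcl X Y p'" unfolding hcl_def using rv_hq hq_sym by blast
qed

section \<open>Hom groups and composition of the derived category\<close>

abbreviation D :: "(('h, 'k) cpx, ('h, 'k) roof set) cat" where "D \<equiv> Db sc"

lemma D_simps [simp]: "X \<in> Ob D \<longleftrightarrow> cx X" "Cmp D = derived_comp sc" "Idn D X = Q_map sc X X (cmap_id X)"
  "Add D = derived_add sc" "Nul D X Y = Q_map sc X Y 0"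
  by (simp_all add: Db_def)

lemma Hom_D: "\<lbrakk>cx X; cx Y\<rbrakk> \<Longrightarrow> \<alpha> \<in> Hom D X Y \<longleftrightarrow> (\<exists>p \<in> chain_map (res X) Y. \<alpha> = hcl X Y p)"
proof -
  assume o: "cx X" "cx Y"
  have h: "Hom D X Y = roofs sc X Y // roof_eq sc X Y" by (simp add: Db_def)
  show ?thesis unfolding h
  proof
    assume "\<alpha> \<in> roofs sc X Y // roof_eq sc X Y"
    then obtain r where r: "r \<in> roofs sc X Y" "\<alpha> = roof_eq sc X Y `` {r}" by (rule quotientE)
    then show "\<exists>p \<in> chain_map (res X) Y. \<alpha> = hcl X Y p" using rv_ex[OF o] roof_class[OF o] by blast
  next
    assume "\<exists>p \<in> chain_map (res X) Y. \<alpha> = hcl X Y p"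
    then obtain p where p: "p \<in> chain_map (res X) Y" "\<alpha> = hcl X Y p" by blast
    have b: "rv X Y (res X, rp X, p) p" using hcl_base[OF o p(1)] unfolding hcl_def by blast
    show "\<alpha> \<in> roofs sc X Y // roof_eq sc X Y"
      unfolding p(2) roof_class[OF o b, symmetric] using rv_roofs[OF b] by (rule quotientI)
  qed
qed

lemma Q_map_hcl:
  assumes o: "cx X" "cx Y" and f: "f \<in> chain_map X Y"
  shows "Q_map sc X Y f = hcl X Y (cmap_comp f (rp X))"
proof -
  note R = cx_res[OF o(1)] and m = rp_cm[OF o(1)]
  have "rv X Y (X, cmap_id X, f) (cmap_comp f (rp X))"
    by (rule rvI[OF o(1) quasi_iso_id[OF o(1)] f m])
      (simp_all add: cm_id_comp[OF m] hq_refl[OF m R o(1)] hq_refl[OF cm_comp[OF m f o(1)] R o(2)])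
  then show ?thesis unfolding Q_map_def using roof_class[OF o] by blast
qed

text \<open>\<open>q\<close> identifies the morphisms of the derived category with homotopy classes of chain maps
  between projective resolutions.\<close>

definition q :: "('h, 'k) cpx \<Rightarrow> ('h, 'k) cpx \<Rightarrow> 'k cmap \<Rightarrow> ('h, 'k) roof set" where
  "q X Y \<phi> = hcl X Y (cmap_comp (rp Y) \<phi>)"

lemma q_hcl:
  assumes o: "cx X" "cx Y" and p: "hq (res X) Y (cmap_comp (rp Y) \<phi>) p"
  shows "q X Y \<phi> = hcl X Y p"
  unfolding q_def using hcl_eq_iff[OF o hqD(1,2)[OF p]] p by blast

lemma ex_q_hcl:
  assumes o: "cx X" "cx Y" and p: "p \<in> chain_map (res X) Y"
  obtains \<phi> where "\<phi> \<in> chain_map (res X) (res Y)" "hq (res X) Y (cmap_comp (rp Y) \<phi>) p" "hcl X Y p = q X Y \<phi>"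
proof -
  obtain \<phi> where f: "\<phi> \<in> chain_map (res X) (res Y)" "hq (res X) Y (cmap_comp (rp Y) \<phi>) p"
    using lift_hq[OF perf_res[OF o(1)] cx_res[OF o(2)] o(2) quasi_iso_rp[OF o(2)] p] by blast
  then show ?thesis using that q_hcl[OF o f(2)] by metis
qed

lemma rp_q_cm: "\<lbrakk>cx X; cx Y; \<phi> \<in> chain_map (res X) (res Y)\<rbrakk> \<Longrightarrow> cmap_comp (rp Y) \<phi> \<in> chain_map (res X) Y"
  using cm_comp[OF _ rp_cm cx_res] by blast

lemma Hom_D_q: "\<lbrakk>cx X; cx Y\<rbrakk> \<Longrightarrow> \<alpha> \<in> Hom D X Y \<longleftrightarrow> (\<exists>\<phi> \<in> chain_map (res X) (res Y). \<alpha> = q X Y \<phi>)"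
proof
  assume o: "cx X" "cx Y" and "\<alpha> \<in> Hom D X Y"
  then obtain p where p: "p \<in> chain_map (res X) Y" "\<alpha> = hcl X Y p" using Hom_D[OF o] by blast
  show "\<exists>\<phi> \<in> chain_map (res X) (res Y). \<alpha> = q X Y \<phi>" using ex_q_hcl[OF o p(1)] p(2) by metis
next
  assume o: "cx X" "cx Y" and "\<exists>\<phi> \<in> chain_map (res X) (res Y). \<alpha> = q X Y \<phi>"
  then show "\<alpha> \<in> Hom D X Y" unfolding Hom_D[OF o] q_def using rp_q_cm[OF o] by blast
qed

lemma q_eq_iff:
  assumes o: "cx X" "cx Y" and f: "\<phi> \<in> chain_map (res X) (res Y)" "\<psi> \<in> chain_map (res X) (res Y)"
  shows "q X Y \<phi> = q X Y \<psi> \<longleftrightarrow> hq (res X) (res Y) \<phi> \<psi>"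
proof
  assume "q X Y \<phi> = q X Y \<psi>"
  then have "hq (res X) Y (cmap_comp (rp Y) \<phi>) (cmap_comp (rp Y) \<psi>)"
    unfolding q_def using hcl_eq_iff[OF o] rp_q_cm[OF o] f by blast
  then show "hq (res X) (res Y) \<phi> \<psi>"
    using lift_unique_hq[OF perf_res[OF o(1)] cx_res[OF o(2)] quasi_iso_rp[OF o(2)] f] by blast
next
  assume "hq (res X) (res Y) \<phi> \<psi>"
  then show "q X Y \<phi> = q X Y \<psi>"
    using q_hcl[OF o hq_l[OF _ rp_cm[OF o(2)] o(2)]] unfolding q_def by blast
qed

text \<open>\<open>derived_comp\<close> collects the results of all representatives and all
  completing squares. By \<open>main\<close> each of them has the same value; conversely one
  canonical square suffices to reach the whole class.\<close>

lemma comp_q: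
  assumes o: "cx X" "cx Y" "cx Z" and f: "\<phi> \<in> chain_map (res X) (res Y)" and g: "\<psi> \<in> chain_map (res Y) (res Z)"
  shows "derived_comp sc X Y Z (q Y Z \<psi>) (q X Y \<phi>) = q X Z (cmap_comp \<psi> \<phi>)"
proof -
  note R = cx_res[OF o(1)] cx_res[OF o(2)] cx_res[OF o(3)]
  let ?p = "cmap_comp (rp Z) (cmap_comp \<psi> \<phi>)"
  have gf: "cmap_comp \<psi> \<phi> \<in> chain_map (res X) (res Z)" using cm_comp[OF f g R(2)] .
  have main: "rv X Z (V, cmap_comp s u, cmap_comp g' h) ?p"
    if a: "(W, s, f') \<in> q X Y \<phi>" and b: "(W', t, g') \<in> q Y Z \<psi>" and V: "cx V" and u: "quasi_iso V W u"
      and h: "h \<in> chain_map V W'" and e: "homotopic V Y (cmap_comp t h) (cmap_comp f' u)" for W s f' W' t g' V u h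
  proof -
    obtain a where a: "a \<in> chain_map (res X) W" "hq (res X) X (cmap_comp s a) (rp X)"
      "hq (res X) Y (cmap_comp f' a) (cmap_comp (rp Y) \<phi>)" "cx W" "quasi_iso W X s" "f' \<in> chain_map W Y"
      using rvE a unfolding q_def hcl_def by blast
    obtain b where b: "b \<in> chain_map (res Y) W'" "hq (res Y) Y (cmap_comp t b) (rp Y)"
      "hq (res Y) Z (cmap_comp g' b) (cmap_comp (rp Z) \<psi>)" "cx W'" "quasi_iso W' Y t" "g' \<in> chain_map W' Z"
      using rvE b unfolding q_def hcl_def by blast
    note um = quasi_iso_cm[OF u] and sm = quasi_iso_cm[OF a(5)] and tm = quasi_iso_cm[OF b(5)]
    have e': "hq V Y (cmap_comp t h) (cmap_comp f' u)"
      unfolding hq_def using V o(2) e cm_comp[OF h tm b(4)] cm_comp[OF um a(6,4)] by blast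
    have su: "quasi_iso V X (cmap_comp s u)" using quasi_iso_comp[OF u a(5) V a(4) o(1)] .
    have gh: "cmap_comp g' h \<in> chain_map V Z" using cm_comp[OF h b(6,4)] .
    obtain v where v: "v \<in> chain_map (res X) V" "hq (res X) W (cmap_comp u v) a"
      using lift_hq[OF perf_res[OF o(1)] V a(4) u a(1)] by blast
    have 1: "hq (res X) X (cmap_comp (cmap_comp s u) v) (rp X)"
      unfolding cmap_comp_assoc using hq_trans[OF hq_l[OF v(2) sm o(1)] a(2)] .
    have hv: "cmap_comp h v \<in> chain_map (res X) W'" using cm_comp[OF v(1) h V] .
    have bf: "cmap_comp b \<phi> \<in> chain_map (res X) W'" using cm_comp[OF f b(1) R(2)] .
    have "hq (res X) Y (cmap_comp t (cmap_comp h v)) (cmap_comp f' (cmap_comp u v))"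
      using hq_r[OF e' v(1) R(1)] unfolding cmap_comp_assoc .
    also have "hq (res X) Y \<dots> (cmap_comp f' a)" using hq_l[OF v(2) a(6) o(2)] .
    also note a(3)
    also have "hq (res X) Y (cmap_comp (rp Y) \<phi>) (cmap_comp t (cmap_comp b \<phi>))"
      using hq_sym[OF hq_r[OF b(2) f R(1)]] unfolding cmap_comp_assoc .
    \<comment> \<open>The two maps agree after the quasi-isomorphism \<open>t\<close>, and lifts
      through a quasi-isomorphism are unique up to homotopy.\<close>
    finally have "hq (res X) W' (cmap_comp h v) (cmap_comp b \<phi>)"
      using lift_unique_hq[OF perf_res[OF o(1)] b(4,5) hv bf] by blast
    then have "hq (res X) Z (cmap_comp g' (cmap_comp h v)) (cmap_comp g' (cmap_comp b \<phi>))"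
      using hq_l b(6) o(3) by blast
    also have "hq (res X) Z \<dots> ?p" using hq_r[OF b(3) f R(1)] unfolding cmap_comp_assoc .
    finally have "hq (res X) Z (cmap_comp (cmap_comp g' h) v) ?p" unfolding cmap_comp_assoc .
    then show ?thesis using rvI[OF V su gh v(1) 1] by blast
  qed
  have pY: "cmap_comp (rp Y) \<phi> \<in> chain_map (res X) Y" and pZ: "cmap_comp (rp Z) \<psi> \<in> chain_map (res Y) Z"
    using rp_q_cm o f g by blast+
  have b1: "(res X, rp X, cmap_comp (rp Y) \<phi>) \<in> q X Y \<phi>" unfolding q_def using hcl_base[OF o(1,2) pY] .
  have b2: "(res Y, rp Y, cmap_comp (rp Z) \<psi>) \<in> q Y Z \<psi>" unfolding q_def using hcl_base[OF o(2,3) pZ] .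
  have e: "homotopic (res X) Y (cmap_comp (rp Y) \<phi>) (cmap_comp (cmap_comp (rp Y) \<phi>) (cmap_id (res X)))"
    unfolding cm_comp_id[OF pY R(1)] using homotopic_refl[OF pY R(1) o(2)] .
  \<comment> \<open>The canonical square: both roofs start at resolutions, the identity completes on
    one side and \<open>\<phi>\<close> on the other.\<close>
  note m0 = main[OF b1 b2 R(1) quasi_iso_id[OF R(1)] f e]
  show ?thesis
  proof (rule Set.set_eqI)
    fix r
    have "r \<in> q X Z (cmap_comp \<psi> \<phi>) \<longleftrightarrow> rv X Z r ?p" unfolding q_def hcl_def by simp
    moreover have "r \<in> derived_comp sc X Y Z (q Y Z \<psi>) (q X Y \<phi>) \<longleftrightarrow> rv X Z r ?p"
    proof
      assume "r \<in> derived_comp sc X Y Z (q Y Z \<psi>) (q X Y \<phi>)"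
      then obtain W s f' W' t g' V u h where
        c: "(W, s, f') \<in> q X Y \<phi>" "(W', t, g') \<in> q Y Z \<psi>" "cx V" "quasi_iso V W u" "h \<in> chain_map V W'"
          "homotopic V Y (cmap_comp t h) (cmap_comp f' u)" "((V, cmap_comp s u, cmap_comp g' h), r) \<in> roof_eq sc X Z"
        unfolding derived_comp_def by blast
      obtain p where p: "rv X Z (V, cmap_comp s u, cmap_comp g' h) p" "rv X Z r p" using c(7) roof_eq_iff[OF o(1,3)] by blast
      show "rv X Z r ?p" using rv_hq[OF p(2)] rv_unique[OF o(1,3) p(1) main[OF c(1-6)]] by blast
    next
      assume "rv X Z r ?p"
      then have "((res X, cmap_comp (rp X) (cmap_id (res X)), cmap_comp (cmap_comp (rp Z) \<psi>) \<phi>), r) \<in> roof_eq sc X Z"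
        using m0 roof_eq_iff[OF o(1,3)] by blast
      then show "r \<in> derived_comp sc X Y Z (q Y Z \<psi>) (q X Y \<phi>)"
        unfolding derived_comp_def using b1 b2 R(1) quasi_iso_id[OF R(1)] f e by blast
    qed
    ultimately show "r \<in> derived_comp sc X Y Z (q Y Z \<psi>) (q X Y \<phi>) \<longleftrightarrow> r \<in> q X Z (cmap_comp \<psi> \<phi>)" by blast
  qed
qed

text \<open>Only roofs with the same denominator are added. Their lifts of the resolution agree up
  to homotopy by uniqueness, so the values add; the resolution of \<open>X\<close> is always
  available as a denominator.\<close>

lemma add_hcl:
  assumes o: "cx X" "cx Y" and p: "p \<in> chain_map (res X) Y" and p': "p' \<in> chain_map (res X) Y"
  shows "derived_add sc X Y (hcl X Y p) (hcl X Y p') = hcl X Y (p + p')"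
proof -
  note R = cx_res[OF o(1)]
  have main: "rv X Y (W, s, f + g) (p + p')" if 1: "rv X Y (W, s, f) p" and 2: "rv X Y (W, s, g) p'" for W s f g
  proof -
    obtain a where a: "a \<in> chain_map (res X) W" "hq (res X) X (cmap_comp s a) (rp X)"
      "hq (res X) Y (cmap_comp f a) p" "cx W" "quasi_iso W X s" "f \<in> chain_map W Y" using rvE[OF 1] by blast
    obtain b where b: "b \<in> chain_map (res X) W" "hq (res X) X (cmap_comp s b) (rp X)"
      "hq (res X) Y (cmap_comp g b) p'" "g \<in> chain_map W Y" using rvE[OF 2] by blast
    have "hq (res X) W a b"
      using lift_unique_hq[OF perf_res[OF o(1)] a(4,5,1) b(1) hq_trans[OF a(2) hq_sym[OF b(2)]]] .
    then have "hq (res X) Y (cmap_comp g a) p'" using hq_trans[OF hq_l[OF _ b(4) o(2)] b(3)] by blast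
    then have "hq (res X) Y (cmap_comp (f + g) a) (p + p')" unfolding cm_comp_plus_l using hq_plus a(3) by blast
    then show ?thesis using rvI[OF a(4,5) cm_plus[OF a(6) b(4) a(4) o(2)] a(1,2)] by blast
  qed
  have b1: "rv X Y (res X, rp X, p) p" and b2: "rv X Y (res X, rp X, p') p'"
    using hcl_base[OF o p] hcl_base[OF o p'] unfolding hcl_def by blast+
  show ?thesis
  proof (rule Set.set_eqI)
    fix r
    show "r \<in> derived_add sc X Y (hcl X Y p) (hcl X Y p') \<longleftrightarrow> r \<in> hcl X Y (p + p')"
    proof
      assume "r \<in> derived_add sc X Y (hcl X Y p) (hcl X Y p')"
      then obtain W s f g where c: "rv X Y (W, s, f) p" "rv X Y (W, s, g) p'" "((W, s, f + g), r) \<in> roof_eq sc X Y"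
        unfolding derived_add_def hcl_def by blast
      obtain z where z: "rv X Y (W, s, f + g) z" "rv X Y r z" using c(3) roof_eq_iff[OF o] by blast
      show "r \<in> hcl X Y (p + p')" unfolding hcl_def
        using rv_hq[OF z(2) rv_unique[OF o z(1) main[OF c(1,2)]]] by blast
    next
      assume "r \<in> hcl X Y (p + p')"
      then have "((res X, rp X, p + p'), r) \<in> roof_eq sc X Y"
        using main[OF b1 b2] roof_eq_iff[OF o] unfolding hcl_def by blast
      then show "r \<in> derived_add sc X Y (hcl X Y p) (hcl X Y p')"
        unfolding derived_add_def hcl_def using b1 b2 by blast
    qed
  qed
qed

lemma add_q:
  assumes o: "cx X" "cx Y" and f: "\<phi> \<in> chain_map (res X) (res Y)" "\<psi> \<in> chain_map (res X) (res Y)"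
  shows "derived_add sc X Y (q X Y \<phi>) (q X Y \<psi>) = q X Y (\<phi> + \<psi>)"
  unfolding q_def add_hcl[OF o rp_q_cm[OF o f(1)] rp_q_cm[OF o f(2)]]
  using cm_comp_plus_r[OF f rp_cm[OF o(2)] cx_res[OF o(2)]] by simp

lemma idn_q: "cx X \<Longrightarrow> Q_map sc X X (cmap_id X) = q X X (cmap_id (res X))"
  unfolding q_def using Q_map_hcl[OF _ _ cm_id] cm_id_comp[OF rp_cm] cm_comp_id[OF rp_cm cx_res] by simp

lemma nul_q: "\<lbrakk>cx X; cx Y\<rbrakk> \<Longrightarrow> Q_map sc X Y 0 = q X Y 0"
  unfolding q_def using Q_map_hcl[OF _ _ cm_zero] zero_cm_comp cm_comp_zero[OF rp_cm cx_res] by metis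

text \<open>Every axiom is pulled back along \<open>q\<close> to chain maps between resolutions,
  where composition and addition are those of functions.\<close>

theorem preadd_D: "preadd D"
proof (rule preadd.intro)
  fix X Y Z :: "('h, 'k) cpx" and f g
  assume "f \<in> Hom D X Y" "g \<in> Hom D Y Z" "X \<in> Ob D" "Y \<in> Ob D" "Z \<in> Ob D"
  then show "Cmp D X Y Z g f \<in> Hom D X Z" using Hom_D_q comp_q cm_comp cx_res by (metis D_simps(1,2))
next
  fix X assume "X \<in> Ob D"
  then show "Idn D X \<in> Hom D X X" using Hom_D_q idn_q cm_id cx_res by (metis D_simps(1,3))
next
  fix W X Y Z :: "('h, 'k) cpx" and f g h
  assume a: "f \<in> Hom D W X" "g \<in> Hom D X Y" "h \<in> Hom D Y Z" and "W \<in> Ob D" "X \<in> Ob D" "Y \<in> Ob D" "Z \<in> Ob D"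
  then have o: "cx W" "cx X" "cx Y" "cx Z" by simp_all
  obtain f' g' h' where m: "f' \<in> chain_map (res W) (res X)" "g' \<in> chain_map (res X) (res Y)" "h' \<in> chain_map (res Y) (res Z)"
    and e: "f = q W X f'" "g = q X Y g'" "h = q Y Z h'" using a Hom_D_q o by metis
  show "Cmp D W X Z (Cmp D X Y Z h g) f = Cmp D W Y Z h (Cmp D W X Y g f)"
    unfolding e D_simps using m o comp_q cm_comp cx_res by (simp add: cmap_comp_assoc)
next
  fix X Y f assume a: "f \<in> Hom D X Y" and "X \<in> Ob D" "Y \<in> Ob D"
  then have o: "cx X" "cx Y" by simp_all
  obtain f' where m: "f' \<in> chain_map (res X) (res Y)" and e: "f = q X Y f'" using a Hom_D_q o by metis
  show "Cmp D X Y Y (Idn D Y) f = f" "Cmp D X X Y f (Idn D X) = f"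
    unfolding e D_simps using m o comp_q idn_q cm_id cx_res by (simp_all add: cm_id_comp[OF m] cm_comp_id[OF m])
next
  fix X Y :: "('h, 'k) cpx" and Z f g g'
  assume a: "f \<in> Hom D X Y" "g \<in> Hom D Y Z" "g' \<in> Hom D Y Z" and "X \<in> Ob D" "Y \<in> Ob D" "Z \<in> Ob D"
  then have o: "cx X" "cx Y" "cx Z" by simp_all
  obtain f1 g1 g2 where m: "f1 \<in> chain_map (res X) (res Y)" "g1 \<in> chain_map (res Y) (res Z)" "g2 \<in> chain_map (res Y) (res Z)"
    and e: "f = q X Y f1" "g = q Y Z g1" "g' = q Y Z g2" using a Hom_D_q o by metis
  show "Cmp D X Y Z (Add D Y Z g g') f = Add D X Z (Cmp D X Y Z g f) (Cmp D X Y Z g' f)"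
    unfolding e D_simps using m o by (simp add: comp_q add_q cm_comp cx_res cm_plus cm_comp_plus_l)
next
  fix X Y :: "('h, 'k) cpx" and Z f f' g
  assume a: "f \<in> Hom D X Y" "f' \<in> Hom D X Y" "g \<in> Hom D Y Z" and "X \<in> Ob D" "Y \<in> Ob D" "Z \<in> Ob D"
  then have o: "cx X" "cx Y" "cx Z" by simp_all
  obtain f1 f2 g1 where m: "f1 \<in> chain_map (res X) (res Y)" "f2 \<in> chain_map (res X) (res Y)" "g1 \<in> chain_map (res Y) (res Z)"
    and e: "f = q X Y f1" "f' = q X Y f2" "g = q Y Z g1" using a Hom_D_q o by metis
  show "Cmp D X Y Z g (Add D X Y f f') = Add D X Z (Cmp D X Y Z g f) (Cmp D X Y Z g f')"
    unfolding e D_simps using m o cm_comp_plus_r[OF m cx_res[OF o(2)]] by (simp add: comp_q add_q cm_comp cx_res cm_plus)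
next
  fix X Y assume "X \<in> Ob D" "Y \<in> Ob D"
  then have o: "cx X" "cx Y" by simp_all
  note R = cx_res[OF o(1)] cx_res[OF o(2)]
  have c: "carrier (hom_group D X Y) = Hom D X Y" "mult (hom_group D X Y) = derived_add sc X Y"
    "one (hom_group D X Y) = q X Y 0" using nul_q[OF o] by (simp_all add: hom_group_def)
  show "comm_group (hom_group D X Y)"
  proof (rule comm_groupI; unfold c)
    show "q X Y 0 \<in> Hom D X Y" using Hom_D_q[OF o] cm_zero[OF R] by blast
    show "derived_add sc X Y x y \<in> Hom D X Y" if "x \<in> Hom D X Y" "y \<in> Hom D X Y" for x y
      using that Hom_D_q[OF o] add_q[OF o] cm_plus[OF _ _ R] by metis
    show "derived_add sc X Y x y = derived_add sc X Y y x" if "x \<in> Hom D X Y" "y \<in> Hom D X Y" for x y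
      using that Hom_D_q[OF o] add_q[OF o] by (metis add.commute)
    show "derived_add sc X Y (derived_add sc X Y x y) z = derived_add sc X Y x (derived_add sc X Y y z)"
      if xyz: "x \<in> Hom D X Y" "y \<in> Hom D X Y" "z \<in> Hom D X Y" for x y z
    proof -
      obtain a b d where "a \<in> chain_map (res X) (res Y)" "b \<in> chain_map (res X) (res Y)" "d \<in> chain_map (res X) (res Y)"
        "x = q X Y a" "y = q X Y b" "z = q X Y d" using xyz unfolding Hom_D_q[OF o] by blast
      then show ?thesis using add_q[OF o] cm_plus[OF _ _ R] by (simp add: add.assoc)
    qed
    show "derived_add sc X Y (q X Y 0) x = x" if "x \<in> Hom D X Y" for x
      using that Hom_D_q[OF o] add_q[OF o cm_zero[OF R]] by (metis add_0)
    show "\<exists>y \<in> Hom D X Y. derived_add sc X Y y x = q X Y 0" if x: "x \<in> Hom D X Y" for x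
    proof -
      obtain a where a: "a \<in> chain_map (res X) (res Y)" "x = q X Y a" using x unfolding Hom_D_q[OF o] by blast
      have "- a \<in> chain_map (res X) (res Y)" using cm_uminus[OF a(1) R] .
      then show ?thesis using add_q[OF o _ a(1), of "- a"] Hom_D_q[OF o] a(2)
        by (intro bexI[of _ "q X Y (- a)"]) auto
    qed
  qed
qed

declare D_simps(2-5) [simp del]

sublocale DC: preadd D
  by (rule preadd_D)

section \<open>The functor from complexes to the derived category\<close>

abbreviation Q :: "('h, 'k) cpx \<Rightarrow> ('h, 'k) cpx \<Rightarrow> 'k cmap \<Rightarrow> ('h, 'k) roof set" where "Q \<equiv> Q_map sc"

lemma Q_idn: "Q X X (cmap_id X) = Idn D X" and Q_nul: "Q X Y 0 = Nul D X Y"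
  by (simp_all only: D_simps)

lemma Q_rep:
  assumes o: "cx X" "cx Y" and f: "f \<in> chain_map X Y"
  obtains \<phi> where "\<phi> \<in> chain_map (res X) (res Y)" "hq (res X) Y (cmap_comp (rp Y) \<phi>) (cmap_comp f (rp X))" "Q X Y f = q X Y \<phi>"
  using ex_q_hcl[OF o cm_comp[OF rp_cm[OF o(1)] f o(1)]] Q_map_hcl[OF o f] by metis

lemma Q_in: "\<lbrakk>f \<in> chain_map X Y; cx X; cx Y\<rbrakk> \<Longrightarrow> Q X Y f \<in> Hom D X Y"
  using Q_rep Hom_D_q by metis

lemma Q_eq: "hq X Y f f' \<Longrightarrow> Q X Y f = Q X Y f'"
proof -
  assume h: "hq X Y f f'"
  then have o: "cx X" "cx Y" unfolding hq_def by blast+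
  have "hq (res X) Y (cmap_comp f (rp X)) (cmap_comp f' (rp X))" using hq_r[OF h rp_cm[OF o(1)] cx_res[OF o(1)]] .
  then show ?thesis
    unfolding Q_map_hcl[OF o hqD(1)[OF h]] Q_map_hcl[OF o hqD(2)[OF h]] using hcl_eq_iff[OF o] hqD by metis
qed

lemma Q_cmp:
  assumes f: "f \<in> chain_map X Y" and g: "g \<in> chain_map Y Z" and o: "cx X" "cx Y" "cx Z"
  shows "Cmp D X Y Z (Q Y Z g) (Q X Y f) = Q X Z (cmap_comp g f)"
proof -
  note R = cx_res[OF o(1)] cx_res[OF o(2)] cx_res[OF o(3)]
  obtain \<phi> where 1: "\<phi> \<in> chain_map (res X) (res Y)" "hq (res X) Y (cmap_comp (rp Y) \<phi>) (cmap_comp f (rp X))" "Q X Y f = q X Y \<phi>"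
    using Q_rep[OF o(1,2) f] by blast
  obtain \<psi> where 2: "\<psi> \<in> chain_map (res Y) (res Z)" "hq (res Y) Z (cmap_comp (rp Z) \<psi>) (cmap_comp g (rp Y))" "Q Y Z g = q Y Z \<psi>"
    using Q_rep[OF o(2,3) g] by blast
  have "hq (res X) Z (cmap_comp (rp Z) (cmap_comp \<psi> \<phi>)) (cmap_comp g (cmap_comp (rp Y) \<phi>))"
    using hq_r[OF 2(2) 1(1) R(1)] unfolding cmap_comp_assoc .
  also have "hq (res X) Z \<dots> (cmap_comp (cmap_comp g f) (rp X))"
    using hq_l[OF 1(2) g o(3)] unfolding cmap_comp_assoc .
  finally show ?thesis
    unfolding 1(3) 2(3) D_simps comp_q[OF o 1(1) 2(1)] Q_map_hcl[OF o(1,3) cm_comp[OF f g o(2)]]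
    using q_hcl[OF o(1,3)] by blast
qed

lemma Q_add:
  assumes f: "f \<in> chain_map X Y" and g: "g \<in> chain_map X Y" and o: "cx X" "cx Y"
  shows "Add D X Y (Q X Y f) (Q X Y g) = Q X Y (f + g)"
  unfolding D_simps Q_map_hcl[OF o f] Q_map_hcl[OF o g] Q_map_hcl[OF o cm_plus[OF f g o]] cm_comp_plus_l
  using add_hcl[OF o cm_comp[OF rp_cm[OF o(1)] f o(1)] cm_comp[OF rp_cm[OF o(1)] g o(1)]] .

text \<open>The inverse is obtained by lifting the resolution of \<open>Y\<close> first through
  \<open>t\<close> and then to the resolution of \<open>X\<close>; both composites are identities by
  uniqueness of lifts.\<close>

lemma Q_iso:
  assumes t: "quasi_iso X Y t" and o: "cx X" "cx Y"
  shows "is_iso D X Y (Q X Y t)"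
proof -
  note R = cx_res[OF o(1)] cx_res[OF o(2)] and tm = quasi_iso_cm[OF t]
  obtain b where b: "b \<in> chain_map (res Y) X" "hq (res Y) Y (cmap_comp t b) (rp Y)"
    using lift_hq[OF perf_res[OF o(2)] o t rp_cm[OF o(2)]] by blast
  obtain \<psi> where p: "\<psi> \<in> chain_map (res Y) (res X)" "hq (res Y) X (cmap_comp (rp X) \<psi>) b"
    using lift_hq[OF perf_res[OF o(2)] R(1) o(1) quasi_iso_rp[OF o(1)] b(1)] by blast
  obtain \<chi> where c: "\<chi> \<in> chain_map (res X) (res Y)" "hq (res X) Y (cmap_comp (rp Y) \<chi>) (cmap_comp t (rp X))" "Q X Y t = q X Y \<chi>"
    using Q_rep[OF o tm] by blast
  have cp: "cmap_comp \<chi> \<psi> \<in> chain_map (res Y) (res Y)" and pc: "cmap_comp \<psi> \<chi> \<in> chain_map (res X) (res X)"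
    using cm_comp[OF p(1) c(1) R(1)] cm_comp[OF c(1) p(1) R(2)] .
  have "hq (res Y) Y (cmap_comp (rp Y) (cmap_comp \<chi> \<psi>)) (cmap_comp t (cmap_comp (rp X) \<psi>))"
    using hq_r[OF c(2) p(1) R(2)] unfolding cmap_comp_assoc .
  also have "hq (res Y) Y \<dots> (cmap_comp t b)" using hq_l[OF p(2) tm o(2)] .
  also note b(2)
  finally have 1: "hq (res Y) (res Y) (cmap_comp \<chi> \<psi>) (cmap_id (res Y))"
    using lift_unique_hq[OF perf_res[OF o(2)] R(2) quasi_iso_rp[OF o(2)] cp cm_id[OF R(2)]]
    unfolding cm_comp_id[OF rp_cm[OF o(2)] R(2)] by blast
  \<comment> \<open>The other composite is compared after \<open>t\<close> and \<open>rp X\<close>,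
    where the relation \<open>1\<close> just proved can be inserted; both quasi-isomorphisms are
    then cancelled.\<close>
  have "hq (res X) Y (cmap_comp t (cmap_comp (rp X) (cmap_comp \<psi> \<chi>))) (cmap_comp (rp Y) (cmap_comp \<chi> (cmap_comp \<psi> \<chi>)))"
    using hq_sym[OF hq_r[OF c(2) pc R(1)]] unfolding cmap_comp_assoc .
  also have "hq (res X) Y \<dots> (cmap_comp (rp Y) \<chi>)"
    using hq_l[OF hq_r[OF 1 c(1) R(1)] rp_cm[OF o(2)] o(2)] unfolding cmap_comp_assoc cm_id_comp[OF c(1)] .
  also note c(2)
  finally have "hq (res X) X (cmap_comp (rp X) (cmap_comp \<psi> \<chi>)) (rp X)"
    using lift_unique_hq[OF perf_res[OF o(1)] o(1) t cm_comp[OF pc rp_cm[OF o(1)] R(1)] rp_cm[OF o(1)]] by blast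
  then have 2: "hq (res X) (res X) (cmap_comp \<psi> \<chi>) (cmap_id (res X))"
    using lift_unique_hq[OF perf_res[OF o(1)] R(1) quasi_iso_rp[OF o(1)] pc cm_id[OF R(1)]]
    unfolding cm_comp_id[OF rp_cm[OF o(1)] R(1)] by blast
  have "Cmp D X Y X (q Y X \<psi>) (Q X Y t) = Idn D X" "Cmp D Y X Y (Q X Y t) (q Y X \<psi>) = Idn D Y"
    unfolding c(3) D_simps comp_q[OF o o(1) c(1) p(1)] comp_q[OF o(2,1,2) p(1) c(1)] idn_q[OF o(1)] idn_q[OF o(2)]
    using q_eq_iff[OF o(1,1) pc cm_id[OF R(1)]] q_eq_iff[OF o(2,2) cp cm_id[OF R(2)]] 1 2 by blast+
  moreover have "q Y X \<psi> \<in> Hom D Y X" using Hom_D_q[OF o(2,1)] p(1) by blast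
  ultimately show ?thesis unfolding is_iso_def using Q_in[OF tm o] by blast
qed

lemma iso_res: "cx X \<Longrightarrow> isomorphic D (res X) X"
  unfolding isomorphic_def using Q_iso[OF quasi_iso_rp cx_res] by blast

text \<open>For a bounded complex of projectives the chosen resolution is a homotopy equivalence,
  because the identity lifts through it.\<close>

lemma perf_section:
  assumes P: "perf P"
  obtains a where "a \<in> chain_map P (res P)" "hq P P (cmap_comp (rp P) a) (cmap_id P)"
    "hq (res P) (res P) (cmap_comp a (rp P)) (cmap_id (res P))"
proof -
  note o = perf_cx[OF P]
  note R = cx_res[OF o] and m = rp_cm[OF o]
  obtain a where a: "a \<in> chain_map P (res P)" "hq P P (cmap_comp (rp P) a) (cmap_id P)"
    using lift_hq[OF P R o quasi_iso_rp[OF o] cm_id[OF o]] by blast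
  have "hq (res P) P (cmap_comp (rp P) (cmap_comp a (rp P))) (cmap_comp (rp P) (cmap_id (res P)))"
    using hq_r[OF a(2) m R] unfolding cmap_comp_assoc cm_id_comp[OF m] cm_comp_id[OF m R] .
  then have "hq (res P) (res P) (cmap_comp a (rp P)) (cmap_id (res P))"
    using lift_unique_hq[OF perf_res[OF o] R quasi_iso_rp[OF o] cm_comp[OF m a(1) o] cm_id[OF R]] by blast
  then show ?thesis using that a by blast
qed

text \<open>Together with \<open>Q_surj\<close>: out of a bounded complex of projectives, morphisms
  of the derived category are homotopy classes of chain maps.\<close>

lemma Q_eqD:
  assumes P: "perf P" and Y: "cx Y" and f: "f \<in> chain_map P Y" "f' \<in> chain_map P Y" and e: "Q P Y f = Q P Y f'"
  shows "hq P Y f f'"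
proof -
  note o = perf_cx[OF P]
  obtain a where a: "a \<in> chain_map P (res P)" "hq P P (cmap_comp (rp P) a) (cmap_id P)"
    using perf_section[OF P] by blast
  have "hq (res P) Y (cmap_comp f (rp P)) (cmap_comp f' (rp P))"
    using e unfolding Q_map_hcl[OF o Y f(1)] Q_map_hcl[OF o Y f(2)]
    using hcl_eq_iff[OF o Y] cm_comp[OF rp_cm[OF o] _ o] f by blast
  from hq_r[OF this a(1) o] have "hq P Y (cmap_comp f (cmap_comp (rp P) a)) (cmap_comp f' (cmap_comp (rp P) a))"
    unfolding cmap_comp_assoc .
  moreover have "hq P Y (cmap_comp g (cmap_comp (rp P) a)) g" if "g \<in> chain_map P Y" for g
    using hq_l[OF a(2) that Y] unfolding cm_comp_id[OF that o] .
  ultimately show ?thesis using f hq_trans hq_sym by metis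
qed

lemma Q_surj:
  assumes P: "perf P" and Y: "cx Y" and a: "\<alpha> \<in> Hom D P Y"
  obtains f where "f \<in> chain_map P Y" "\<alpha> = Q P Y f"
proof -
  note o = perf_cx[OF P]
  obtain p where p: "p \<in> chain_map (res P) Y" "\<alpha> = hcl P Y p" using a Hom_D[OF o Y] by blast
  obtain s where s: "s \<in> chain_map P (res P)" "hq (res P) (res P) (cmap_comp s (rp P)) (cmap_id (res P))"
    using perf_section[OF P] by blast
  have m: "cmap_comp p s \<in> chain_map P Y" using cm_comp[OF s(1) p(1) cx_res[OF o]] .
  have "hq (res P) Y (cmap_comp (cmap_comp p s) (rp P)) p"
    using hq_l[OF s(2) p(1) Y] unfolding cmap_comp_assoc cm_comp_id[OF p(1) cx_res[OF o]] .
  then have "hcl P Y (cmap_comp (cmap_comp p s) (rp P)) = hcl P Y p"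
    using hcl_eq_iff[OF o Y] cm_comp[OF rp_cm[OF o] m o] p(1) by blast
  then show ?thesis using that[OF m] Q_map_hcl[OF o Y m] p(2) by simp
qed

end

lemma cpx_eqI: "\<lbrakk>cmod X = cmod Y; diff X = diff Y\<rbrakk> \<Longrightarrow> X = (Y :: ('h, 'k) cpx)"
  by simp

section \<open>The shift functor\<close>

context fd_algebra
begin

lemma cshift_cshift: "cshift m (cshift n X) = cshift (n + m) X"
proof (rule cpx_eqI)
  have e: "i + m + n = i + (n + m)" for i :: int by simp
  show "cmod (cshift m (cshift n X)) = cmod (cshift (n + m) X)" by (rule ext) (simp add: e)
  show "diff (cshift m (cshift n X)) = diff (cshift (n + m) X)" by (rule ext) (simp add: e)
qed

lemma cshift_0: "cshift 0 X = X"
  by (rule cpx_eqI) (simp_all add: fun_eq_iff)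

lemma cmap_shift_apply: "cmap_shift n f i = f (i + n)"
  by (simp add: cmap_shift_def)

lemma cmap_shift_shift: "cmap_shift m (cmap_shift n f) = cmap_shift (n + m) f"
  by (rule ext) (simp add: cmap_shift_apply algebra_simps)

lemma cmap_shift_0: "cmap_shift 0 f = f"
  by (rule ext) (simp add: cmap_shift_apply)

lemma cmap_shift_comp: "cmap_shift n (cmap_comp g f) = cmap_comp (cmap_shift n g) (cmap_shift n f)"
  unfolding cmap_shift_def cmap_comp_def ..

lemma cmap_shift_plus: "cmap_shift n (f + g) = cmap_shift n f + cmap_shift n g"
  by (simp add: cmap_shift_def fun_eq_iff)

lemma cmap_shift_id: "cmap_shift n (cmap_id X) = cmap_id (cshift n X)"
  by (rule ext) (simp add: cmap_shift_apply cmap_id_def)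

lemma cmap_shift_cm:
  assumes f: "f \<in> chain_map X Y" and o: "cx X" "cx Y"
  shows "cmap_shift n f \<in> chain_map (cshift n X) (cshift n Y)"
proof (rule chain_mapI[OF cx_cshift[OF o(1)] cx_cshift[OF o(2)]])
  show "cmap_shift n f i \<in> mod_hom (cmod (cshift n X) i) (cmod (cshift n Y) i)" for i
    using cm_hom[OF f, of "i + n"] by (simp add: cmap_shift_apply)
  fix i v assume "v \<in> carr (cmod (cshift n X) i)"
  then have v: "v \<in> carr (cmod X (i + n))" by simp
  have "f (i + n + 1) (- diff X (i + n) v) = - f (i + n + 1) (diff X (i + n) v)"
    using hom_neg[OF cm_hom[OF f] cx_modl[OF o(1)] hom_in[OF cx_diff[OF o(1)] v]] .
  moreover have e: "i + 1 + n = i + n + 1" by simp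
  ultimately show "cmap_shift n f (i + 1) (diff (cshift n X) i v) = diff (cshift n Y) i (cmap_shift n f i v)"
    unfolding cmap_shift_apply cshift_simps e using cm_comm[OF f, of "i + n" v] by simp
qed

lemma cmap_shift_homotopic:
  assumes h: "homotopic X Y f g" and f: "f \<in> chain_map X Y" "g \<in> chain_map X Y" and o: "cx X" "cx Y"
  shows "homotopic (cshift n X) (cshift n Y) (cmap_shift n f) (cmap_shift n g)"
proof -
  obtain h where h: "\<And>i. h i \<in> mod_hom (cmod X i) (cmod Y (i - 1))"
    "\<And>i v. f i v - g i v = diff Y (i - 1) (h i v) + h (i + 1) (diff X i v)" using homotopicE[OF h] by blast
  let ?k = "\<lambda>i. if even n then h (i + n) else - h (i + n)"
  have e: "i - 1 + n = i + n - 1" "i + 1 + n = i + n + 1" for i by simp_all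
  show ?thesis
  proof (rule homotopicI[where h = ?k, OF cmap_shift_cm[OF f(1) o] cmap_shift_cm[OF f(2) o] cx_cshift[OF o(1)] cx_cshift[OF o(2)]])
    show "?k i \<in> mod_hom (cmod (cshift n X) i) (cmod (cshift n Y) (i - 1))" for i
      unfolding cshift_simps e using h(1)[of "i + n"] hom_uminus[OF h(1)[of "i + n"] cx_modl[OF o(2)]] by simp
    fix i v assume "v \<in> carr (cmod (cshift n X) i)"
    then have v: "v \<in> carr (cmod X (i + n))" by simp
    have "h (i + n + 1) (- diff X (i + n) v) = - h (i + n + 1) (diff X (i + n) v)"
      using hom_neg[OF h(1) cx_modl[OF o(1)] hom_in[OF cx_diff[OF o(1)] v]] .
    moreover have "diff Y (i + n - 1) (- h (i + n) v) = - diff Y (i + n - 1) (h (i + n) v)"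
      using hom_neg[OF cx_diff[OF o(2)] cx_modl[OF o(2)] hom_in[OF h(1) v]] .
    ultimately show "cmap_shift n f i v - cmap_shift n g i v = diff (cshift n Y) (i - 1) (?k i v) + ?k (i + 1) (diff (cshift n X) i v)"
      unfolding cmap_shift_apply cshift_simps e using h(2)[of "i + n" v] by simp
  qed
qed

lemma quasi_iso_shift:
  assumes f: "quasi_iso X Y f" and o: "cx X" "cx Y"
  shows "quasi_iso (cshift n X) (cshift n Y) (cmap_shift n f)"
  using f cmap_shift_cm[OF quasi_iso_cm[OF f] o]
  unfolding quasi_iso_iff[OF o] quasi_iso_iff[OF cx_cshift[OF o(1)] cx_cshift[OF o(2)]]
    cocycles_cshift coboundaries_cshift[OF o(1)] coboundaries_cshift[OF o(2)] cmap_shift_apply by blast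

definition sh :: "int \<Rightarrow> ('h, 'k) roof \<Rightarrow> ('h, 'k) roof" where
  "sh n = (\<lambda>(W, s, f). (cshift n W, cmap_shift n s, cmap_shift n f))"

lemma sh_apply: "sh n (W, s, f) = (cshift n W, cmap_shift n s, cmap_shift n f)"
  by (simp add: sh_def)

lemma sh_sh: "sh m (sh n r) = sh (n + m) r" and sh_0: "sh 0 r = r"
  by (cases r; simp add: sh_apply cshift_cshift cmap_shift_shift cshift_0 cmap_shift_0)+

lemma sh_roofs: "\<lbrakk>cx X; cx Y; r \<in> roofs sc X Y\<rbrakk> \<Longrightarrow> sh n r \<in> roofs sc (cshift n X) (cshift n Y)"
  by (cases r) (simp add: in_roofs sh_apply cx_cshift quasi_iso_shift cmap_shift_cm)

lemma sh_roof_eq: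
  assumes o: "cx X" "cx Y" and e: "(r, r') \<in> roof_eq sc X Y"
  shows "(sh n r, sh n r') \<in> roof_eq sc (cshift n X) (cshift n Y)"
proof -
  obtain W s f where r: "r = (W, s, f)" by (cases r) auto
  obtain W' s' f' where r': "r' = (W', s', f')" by (cases r') auto
  obtain V u u' where V: "(W, s, f) \<in> roofs sc X Y" "(W', s', f') \<in> roofs sc X Y"
      "u \<in> chain_map V W" "u' \<in> chain_map V W'" "cx V" "quasi_iso V X (cmap_comp s u)"
      "homotopic V X (cmap_comp s u) (cmap_comp s' u')" "homotopic V Y (cmap_comp f u) (cmap_comp f' u')"
    using e unfolding r r' roof_eq_def' by blast
  have W: "cx W" "s \<in> chain_map W X" "f \<in> chain_map W Y" "cx W'" "s' \<in> chain_map W' X" "f' \<in> chain_map W' Y"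
    using V(1,2) quasi_iso_cm unfolding in_roofs by blast+
  note c = cm_comp[OF V(3) W(2,1)] cm_comp[OF V(4) W(5,4)] cm_comp[OF V(3) W(3,1)] cm_comp[OF V(4) W(6,4)]
  have "cmap_shift n u \<in> chain_map (cshift n V) (cshift n W)" "cmap_shift n u' \<in> chain_map (cshift n V) (cshift n W')"
    using cmap_shift_cm V W by blast+
  moreover note cx_cshift[OF V(5)] quasi_iso_shift[OF V(6,5) o(1)] cmap_shift_homotopic[OF V(7) c(1,2) V(5) o(1)]
    cmap_shift_homotopic[OF V(8) c(3,4) V(5) o(2)] sh_roofs[OF o V(1)] sh_roofs[OF o V(2)]
  ultimately show ?thesis unfolding r r' sh_apply roof_eq_def' cmap_shift_comp by blast
qed

lemma sh_roof_class:
  assumes o: "cx X" "cx Y"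
  shows "sh n ` (roof_eq sc X Y `` {r}) = roof_eq sc (cshift n X) (cshift n Y) `` {sh n r}"
proof
  show "sh n ` (roof_eq sc X Y `` {r}) \<subseteq> roof_eq sc (cshift n X) (cshift n Y) `` {sh n r}"
    using sh_roof_eq[OF o] by blast
  show "roof_eq sc (cshift n X) (cshift n Y) `` {sh n r} \<subseteq> sh n ` (roof_eq sc X Y `` {r})"
  proof
    fix r' assume "r' \<in> roof_eq sc (cshift n X) (cshift n Y) `` {sh n r}"
    then have "(sh n r, r') \<in> roof_eq sc (cshift n X) (cshift n Y)" by blast
    from sh_roof_eq[OF cx_cshift[OF o(1)] cx_cshift[OF o(2)] this, of "-n"]
    have "(r, sh (-n) r') \<in> roof_eq sc X Y" by (simp add: sh_sh sh_0 cshift_cshift cshift_0)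
    moreover have "r' = sh n (sh (-n) r')" by (simp add: sh_sh sh_0)
    ultimately show "r' \<in> sh n ` (roof_eq sc X Y `` {r})" by blast
  qed
qed

lemma sh_comp_sub:
  assumes o: "cx X" "cx Y" "cx Z" and A: "\<alpha> \<subseteq> roofs sc X Y" "\<beta> \<subseteq> roofs sc Y Z"
  shows "sh n ` derived_comp sc X Y Z \<beta> \<alpha> \<subseteq> derived_comp sc (cshift n X) (cshift n Y) (cshift n Z) (sh n ` \<beta>) (sh n ` \<alpha>)"
proof
  fix r' assume "r' \<in> sh n ` derived_comp sc X Y Z \<beta> \<alpha>"
  then obtain r where r: "r \<in> derived_comp sc X Y Z \<beta> \<alpha>" "r' = sh n r" by blast
  obtain W s f W' t g V u h where c: "(W, s, f) \<in> \<alpha>" "(W', t, g) \<in> \<beta>" "cx V" "quasi_iso V W u" "h \<in> chain_map V W'"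
      "homotopic V Y (cmap_comp t h) (cmap_comp f u)" "((V, cmap_comp s u, cmap_comp g h), r) \<in> roof_eq sc X Z"
    using r(1) unfolding derived_comp_def by blast
  have W: "cx W" "cx W'" "f \<in> chain_map W Y" "t \<in> chain_map W' Y"
    using subsetD[OF A(1) c(1)] subsetD[OF A(2) c(2)] quasi_iso_cm unfolding in_roofs by blast+
  have 1: "sh n (W, s, f) \<in> sh n ` \<alpha>" "sh n (W', t, g) \<in> sh n ` \<beta>" using c(1,2) by blast+
  have 2: "homotopic (cshift n V) (cshift n Y) (cmap_comp (cmap_shift n t) (cmap_shift n h)) (cmap_comp (cmap_shift n f) (cmap_shift n u))"
    using cmap_shift_homotopic[OF c(6) cm_comp[OF c(5) W(4,2)] cm_comp[OF quasi_iso_cm[OF c(4)] W(3,1)] c(3) o(2)]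
    unfolding cmap_shift_comp .
  have 3: "((cshift n V, cmap_comp (cmap_shift n s) (cmap_shift n u), cmap_comp (cmap_shift n g) (cmap_shift n h)), sh n r)
     \<in> roof_eq sc (cshift n X) (cshift n Z)"
    using sh_roof_eq[OF o(1,3) c(7), of n] unfolding sh_apply cmap_shift_comp .
  show "r' \<in> derived_comp sc (cshift n X) (cshift n Y) (cshift n Z) (sh n ` \<beta>) (sh n ` \<alpha>)"
    unfolding derived_comp_def r(2)
    using 1[unfolded sh_apply] cx_cshift[OF c(3)] quasi_iso_shift[OF c(4,3) W(1)] cmap_shift_cm[OF c(5,3) W(2)] 2 3 by blast
qed

lemma sh_add_sub:
  assumes o: "cx X" "cx Y"
  shows "sh n ` derived_add sc X Y \<alpha> \<beta> \<subseteq> derived_add sc (cshift n X) (cshift n Y) (sh n ` \<alpha>) (sh n ` \<beta>)"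
proof
  fix r' assume "r' \<in> sh n ` derived_add sc X Y \<alpha> \<beta>"
  then obtain r where r: "r \<in> derived_add sc X Y \<alpha> \<beta>" "r' = sh n r" by blast
  obtain W s f g where c: "(W, s, f) \<in> \<alpha>" "(W, s, g) \<in> \<beta>" "((W, s, f + g), r) \<in> roof_eq sc X Y"
    using r(1) unfolding derived_add_def by blast
  have 1: "sh n (W, s, f) \<in> sh n ` \<alpha>" "sh n (W, s, g) \<in> sh n ` \<beta>" using c(1,2) by blast+
  have 2: "((cshift n W, cmap_shift n s, cmap_shift n f + cmap_shift n g), sh n r) \<in> roof_eq sc (cshift n X) (cshift n Y)"
    using sh_roof_eq[OF o c(3), of n] unfolding sh_apply cmap_shift_plus .
  show "r' \<in> derived_add sc (cshift n X) (cshift n Y) (sh n ` \<alpha>) (sh n ` \<beta>)"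
    unfolding derived_add_def r(2) using 1[unfolded sh_apply] 2 by blast
qed

lemma sh_image_inv: "sh n ` sh (-n) ` A = A" "sh (-n) ` sh n ` A = A"
  by (simp_all add: image_image sh_sh sh_0)

lemma shift_func_simps: "fobj (shift_func n) = cshift n" "fmap (shift_func n) X Y \<alpha> = sh n ` \<alpha>"
  by (simp_all add: shift_func_def sh_def)

end

context hered
begin

lemma Hom_D_class: "\<alpha> \<in> Hom D X Y \<longleftrightarrow> (\<exists>r \<in> roofs sc X Y. \<alpha> = roof_eq sc X Y `` {r})"
  by (simp add: Db_def quotient_def)

lemma Hom_D_sub: "\<lbrakk>\<alpha> \<in> Hom D X Y; cx X; cx Y\<rbrakk> \<Longrightarrow> \<alpha> \<subseteq> roofs sc X Y"
proof -
  assume a: "\<alpha> \<in> Hom D X Y" and o: "cx X" "cx Y"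
  obtain p where "\<alpha> = hcl X Y p" using a unfolding Hom_D[OF o] by blast
  then show ?thesis unfolding hcl_def by (simp add: subset_iff rv_roofs[of X Y])
qed

text \<open>For sums and composites only one inclusion is proved directly. The other follows by
  applying it to the inverse shift, since the shifts by \<open>n\<close> and -n are strictly inverse
  on roofs.\<close>

lemma shift_additive: "additive_functor D D (shift_func n)"
  unfolding additive_functor_def shift_func_simps D_simps(1)
proof (intro conjI ballI)
  fix X :: "('h, 'k) cpx" assume "X \<in> Ob D"
  then have X: "cx X" by simp
  show "cx (cshift n X)" using cx_cshift[OF X] .
  show "sh n ` Idn D X = Idn D (cshift n X)"
    unfolding D_simps Q_map_def sh_roof_class[OF X X] sh_apply cmap_shift_id ..
  fix Y :: "('h, 'k) cpx" assume "Y \<in> Ob D"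
  then have Y: "cx Y" by simp
  note sX = cx_cshift[OF X, of n] and sY = cx_cshift[OF Y, of n]
  show "sh n ` f \<in> Hom D (cshift n X) (cshift n Y)" if "f \<in> Hom D X Y" for f
    using that sh_roof_class[OF X Y] sh_roofs[OF X Y] unfolding Hom_D_class by blast
  show "sh n ` Add D X Y f g = Add D (cshift n X) (cshift n Y) (sh n ` f) (sh n ` g)" for f g
    unfolding D_simps
  proof
    show "sh n ` derived_add sc X Y f g \<subseteq> derived_add sc (cshift n X) (cshift n Y) (sh n ` f) (sh n ` g)"
      using sh_add_sub[OF X Y] .
    have "sh (-n) ` derived_add sc (cshift n X) (cshift n Y) (sh n ` f) (sh n ` g) \<subseteq> derived_add sc X Y f g"
      using sh_add_sub[OF sX sY, of "-n" "sh n ` f" "sh n ` g"] by (simp add: sh_image_inv cshift_cshift cshift_0)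
    from image_mono[OF this, of "sh n"]
    show "derived_add sc (cshift n X) (cshift n Y) (sh n ` f) (sh n ` g) \<subseteq> sh n ` derived_add sc X Y f g"
      unfolding sh_image_inv .
  qed
  fix Z :: "('h, 'k) cpx" assume "Z \<in> Ob D"
  then have Z: "cx Z" by simp
  note sZ = cx_cshift[OF Z, of n]
  fix f g assume f: "f \<in> Hom D X Y" and g: "g \<in> Hom D Y Z"
  note fs = Hom_D_sub[OF f X Y] and gs = Hom_D_sub[OF g Y Z]
  have fs': "sh n ` f \<subseteq> roofs sc (cshift n X) (cshift n Y)" and gs': "sh n ` g \<subseteq> roofs sc (cshift n Y) (cshift n Z)"
    using sh_roofs[OF X Y] sh_roofs[OF Y Z] fs gs by blast+
  show "sh n ` Cmp D X Y Z g f = Cmp D (cshift n X) (cshift n Y) (cshift n Z) (sh n ` g) (sh n ` f)"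
    unfolding D_simps
  proof
    show "sh n ` derived_comp sc X Y Z g f \<subseteq> derived_comp sc (cshift n X) (cshift n Y) (cshift n Z) (sh n ` g) (sh n ` f)"
      using sh_comp_sub[OF X Y Z fs gs] .
    have "sh (-n) ` derived_comp sc (cshift n X) (cshift n Y) (cshift n Z) (sh n ` g) (sh n ` f) \<subseteq> derived_comp sc X Y Z g f"
      using sh_comp_sub[OF sX sY sZ fs' gs', of "-n"] by (simp add: sh_image_inv cshift_cshift cshift_0)
    from image_mono[OF this, of "sh n"]
    show "derived_comp sc (cshift n X) (cshift n Y) (cshift n Z) (sh n ` g) (sh n ` f) \<subseteq> sh n ` derived_comp sc X Y Z g f"
      unfolding sh_image_inv .
  qed
qed

text \<open>Opposite shifts are strictly inverse, so identities serve as both natural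
  isomorphisms.\<close>

lemma shift_quasi_inverse: "quasi_inverse D (shift_func n) (shift_func (-n)) (Idn D) (Idn D)"
proof -
  have c: "cshift (-n) (cshift n X) = X" "cshift n (cshift (-n) X) = X" for X :: "('h, 'k) cpx"
    by (simp_all add: cshift_cshift cshift_0)
  have i: "sh m ` Idn D X = Idn D (cshift m X)" if "cx X" for m X
    using DC.af_idn[OF shift_additive, of X m] that unfolding shift_func_simps by simp
  have n1: "natural_iso D D id_func (comp_func (shift_func (-n)) (shift_func n)) (Idn D)"
    unfolding natural_iso_def id_func_def comp_func_def shift_func_simps
    by (simp add: c sh_image_inv shift_func_simps)
  have n2: "natural_iso D D id_func (comp_func (shift_func n) (shift_func (-n))) (Idn D)"
    unfolding natural_iso_def id_func_def comp_func_def shift_func_simps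
    by (simp add: c sh_image_inv shift_func_simps)
  show ?thesis unfolding quasi_inverse_def using shift_additive n1 n2 i
    by (simp add: shift_func_simps c cx_cshift)
qed

end

section \<open>Weak cokernels and endomorphism rings\<close>

context preadd
begin

text \<open>With \<open>y\<close> inverse to \<open>x\<close>, an endomorphism \<open>f\<close> of
  \<open>X\<close> is x times y f. Conjugation decides invertibility, and nilpotence passes between
  the two orders of this product.\<close>

lemma nil_or_iso_iso:
  assumes P: "nil_or_iso P" and i: "isomorphic C P X" and X: "X \<in> Ob C"
  shows "nil_or_iso X"
  unfolding nil_or_iso_def
proof (intro conjI ballI X)
  fix f assume f: "f \<in> Hom C X X"
  have Po: "P \<in> Ob C" using P nil_or_iso_Ob by blast
  obtain x where x: "is_iso C P X x" using i unfolding isomorphic_def by blast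
  obtain y where y: "x \<in> Hom C P X" "y \<in> Hom C X P" "Cmp C P X P y x = Idn C P" "Cmp C X P X x y = Idn C X" "is_iso C X P y"
    using is_isoE[OF x] by blast
  let ?i = "Cmp C X X P y f"
  have i: "?i \<in> Hom C X P" using f y X Po by simp
  have pi: "Cmp C X P X x ?i = f" using f y X Po by simp
  have ip: "Cmp C P X P ?i x \<in> Hom C P P" using i y X Po by simp
  show "is_iso C X X f \<or> (\<exists>n::nat. f [^]\<^bsub>End X\<^esub> n = Nul C X X)"
  proof (cases "is_iso C P P (Cmp C P X P ?i x)")
    case True
    have "Cmp C X P X (Cmp C P P X x (Cmp C P X P ?i x)) y = f" using f y X Po by (simp add: assoc)
    moreover have "is_iso C X X (Cmp C X P X (Cmp C P P X x (Cmp C P X P ?i x)) y)"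
      using is_iso_cmp[OF y(5) is_iso_cmp[OF True x Po Po X] X Po X] .
    ultimately show ?thesis by simp
  next
    case False
    then obtain n :: nat where n: "(Cmp C P X P ?i x) [^]\<^bsub>End P\<^esub> n = Nul C P P" using nil_or_isoD[OF P ip] by blast
    have "f [^]\<^bsub>End X\<^esub> Suc n = Nul C X X" using cmp_pow_Suc[OF y(1) i Po X, of n] i y(1) Po X unfolding pi n by simp
    then show ?thesis by blast
  qed
qed

text \<open>Splitting off one factor on either side of the power gives a left and a right inverse,
  which then coincide.\<close>

lemma is_iso_pow_Suc:
  assumes f: "f \<in> Hom C X X" and X: "X \<in> Ob C" and i: "is_iso C X X (f [^]\<^bsub>End X\<^esub> Suc n)"
  shows "is_iso C X X f"
proof -
  interpret R: ring "End X" using ring_End X by blast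
  let ?g = "f [^]\<^bsub>End X\<^esub> n"
  have g: "?g \<in> Hom C X X" using f X by simp
  have 1: "f [^]\<^bsub>End X\<^esub> Suc n = Cmp C X X X ?g f" by (rule End_pow_Suc)
  have 2: "f [^]\<^bsub>End X\<^esub> Suc n = Cmp C X X X f ?g" using R.nat_pow_Suc2[of f n] f by simp
  obtain v where v: "v \<in> Hom C X X" "Cmp C X X X v (f [^]\<^bsub>End X\<^esub> Suc n) = Idn C X" "Cmp C X X X (f [^]\<^bsub>End X\<^esub> Suc n) v = Idn C X"
    using i unfolding is_iso_def by blast
  let ?l = "Cmp C X X X v ?g" and ?r = "Cmp C X X X ?g v"
  have lr: "?l \<in> Hom C X X" "?r \<in> Hom C X X" using v g X by simp_all
  have l: "Cmp C X X X ?l f = Idn C X" using v(2) assoc[OF f g v(1) X X X X] unfolding 1 by simp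
  have r: "Cmp C X X X f ?r = Idn C X" using v(3) assoc[OF v(1) g f X X X X] unfolding 2 by simp
  have "?l = Cmp C X X X ?l (Cmp C X X X f ?r)" using lr r X by simp
  also have "\<dots> = ?r" using assoc[OF lr(2) f lr(1) X X X X] l lr X by simp
  finally show ?thesis unfolding is_iso_def using f lr l r by metis
qed

text \<open>The object \<open>B\<close> is arbitrary: of a triangle only the exactness of the Hom sequences is used.\<close>

definition is_weak_cokernel :: "'o \<Rightarrow> 'o \<Rightarrow> 'a \<Rightarrow> bool" where
  "is_weak_cokernel X V h \<longleftrightarrow> (\<exists>B \<in> Ob C. \<exists>c \<in> Hom C B X. Cmp C B X V h c = Nul C B V \<and>
     (\<forall>U \<in> Ob C. \<forall>w \<in> Hom C X U. Cmp C B X U w c = Nul C B U \<longrightarrow> (\<exists>g \<in> Hom C V U. w = Cmp C X V U g h)))"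

definition is_weak_kernel :: "'o \<Rightarrow> 'o \<Rightarrow> 'a \<Rightarrow> bool" where
  "is_weak_kernel V U g \<longleftrightarrow> (\<exists>B \<in> Ob C. \<exists>s \<in> Hom C U B. Cmp C V U B s g = Nul C V B \<and>
     (\<forall>X \<in> Ob C. \<forall>w \<in> Hom C X U. Cmp C X U B s w = Nul C X B \<longrightarrow> (\<exists>h \<in> Hom C X V. w = Cmp C X V U g h)))"

lemma is_weak_cokernelI:
  "\<lbrakk>B \<in> Ob C; c \<in> Hom C B X; Cmp C B X V h c = Nul C B V;
    \<And>U w. \<lbrakk>U \<in> Ob C; w \<in> Hom C X U; Cmp C B X U w c = Nul C B U\<rbrakk> \<Longrightarrow> \<exists>g \<in> Hom C V U. w = Cmp C X V U g h\<rbrakk>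
   \<Longrightarrow> is_weak_cokernel X V h"
  unfolding is_weak_cokernel_def by blast

lemma is_weak_kernelI:
  "\<lbrakk>B \<in> Ob C; s \<in> Hom C U B; Cmp C V U B s g = Nul C V B;
    \<And>X w. \<lbrakk>X \<in> Ob C; w \<in> Hom C X U; Cmp C X U B s w = Nul C X B\<rbrakk> \<Longrightarrow> \<exists>h \<in> Hom C X V. w = Cmp C X V U g h\<rbrakk>
   \<Longrightarrow> is_weak_kernel V U g"
  unfolding is_weak_kernel_def by blast

text \<open>Invariance under isomorphic replacement of a morphism reduces the existence theorem to
  chain maps between resolutions.\<close>

lemma is_weak_cokernel_iso:
  assumes k: "is_weak_cokernel X V h" and h: "h \<in> Hom C X V" and x: "is_iso C X X' x" and v: "is_iso C V V' v"
    and h': "h' \<in> Hom C X' V'" and e: "Cmp C X X' V' h' x = Cmp C X V V' v h"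
    and o: "X \<in> Ob C" "V \<in> Ob C" "X' \<in> Ob C" "V' \<in> Ob C"
  shows "is_weak_cokernel X' V' h'"
proof -
  obtain B c where c: "B \<in> Ob C" "c \<in> Hom C B X" "Cmp C B X V h c = Nul C B V"
    "\<And>U w. \<lbrakk>U \<in> Ob C; w \<in> Hom C X U; Cmp C B X U w c = Nul C B U\<rbrakk> \<Longrightarrow> \<exists>g \<in> Hom C V U. w = Cmp C X V U g h"
    using k unfolding is_weak_cokernel_def by blast
  obtain y where y: "x \<in> Hom C X X'" "y \<in> Hom C X' X" "Cmp C X X' X y x = Idn C X" "Cmp C X' X X' x y = Idn C X'"
    using is_isoE[OF x] by blast
  obtain u where u: "v \<in> Hom C V V'" "u \<in> Hom C V' V" "Cmp C V V' V u v = Idn C V" "Cmp C V' V V' v u = Idn C V'"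
    using is_isoE[OF v] by blast
  let ?c = "Cmp C B X X' x c"
  have c': "?c \<in> Hom C B X'" using c y o by simp
  have "Cmp C B X' V' h' ?c = Cmp C B X V' (Cmp C X X' V' h' x) c" using assoc[OF c(2) y(1) h'] c(1) o by simp
  also have "\<dots> = Cmp C B V V' v (Cmp C B X V h c)" unfolding e using assoc[OF c(2) h u(1)] c(1) o by simp
  finally have 1: "Cmp C B X' V' h' ?c = Nul C B V'" using c u o by simp
  have "\<exists>g \<in> Hom C V' U. w = Cmp C X' V' U g h'"
    if U: "U \<in> Ob C" and w: "w \<in> Hom C X' U" "Cmp C B X' U w ?c = Nul C B U" for U w
  proof -
    have wx: "Cmp C X X' U w x \<in> Hom C X U" using w y o U by simp
    have "Cmp C B X U (Cmp C X X' U w x) c = Nul C B U" using assoc[OF c(2) y(1) w(1)] w(2) c(1) o U by simp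
    then obtain g where g: "g \<in> Hom C V U" "Cmp C X X' U w x = Cmp C X V U g h" using c(4)[OF U wx] by blast
    have gu: "Cmp C V' V U g u \<in> Hom C V' U" using g u o U by simp
    have "Cmp C X X' U (Cmp C X' V' U (Cmp C V' V U g u) h') x = Cmp C X V' U (Cmp C V' V U g u) (Cmp C X X' V' h' x)"
      using assoc[OF y(1) h' gu] o U by simp
    also have "\<dots> = Cmp C X V U g (Cmp C X V' V u (Cmp C X V V' v h))"
      unfolding e using assoc[OF cmp_in[OF h u(1)] u(2) g(1)] o U by simp
    also have "\<dots> = Cmp C X X' U w x" using cancel_l[OF u(3) h u(1,2)] g(2) o by simp
    finally have "Cmp C X' V' U (Cmp C V' V U g u) h' = w"
      using cmp_cancel_iso_r[OF x _ w(1)] gu h' o U by simp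
    then show ?thesis using gu by blast
  qed
  then show ?thesis unfolding is_weak_cokernel_def using c(1) c' 1 by blast
qed

lemma is_weak_kernel_iso:
  assumes k: "is_weak_kernel V U g" and g: "g \<in> Hom C V U" and v: "is_iso C V V' v" and u: "is_iso C U U' u"
    and g': "g' \<in> Hom C V' U'" and e: "Cmp C V V' U' g' v = Cmp C V U U' u g"
    and o: "V \<in> Ob C" "U \<in> Ob C" "V' \<in> Ob C" "U' \<in> Ob C"
  shows "is_weak_kernel V' U' g'"
proof -
  obtain B s where s: "B \<in> Ob C" "s \<in> Hom C U B" "Cmp C V U B s g = Nul C V B"
    "\<And>X w. \<lbrakk>X \<in> Ob C; w \<in> Hom C X U; Cmp C X U B s w = Nul C X B\<rbrakk> \<Longrightarrow> \<exists>h \<in> Hom C X V. w = Cmp C X V U g h"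
    using k unfolding is_weak_kernel_def by blast
  obtain y where y: "v \<in> Hom C V V'" "y \<in> Hom C V' V" "Cmp C V V' V y v = Idn C V" "Cmp C V' V V' v y = Idn C V'"
    using is_isoE[OF v] by blast
  obtain x where x: "u \<in> Hom C U U'" "x \<in> Hom C U' U" "Cmp C U U' U x u = Idn C U" "Cmp C U' U U' u x = Idn C U'" "is_iso C U' U x"
    using is_isoE[OF u] by blast
  let ?s = "Cmp C U' U B s x"
  have s': "?s \<in> Hom C U' B" using s x o by simp
  have ev: "g' = Cmp C V' U U' u (Cmp C V' V U g y)"
  proof -
    have "Cmp C V V' U' (Cmp C V' U U' u (Cmp C V' V U g y)) v = Cmp C V U U' u (Cmp C V V' U (Cmp C V' V U g y) v)"
      using assoc[OF y(1) cmp_in[OF y(2) g] x(1)] o by simp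
    also have "Cmp C V V' U (Cmp C V' V U g y) v = g" using assoc[OF y(1,2) g] y(3) g o by simp
    finally show ?thesis using cmp_cancel_iso_r[OF v g', of "Cmp C V' U U' u (Cmp C V' V U g y)"] e g y x o by simp
  qed
  have "Cmp C V' U' B ?s g' = Cmp C V' U B s (Cmp C V' U' U x g')" using assoc[OF g' x(2) s(2)] s(1) o by simp
  also have "Cmp C V' U' U x g' = Cmp C V' V U g y" unfolding ev using cancel_l[OF x(3) cmp_in[OF y(2) g] x(1,2)] o by simp
  also have "Cmp C V' U B s (Cmp C V' V U g y) = Cmp C V' V B (Cmp C V U B s g) y" using assoc[OF y(2) g s(2)] s(1) o by simp
  finally have 1: "Cmp C V' U' B ?s g' = Nul C V' B" using s y o by simp
  have "\<exists>h \<in> Hom C X V'. w = Cmp C X V' U' g' h"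
    if X: "X \<in> Ob C" and w: "w \<in> Hom C X U'" "Cmp C X U' B ?s w = Nul C X B" for X w
  proof -
    have xw: "Cmp C X U' U x w \<in> Hom C X U" using w x o X by simp
    have "Cmp C X U B s (Cmp C X U' U x w) = Nul C X B" using assoc[OF w(1) x(2) s(2)] w(2) s(1) o X by simp
    then obtain h where h: "h \<in> Hom C X V" "Cmp C X U' U x w = Cmp C X V U g h" using s(4)[OF X xw] by blast
    have vh: "Cmp C X V V' v h \<in> Hom C X V'" using h y o X by simp
    have "Cmp C X V' U' g' (Cmp C X V V' v h) = Cmp C X V U' (Cmp C V V' U' g' v) h" using assoc[OF h(1) y(1) g'] o X by simp
    also have "\<dots> = Cmp C X U U' u (Cmp C X U' U x w)" unfolding e h(2) using assoc[OF h(1) g x(1)] o X by simp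
    also have "\<dots> = w" using cancel_l[OF x(4) w(1) x(2,1)] o X by simp
    finally show ?thesis using vh by metis
  qed
  then show ?thesis unfolding is_weak_kernel_def using s(1) s' 1 by blast
qed

end

context hered
begin

text \<open>The preceding morphism is the projection \<open>?c\<close> from the cone shifted by -1
  to \<open>P\<close>. A null homotopy \<open>k\<close> of x c restricts on the summand
  \<open>V\<close> to a chain map \<open>?g\<close>, and on the summand \<open>P\<close> to a
  homotopy \<open>?l\<close> between \<open>x\<close> and - g f.\<close>

lemma perf_weak_cokernel:
  assumes P: "perf P" and V: "perf V" and f: "f \<in> chain_map P V"
  shows "DC.is_weak_cokernel P V (Q P V f)"
proof -
  note cP = perf_cx[OF P] and cV = perf_cx[OF V]
  let ?K = "cone P V f"
  let ?C = "cshift (-1) ?K"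
  have pC: "perf ?C" using perf_cshift[OF perf_cone[OF P V f]] .
  note cC = perf_cx[OF pC] and cK = cx_cone[OF cP cV f]
  note mP = cx_modl[OF cP] and mV = cx_modl[OF cV]
  have Cm: "cmod ?C i = sum_module (cmod P i) (cmod V (i - 1))" for i by (simp add: cone_simps(2))
  have Cd: "diff ?C i u = interleave (diff P i (evens u)) (- f i (evens u) - diff V (i - 1) (odds u))"
    if u: "evens u \<in> carr (cmod P i)" "odds u \<in> carr (cmod V (i - 1))" for i u
  proof -
    have E: "diff ?C i = - diff ?K (i - 1)" by simp
    have EE: "diff ?C i u = - diff ?K (i - 1) u" unfolding E by (rule uminus_apply)
    have D: "diff ?K (i - 1) u = interleave (- diff P i (evens u)) (f i (evens u) + diff V (i - 1) (odds u))"
      using cone_simps(3)[of u P "i - 1" V f] u by simp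
    show ?thesis unfolding EE D
      by (rule seq_eqI) (simp_all only: evens_interleave odds_interleave evens_simps odds_simps minus_minus minus_add_distrib diff_conv_add_uminus)
  qed
  have Cc: "u \<in> carr (cmod ?C i) \<longleftrightarrow> evens u \<in> carr (cmod P i) \<and> odds u \<in> carr (cmod V (i - 1))" for u i
    unfolding Cm by (simp add: sum_module_simps)
  let ?c = "\<lambda>i. restr0 (carr (cmod ?C i)) evens"
  have idC: "restr0 (carr (cmod ?C i)) (\<lambda>u. u) \<in> mod_hom (cmod ?C i) (sum_module (cmod P i) (cmod V (i - 1)))" for i
    using hom_id[OF cx_modl[OF cC], of i] unfolding Cm .
  have ce: "?c i = (\<lambda>v. evens (restr0 (carr (cmod ?C i)) (\<lambda>u. u) v))" for i by (rule ext) (simp add: restr0_def)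
  have ch: "?c i \<in> mod_hom (cmod ?C i) (cmod P i)" for i unfolding ce using hom_evens[OF idC] .
  have c: "?c \<in> chain_map ?C P"
  proof (rule chain_mapI[OF cC cP ch])
    fix i u assume u: "u \<in> carr (cmod ?C i)"
    then have u': "evens u \<in> carr (cmod P i)" "odds u \<in> carr (cmod V (i - 1))" using Cc by blast+
    have "diff ?C i u \<in> carr (cmod ?C (i + 1))" using hom_in[OF cx_diff[OF cC] u] .
    then have "?c (i + 1) (diff ?C i u) = evens (diff ?C i u)" by (simp only: restr0_def if_True)
    then show "?c (i + 1) (diff ?C i u) = diff P i (?c i u)" unfolding Cd[OF u'] using u by (simp only: restr0_def if_True evens_interleave)
  qed
  let ?o = "\<lambda>i. restr0 (carr (cmod ?C i)) odds"
  have oe: "?o i = (\<lambda>v. odds (restr0 (carr (cmod ?C i)) (\<lambda>u. u) v))" for i by (rule ext) (simp add: restr0_def)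
  have oh: "?o i \<in> mod_hom (cmod ?C i) (cmod V (i - 1))" for i unfolding oe using hom_odds[OF idC] .
  have "homotopic ?C V (cmap_comp f ?c) 0"
  proof (rule homotopicI[where h = "\<lambda>i. - ?o i", OF cm_comp[OF c f cP] cm_zero[OF cC cV] cC cV])
    show "- ?o i \<in> mod_hom (cmod ?C i) (cmod V (i - 1))" for i using hom_uminus[OF oh mV] .
    fix i u assume u: "u \<in> carr (cmod ?C i)"
    then have u': "evens u \<in> carr (cmod P i)" "odds u \<in> carr (cmod V (i - 1))" using Cc by blast+
    have d: "diff ?C i u \<in> carr (cmod ?C (i + 1))" using hom_in[OF cx_diff[OF cC] u] .
    have 1: "diff V (i - 1) (- odds u) = - diff V (i - 1) (odds u)"
      using hom_neg[OF cx_diff'[OF cV] mV u'(2)] .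
    have 2: "(- ?o i) u = - odds u" "(- ?o (i + 1)) (diff ?C i u) = - (- f i (evens u) - diff V (i - 1) (odds u))"
      using u d unfolding uminus_apply[of "?o i" u] uminus_apply[of "?o (i + 1)"] Cd[OF u']
      by (simp_all only: restr0_def if_True odds_interleave)
    have 3: "cmap_comp f ?c i u = f i (evens u)" using u by (simp only: cmap_comp_def comp_apply restr0_def if_True)
    show "cmap_comp f ?c i u - 0 i u = diff V (i - 1) ((- ?o i) u) + (- ?o (i + 1)) (diff ?C i u)"
      unfolding 2 1 3 by simp
  qed
  then have "hq ?C V (cmap_comp f ?c) 0" unfolding hq_def using cC cV cm_comp[OF c f cP] cm_zero[OF cC cV] by blast
  then have 1: "Cmp D ?C P V (Q P V f) (Q ?C P ?c) = Nul D ?C V"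
    unfolding Q_cmp[OF c f cC cP cV] using Q_eq Q_nul by metis
  have "\<exists>g \<in> Hom D V U. w = Cmp D P V U g (Q P V f)"
    if U: "cx U" and w: "w \<in> Hom D P U" "Cmp D ?C P U w (Q ?C P ?c) = Nul D ?C U" for U w
  proof -
    note mU = cx_modl[OF U]
    obtain x where x: "x \<in> chain_map P U" "w = Q P U x" using Q_surj[OF P U w(1)] by blast
    have xc: "cmap_comp x ?c \<in> chain_map ?C U" using cm_comp[OF c x(1) cP] .
    have "Q ?C U (cmap_comp x ?c) = Q ?C U 0" using w(2) unfolding x(2) Q_cmp[OF c x(1) cC cP U] Q_nul .
    then have H: "homotopic ?C U (cmap_comp x ?c) 0"
      using Q_eqD[OF pC U xc cm_zero[OF cC U]] hqD(3) by blast
    obtain k where k: "\<And>i. k i \<in> mod_hom (cmod ?C i) (cmod U (i - 1))"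
      "\<And>i u. cmap_comp x ?c i u - 0 i u = diff U (i - 1) (k i u) + k (i + 1) (diff ?C i u)" using homotopicE[OF H] by blast
    have k0: "k i 0 = 0" for i using hom_0[OF k(1) cx_modl[OF cC]] .
    let ?g = "\<lambda>i. restr0 (carr (cmod V i)) (\<lambda>v. k (i + 1) (interleave 0 v))"
    let ?l = "\<lambda>i. restr0 (carr (cmod P i)) (\<lambda>v. k i (interleave v 0))"
    have kS: "k (i + 1) \<in> mod_hom (cmod ?C (i + 1)) (cmod U i)" for i using k(1)[of "i + 1"] by simp
    have in1: "interleave 0 v \<in> carr (cmod ?C (i + 1))" if "v \<in> carr (cmod V i)" for v i using that mP unfolding Cc by simp
    have in2: "interleave v 0 \<in> carr (cmod ?C i)" if "v \<in> carr (cmod P i)" for v i using that mV unfolding Cc by simp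
    have act1: "act (cmod ?C (i + 1)) h (interleave 0 v) = interleave 0 (act (cmod V i) h v)" for i h v
      unfolding Cm using mP by (simp add: sum_module_simps)
    have act2: "act (cmod ?C i) h (interleave v 0) = interleave (act (cmod P i) h v) 0" for i h v
      unfolding Cm using mV by (simp add: sum_module_simps)
    have gh: "?g i \<in> mod_hom (cmod V i) (cmod U i)" for i
    proof (rule mod_homI)
      fix v assume v: "v \<in> carr (cmod V i)"
      show "?g i v \<in> carr (cmod U i)" using v hom_in[OF kS in1[OF v]] by (simp add: restr0_def)
      show "?g i (act (cmod V i) h v) = act (cmod U i) h (?g i v)" for h
        using v hom_act[OF kS in1[OF v], of h] mV unfolding act1 by (simp add: restr0_def)
      show "?g i (v + w) = ?g i v + ?g i w" if "w \<in> carr (cmod V i)" for w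
        using v that hom_add[OF kS in1[OF v] in1[OF that]] mV by (simp add: restr0_def interleave_add)
    qed (simp add: restr0_def)
    have lh: "?l i \<in> mod_hom (cmod P i) (cmod U (i - 1))" for i
    proof (rule mod_homI)
      fix v assume v: "v \<in> carr (cmod P i)"
      show "?l i v \<in> carr (cmod U (i - 1))" using v hom_in[OF k(1) in2[OF v]] by (simp add: restr0_def)
      show "?l i (act (cmod P i) h v) = act (cmod U (i - 1)) h (?l i v)" for h
        using v hom_act[OF k(1) in2[OF v], of h] mP unfolding act2 by (simp add: restr0_def)
      show "?l i (v + w) = ?l i v + ?l i w" if "w \<in> carr (cmod P i)" for w
        using v that hom_add[OF k(1) in2[OF v] in2[OF that]] mP by (simp add: restr0_def interleave_add)
    qed (simp add: restr0_def)
    have x0: "x i 0 = 0" for i using hom_0[OF cm_hom[OF x(1)] mP] .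
    have f0: "f i 0 = 0" for i using hom_0[OF cm_hom[OF f] mP] .
    have dP0: "diff P i 0 = 0" for i using hom_0[OF cx_diff[OF cP] mP] .
    have dV0: "diff V i 0 = 0" for i using hom_0[OF cx_diff[OF cV] mV] .
    have g: "?g \<in> chain_map V U"
    proof (rule chain_mapI[OF cV U gh])
      fix i v assume v: "v \<in> carr (cmod V i)"
      have dv: "diff V i v \<in> carr (cmod V (i + 1))" using hom_in[OF cx_diff[OF cV] v] .
      have "diff ?C (i + 1) (interleave 0 v) = interleave 0 (- diff V i v)"
        using Cd[of "interleave 0 v" "i + 1"] v mP by (simp add: f0 dP0)
      also have "\<dots> = - interleave 0 (diff V i v)"
        by (rule seq_eqI) (simp_all only: evens_interleave odds_interleave evens_simps odds_simps minus_zero)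
      finally have "k (i + 1 + 1) (diff ?C (i + 1) (interleave 0 v)) = - k (i + 1 + 1) (interleave 0 (diff V i v))"
        using hom_neg[OF k(1) cx_modl[OF cC] in1[OF dv]] by simp
      moreover have "cmap_comp x ?c (i + 1) (interleave 0 v) = 0"
        using in1[OF v] by (simp only: cmap_comp_def comp_apply restr0_def if_True evens_interleave x0)
      ultimately have "0 = diff U i (k (i + 1) (interleave 0 v)) + - k (i + 1 + 1) (interleave 0 (diff V i v))"
        using k(2)[of "i + 1" "interleave 0 v"] by simp
      then show "?g (i + 1) (diff V i v) = diff U i (?g i v)" using v dv by (simp add: restr0_def)
    qed
    have gf: "cmap_comp ?g f \<in> chain_map P U" using cm_comp[OF f g cV] .
    \<comment> \<open>The differential of \<open>?C\<close> contains -f, so the factorisation is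
      through \<open>- ?g\<close>.\<close>
    have ng: "- ?g \<in> chain_map V U" using cm_uminus[OF g cV U] .
    have "homotopic P U x (cmap_comp (- ?g) f)"
    proof (rule homotopicI[where h = ?l, OF x(1) cm_comp[OF f ng cV] cP U lh])
      fix i v assume v: "v \<in> carr (cmod P i)"
      have dv: "diff P i v \<in> carr (cmod P (i + 1))" using hom_in[OF cx_diff[OF cP] v] .
      have fv: "f i v \<in> carr (cmod V i)" using hom_in[OF cm_hom[OF f] v] .
      have "diff ?C i (interleave v 0) = interleave (diff P i v) (- f i v)"
        using Cd[of "interleave v 0" i] v mV by (simp add: dV0)
      also have "\<dots> = interleave (diff P i v) 0 - interleave 0 (f i v)"
        by (rule seq_eqI) (simp_all only: evens_interleave odds_interleave evens_simps odds_simps diff_zero diff_0)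
      finally have "k (i + 1) (diff ?C i (interleave v 0)) = k (i + 1) (interleave (diff P i v) 0) - k (i + 1) (interleave 0 (f i v))"
        using hom_diff[OF k(1) cx_modl[OF cC] in2[OF dv] in1[OF fv]] by simp
      moreover have "cmap_comp x ?c i (interleave v 0) = x i v"
        using in2[OF v] by (simp only: cmap_comp_def comp_apply restr0_def if_True evens_interleave)
      ultimately have "x i v = diff U (i - 1) (k i (interleave v 0)) + (k (i + 1) (interleave (diff P i v) 0) - k (i + 1) (interleave 0 (f i v)))"
        using k(2)[of i "interleave v 0"] by simp
      moreover have "cmap_comp (- ?g) f i v = - k (i + 1) (interleave 0 (f i v))"
        using fv by (simp add: cmap_comp_def restr0_def)
      moreover have "?l i v = k i (interleave v 0)" "?l (i + 1) (diff P i v) = k (i + 1) (interleave (diff P i v) 0)"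
        using v dv by (simp_all only: restr0_def if_True)
      ultimately show "x i v - cmap_comp (- ?g) f i v = diff U (i - 1) (?l i v) + ?l (i + 1) (diff P i v)"
        by simp
    qed
    then have "hq P U x (cmap_comp (- ?g) f)" unfolding hq_def using cP U x(1) cm_comp[OF f ng cV] by blast
    then have "w = Cmp D P V U (Q V U (- ?g)) (Q P V f)" unfolding x(2) Q_cmp[OF f ng cP cV U] using Q_eq by blast
    then show ?thesis using Q_in[OF ng cV U] by blast
  qed
  from DC.is_weak_cokernelI[unfolded D_simps(1), OF cC Q_in[OF c cC cP] 1 this] show ?thesis .
qed

text \<open>The next morphism is the inclusion into the cone. A morphism killed by it is moved to
  the resolution of its source, where it is a chain map with null-homotopic composite, and
  \<open>cone_factor\<close> lifts it through \<open>f\<close>.\<close>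

lemma perf_weak_kernel:
  assumes V: "perf V" and U: "perf U" and f: "f \<in> chain_map V U"
  shows "DC.is_weak_kernel V U (Q V U f)"
proof -
  note cV = perf_cx[OF V] and cU = perf_cx[OF U]
  let ?K = "cone V U f"
  note cK = cx_cone[OF cV cU f] and s = cone_in_cm[OF cV cU f]
  note mV = cx_modl[OF cV] and mU = cx_modl[OF cU]
  have sf: "cmap_comp (cone_in U) f \<in> chain_map V ?K" using cm_comp[OF f s cU] .
  let ?k = "\<lambda>i. restr0 (carr (cmod V i)) (\<lambda>v. interleave v 0)"
  have "homotopic V ?K (cmap_comp (cone_in U) f) 0"
  proof (rule homotopicI[where h = ?k, OF sf cm_zero[OF cV cK] cV cK])
    fix i
    have c: "cmod ?K (i - 1) = sum_module (cmod V i) (cmod U (i - 1))" by (simp add: cone_simps(2))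
    show "?k i \<in> mod_hom (cmod V i) (cmod ?K (i - 1))"
      unfolding c by (rule mod_homI) (simp_all add: restr0_def sum_module_simps mV mU interleave_add)
    fix v assume v: "v \<in> carr (cmod V i)"
    have dv: "diff V i v \<in> carr (cmod V (i + 1))" using hom_in[OF cx_diff[OF cV] v] .
    have fv: "f i v \<in> carr (cmod U i)" using hom_in[OF cm_hom[OF f] v] .
    have d0: "diff U (i - 1) 0 = 0" using hom_0[OF cx_diff[OF cU] mU] .
    have "diff ?K (i - 1) (interleave v 0) = interleave (- diff V i v) (f i v)"
      using cone_simps(3)[of "interleave v 0" V "i - 1" U f] v mU by (simp add: d0)
    then have "diff ?K (i - 1) (?k i v) + ?k (i + 1) (diff V i v) = interleave 0 (f i v)"
      using v dv by (simp add: restr0_def interleave_add)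
    then show "cmap_comp (cone_in U) f i v - 0 i v = diff ?K (i - 1) (?k i v) + ?k (i + 1) (diff V i v)"
      using fv by (simp add: cmap_comp_def cone_in_apply)
  qed
  then have "hq V ?K (cmap_comp (cone_in U) f) 0" unfolding hq_def using cV cK sf cm_zero[OF cV cK] by blast
  then have 1: "Cmp D V U ?K (Q U ?K (cone_in U)) (Q V U f) = Nul D V ?K"
    unfolding Q_cmp[OF f s cV cU cK] using Q_eq Q_nul by metis
  have "\<exists>h \<in> Hom D X V. w = Cmp D X V U (Q V U f) h"
    if X: "cx X" and w: "w \<in> Hom D X U" "Cmp D X U ?K (Q U ?K (cone_in U)) w = Nul D X ?K" for X w
  proof -
    note R = cx_res[OF X] and pR = perf_res[OF X]
    let ?p = "Q (res X) X (rp X)"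
    have p: "is_iso D (res X) X ?p" using Q_iso[OF quasi_iso_rp[OF X] R X] .
    obtain y where y: "?p \<in> Hom D (res X) X" "y \<in> Hom D X (res X)" "Cmp D (res X) X (res X) y ?p = Idn D (res X)" "Cmp D X (res X) X ?p y = Idn D X"
      by (rule DC.is_isoE[OF p]) (rule that)
    have wp: "Cmp D (res X) X U w ?p \<in> Hom D (res X) U" using DC.cmp_in[OF y(1) w(1)] X R cU by simp
    obtain x where x: "x \<in> chain_map (res X) U" "Cmp D (res X) X U w ?p = Q (res X) U x"
      using Q_surj[OF pR cU wp] by blast
    have "Cmp D (res X) U ?K (Q U ?K (cone_in U)) (Cmp D (res X) X U w ?p) = Nul D (res X) ?K"
      using DC.assoc[OF y(1) w(1) Q_in[OF s cU cK]] w(2) y X R cU cK by simp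
    then have "Q (res X) ?K (cmap_comp (cone_in U) x) = Q (res X) ?K 0"
      unfolding x(2) Q_cmp[OF x(1) s R cU cK] Q_nul .
    then have "homotopic (res X) ?K (cmap_comp (cone_in U) x) 0"
      using Q_eqD[OF pR cK cm_comp[OF x(1) s cU] cm_zero[OF R cK]] hqD(3) by blast
    then obtain a where a: "a \<in> chain_map (res X) V" "homotopic (res X) U (cmap_comp f a) x"
      using cone_factor[OF cV cU R f x(1)] by blast
    then have "hq (res X) U (cmap_comp f a) x" unfolding hq_def using R cU cm_comp[OF a(1) f cV] x(1) by blast
    then have e: "Cmp D (res X) X U w ?p = Cmp D (res X) V U (Q V U f) (Q (res X) V a)"
      unfolding x(2) Q_cmp[OF a(1) f R cV cU] using Q_eq by metis
    have "w = Cmp D X (res X) U (Cmp D (res X) X U w ?p) y"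
      using DC.assoc[OF y(2,1) w(1)] y(4) w(1) X R cU by simp
    also have "\<dots> = Cmp D X V U (Q V U f) (Cmp D X (res X) V (Q (res X) V a) y)"
      unfolding e using DC.assoc[OF y(2) Q_in[OF a(1) R cV] Q_in[OF f cV cU]] X R cV cU by simp
    finally show ?thesis using DC.cmp_in[OF y(2) Q_in[OF a(1) R cV]] X R cV by auto
  qed
  from DC.is_weak_kernelI[unfolded D_simps(1), OF cK Q_in[OF s cU cK] 1 this] show ?thesis .
qed

text \<open>Up to isomorphisms of source and target every morphism is a chain map between
  resolutions; the two existence theorems for weak kernels and cokernels follow from this.\<close>

lemma hom_to_res:
  assumes o: "cx X" "cx Y" and h: "h \<in> Hom D X Y"
  obtains f where "f \<in> chain_map (res X) (res Y)"
    "Cmp D (res X) X Y h (Q (res X) X (rp X)) = Cmp D (res X) (res Y) Y (Q (res Y) Y (rp Y)) (Q (res X) (res Y) f)"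
proof -
  note R = cx_res[OF o(1)] cx_res[OF o(2)]
  note m = rp_cm[OF o(1)] rp_cm[OF o(2)]
  have "Cmp D (res X) X Y h (Q (res X) X (rp X)) \<in> Hom D (res X) Y" using h Q_in[OF m(1) R(1) o(1)] R o by simp
  then obtain p where p: "p \<in> chain_map (res X) Y" "Cmp D (res X) X Y h (Q (res X) X (rp X)) = Q (res X) Y p"
    using Q_surj[OF perf_res[OF o(1)] o(2)] by blast
  obtain f where f: "f \<in> chain_map (res X) (res Y)" "hq (res X) Y (cmap_comp (rp Y) f) p"
    using lift_hq[OF perf_res[OF o(1)] R(2) o(2) quasi_iso_rp[OF o(2)] p(1)] by blast
  show ?thesis using that[OF f(1)] unfolding p(2) Q_cmp[OF f(1) m(2) R o(2)] using Q_eq[OF f(2)] by simp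
qed

theorem weak_cokernel: "\<lbrakk>cx X; cx Y; h \<in> Hom D X Y\<rbrakk> \<Longrightarrow> DC.is_weak_cokernel X Y h"
proof -
  assume o: "cx X" "cx Y" and h: "h \<in> Hom D X Y"
  note R = cx_res[OF o(1)] cx_res[OF o(2)]
  obtain f where f: "f \<in> chain_map (res X) (res Y)"
    "Cmp D (res X) X Y h (Q (res X) X (rp X)) = Cmp D (res X) (res Y) Y (Q (res Y) Y (rp Y)) (Q (res X) (res Y) f)"
    using hom_to_res[OF o h] by blast
  show ?thesis
    using DC.is_weak_cokernel_iso[OF perf_weak_cokernel[OF perf_res[OF o(1)] perf_res[OF o(2)] f(1)] Q_in[OF f(1) R]
        Q_iso[OF quasi_iso_rp[OF o(1)] R(1) o(1)] Q_iso[OF quasi_iso_rp[OF o(2)] R(2) o(2)] h f(2)] R o by simp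
qed

theorem weak_kernel: "\<lbrakk>cx X; cx Y; h \<in> Hom D X Y\<rbrakk> \<Longrightarrow> DC.is_weak_kernel X Y h"
proof -
  assume o: "cx X" "cx Y" and h: "h \<in> Hom D X Y"
  note R = cx_res[OF o(1)] cx_res[OF o(2)]
  obtain f where f: "f \<in> chain_map (res X) (res Y)"
    "Cmp D (res X) X Y h (Q (res X) X (rp X)) = Cmp D (res X) (res Y) Y (Q (res Y) Y (rp Y)) (Q (res X) (res Y) f)"
    using hom_to_res[OF o h] by blast
  show ?thesis
    using DC.is_weak_kernel_iso[OF perf_weak_kernel[OF perf_res[OF o(1)] perf_res[OF o(2)] f(1)] Q_in[OF f(1) R]
        Q_iso[OF quasi_iso_rp[OF o(1)] R(1) o(1)] Q_iso[OF quasi_iso_rp[OF o(2)] R(2) o(2)] h f(2)] R o by simp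
qed

end

section \<open>Fitting decomposition for complexes\<close>

context preadd
begin

text \<open>Two retracts whose idempotents add up to the identity form a direct sum: orthogonality
  is automatic. One of them is then zero.\<close>

lemma indecomposable_retracts:
  assumes X: "indecomposable C X" and o: "A \<in> Ob C" "B \<in> Ob C"
    and i: "i \<in> Hom C A X" "p \<in> Hom C X A" "Cmp C A X A p i = Idn C A"
    and j: "j \<in> Hom C B X" "q \<in> Hom C X B" "Cmp C B X B q j = Idn C B"
    and s: "Add C X X (Cmp C X A X i p) (Cmp C X B X j q) = Idn C X"
  shows "Cmp C X A X i p = Idn C X \<or> Cmp C X A X i p = Nul C X X"
proof -
  have Xo: "X \<in> Ob C" using X unfolding indecomposable_def by blast
  have ortho: "Cmp C A' X B' q' i' = Nul C A' B'"
    if o': "A' \<in> Ob C" "B' \<in> Ob C" and i': "i' \<in> Hom C A' X" "p' \<in> Hom C X A'" "Cmp C A' X A' p' i' = Idn C A'"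
      and j': "j' \<in> Hom C B' X" "q' \<in> Hom C X B'" "Cmp C B' X B' q' j' = Idn C B'"
      and s': "Add C X X (Cmp C X A' X i' p') (Cmp C X B' X j' q') = Idn C X" for A' B' i' j' p' q'
  proof -
    let ?t = "Cmp C A' X B' q' i'"
    have t: "?t \<in> Hom C A' B'" using i' j' o' Xo by simp
    have a: "Cmp C A' X B' q' (Cmp C A' X X (Cmp C X A' X i' p') i') = ?t"
      using assoc[OF i'(1,2,1) o'(1) Xo o'(1) Xo] i' o' Xo by simp
    have b: "Cmp C A' X B' q' (Cmp C A' X X (Cmp C X B' X j' q') i') = ?t"
      using assoc[OF i'(1) j'(2,1) o'(1) Xo o'(2) Xo] cancel_l[OF j'(3) t j'(1,2)] o' Xo by simp
    have "?t = Cmp C A' X B' q' (Cmp C A' X X (Add C X X (Cmp C X A' X i' p') (Cmp C X B' X j' q')) i')"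
      unfolding s' using i' o' Xo by simp
    also have "\<dots> = Add C A' B' ?t ?t"
      using i' j' o' Xo by (simp add: cmp_add_l cmp_add_r a b)
    \<comment> \<open>Inserting the decomposition of the identity between i' and q' doubles the
      morphism, so it is zero.\<close>
    finally have e: "?t = Add C A' B' ?t ?t" .
    interpret G: comm_group "hom_group C A' B'" using grp o' by blast
    show ?thesis using e t G.l_cancel_one'[of ?t ?t] by (simp add: hom_group_def)
  qed
  have ji: "Add C X X (Cmp C X B X j q) (Cmp C X A X i p) = Idn C X"
  proof -
    interpret G: comm_group "hom_group C X X" using grp Xo by blast
    show ?thesis using s G.m_comm[of "Cmp C X B X j q" "Cmp C X A X i p"] i j o Xo by (simp add: hom_group_def)
  qed
  have "is_direct_sum C A B X" unfolding is_direct_sum_def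
    by (intro bexI[of _ i] bexI[of _ j] bexI[of _ p] bexI[of _ q] conjI ortho[OF o i j s] ortho[OF o(2,1) j i ji] i j s)
  then have "zero_object C A \<or> zero_object C B" using X o unfolding indecomposable_def by blast
  then show ?thesis
  proof
    assume "zero_object C A"
    then have "p = Cmp C X A A (Nul C A A) p" unfolding zero_object_def using i o Xo by (metis idl)
    then have "p = Nul C X A" using i o Xo by simp
    then show ?thesis using i o Xo by simp
  next
    assume "zero_object C B"
    then have "q = Cmp C X B B (Nul C B B) q" unfolding zero_object_def using j o Xo by (metis idl)
    then have "q = Nul C X B" using j o Xo by simp
    then have "Cmp C X B X j q = Nul C X X" using j o Xo by simp
    then show ?thesis using s i o Xo by simp
  qed
qed

end

context hered
begin

text \<open>The equation for \<open>e\<close> holds strictly, not only up to homotopy, so its image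
  is a subcomplex and a bounded complex of modules.\<close>

lemma split_idempotent:
  assumes X: "cx X" and e: "e \<in> chain_map X X" and ee: "\<And>i v. e i (e i v) = e i v"
  obtains A i p where "cx A" "i \<in> chain_map A X" "p \<in> chain_map X A" "cmap_comp p i = cmap_id A" "cmap_comp i p = e"
proof -
  let ?A = "\<lparr>cmod = \<lambda>i. sub (cmod X i) (e i ` carr (cmod X i)), diff = \<lambda>i. restr0 (e i ` carr (cmod X i)) (diff X i)\<rparr>"
  note mX = cx_modl[OF X] and fX = cx_fg[OF X] and eh = cm_hom[OF e] and dh = cx_diff[OF X]
  have sb: "v \<in> carr (cmod X i)" if "v \<in> e i ` carr (cmod X i)" for i v using that hom_in[OF eh] by blast
  have fe: "e i v = v" if "v \<in> e i ` carr (cmod X i)" for i v using that ee by auto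
  have fgA: "fg_module sc (cmod ?A i)" for i using fg_image[OF eh fX fX] by simp
  have mA: "modl (cmod ?A i)" for i using fgA fg_module_modl by blast
  have di: "diff X i v \<in> e (i + 1) ` carr (cmod X (i + 1))" if v: "v \<in> e i ` carr (cmod X i)" for i v
  proof -
    have "diff X i v = e (i + 1) (diff X i v)" using cm_comm[OF e, of i v] fe[OF v] by simp
    then show ?thesis using hom_in[OF dh sb[OF v]] by blast
  qed
  have sadd: "v + w \<in> e i ` carr (cmod X i)" if "v \<in> e i ` carr (cmod X i)" "w \<in> e i ` carr (cmod X i)" for i v w
    using modl_add[OF mA] that by simp
  have sact: "act (cmod X i) h v \<in> e i ` carr (cmod X i)" if "v \<in> e i ` carr (cmod X i)" for i h v
    using modl_act[OF mA] that by simp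
  obtain n where n: "\<And>i. n < \<bar>i\<bar> \<Longrightarrow> carr (cmod X i) = {0}" using cx_bound[OF X] by blast
  have A: "cx ?A"
  proof (rule cxI[OF fgA])
    show "diff ?A i \<in> mod_hom (cmod ?A i) (cmod ?A (i + 1))" for i
      by (rule mod_homI) (simp_all add: restr0_def di sadd sact sb hom_add[OF dh] hom_act[OF dh])
    show "diff ?A (i + 1) (diff ?A i v) = 0" for i v
      using cx_dd[OF X, of i v] by (simp add: restr0_def hom_0[OF dh mX])
    show "n < \<bar>i\<bar> \<Longrightarrow> carr (cmod ?A i) = {0}" for i using n[of i] hom_0[OF eh mX] by simp
  qed
  \<comment> \<open>Maps are extended by zero off the carrier, so the identity of the image complex
    is literally its inclusion into \<open>X\<close>.\<close>
  let ?i = "cmap_id ?A"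
  have ii: "?i i v = (if v \<in> e i ` carr (cmod X i) then v else 0)" for i v by (simp add: cmap_id_def restr0_def)
  have i: "?i \<in> chain_map ?A X"
  proof (rule chain_mapI[OF A X])
    show "?i i \<in> mod_hom (cmod ?A i) (cmod X i)" for i
      by (rule mod_homI) (simp_all add: ii sadd sact sb)
    fix i v assume v: "v \<in> carr (cmod ?A i)"
    then have "diff ?A i v = diff X i v" by (simp add: restr0_def)
    then show "?i (i + 1) (diff ?A i v) = diff X i (?i i v)" unfolding ii using v di by simp
  qed
  have p: "e \<in> chain_map X ?A"
  proof (rule chain_mapI[OF X A])
    show "e i \<in> mod_hom (cmod X i) (cmod ?A i)" for i using hom_sub_codomain[OF eh, of i "e i ` carr (cmod X i)"] by simp
  qed (simp add: cm_comm[OF e] restr0_def)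
  have "cmap_comp e ?i = ?i"
  proof (rule ext, rule ext)
    fix i v
    show "cmap_comp e ?i i v = ?i i v"
      unfolding cmap_comp_def comp_apply ii using fe[of v i] hom_0[OF eh mX, of i] by (simp split: if_split)
  qed
  moreover have "cmap_comp ?i e = e"
  proof (rule ext, rule ext)
    fix i v
    show "cmap_comp ?i e i v = e i v"
      unfolding cmap_comp_def comp_apply ii using hom_out[OF eh, of v i] by (metis imageI)
  qed
  ultimately show ?thesis using that[OF A i p] by blast
qed

text \<open>Both \<open>e\<close> and its complement split, which presents \<open>X\<close> as a sum
  of two retracts.\<close>

lemma indecomposable_idempotent:
  assumes X: "indecomposable D X" and e: "e \<in> chain_map X X" and ee: "\<And>i v. e i (e i v) = e i v"
  shows "Q X X e = Idn D X \<or> Q X X e = Nul D X X"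
proof -
  have Xo: "cx X" using X unfolding indecomposable_def by simp
  note id = cm_id[OF Xo] and eh = cm_hom[OF e] and mX = cx_modl[OF Xo]
  let ?f = "cmap_id X - e"
  have f: "?f \<in> chain_map X X" using cm_minus[OF id e Xo Xo] .
  have fv: "?f i v = (if v \<in> carr (cmod X i) then v - e i v else 0)" for i v
    using hom_out[OF eh] by (simp add: cmap_id_def restr0_def)
  have ff: "?f i (?f i v) = ?f i v" for i v
    using hom_diff[OF eh mX _ hom_in[OF eh]] mX hom_in[OF eh] ee hom_0[OF eh mX] unfolding fv by simp
  obtain A i p where A: "cx A" "i \<in> chain_map A X" "p \<in> chain_map X A" "cmap_comp p i = cmap_id A" "cmap_comp i p = e"
    using split_idempotent[OF Xo e ee] by blast
  obtain B j q where B: "cx B" "j \<in> chain_map B X" "q \<in> chain_map X B" "cmap_comp q j = cmap_id B" "cmap_comp j q = ?f"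
    using split_idempotent[OF Xo f ff] by blast
  have a: "Cmp D A X A (Q X A p) (Q A X i) = Idn D A" unfolding Q_cmp[OF A(2,3,1) Xo A(1)] A(4) Q_idn ..
  have b: "Cmp D B X B (Q X B q) (Q B X j) = Idn D B" unfolding Q_cmp[OF B(2,3,1) Xo B(1)] B(4) Q_idn ..
  have e1: "Cmp D X A X (Q A X i) (Q X A p) = Q X X e" unfolding Q_cmp[OF A(3,2) Xo A(1) Xo] A(5) ..
  have e2: "Cmp D X B X (Q B X j) (Q X B q) = Q X X ?f" unfolding Q_cmp[OF B(3,2) Xo B(1) Xo] B(5) ..
  have "e + ?f = cmap_id X" by simp
  then have s: "Add D X X (Cmp D X A X (Q A X i) (Q X A p)) (Cmp D X B X (Q B X j) (Q X B q)) = Idn D X"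
    unfolding e1 e2 Q_add[OF e f Xo Xo] using Q_idn by metis
  show ?thesis
    using DC.indecomposable_retracts[OF X _ _ Q_in[OF A(2,1) Xo] Q_in[OF A(3) Xo A(1)] a Q_in[OF B(2,1) Xo] Q_in[OF B(3) Xo B(1)] b s]
      A(1) B(1) unfolding e1 by simp
qed

text \<open>The hypotheses say that squaring changes neither kernel nor image, so \<open>g\<close>
  is bijective on its image. The map \<open>x\<close> is the group inverse of \<open>g\<close>: it
  takes values in the image and satisfies g g x = g.\<close>

lemma hom_group_inverse:
  assumes M: "modl M" and g: "g \<in> mod_hom M M" and inj: "\<And>v. \<lbrakk>v \<in> carr M; g (g v) = 0\<rbrakk> \<Longrightarrow> g v = 0"
    and sur: "\<And>v. v \<in> carr M \<Longrightarrow> \<exists>w \<in> carr M. g v = g (g w)"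
  obtains x where "x \<in> mod_hom M M" "\<And>v. v \<in> carr M \<Longrightarrow> x v \<in> g ` carr M" "\<And>v. v \<in> carr M \<Longrightarrow> g (g (x v)) = g v"
    "\<And>a b. \<lbrakk>a \<in> g ` carr M; b \<in> g ` carr M; g (g a) = g (g b)\<rbrakk> \<Longrightarrow> a = b"
proof -
  note gin = hom_in[OF g]
  have sb: "a \<in> carr M" if "a \<in> g ` carr M" for a using that gin by blast
  have un: "a = b" if a: "a \<in> g ` carr M" "b \<in> g ` carr M" "g (g a) = g (g b)" for a b
  proof -
    obtain u w where u: "u \<in> carr M" "w \<in> carr M" "a = g u" "b = g w" using a by blast
    have d: "u - w \<in> carr M" using M u by simp
    have e: "a - b = g (u - w)" unfolding u(3,4) using hom_diff[OF g M u(1,2)] by simp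
    have "g (g (a - b)) = 0" using a(3) hom_diff[OF g M sb[OF a(1)] sb[OF a(2)]] hom_diff[OF g M gin[OF sb[OF a(1)]] gin[OF sb[OF a(2)]]] by simp
    then have "g (a - b) = 0" using inj[of "a - b"] M sb a by simp
    then have "g (u - w) = 0" using inj[OF d] unfolding e by blast
    then show ?thesis using e by simp
  qed
  have ex: "\<exists>a. a \<in> g ` carr M \<and> g (g a) = g v" if v: "v \<in> carr M" for v
  proof -
    obtain w where w: "w \<in> carr M" "g v = g (g w)" using sur[OF v] by blast
    obtain w' where w': "w' \<in> carr M" "g w = g (g w')" using sur[OF w(1)] by blast
    then show ?thesis using w by auto
  qed
  \<comment> \<open>The values are chosen pointwise; linearity follows from the uniqueness
    \<open>un\<close>, as both sides of each equation lie in the image of \<open>g\<close>.\<close>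
  define x where "x v = (if v \<in> carr M then SOME a. a \<in> g ` carr M \<and> g (g a) = g v else 0)" for v
  have x: "x v \<in> g ` carr M" "g (g (x v)) = g v" if "v \<in> carr M" for v
    using someI_ex[OF ex[OF that]] that unfolding x_def by simp_all
  note im = subspace_image[OF g M M]
  have "x \<in> mod_hom M M"
  proof (rule mod_homI)
    fix v assume v: "v \<in> carr M"
    show "x v \<in> carr M" using sb x(1)[OF v] .
    show "x (act M h v) = act M h (x v)" for h
    proof (rule un)
      show "x (act M h v) \<in> g ` carr M" using x(1) M v by simp
      show "act M h (x v) \<in> g ` carr M" using im(2)[OF x(1)[OF v]] .
      show "g (g (x (act M h v))) = g (g (act M h (x v)))"
        using x(2)[OF modl_act[OF M v]] hom_act[OF g v] x(2)[OF v] hom_act[OF g sb[OF x(1)[OF v]]] hom_act[OF g gin[OF sb[OF x(1)[OF v]]]]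
        by simp
    qed
    fix w assume w: "w \<in> carr M"
    show "x (v + w) = x v + x w"
    proof (rule un)
      show "x (v + w) \<in> g ` carr M" using x(1) M v w by simp
      show "x v + x w \<in> g ` carr M" using sq.subspace_add[OF im(1) x(1)[OF v] x(1)[OF w]] .
      show "g (g (x (v + w))) = g (g (x v + x w))"
        using x(2)[OF modl_add[OF M v w]] hom_add[OF g v w] x(2)[OF v] x(2)[OF w] hom_add[OF g sb[OF x(1)[OF v]] sb[OF x(1)[OF w]]]
          hom_add[OF g gin[OF sb[OF x(1)[OF v]]] gin[OF sb[OF x(1)[OF w]]]] by simp
    qed
  qed (simp add: x_def)
  then show ?thesis using that x un by blast
qed

lemma Q_pow:
  assumes X: "cx X" and f: "f \<in> chain_map X X"
  shows "(\<lambda>i. f i ^^ Suc n) \<in> chain_map X X" "Q X X f [^]\<^bsub>DC.End X\<^esub> Suc n = Q X X (\<lambda>i. f i ^^ Suc n)"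
proof (induction n)
  case 0
  show 1: "(\<lambda>i. f i ^^ Suc 0) \<in> chain_map X X" using f by simp
  show "Q X X f [^]\<^bsub>DC.End X\<^esub> Suc 0 = Q X X (\<lambda>i. f i ^^ Suc 0)"
    unfolding DC.End_pow_Suc using DC.idl[OF Q_in[OF f X X]] X by (simp add: nat_pow_def)
next
  case (Suc n)
  have 1: "(\<lambda>i. f i ^^ Suc (Suc n)) = cmap_comp (\<lambda>i. f i ^^ Suc n) f"
    unfolding cmap_comp_def by (rule ext) (rule funpow_Suc_right)
  show "(\<lambda>i. f i ^^ Suc (Suc n)) \<in> chain_map X X" unfolding 1 using cm_comp[OF f Suc(1) X] .
  show "Q X X f [^]\<^bsub>DC.End X\<^esub> Suc (Suc n) = Q X X (\<lambda>i. f i ^^ Suc (Suc n))"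
    unfolding 1 DC.End_pow_Suc[of _ _ "Suc n"] Suc(2) Q_cmp[OF f Suc(1) X X X] ..
qed

text \<open>With \<open>g\<close> a high power of \<open>f\<close> and \<open>x\<close> its
  degreewise group inverse, g x is the projection onto the stable image, a strict idempotent chain
  map. If it is the identity then \<open>g\<close> and hence \<open>f\<close> is invertible; if it
  is zero then so is g = (g x) g.\<close>

lemma perf_nil_or_iso:
  assumes P: "perf P" and X: "indecomposable D P"
  shows "DC.nil_or_iso P"
  unfolding DC.nil_or_iso_def
proof (intro conjI ballI)
  note cP = perf_cx[OF P]
  note mP = cx_modl[OF cP]
  show "P \<in> Ob D" using cP by simp
  fix \<alpha> assume "\<alpha> \<in> Hom D P P"
  then obtain f where f: "f \<in> chain_map P P" "\<alpha> = Q P P f" using Q_surj[OF P cP] by blast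
  have "\<exists>n. \<forall>m\<ge>n. (\<forall>v \<in> carr (cmod P i). (f i ^^ (m + m)) v = 0 \<longrightarrow> (f i ^^ m) v = 0) \<and>
    (\<forall>v \<in> carr (cmod P i). \<exists>w \<in> carr (cmod P i). (f i ^^ m) v = (f i ^^ (m + m)) w)" for i
    using fitting[OF cx_fg[OF cP] cm_hom[OF f(1)]] .
  then obtain N where N: "\<And>i m v. \<lbrakk>N i \<le> m; v \<in> carr (cmod P i); (f i ^^ (m + m)) v = 0\<rbrakk> \<Longrightarrow> (f i ^^ m) v = 0"
    "\<And>i m v. \<lbrakk>N i \<le> m; v \<in> carr (cmod P i)\<rbrakk> \<Longrightarrow> \<exists>w \<in> carr (cmod P i). (f i ^^ m) v = (f i ^^ (m + m)) w" by metis
  obtain n where n: "\<And>i. n < \<bar>i\<bar> \<Longrightarrow> carr (cmod P i) = {0}" using cx_bound[OF cP] by blast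
  \<comment> \<open>A sum of natural numbers bounds each of them, so one exponent serves in all
    degrees from -n to n; elsewhere the modules are zero.\<close>
  define m where "m = (\<Sum>i\<in>{-n..n}. N i)"
  let ?g = "\<lambda>i. f i ^^ Suc m"
  note g = Q_pow[OF cP f(1), of m]
  note gh = cm_hom[OF g(1)]
  have g0: "?g i 0 = 0" for i using hom_0[OF gh mP] .
  have gg: "?g i (?g i v) = (f i ^^ (Suc m + Suc m)) v" for i v by (simp only: funpow_add comp_apply)
  have le: "N i \<le> Suc m" if "\<not> n < \<bar>i\<bar>" for i
  proof -
    have "i \<in> {-n..n}" using that by auto
    then have "N i \<le> m" unfolding m_def by (intro member_le_sum) auto
    then show ?thesis by simp
  qed
  have i1: "?g i v = 0" if "v \<in> carr (cmod P i)" "?g i (?g i v) = 0" for i v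
  proof (cases "n < \<bar>i\<bar>")
    case True
    then have "v = 0" using n[of i] that(1) by simp
    then show ?thesis using g0 by simp
  next
    case False
    show ?thesis using N(1)[OF le[OF False] that(1)] that(2) unfolding gg .
  qed
  have i2: "\<exists>w \<in> carr (cmod P i). ?g i v = ?g i (?g i w)" if v: "v \<in> carr (cmod P i)" for i v
  proof (cases "n < \<bar>i\<bar>")
    case True
    then have "v = 0" using n[of i] v by simp
    then have "?g i v = ?g i (?g i v)" using g0 by metis
    then show ?thesis using v by metis
  next
    case False
    show ?thesis using N(2)[OF le[OF False] v] unfolding gg .
  qed
  have "\<exists>x. x \<in> mod_hom (cmod P i) (cmod P i) \<and> (\<forall>v \<in> carr (cmod P i). x v \<in> ?g i ` carr (cmod P i)) \<and>
    (\<forall>v \<in> carr (cmod P i). ?g i (?g i (x v)) = ?g i v) \<and>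
    (\<forall>a \<in> ?g i ` carr (cmod P i). \<forall>b \<in> ?g i ` carr (cmod P i). ?g i (?g i a) = ?g i (?g i b) \<longrightarrow> a = b)" for i
    by (rule hom_group_inverse[OF mP gh i1 i2]) (assumption | blast)+
  then obtain x where x: "\<And>i. x i \<in> mod_hom (cmod P i) (cmod P i)"
    "\<And>i v. v \<in> carr (cmod P i) \<Longrightarrow> x i v \<in> ?g i ` carr (cmod P i)"
    "\<And>i v. v \<in> carr (cmod P i) \<Longrightarrow> ?g i (?g i (x i v)) = ?g i v"
    "\<And>i a b. \<lbrakk>a \<in> ?g i ` carr (cmod P i); b \<in> ?g i ` carr (cmod P i); ?g i (?g i a) = ?g i (?g i b)\<rbrakk> \<Longrightarrow> a = b"
    by metis
  note gin = hom_in[OF gh] and xin = hom_in[OF x(1)]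
  have x0: "x i 0 = 0" for i using hom_0[OF x(1) mP] .
  have xc: "x \<in> chain_map P P"
  proof (rule chain_mapI[OF cP cP x(1)])
    fix i v assume v: "v \<in> carr (cmod P i)"
    note dv = hom_in[OF cx_diff[OF cP]]
    obtain u where u: "u \<in> carr (cmod P i)" "x i v = ?g i u" using x(2)[OF v] by blast
    show "x (i + 1) (diff P i v) = diff P i (x i v)"
    proof (rule x(4)[OF x(2)[OF dv[OF v]]])
      show "diff P i (x i v) \<in> ?g (i + 1) ` carr (cmod P (i + 1))"
        unfolding u(2) using cm_comm[OF g(1), of i u] dv[OF u(1)] by (metis imageI)
      show "?g (i + 1) (?g (i + 1) (x (i + 1) (diff P i v))) = ?g (i + 1) (?g (i + 1) (diff P i (x i v)))"
        unfolding x(3)[OF dv[OF v]] cm_comm[OF g(1)] x(3)[OF v] ..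
    qed
  qed
  have gx: "?g i (x i v) = x i (?g i v)" for i v
  proof (cases "v \<in> carr (cmod P i)")
    case True
    show ?thesis
    proof (rule x(4)[OF imageI[OF xin[OF True]] x(2)[OF gin[OF True]]])
      show "?g i (?g i (?g i (x i v))) = ?g i (?g i (x i (?g i v)))"
        unfolding x(3)[OF True] x(3)[OF gin[OF True]] ..
    qed
  next
    case False
    show ?thesis unfolding hom_out[OF x(1) False] hom_out[OF gh False] x0 g0 ..
  qed
  have gxg: "?g i (x i (?g i v)) = ?g i v" for i v
  proof (cases "v \<in> carr (cmod P i)")
    case True
    show ?thesis
    proof (rule x(4)[OF imageI[OF xin[OF gin[OF True]]] imageI[OF True]])
      show "?g i (?g i (?g i (x i (?g i v)))) = ?g i (?g i (?g i v))" unfolding x(3)[OF gin[OF True]] ..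
    qed
  next
    case False
    show ?thesis unfolding hom_out[OF gh False] x0 g0 ..
  qed
  \<comment> \<open>Because \<open>g\<close> and \<open>x\<close> commute, the composites in both
    orders are the same idempotent, which makes \<open>x\<close> a two-sided inverse when it is the
    identity.\<close>
  let ?e = "cmap_comp ?g x"
  have e: "?e \<in> chain_map P P" using cm_comp[OF xc g(1) cP] .
  have e2: "?e = cmap_comp x ?g" unfolding cmap_comp_def by (rule ext, rule ext) (simp only: comp_apply gx)
  have eg: "cmap_comp ?e ?g = ?g" unfolding cmap_comp_def by (rule ext, rule ext) (simp only: comp_apply gxg)
  have "?e i (?e i v) = ?e i v" for i v unfolding cmap_comp_def comp_apply gxg ..
  from indecomposable_idempotent[OF X e this]
  show "is_iso D P P \<alpha> \<or> (\<exists>n::nat. \<alpha> [^]\<^bsub>DC.End P\<^esub> n = Nul D P P)"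
  proof
    assume 1: "Q P P ?e = Idn D P"
    have "Cmp D P P P (Q P P x) (Q P P ?g) = Idn D P" "Cmp D P P P (Q P P ?g) (Q P P x) = Idn D P"
      unfolding Q_cmp[OF g(1) xc cP cP cP] Q_cmp[OF xc g(1) cP cP cP] e2[symmetric] using 1 by blast+
    then have "is_iso D P P (Q P P ?g)" unfolding is_iso_def using Q_in[OF xc cP cP] Q_in[OF g(1) cP cP] by blast
    then have "is_iso D P P \<alpha>" using DC.is_iso_pow_Suc[OF Q_in[OF f(1) cP cP], of m] cP unfolding g(2) f(2) by simp
    then show ?thesis ..
  next
    assume 0: "Q P P ?e = Nul D P P"
    have "Q P P ?g = Cmp D P P P (Q P P ?e) (Q P P ?g)" unfolding Q_cmp[OF g(1) e cP cP cP] eg ..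
    also have "\<dots> = Nul D P P" unfolding 0 using Q_in[OF g(1) cP cP] cP by simp
    finally have "\<alpha> [^]\<^bsub>DC.End P\<^esub> Suc m = Nul D P P" unfolding f(2) g(2) .
    then show ?thesis by blast
  qed
qed

theorem indecomposable_nil_or_iso:
  assumes X: "indecomposable D X"
  shows "DC.nil_or_iso X"
proof -
  have o: "cx X" using X unfolding indecomposable_def by simp
  have "indecomposable D (res X)"
    using DC.indecomposable_iso[OF DC.iso_sym[OF iso_res[OF o]] ] X cx_res[OF o] o by simp
  from DC.nil_or_iso_iso[OF perf_nil_or_iso[OF perf_res[OF o] this] iso_res[OF o]] show ?thesis using o by simp
qed

end

section \<open>Auslander-Reiten triangles\<close>

context preadd
begin

lemma nz_iso: "\<lbrakk>isomorphic C X X'; isomorphic C Y Y'; X \<in> Ob C; X' \<in> Ob C; Y \<in> Ob C; Y' \<in> Ob C\<rbrakk> \<Longrightarrow> nz X Y \<longleftrightarrow> nz X' Y'"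
  using nz_iso1[of X X' Y] nz_iso1[of X' X Y'] nz_iso2[of Y Y' X'] nz_iso2[of Y' Y X] iso_sym by blast

lemma almost_vanishing_factor:
  assumes o: "X \<in> Ob C" "S \<in> Ob C" "V \<in> Ob C" and w: "w \<in> Hom C X S"
    and a: "\<And>W f. \<lbrakk>W \<in> Ob C; f \<in> Hom C W X; \<not> retraction C W X f\<rbrakk> \<Longrightarrow> Cmp C W X S w f = Nul C W S"
    and h: "h \<in> Hom C X V" "h \<noteq> Nul C X V" "is_weak_cokernel X V h"
  shows "\<exists>g \<in> Hom C V S. w = Cmp C X V S g h"
proof -
  obtain B c where c: "B \<in> Ob C" "c \<in> Hom C B X" "Cmp C B X V h c = Nul C B V"
    "\<And>U w. \<lbrakk>U \<in> Ob C; w \<in> Hom C X U; Cmp C B X U w c = Nul C B U\<rbrakk> \<Longrightarrow> \<exists>g \<in> Hom C V U. w = Cmp C X V U g h"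
    using h(3) unfolding is_weak_cokernel_def by blast
  have "\<not> retraction C B X c"
  proof
    assume "retraction C B X c"
    then obtain g where g: "g \<in> Hom C X B" "Cmp C X B X c g = Idn C X" unfolding retraction_def by blast
    have "h = Cmp C X X V h (Cmp C X B X c g)" unfolding g(2) using h o by simp
    also have "\<dots> = Nul C X V" using assoc[OF g(1) c(2) h(1) o(1) c(1) o(1,3)] c g o by simp
    finally show False using h(2) by blast
  qed
  then show ?thesis using c(4)[OF o(2) w a[OF c(1,2)]] by blast
qed

lemma End_pow_fixes:
  assumes e: "e \<in> Hom C S S" "Cmp C X S S e w = w" and w: "w \<in> Hom C X S" and o: "X \<in> Ob C" "S \<in> Ob C"
  shows "Cmp C X S S (e [^]\<^bsub>End S\<^esub> (n::nat)) w = w"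
proof (induction n)
  case 0
  then show ?case using w o by (simp add: nat_pow_def)
next
  case (Suc n)
  have "Cmp C X S S (e [^]\<^bsub>End S\<^esub> Suc n) w = Cmp C X S S (e [^]\<^bsub>End S\<^esub> n) (Cmp C X S S e w)"
    unfolding End_pow_Suc using assoc[OF w e(1) End_pow_in[OF o(2) e(1)]] o by simp
  then show ?case using Suc e(2) by simp
qed

text \<open>It suffices that w is killed by the morphism \<open>s\<close> of which \<open>g\<close>
  is a weak kernel. Otherwise \<open>w\<close> factors through s w, so some t s fixes
  \<open>w\<close>. If t s is invertible then g = 0 because s g = 0; if it is nilpotent then w =
  0.\<close>

lemma almost_vanishing_cofactor:
  assumes o: "X \<in> Ob C" "V \<in> Ob C" and S: "nil_or_iso S" and w: "w \<in> Hom C X S" "w \<noteq> Nul C X S"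
    and a: "\<And>W f. \<lbrakk>W \<in> Ob C; f \<in> Hom C W X; \<not> retraction C W X f\<rbrakk> \<Longrightarrow> Cmp C W X S w f = Nul C W S"
    and k: "\<And>V h. \<lbrakk>V \<in> Ob C; h \<in> Hom C X V\<rbrakk> \<Longrightarrow> is_weak_cokernel X V h"
    and g: "g \<in> Hom C V S" "g \<noteq> Nul C V S" "is_weak_kernel V S g"
  shows "\<exists>h \<in> Hom C X V. w = Cmp C X V S g h"
proof -
  note So = nil_or_iso_Ob[OF S]
  obtain B s where s: "B \<in> Ob C" "s \<in> Hom C S B" "Cmp C V S B s g = Nul C V B"
    "\<And>X w. \<lbrakk>X \<in> Ob C; w \<in> Hom C X S; Cmp C X S B s w = Nul C X B\<rbrakk> \<Longrightarrow> \<exists>h \<in> Hom C X V. w = Cmp C X V S g h"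
    using g(3) unfolding is_weak_kernel_def by blast
  have "Cmp C X S B s w = Nul C X B"
  proof (rule ccontr)
    assume n: "Cmp C X S B s w \<noteq> Nul C X B"
    have sw: "Cmp C X S B s w \<in> Hom C X B" using s w o So by simp
    obtain t where t: "t \<in> Hom C B S" "w = Cmp C X B S t (Cmp C X S B s w)"
      using almost_vanishing_factor[OF o(1) So s(1) w(1) a sw n k[OF s(1) sw]] by blast
    let ?e = "Cmp C S B S t s"
    have e: "?e \<in> Hom C S S" using t s So by simp
    have ew: "Cmp C X S S ?e w = w" using assoc[OF w(1) s(2) t(1) o(1) So s(1) So] t(2) by simp
    show False
    proof (cases "is_iso C S S ?e")
      case True
      then obtain v where v: "v \<in> Hom C S S" "Cmp C S S S v ?e = Idn C S" unfolding is_iso_def by blast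
      have "g = Cmp C V S S v (Cmp C V S S ?e g)" using cancel_l[OF v(2) g(1) e v(1)] o So by simp
      also have "Cmp C V S S ?e g = Cmp C V B S t (Cmp C V S B s g)" using assoc[OF g(1) s(2) t(1)] o So s by simp
      also have "\<dots> = Nul C V S" unfolding s(3) using t o So s by simp
      finally show False using g(2) v(1) o So by simp
    next
      case False
      then obtain n :: nat where "?e [^]\<^bsub>End S\<^esub> n = Nul C S S" using nil_or_isoD[OF S e] by blast
      then have "Cmp C X S S (Nul C S S) w = w" using End_pow_fixes[OF e ew w(1) o(1) So, of n] by simp
      then show False using w o So by simp
    qed
  qed
  then show ?thesis using s(4)[OF o(1) w(1)] by blast
qed

end

context hered
begin

text \<open>After transport to a mapping cone the composite is projection after inclusion, which is
  zero on the level of complexes.\<close>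

lemma distinguished_comp:
  assumes d: "distinguished sc X Y Z u v w"
  shows "Cmp D Y Z (cshift 1 X) w v = Nul D Y (cshift 1 X)"
proof -
  have o: "cx X" "cx Y" "cx Z" and v: "v \<in> Hom D Y Z" and w: "w \<in> Hom D Z (cshift 1 X)"
    using d unfolding distinguished_def by auto
  obtain A B f a b c where A: "cx A" "cx B" "f \<in> chain_map A B"
      and i: "is_iso D X A a" "is_iso D Y B b" "is_iso D Z (cone A B f) c"
      and e: "Cmp D Y B (cone A B f) (Q B (cone A B f) (cone_in B)) b = Cmp D Y Z (cone A B f) c v"
        "Cmp D Z (cone A B f) (cshift 1 A) (Q (cone A B f) (cshift 1 A) (cone_out A B f)) c =
          Cmp D Z (cshift 1 X) (cshift 1 A) (fmap (shift_func 1) X A a) w"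
    using d unfolding distinguished_def by (elim conjE exE) (rule that)
  let ?K = "cone A B f" and ?s = "fmap (shift_func 1) X A a"
  note K = cx_cone[OF A] and sA = cx_cshift[OF A(1), of 1] and sX = cx_cshift[OF o(1), of 1]
  have s: "is_iso D (cshift 1 X) (cshift 1 A) ?s"
    using DC.af_is_iso[OF shift_additive i(1), of 1] o A unfolding shift_func_simps(1) by simp
  have sh: "?s \<in> Hom D (cshift 1 X) (cshift 1 A)" and b: "b \<in> Hom D Y B" and c: "c \<in> Hom D Z ?K"
    using s i unfolding is_iso_def by blast+
  note ci = Q_in[OF cone_in_cm[OF A] A(2) K] and co = Q_in[OF cone_out_cm[OF A] K sA]
  have wv: "Cmp D Y Z (cshift 1 X) w v \<in> Hom D Y (cshift 1 X)" using DC.cmp_in[OF v w] o sX by simp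
  have "Cmp D Y (cshift 1 X) (cshift 1 A) ?s (Cmp D Y Z (cshift 1 X) w v)
    = Cmp D Y Z (cshift 1 A) (Cmp D Z (cshift 1 X) (cshift 1 A) ?s w) v"
    using DC.assoc[OF v w sh] o sX sA by simp
  also have "\<dots> = Cmp D Y ?K (cshift 1 A) (Q ?K (cshift 1 A) (cone_out A B f)) (Cmp D Y Z ?K c v)"
    unfolding e(2)[symmetric] using DC.assoc[OF v c co] o K sA by simp
  also have "\<dots> = Cmp D Y B (cshift 1 A) (Cmp D B ?K (cshift 1 A) (Q ?K (cshift 1 A) (cone_out A B f)) (Q B ?K (cone_in B))) b"
    unfolding e(1)[symmetric] using DC.assoc[OF b ci co] o A K sA by simp
  also have "\<dots> = Nul D Y (cshift 1 A)"
    unfolding Q_cmp[OF cone_in_cm[OF A] cone_out_cm[OF A] A(2) K sA] cone_out_in[OF A] Q_nul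
    using DC.cmp_nul_l[OF b] o A sA by simp
  also have "\<dots> = Cmp D Y (cshift 1 X) (cshift 1 A) ?s (Nul D Y (cshift 1 X))"
    using DC.cmp_nul_r[OF sh] o sX sA by simp
  finally show ?thesis
    using DC.cmp_cancel_iso_l[OF s wv DC.nul_in] o sX sA by simp
qed

text \<open>
  If \<open>h : X \<rightarrow> V\<close> is nonzero and \<open>c\<close> is a morphism with weak cokernel \<open>h\<close>, then \<open>c\<close> is no retraction, so it
  lifts over the middle term of the Auslander-Reiten triangle and is killed by the connecting morphism
  \<open>w : X \<rightarrow> (\<tau>X)[1]\<close>; hence \<open>w\<close> factors over \<open>h\<close>. The dual argument needs that \<open>\<tau>X\<close> has a local
  endomorphism ring.
\<close>

theorem serre_duality:
  assumes t: "AR_translation sc \<tau>" and X: "indecomposable D X" and V: "cx V"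
  shows "DC.nz X V \<longleftrightarrow> DC.nz V (cshift 1 (fobj \<tau> X))"
proof -
  have Xo: "cx X" using X unfolding indecomposable_def by simp
  obtain Y u v w where "AR_triangle sc (fobj \<tau> X) Y X u v w" using t X unfolding AR_translation_def by blast
  then have d: "distinguished sc (fobj \<tau> X) Y X u v w" and T: "indecomposable D (fobj \<tau> X)"
    and w0: "w \<noteq> Nul D X (cshift 1 (fobj \<tau> X))"
    and l: "\<And>W f. \<lbrakk>W \<in> Ob D; f \<in> Hom D W X; \<not> retraction D W X f\<rbrakk> \<Longrightarrow> \<exists>f' \<in> Hom D W Y. Cmp D W Y X v f' = f"
    unfolding AR_triangle_def by blast+
  let ?S = "cshift 1 (fobj \<tau> X)"
  have Yo: "cx Y" and v: "v \<in> Hom D Y X" and w: "w \<in> Hom D X ?S" using d unfolding distinguished_def by auto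
  have S: "indecomposable D ?S"
    using DC.qi_indecomposable[OF shift_quasi_inverse T, of 1] unfolding shift_func_simps(1) .
  then have So: "cx ?S" unfolding indecomposable_def by simp
  have a: "Cmp D W X ?S w f = Nul D W ?S" if f: "W \<in> Ob D" "f \<in> Hom D W X" "\<not> retraction D W X f" for W f
  proof -
    obtain f' where f': "f' \<in> Hom D W Y" "Cmp D W Y X v f' = f" using l[OF f] by blast
    have "Cmp D W X ?S w f = Cmp D W Y ?S (Cmp D Y X ?S w v) f'"
      unfolding f'(2)[symmetric] using DC.assoc[OF f'(1) v w] f(1) Xo Yo So by simp
    then show ?thesis unfolding distinguished_comp[OF d] using DC.cmp_nul_l[OF f'(1)] f(1) Yo So by simp
  qed
  have k: "DC.is_weak_cokernel X V h" if "V \<in> Ob D" "h \<in> Hom D X V" for V h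
    using weak_cokernel[OF Xo _ that(2)] that(1) by simp
  have o: "X \<in> Ob D" "?S \<in> Ob D" "V \<in> Ob D" using Xo So V by simp_all
  show ?thesis
  proof
    assume "DC.nz X V"
    then obtain h where h: "h \<in> Hom D X V" "h \<noteq> Nul D X V" unfolding DC.nz_def by blast
    obtain g where g: "g \<in> Hom D V ?S" "w = Cmp D X V ?S g h"
      using DC.almost_vanishing_factor[OF o w a h k[OF o(3) h(1)]] by blast
    have "g \<noteq> Nul D V ?S" using g(2) w0 DC.cmp_nul_l[OF h(1)] o by metis
    then show "DC.nz V ?S" unfolding DC.nz_def using g(1) by blast
  next
    assume "DC.nz V ?S"
    then obtain g where g: "g \<in> Hom D V ?S" "g \<noteq> Nul D V ?S" unfolding DC.nz_def by blast
    obtain h where h: "h \<in> Hom D X V" "w = Cmp D X V ?S g h"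
      using DC.almost_vanishing_cofactor[OF o(1,3) indecomposable_nil_or_iso[OF S] w w0 a k g weak_kernel[OF V So g(1)]] by blast
    have "h \<noteq> Nul D X V" using h(2) w0 DC.cmp_nul_r[OF g(1)] o by metis
    then show "DC.nz X V" unfolding DC.nz_def using h(1) by blast
  qed
qed

section \<open>Compatibility with the shift, and duality for Ext\<close>

lemma nz_cshift: "\<lbrakk>cx X; cx Y\<rbrakk> \<Longrightarrow> DC.nz (cshift n X) (cshift n Y) \<longleftrightarrow> DC.nz X Y"
  using DC.qi_nz[OF shift_quasi_inverse, of X Y n] unfolding shift_func_simps by simp

text \<open>Compatibility on objects, for all shifts and without naturality: nonvanishing and
  isomorphism classes depend on objects alone.\<close>

definition commutes_shift :: "(('h, 'k) cpx, ('h, 'k) roof set, ('h, 'k) cpx, ('h, 'k) roof set) func \<Rightarrow> bool" where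
  "commutes_shift G \<longleftrightarrow> additive_functor D D G \<and>
     (\<forall>X n. cx X \<longrightarrow> isomorphic D (fobj G (cshift n X)) (cshift n (fobj G X)))"

lemma commutes_shiftD:
  assumes "commutes_shift G" "cx X"
  shows "cx (fobj G X)" "isomorphic D (fobj G (cshift n X)) (cshift n (fobj G X))"
  using assms DC.af_ob[of G X] unfolding commutes_shift_def by simp_all

lemma cshift_isomorphic: "\<lbrakk>isomorphic D X Y; cx X; cx Y\<rbrakk> \<Longrightarrow> isomorphic D (cshift n X) (cshift n Y)"
  using DC.af_isomorphic[OF shift_additive, of X Y n] unfolding shift_func_simps by simp

lemma cx_isomorphic_trans: "\<lbrakk>isomorphic D X Y; isomorphic D Y Z; cx X; cx Y; cx Z\<rbrakk> \<Longrightarrow> isomorphic D X Z"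
  using DC.iso_trans by simp

lemma commutes_shift_comp:
  assumes S: "commutes_shift S" and T: "commutes_shift T"
  shows "commutes_shift (comp_func S T)"
  unfolding commutes_shift_def
proof (intro conjI allI impI)
  have a: "additive_functor D D S" "additive_functor D D T" using S T unfolding commutes_shift_def by blast+
  then show "additive_functor D D (comp_func S T)" by (rule DC.af_comp_func)
  fix X :: "('h, 'k) cpx" and n assume X: "cx X"
  note TX = commutes_shiftD[OF T X]
  have "isomorphic D (fobj S (fobj T (cshift n X))) (fobj S (cshift n (fobj T X)))"
    using DC.af_isomorphic[OF a(1) TX(2)] commutes_shiftD(1)[OF T cx_cshift[OF X]] cx_cshift[OF TX(1)] by simp
  from cx_isomorphic_trans[OF this commutes_shiftD(2)[OF S TX(1)]]
  show "isomorphic D (fobj (comp_func S T) (cshift n X)) (cshift n (fobj (comp_func S T) X))"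
    unfolding comp_func_def using commutes_shiftD(1)[OF S] commutes_shiftD(1)[OF T] cx_cshift X by simp
qed

lemma commutes_shift_npow: "commutes_shift G \<Longrightarrow> commutes_shift (npow G n)"
proof (induction n)
  case 0
  then show ?case unfolding commutes_shift_def using DC.af_id_func DC.iso_refl by (simp add: id_func_def cx_cshift)
qed (simp add: commutes_shift_comp)

lemma commutes_shift_shift: "commutes_shift (shift_func n)"
  unfolding commutes_shift_def using shift_additive DC.iso_refl
  by (simp add: shift_func_simps cshift_cshift add.commute cx_cshift)

text \<open>The definition provides the shift by 1 and iteration the positive ones. For negative
  \<open>n\<close> the positive shift is applied to the object shifted by \<open>n\<close>, and the
  result is shifted back.\<close>

lemma triangle_functor_commutes_shift:
  assumes G: "triangle_functor sc G"
  shows "commutes_shift G"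
  unfolding commutes_shift_def
proof (intro conjI allI impI)
  show a: "additive_functor D D G" using G unfolding triangle_functor_def by blast
  obtain \<phi> where "natural_iso D D (comp_func G (shift_func 1)) (comp_func (shift_func 1) G) \<phi>"
    using G unfolding triangle_functor_def by blast
  then have "is_iso D (fobj (comp_func G (shift_func 1)) X) (fobj (comp_func (shift_func 1) G) X) (\<phi> X)" if "cx X" for X
    using that unfolding natural_iso_def by simp
  then have 1: "isomorphic D (fobj G (cshift 1 X)) (cshift 1 (fobj G X))" if "cx X" for X
    using that unfolding isomorphic_def comp_func_def shift_func_simps by auto
  have ob: "cx (fobj G X)" if "cx X" for X using DC.af_ob[OF a] that by simp
  have 2: "isomorphic D (fobj G (cshift (int n) X)) (cshift (int n) (fobj G X))" if X: "cx X" for n X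
  proof (induction n)
    case 0
    then show ?case using DC.iso_refl ob[OF X] by (simp add: cshift_0)
  next
    case (Suc n)
    have e: "cshift (int (Suc n)) Y = cshift 1 (cshift (int n) Y)" for Y :: "('h, 'k) cpx" by (simp add: cshift_cshift add.commute)
    note cn = cx_cshift[OF X, of "int n"]
    show ?case unfolding e
      using cx_isomorphic_trans[OF 1[OF cn] cshift_isomorphic[OF Suc]] ob X by (simp add: cx_cshift)
  qed
  fix X :: "('h, 'k) cpx" and n assume X: "cx X"
  show "isomorphic D (fobj G (cshift n X)) (cshift n (fobj G X))"
  proof (cases "0 \<le> n")
    case True
    then show ?thesis using 2[OF X, of "nat n"] by simp
  next
    case False
    let ?Y = "cshift n X"
    note Y = cx_cshift[OF X, of n]
    have e: "cshift (int (nat (-n))) (cshift n X) = X" "cshift n (cshift (int (nat (-n))) Z) = Z" for Z :: "('h, 'k) cpx"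
      using False by (simp_all add: cshift_cshift cshift_0)
    have "isomorphic D (fobj G X) (cshift (int (nat (-n))) (fobj G ?Y))" using 2[OF Y, of "nat (-n)"] unfolding e .
    from cshift_isomorphic[OF this, of n] show ?thesis unfolding e using DC.iso_sym ob X Y by (simp add: cx_cshift)
  qed
qed

text \<open>Insert G G' inside the shift, commute \<open>G\<close> outwards, and cancel it by
  applying \<open>G'\<close>.\<close>

lemma commutes_shift_inverse:
  assumes G: "commutes_shift G" and q: "quasi_inverse D G G' \<eta> \<theta>"
  shows "commutes_shift G'"
  unfolding commutes_shift_def
proof (intro conjI allI impI)
  show a: "additive_functor D D G'" using DC.qi_af(2)[OF q] .
  fix X :: "('h, 'k) cpx" and n assume X: "cx X"
  have ob: "cx (fobj G' X)" if "cx X" for X using DC.af_ob[OF a] that by simp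
  note ob' = commutes_shiftD(1)[OF G]
  have "isomorphic D (cshift n X) (cshift n (fobj G (fobj G' X)))"
    using cshift_isomorphic[OF DC.qi_isomorphic(2)[OF q]] X ob ob' by simp
  then have "isomorphic D (cshift n X) (fobj G (cshift n (fobj G' X)))"
    using cx_isomorphic_trans[OF _ DC.iso_sym[OF commutes_shiftD(2)[OF G ob[OF X]]]] X ob ob' by (simp add: cx_cshift)
  then have "isomorphic D (fobj G' (cshift n X)) (fobj G' (fobj G (cshift n (fobj G' X))))"
    using DC.af_isomorphic[OF a] X ob ob' by (simp add: cx_cshift)
  then show "isomorphic D (fobj G' (cshift n X)) (cshift n (fobj G' X))"
    using cx_isomorphic_trans[OF _ DC.iso_sym[OF DC.qi_isomorphic(1)[OF q]]] X ob ob' by (simp add: cx_cshift)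
qed

lemma commutes_shift_ipow: "\<lbrakk>commutes_shift G; quasi_inverse D G G' \<eta> \<theta>\<rbrakk> \<Longrightarrow> commutes_shift (ipow G G' k)"
  unfolding ipow_def using commutes_shift_npow commutes_shift_inverse by simp

text \<open>Serre duality with Y[1] in place of \<open>V\<close> puts a shift on both sides, which
  is cancelled. Adjunction moves \<open>\<tau>\<close> to the other side as its quasi-inverse, and
  shifting once more produces the functor \<open>F\<close> and an Ext group again.\<close>

lemma ext_duality:
  assumes t: "AR_translation sc \<tau>" and q: "quasi_inverse D \<tau> \<tau>' \<alpha> \<beta>" and X: "indecomposable D X" and Y: "cx Y"
  shows "DC.nz X (cshift 1 Y) \<longleftrightarrow> DC.nz (fobj (comp_func (shift_func 1) \<tau>') Y) (cshift 1 X)"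
proof -
  have Xo: "cx X" using X unfolding indecomposable_def by simp
  have o: "cx (fobj \<tau> X)" "cx (fobj \<tau>' Y)" using DC.af_ob[OF DC.qi_af(1)[OF q]] DC.af_ob[OF DC.qi_af(2)[OF q]] Xo Y by simp_all
  have "DC.nz X (cshift 1 Y) \<longleftrightarrow> DC.nz Y (fobj \<tau> X)"
    unfolding serre_duality[OF t X cx_cshift[OF Y]] nz_cshift[OF Y o(1)] ..
  also have "\<dots> \<longleftrightarrow> DC.nz (fobj \<tau>' Y) X" using DC.qi_adj_nz[OF q] Y Xo by simp
  finally show ?thesis unfolding comp_func_def shift_func_simps using nz_cshift[OF o(2) Xo] by simp
qed

text \<open>
  If \<open>F\<^sup>-\<^sup>1X \<notin> T\<close>, then some \<open>Y \<in> T\<close> has \<open>Ext(Y, F\<^sup>-\<^sup>1X) \<noteq> 0\<close>, which is dual to \<open>Ext(X, Y) = 0\<close>.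
  If \<open>FX \<notin> T\<close>, then some \<open>Y \<in> T\<close> has \<open>Ext(Y, FX) \<noteq> 0\<close>, that is \<open>Ext(F\<^sup>-\<^sup>1Y, X) \<noteq> 0\<close>, where
  \<open>F\<^sup>-\<^sup>1Y \<in> T\<close>.
\<close>

lemma ext_configuration_closed:
  assumes t: "AR_translation sc \<tau>" and q: "quasi_inverse D \<tau> \<tau>' \<alpha> \<beta>"
    and F: "F = comp_func (shift_func 1) \<tau>'" and qF: "quasi_inverse D F F' \<eta> \<theta>"
    and T: "ext_configuration D (cshift 1) T" and X: "cx X" "iso_class D X \<in> T"
  shows "iso_class D (fobj F' X) \<in> T" "iso_class D (fobj F X) \<in> T"
proof -
  have E1: "\<not> DC.nz X (cshift 1 Y)" if "cx X" "cx Y" "iso_class D X \<in> T" "iso_class D Y \<in> T" for X Y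
    using T that DC.ext1_vanishes_iff[of X "cshift 1" Y] unfolding ext_configuration_def by (simp add: cx_cshift)
  have E2: "\<exists>X. cx X \<and> iso_class D X \<in> T \<and> DC.nz X (cshift 1 Z)" if Z': "indecomposable D Z" "iso_class D Z \<notin> T" for Z
  proof -
    have Z: "cx Z" using Z'(1) unfolding indecomposable_def by simp
    have "\<forall>Z. indecomposable D Z \<and> iso_class D Z \<notin> T \<longrightarrow> (\<exists>X \<in> Ob D. iso_class D X \<in> T \<and> \<not> ext1_vanishes D (cshift 1) X Z)"
      using T unfolding ext_configuration_def by (elim conjE)
    then obtain X where X: "X \<in> Ob D" "iso_class D X \<in> T" "\<not> ext1_vanishes D (cshift 1) X Z"
      using Z' by (elim allE[of _ Z] impE bexE conjE) (rule conjI)+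
    show ?thesis using DC.ext1_vanishes_iff[of X "cshift 1" Z, OF X(1)] X Z cx_cshift[OF Z, of 1] by (intro exI[of _ X]) simp
  qed
  have ind: "indecomposable D X" if "cx X" "iso_class D X \<in> T" for X
  proof -
    have "iso_class D X \<in> ind D" using T that unfolding ext_configuration_def by blast
    then show ?thesis using DC.in_ind_iff[of X] that(1) by simp
  qed
  have cF: "commutes_shift F"
    unfolding F using commutes_shift_comp[OF commutes_shift_shift] commutes_shift_inverse[OF triangle_functor_commutes_shift q]
      t unfolding AR_translation_def triangle_autoequivalence_def by blast
  note oF = commutes_shiftD(1)[OF cF]
  have oF': "cx (fobj F' Z)" if "cx Z" for Z using DC.af_ob[OF DC.qi_af(2)[OF qF]] that by simp
  have inv: "iso_class D (fobj F' X) \<in> T" if X: "cx X" "iso_class D X \<in> T" for X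
  proof (rule ccontr)
    let ?Z = "fobj F' X"
    assume Z: "iso_class D ?Z \<notin> T"
    have "indecomposable D ?Z" using DC.qi_indecomposable[OF DC.qi_sym[OF qF] ind[OF X]] .
    from E2[OF this Z] obtain Y where Y: "cx Y" "iso_class D Y \<in> T" "DC.nz Y (cshift 1 ?Z)" by blast
    \<comment> \<open>Duality is used at the pair \<open>Y\<close>, \<open>?Z\<close>; afterwards F
      F' X is replaced by the isomorphic \<open>X\<close>.\<close>
    then have "DC.nz (fobj F ?Z) (cshift 1 Y)" using ext_duality[OF t q ind[OF Y(1,2)] oF'[OF X(1)]] unfolding F by blast
    then have "DC.nz X (cshift 1 Y)"
      using DC.nz_iso1[OF DC.iso_sym[OF DC.qi_isomorphic(2)[OF qF]]] X Y oF oF' by (simp add: cx_cshift)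
    then show False using E1 X Y by blast
  qed
  show "iso_class D (fobj F' X) \<in> T" using inv[OF X] .
  show "iso_class D (fobj F X) \<in> T"
  proof (rule ccontr)
    assume Z: "iso_class D (fobj F X) \<notin> T"
    have "indecomposable D (fobj F X)" using DC.qi_indecomposable[OF qF ind[OF X]] .
    from E2[OF this Z] obtain Y where Y: "cx Y" "iso_class D Y \<in> T" "DC.nz Y (cshift 1 (fobj F X))" by blast
    \<comment> \<open>The shift is moved inside \<open>F\<close> so that the adjunction
      applies.\<close>
    then have "DC.nz Y (fobj F (cshift 1 X))"
      using DC.nz_iso2[OF DC.iso_sym[OF commutes_shiftD(2)[OF cF X(1), of 1]]] X oF by (simp add: cx_cshift)
    then have "DC.nz (fobj F' Y) (cshift 1 X)" using DC.qi_adj_nz[OF qF] X Y by (simp add: cx_cshift)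
    then show False using E1[OF oF'[OF Y(1)] X(1) inv[OF Y(1,2)] X(2)] by blast
  qed
qed

end

section \<open>Orbits are free\<close>

context hered
begin

lemma carr_zero_module: "carr (zero_module :: ('h, 'k) fmod) = {0}"
  by (simp add: zero_module_def)

lemma cshift_stalk: "cmod (cshift n (stalk M)) i = (if i + n = 0 then M else zero_module)"
  "diff (cshift n (stalk M)) i = 0"
  by (auto simp: cshift_def stalk_def)

lemma cx_stalk: "fg_module sc M \<Longrightarrow> cx (stalk M)"
proof (rule cxI[where n = 0])
  assume M: "fg_module sc M"
  have z: "modl zero_module" and m: "modl M" using fg_module_modl[OF fg_zero_module] fg_module_modl[OF M] .
  show "fg_module sc (cmod (stalk M) i)" for i using M fg_zero_module by (simp add: stalk_def)
  have d: "diff (stalk M) i = 0" for i by (simp add: stalk_def fun_eq_iff)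
  show "diff (stalk M) i \<in> mod_hom (cmod (stalk M) i) (cmod (stalk M) (i + 1))" for i
    unfolding d using hom_zero m z by (simp add: stalk_def)
  show "diff (stalk M) (i + 1) (diff (stalk M) i v) = 0" for i v unfolding d by simp
  show "0 < \<bar>i\<bar> \<Longrightarrow> carr (cmod (stalk M) i) = {0}" for i by (simp add: stalk_def carr_zero_module)
qed

text \<open>The regular module in degree \<open>j\<close>; the morphisms from it detect the cohomology in degree \<open>j\<close>.\<close>

definition regs :: "int \<Rightarrow> ('h, 'k) cpx" where
  "regs j = cshift (-j) (stalk reg)"

lemma regs_simps: "cmod (regs j) i = (if i = j then reg else zero_module)" "diff (regs j) i = 0"
  unfolding regs_def cshift_stalk by simp_all

lemma cshift_regs: "cshift n (regs j) = regs (j - n)"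
  unfolding regs_def cshift_cshift by simp

lemma perf_regs: "perf (regs j)"
  unfolding perf_def regs_simps
  using cx_cshift[OF cx_stalk[OF fg_reg], of "-j"] projective_reg projective_zero[OF carr_zero_module fg_zero_module]
  unfolding regs_def[symmetric] by simp

lemmas cx_regs = perf_cx[OF perf_regs]

lemma exact_at_zero: "\<lbrakk>cx X; carr (cmod X i) = {0}\<rbrakk> \<Longrightarrow> exact_at X i"
  unfolding exact_at_def cocycles_def using coboundary_0[of X i] by auto

text \<open>\<open>null_homotopic\<close> for morphisms of the derived category: \<open>P\<close>
  sees \<open>Y\<close> only in the degrees where \<open>P\<close> is nonzero.\<close>

lemma perf_nz_zero:
  assumes P: "perf P" and Y: "cx Y" and e: "\<And>i. carr (cmod P i) \<noteq> {0} \<Longrightarrow> exact_at Y i"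
  shows "\<not> DC.nz P Y"
proof
  note cP = perf_cx[OF P]
  assume "DC.nz P Y"
  then obtain g where g: "g \<in> Hom D P Y" "g \<noteq> Nul D P Y" unfolding DC.nz_def by blast
  obtain f where f: "f \<in> chain_map P Y" "g = Q P Y f" using Q_surj[OF P Y g(1)] by blast
  have "hq P Y f 0" unfolding hq_def using null_homotopic[OF P Y f(1) e] cP Y f(1) cm_zero[OF cP Y] by blast
  then have "Q P Y f = Nul D P Y" using Q_eq Q_nul by metis
  then show False using g(2) f(2) by simp
qed

text \<open>A cocycle \<open>v\<close> is the image of 1 under a chain map from
  \<open>regs j\<close>, and a null homotopy of that map yields a cochain bounding \<open>v\<close>.
  In terms of morphisms, exactness is visibly invariant under isomorphism in the derived
  category.\<close>

lemma exact_at_iff: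
  assumes X: "cx X"
  shows "exact_at X j \<longleftrightarrow> \<not> DC.nz (regs j) X"
proof
  assume "exact_at X j"
  then show "\<not> DC.nz (regs j) X"
    using perf_nz_zero[OF perf_regs X, of j] unfolding regs_simps using carr_zero_module by metis
next
  assume n: "\<not> DC.nz (regs j) X"
  note mX = cx_modl[OF X] and mz = fg_module_modl[OF fg_zero_module] and dh = cx_diff[OF X]
  show "exact_at X j" unfolding exact_at_def
  proof
    fix v assume v: "v \<in> cocycles X j"
    note v' = cocyclesD[OF v]
    define f where "f i = (if i = j then rhom (cmod X j) v else 0)" for i
    have f: "f \<in> chain_map (regs j) X"
    proof (rule chain_mapI[OF cx_regs X])
      show h: "f i \<in> mod_hom (cmod (regs j) i) (cmod X i)" for i
        unfolding regs_simps f_def using rhom_in[OF mX v'(1)] hom_zero[OF mz mX] by simp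
      fix i u assume u: "u \<in> carr (cmod (regs j) i)"
      have "diff X i (f i u) = 0"
      proof (cases "i = j")
        case True
        then obtain h where "u = enc h" using u by (auto simp: regs_simps reg_simps)
        then have "f i u = act (cmod X j) h v" unfolding f_def using True rhom_enc by simp
        then show ?thesis using hom_act[OF dh v'(1), of h] v'(2) mX True by simp
      next
        case False
        then show ?thesis unfolding f_def using hom_0[OF dh mX, of i] by simp
      qed
      then show "f (i + 1) (diff (regs j) i u) = diff X i (f i u)"
        unfolding regs_simps using hom_0[OF h cx_modl[OF cx_regs], of "i + 1"] by simp
    qed
    have "Q (regs j) X f = Nul D (regs j) X" using n Q_in[OF f cx_regs X] unfolding DC.nz_def by blast
    then have "homotopic (regs j) X f 0"
      using Q_eqD[OF perf_regs X f cm_zero[OF cx_regs X]] Q_nul hqD(3) by metis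
    then obtain h where h: "\<And>i. h i \<in> mod_hom (cmod (regs j) i) (cmod X (i - 1))"
      "\<And>i u. f i u - 0 i u = diff X (i - 1) (h i u) + h (i + 1) (diff (regs j) i u)" using homotopicE by blast
    have r: "enc 1 \<in> carr (cmod (regs j) j)" by (simp add: regs_simps reg_simps)
    have "f j (enc 1) = v" unfolding f_def using rhom_enc[of "cmod X j" v 1] mX v'(1) by simp
    then have "v = diff X (j - 1) (h j (enc 1))"
      using h(2)[of j "enc 1"] hom_0[OF h(1) cx_modl[OF cx_regs], of "j + 1"] unfolding regs_simps by simp
    then show "v \<in> coboundaries X j" using coboundariesI[OF hom_in[OF h(1) r]] by simp
  qed
qed

lemma nz_regs: "DC.nz (regs j) (regs n) \<Longrightarrow> n = j"
  using exact_at_iff[OF cx_regs, of n j] exact_at_zero[OF cx_regs, of n j] carr_zero_module unfolding regs_simps by metis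

lemma acyclic_zero:
  assumes X: "cx X" and e: "\<And>i. exact_at X i"
  shows "zero_object D X"
proof -
  have "\<not> DC.nz (res X) X" using perf_nz_zero[OF perf_res[OF X] X e] .
  then have "\<not> DC.nz X X" using DC.nz_iso1[OF DC.iso_sym[OF iso_res[OF X]], of X] X cx_res[OF X] D_simps(1) by blast
  then show ?thesis using DC.zero_object_iff_nz[of X] X by simp
qed

text \<open>The complex lives in one degree with zero differential, so homotopies contribute nothing
  and equality in the derived category is equality of maps.\<close>

lemma regs_Q_eq:
  assumes f: "f \<in> chain_map (regs j) (regs j)" "f' \<in> chain_map (regs j) (regs j)"
    and e: "Q (regs j) (regs j) f = Q (regs j) (regs j) f'"
  shows "f = f'"
proof (rule ext, rule ext)
  fix i u
  obtain h where h: "\<And>i. h i \<in> mod_hom (cmod (regs j) i) (cmod (regs j) (i - 1))"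
    "\<And>i u. f i u - f' i u = diff (regs j) (i - 1) (h i u) + h (i + 1) (diff (regs j) i u)"
    using homotopicE[OF hqD(3)[OF Q_eqD[OF perf_regs cx_regs f e]]] by blast
  show "f i u = f' i u"
    using h(2)[of i u] hom_0[OF h(1) cx_modl[OF cx_regs], of "i + 1"] unfolding regs_simps by simp
qed

text \<open>The relation e e' = e' puts the image of \<open>e'\<close> inside that of
  \<open>e\<close>, and the dimensions force equality; an idempotent is the identity on its
  image.\<close>

lemma regs_dim_retract:
  fixes e e' :: "'k cmap"
  assumes e: "e \<in> chain_map (regs j) (regs j)" "e' \<in> chain_map (regs j) (regs j)"
    and ee: "cmap_comp e e' = e'" "cmap_comp e' e' = e'"
    and d: "sq.dim (e j ` carr reg) \<le> sq.dim (e' j ` carr reg)"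
  shows "cmap_comp e' e = e"
proof -
  have h: "e j \<in> mod_hom reg reg" "e' j \<in> mod_hom reg reg" using cm_hom[OF e(1), of j] cm_hom[OF e(2), of j] unfolding regs_simps by simp_all
  note m = fg_module_modl[OF fg_reg]
  have fd: "fd (e j ` carr reg)" using fg_image[OF h(1) fg_reg fg_reg] fg_module_iff by simp
  have sub: "e' j ` carr reg \<subseteq> e j ` carr reg"
  proof
    fix x assume "x \<in> e' j ` carr reg"
    then obtain u where u: "u \<in> carr reg" "x = e' j u" by blast
    have "x = e j (e' j u)" using fun_cong[OF fun_cong[OF ee(1), of j], of u] u(2) by (simp add: cmap_comp_def)
    then show "x \<in> e j ` carr reg" using hom_in[OF h(2) u(1)] by blast
  qed
  note ss = subspace_image(1)[OF h(2) m m] subspace_image(1)[OF h(1) m m]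
  have eq: "e' j ` carr reg = e j ` carr reg" using fd_dim_mono[OF fd sub ss] d by simp
  show ?thesis
  proof (rule ext, rule ext)
    fix i v
    show "cmap_comp e' e i v = e i v"
    proof (cases "i = j \<and> v \<in> carr reg")
      case True
      then have "e j v \<in> e' j ` carr reg" unfolding eq by blast
      then obtain u where u: "e j v = e' j u" by blast
      show ?thesis using fun_cong[OF fun_cong[OF ee(2), of j], of u] u True by (simp add: cmap_comp_def)
    next
      case False
      have 0: "g i v = 0" if "g \<in> chain_map (regs j) (regs j)" for g
      proof (cases "v \<in> carr (cmod (regs j) i)")
        case True
        then have "v = 0" using False carr_zero_module unfolding regs_simps by (auto split: if_splits)
        then show ?thesis using hom_0[OF cm_hom[OF that] cx_modl[OF cx_regs]] by simp
      qed (use hom_out[OF cm_hom[OF that]] in simp)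
      show ?thesis using 0[OF cm_comp[OF e cx_regs]] 0[OF e(1)] by simp
    qed
  qed
qed

text \<open>
  A retract of \<open>regs j\<close> corresponds to an idempotent of the regular module; the one with the image of least
  dimension that still maps to \<open>Y\<close> is indecomposable.
\<close>

lemma ex_indecomposable_retract:
  assumes Y: "cx Y" and n: "DC.nz (regs j) Y"
  obtains Z where "indecomposable D Z" "DC.nz Z Y" "\<And>V. \<lbrakk>cx V; DC.nz Z V\<rbrakk> \<Longrightarrow> DC.nz (regs j) V"
proof -
  let ?S = "regs j"
  have So: "?S \<in> Ob D" using cx_regs by simp
  \<comment> \<open>The dimensions realised by admissible retracts. The idempotent of a retract is a
    chain map \<open>e\<close> on the nose, so the dimension of its image makes sense and can be
    minimised.\<close>
  define R where "R k \<longleftrightarrow> (\<exists>Z i p e. cx Z \<and> i \<in> Hom D Z ?S \<and> p \<in> Hom D ?S Z \<and> Cmp D Z ?S Z p i = Idn D Z \<and>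
    e \<in> chain_map ?S ?S \<and> Cmp D ?S Z ?S i p = Q ?S ?S e \<and> DC.nz Z Y \<and> sq.dim (e j ` carr reg) = k)" for k
  have "Cmp D ?S ?S ?S (Idn D ?S) (Idn D ?S) = Idn D ?S" using DC.idl[OF DC.idn_in[OF So] So So] .
  then have "R (sq.dim (cmap_id ?S j ` carr reg))" unfolding R_def
    using DC.idn_in[OF So] cx_regs cm_id[OF cx_regs] n Q_idn by metis
  then have "R (LEAST k. R k)" by (rule LeastI)
  moreover define k where "k = (LEAST k. R k)"
  ultimately have R: "R k" by simp
  have k: "k \<le> l" if "R l" for l unfolding k_def using that by (rule Least_le)
  obtain Z i p e where Z: "cx Z" "i \<in> Hom D Z ?S" "p \<in> Hom D ?S Z" "Cmp D Z ?S Z p i = Idn D Z"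
      "e \<in> chain_map ?S ?S" "Cmp D ?S Z ?S i p = Q ?S ?S e" "DC.nz Z Y" "sq.dim (e j ` carr reg) = k"
    using R unfolding R_def by (elim exE conjE) (rule that)
  have Zo: "Z \<in> Ob D" using Z by simp
  \<comment> \<open>A retract \<open>A\<close> of \<open>Z\<close> that still maps to
    \<open>Y\<close> competes in the minimum. Its idempotent has an image inside that of
    \<open>Z\<close> and of no smaller dimension, so \<open>A\<close> is all of
    \<open>Z\<close>.\<close>
  have key: "Cmp D Z A Z a b = Idn D Z"
    if A: "A \<in> Ob D" "DC.nz A Y" and a: "a \<in> Hom D A Z" "b \<in> Hom D Z A" "Cmp D A Z A b a = Idn D A" for A a b
  proof -
    let ?i = "Cmp D A Z ?S i a" and ?p = "Cmp D ?S Z A b p"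
    have ip: "?i \<in> Hom D A ?S" "?p \<in> Hom D ?S A" using Z a A Zo So by simp_all
    have pi: "Cmp D A ?S A ?p ?i = Idn D A"
    proof -
      have "Cmp D A ?S A ?p ?i = Cmp D A Z A b (Cmp D A ?S Z p ?i)" using DC.assoc[OF ip(1) Z(3) a(2)] A Zo So by simp
      also have "Cmp D A ?S Z p ?i = a" using DC.cancel_l[OF Z(4) a(1) Z(2,3)] A Zo So by simp
      finally show ?thesis using a(3) by simp
    qed
    have "Cmp D ?S A ?S ?i ?p \<in> Hom D ?S ?S" using ip A So by simp
    then obtain e' where e': "e' \<in> chain_map ?S ?S" "Cmp D ?S A ?S ?i ?p = Q ?S ?S e'" using Q_surj[OF perf_regs cx_regs] by metis
    have "R (sq.dim (e' j ` carr reg))" unfolding R_def using A(1) ip pi e' A(2) unfolding D_simps(1) by metis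
    then have d: "sq.dim (e j ` carr reg) \<le> sq.dim (e' j ` carr reg)" using k Z(8) by simp
    have "Q ?S ?S (cmap_comp e e') = Q ?S ?S e'"
    proof -
      have "Cmp D A ?S ?S (Cmp D ?S Z ?S i p) ?i = ?i"
        using DC.assoc[OF ip(1) Z(3,2)] DC.cancel_l[OF Z(4) a(1) Z(2,3)] A Zo So by simp
      then have "Cmp D ?S ?S ?S (Cmp D ?S Z ?S i p) (Cmp D ?S A ?S ?i ?p) = Cmp D ?S A ?S ?i ?p"
        using DC.assoc[OF ip(2,1) DC.cmp_in[OF Z(3,2)]] A Zo So by simp
      then show ?thesis unfolding e'(2) Z(6) Q_cmp[OF e'(1) Z(5) cx_regs cx_regs cx_regs] .
    qed
    then have 1: "cmap_comp e e' = e'" using regs_Q_eq[OF cm_comp[OF e'(1) Z(5) cx_regs] e'(1)] by blast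
    have "Q ?S ?S (cmap_comp e' e') = Q ?S ?S e'"
    proof -
      have "Cmp D ?S ?S ?S (Cmp D ?S A ?S ?i ?p) (Cmp D ?S A ?S ?i ?p) = Cmp D ?S A ?S ?i (Cmp D ?S ?S A ?p (Cmp D ?S A ?S ?i ?p))"
        using DC.assoc[OF DC.cmp_in[OF ip(2,1)] ip(2,1)] A So by simp
      also have "\<dots> = Cmp D ?S A ?S ?i ?p" using DC.cancel_l[OF pi ip(2,1,2)] A So by simp
      finally show ?thesis unfolding e'(2) Q_cmp[OF e'(1) e'(1) cx_regs cx_regs cx_regs] .
    qed
    then have 2: "cmap_comp e' e' = e'" using regs_Q_eq[OF cm_comp[OF e'(1) e'(1) cx_regs] e'(1)] by blast
    have 3: "Cmp D ?S ?S ?S (Cmp D ?S A ?S ?i ?p) (Cmp D ?S Z ?S i p) = Cmp D ?S Z ?S i p"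
      unfolding e'(2) Z(6) Q_cmp[OF Z(5) e'(1) cx_regs cx_regs cx_regs] regs_dim_retract[OF Z(5) e'(1) 1 2 d] ..
    let ?ab = "Cmp D Z A Z a b"
    have ab: "?ab \<in> Hom D Z Z" using a A Zo by simp
    have iab: "Cmp D ?S A ?S ?i ?p = Cmp D ?S Z ?S i (Cmp D ?S Z Z ?ab p)"
      using DC.assoc[OF ip(2) a(1) Z(2)] DC.assoc[OF Z(3) a(2,1)] A Zo So by simp
    have "Cmp D ?S ?S ?S (Cmp D ?S A ?S ?i ?p) (Cmp D ?S Z ?S i p) = Cmp D ?S Z ?S i (Cmp D ?S Z Z ?ab p)"
    proof -
      have abp: "Cmp D ?S Z Z ?ab p \<in> Hom D ?S Z" using ab Z Zo So by simp
      have "Cmp D ?S ?S ?S (Cmp D ?S Z ?S i (Cmp D ?S Z Z ?ab p)) (Cmp D ?S Z ?S i p)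
        = Cmp D ?S Z ?S i (Cmp D ?S ?S Z (Cmp D ?S Z Z ?ab p) (Cmp D ?S Z ?S i p))"
        using DC.assoc[OF DC.cmp_in[OF Z(3,2)] abp Z(2)] Zo So by simp
      also have "Cmp D ?S ?S Z (Cmp D ?S Z Z ?ab p) (Cmp D ?S Z ?S i p) = Cmp D ?S Z Z ?ab (Cmp D ?S ?S Z p (Cmp D ?S Z ?S i p))"
        using DC.assoc[OF DC.cmp_in[OF Z(3,2)] Z(3) ab] Zo So by simp
      also have "Cmp D ?S ?S Z p (Cmp D ?S Z ?S i p) = p" using DC.cancel_l[OF Z(4) Z(3,2,3)] Zo So by simp
      finally show ?thesis unfolding iab .
    qed
    with 3 have 4: "Cmp D ?S Z ?S i (Cmp D ?S Z Z ?ab p) = Cmp D ?S Z ?S i p" by simp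
    have "?ab = Cmp D Z ?S Z p (Cmp D Z ?S ?S (Cmp D ?S Z ?S i (Cmp D ?S Z Z ?ab p)) i)"
    proof -
      have "Cmp D Z ?S ?S (Cmp D ?S Z ?S i (Cmp D ?S Z Z ?ab p)) i = Cmp D Z Z ?S i (Cmp D Z ?S Z (Cmp D ?S Z Z ?ab p) i)"
        using DC.assoc[OF Z(2) DC.cmp_in[OF Z(3) ab] Z(2)] Zo So by simp
      also have "Cmp D Z ?S Z (Cmp D ?S Z Z ?ab p) i = ?ab"
        using DC.assoc[OF Z(2,3) ab] Z(4) ab Zo So by simp
      finally show ?thesis using DC.cancel_l[OF Z(4) ab Z(2,3)] Zo So by simp
    qed
    also have "\<dots> = Idn D Z"
    proof -
      have "Cmp D Z ?S ?S (Cmp D ?S Z ?S i p) i = i" using DC.assoc[OF Z(2,3,2)] Z Zo So by simp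
      then show ?thesis unfolding 4 using Z(4) by simp
    qed
    finally show ?thesis .
  qed
  obtain f where f: "f \<in> Hom D Z Y" "f \<noteq> Nul D Z Y" using Z(7) unfolding DC.nz_def by blast
  have Yo: "Y \<in> Ob D" using Y by simp
  \<comment> \<open>If \<open>f\<close> is nonzero on the summand \<open>A\<close>, then
    \<open>A\<close> is all of \<open>Z\<close> by \<open>key\<close>, and the projection
    \<open>q\<close> to the other summand vanishes.\<close>
  have zero: "zero_object D B"
    if o: "A \<in> Ob D" "B \<in> Ob D" and a: "a \<in> Hom D A Z" "b \<in> Hom D Z A" "Cmp D A Z A b a = Idn D A"
      and c: "c \<in> Hom D B Z" "q \<in> Hom D Z B" "Cmp D B Z B q c = Idn D B" "Cmp D A Z B q a = Nul D A B"
      and fa: "Cmp D A Z Y f a \<noteq> Nul D A Y" for A B a b c q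
  proof -
    have "DC.nz A Y" unfolding DC.nz_def using fa f(1) a(1) o Zo Yo by (intro bexI[of _ "Cmp D A Z Y f a"]) simp_all
    from key[OF o(1) this a] have "q = Cmp D Z Z B q (Cmp D Z A Z a b)" using c(2) o Zo by simp
    also have "\<dots> = Nul D Z B" using DC.assoc[OF a(2,1) c(2)] c(4) a o Zo by simp
    finally show ?thesis unfolding zero_object_def using c o Zo by (metis DC.cmp_nul_l)
  qed
  have "indecomposable D Z" unfolding indecomposable_def
  proof (intro conjI ballI impI Zo)
    show "\<not> zero_object D Z" using Z(7) f Zo Yo unfolding zero_object_def by (metis DC.idr DC.cmp_nul_r)
    fix A B assume o: "A \<in> Ob D" "B \<in> Ob D" and "is_direct_sum D A B Z"
    then obtain a c b q where s: "a \<in> Hom D A Z" "c \<in> Hom D B Z" "b \<in> Hom D Z A" "q \<in> Hom D Z B"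
      "Cmp D A Z A b a = Idn D A" "Cmp D B Z B q c = Idn D B" "Cmp D A Z B q a = Nul D A B" "Cmp D B Z A b c = Nul D B A"
      "Add D Z Z (Cmp D Z A Z a b) (Cmp D Z B Z c q) = Idn D Z" unfolding is_direct_sum_def by blast
    show "zero_object D A \<or> zero_object D B"
    proof (rule ccontr)
      assume "\<not> (zero_object D A \<or> zero_object D B)"
      then have 0: "Cmp D A Z Y f a = Nul D A Y" "Cmp D B Z Y f c = Nul D B Y"
        using zero[OF o s(1,3,5,2,4,6,7)] zero[OF o(2,1) s(2,4,6,1,3,5,8)] by blast+
      \<comment> \<open>The two idempotents add up to the identity, so \<open>f\<close> cannot
        vanish on both summands.\<close>
      have "f = Cmp D Z Z Y f (Add D Z Z (Cmp D Z A Z a b) (Cmp D Z B Z c q))" unfolding s(9) using f(1) Zo Yo by simp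
      also have "\<dots> = Add D Z Y (Cmp D Z A Y (Cmp D A Z Y f a) b) (Cmp D Z B Y (Cmp D B Z Y f c) q)"
        using DC.cmp_add_r[of "Cmp D Z A Z a b" Z Z "Cmp D Z B Z c q" f Y] DC.assoc[OF s(3,1) f(1)] DC.assoc[OF s(4,2) f(1)] s f o Zo Yo by simp
      also have "\<dots> = Nul D Z Y" unfolding 0 using s o Zo Yo by simp
      finally show False using f(2) by blast
    qed
  qed
  moreover have "DC.nz ?S V" if V: "cx V" "DC.nz Z V" for V
  proof -
    have Vo: "V \<in> Ob D" using V by simp
    obtain g where g: "g \<in> Hom D Z V" "g \<noteq> Nul D Z V" using V(2) unfolding DC.nz_def by blast
    have gp: "Cmp D ?S Z V g p \<in> Hom D ?S V" using g Z Zo So Vo by simp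
    have "g = Cmp D Z ?S V (Cmp D ?S Z V g p) i" using DC.assoc[OF Z(2,3) g(1)] Z(4) g(1) Zo So Vo by simp
    then have "Cmp D ?S Z V g p \<noteq> Nul D ?S V" using g(2) DC.cmp_nul_l[OF Z(2) Zo So Vo] by metis
    then show ?thesis unfolding DC.nz_def using gp by blast
  qed
  ultimately show ?thesis using that Z(7) by blast
qed

end

section \<open>Objects fixed by a power\<close>

context orbit
begin

lemma pw_isomorphic: "\<lbrakk>isomorphic C X Y; X \<in> Ob C; Y \<in> Ob C\<rbrakk> \<Longrightarrow> isomorphic C (pw k X) (pw k Y)"
  using af_isomorphic[OF af_ipow] .

lemma pw_add_isomorphic: "X \<in> Ob C \<Longrightarrow> isomorphic C (pw (j + i) X) (pw j (pw i X))"
  unfolding isomorphic_def using co_iso[of X j i] by blast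

lemma pw_ob: "X \<in> Ob C \<Longrightarrow> pw k X \<in> Ob C"
  using af_ob[OF af_ipow] .

lemma pw_fix:
  assumes X: "X \<in> Ob C" and f: "isomorphic C (pw k X) X"
  shows "isomorphic C (pw k (pw i X)) (pw i X)"
proof -
  have 1: "isomorphic C (pw k (pw i X)) (pw (i + k) X)" using iso_sym[OF pw_add_isomorphic[OF X, of k i]] by (simp add: add.commute)
  note 2 = iso_trans[OF pw_add_isomorphic[OF X, of i k] pw_isomorphic[OF f, of i]]
  show ?thesis using iso_trans[OF 1 2] X by (simp add: pw_ob)
qed

lemma pw_fix_mult:
  assumes X: "X \<in> Ob C" and f: "isomorphic C (pw k X) X"
  shows "isomorphic C (pw (int t * k) X) X"
proof (induction t)
  case 0
  then show ?case using iso_refl X by simp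
next
  case (Suc t)
  have e: "int (Suc t) * k = k + int t * k" by (simp add: algebra_simps)
  note 1 = iso_trans[OF pw_add_isomorphic[OF X, of k "int t * k"] pw_isomorphic[OF Suc, of k]]
  show ?case unfolding e using iso_trans[OF 1 f] X by (simp add: pw_ob)
qed

lemma pw_fix_neg:
  assumes X: "X \<in> Ob C" and f: "isomorphic C (pw k X) X"
  shows "isomorphic C (pw (-k) X) X"
proof -
  have "isomorphic C X (pw (-k) (pw k X))" using pw_add_isomorphic[OF X, of "-k" k] by simp
  from iso_trans[OF this pw_isomorphic[OF f, of "-k"]] show ?thesis using X iso_sym by (simp add: pw_ob)
qed

end

context hered
begin

text \<open>
  The projective resolution is cut off below degree \<open>a\<close>; by heredity the coboundaries in degree \<open>a\<close>, which
  are put in degree \<open>a - 1\<close>, form a projective module.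
\<close>

lemma truncation:
  assumes W: "cx W" and ex: "\<And>i. i < a \<Longrightarrow> exact_at W i"
  obtains P where "perf P" "isomorphic D P W" "\<And>i. carr (cmod P i) \<noteq> {0} \<Longrightarrow> a - 1 \<le> i"
proof -
  let ?P = "res W"
  note pP = perf_res[OF W] and cP = cx_res[OF W]
  note mP = cx_modl[OF cP] and fP = cx_fg[OF cP] and dh = cx_diff[OF cP]
  \<comment> \<open>Exactness is tested by morphisms from \<open>regs i\<close>, so it passes from
    \<open>W\<close> to its resolution.\<close>
  have exP: "exact_at ?P i" if "i < a" for i
    using ex[OF that] DC.nz_iso2[OF iso_res[OF W], of "regs i"] cx_regs cP W
    unfolding exact_at_iff[OF W] exact_at_iff[OF cP] D_simps(1) by blast
  let ?B = "coboundaries ?P a"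
  let ?K = "\<lparr>cmod = \<lambda>i. if a \<le> i then cmod ?P i else if i = a - 1 then sub (cmod ?P a) ?B else zero_module,
    diff = \<lambda>i. if a \<le> i then diff ?P i else if i = a - 1 then restr0 ?B (\<lambda>v. v) else 0\<rparr>"
  have c: "a \<le> i \<Longrightarrow> cmod ?K i = cmod ?P i" "cmod ?K (a - 1) = sub (cmod ?P a) ?B" "i < a - 1 \<Longrightarrow> cmod ?K i = zero_module"
    and d: "a \<le> i \<Longrightarrow> diff ?K i = diff ?P i" "diff ?K (a - 1) = restr0 ?B (\<lambda>v. v)" "i < a - 1 \<Longrightarrow> diff ?K i = 0" for i by simp_all
  have cases3: "R" if "a \<le> i \<Longrightarrow> R" "i = a - 1 \<Longrightarrow> R" "i < a - 1 \<Longrightarrow> R" for i R using that by linarith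
  note mz = fg_module_modl[OF fg_zero_module]
  have fgB: "fg_module sc (sub (cmod ?P a) ?B)"
    unfolding coboundaries_def using fg_image[OF cx_diff'[OF cP] fP fP] .
  note mB = fg_module_modl[OF fgB]
  have Bs: "?B \<subseteq> cocycles ?P a" using coboundary_in_cocycles[OF cP] by blast
  have Bc: "?B \<subseteq> carr (cmod ?P a)" using Bs cocyclesD(1) by blast
  have fgK: "fg_module sc (cmod ?K i)" for i
    by (rule cases3[of i]) (simp_all only: c fP fgB fg_zero_module)
  have mK: "modl (cmod ?K i)" for i using fg_module_modl[OF fgK] .
  obtain n where n: "0 \<le> n" "\<And>i. n < \<bar>i\<bar> \<Longrightarrow> carr (cmod ?P i) = {0}" using cx_bound[OF cP] by blast
  have incl: "restr0 ?B (\<lambda>v. v) \<in> mod_hom (sub (cmod ?P a) ?B) (cmod ?P a)"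
    using hom_sub_codomainD[of _ _ "cmod ?P a" ?B] hom_id[OF mB] Bc by simp
  have dK: "diff ?K i \<in> mod_hom (cmod ?K i) (cmod ?K (i + 1))" for i
  proof (rule cases3[of i])
    assume "a \<le> i"
    then show ?thesis using dh[of i] c(1)[of i] c(1)[of "i + 1"] d(1)[of i] by simp
  next
    assume i: "i = a - 1"
    have "cmod ?K (i + 1) = cmod ?P a" using i c(1)[of a] by simp
    then show ?thesis using incl unfolding i d(2) c(2) by simp
  next
    assume i: "i < a - 1"
    show ?thesis unfolding d(3)[OF i] using hom_zero[OF mK mK] .
  qed
  have ddK: "diff ?K (i + 1) (diff ?K i v) = 0" for i v
  proof (rule cases3[of i])
    assume "a \<le> i"
    then show ?thesis using cx_dd[OF cP, of i v] d(1)[of i] d(1)[of "i + 1"] by simp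
  next
    assume i: "i = a - 1"
    have "diff ?K (i + 1) = diff ?P a" using i d(1)[of a] by simp
    then show ?thesis unfolding i d(2) using cocyclesD(2) Bs hom_0[OF dh mP, of a] by (auto simp: restr0_def)
  next
    assume i: "i < a - 1"
    show ?thesis unfolding d(3)[OF i] using hom_0[OF dK mK, of "i + 1"] by (simp only: zero_fun_apply)
  qed
  have cK: "cx ?K"
  proof (rule cxI[OF fgK dK ddK])
    fix i assume i: "max n \<bar>a - 1\<bar> < \<bar>i\<bar>"
    show "carr (cmod ?K i) = {0}"
    proof (rule cases3[of i])
      assume a: "a \<le> i"
      have "n < \<bar>i\<bar>" using i by simp
      from n(2)[OF this] show ?thesis unfolding c(1)[OF a] .
    next
      assume "i = a - 1" then show ?thesis using i by simp
    next
      assume "i < a - 1" then show ?thesis using c(3)[of i] carr_zero_module by simp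
    qed
  qed
  have "projective_module sc (cmod ?P i)" for i using pP unfolding perf_def by blast
  then have "projective_module sc (cmod ?K i)" for i
    by (rule_tac cases3[of i]) (simp_all only: c projective_sub[OF _ Bc fgB] projective_zero[OF carr_zero_module fg_zero_module])
  then have pK: "perf ?K" unfolding perf_def using cK by blast
  \<comment> \<open>The comparison map is the identity from degree \<open>a\<close> on and, in
    degree a - 1, the differential onto the coboundaries. In lower degrees both complexes are exact,
    so zero is good enough.\<close>
  define t where "t i = (if a \<le> i then restr0 (carr (cmod ?P i)) (\<lambda>v. v) else if i = a - 1 then diff ?P i else 0)" for i
  have t1: "a \<le> i \<Longrightarrow> v \<in> carr (cmod ?P i) \<Longrightarrow> t i v = v" and t2: "t (a - 1) = diff ?P (a - 1)" and t3: "i < a - 1 \<Longrightarrow> t i = 0" for i v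
    by (simp_all add: t_def restr0_def)
  have th: "t i \<in> mod_hom (cmod ?P i) (cmod ?K i)" for i
  proof (rule cases3[of i])
    assume i: "a \<le> i"
    then show ?thesis unfolding c(1)[OF i] t_def using hom_id[OF mP] by simp
  next
    assume i: "i = a - 1"
    show ?thesis unfolding i t2 c(2)
      using hom_sub_codomain[OF cx_diff'[OF cP], of a ?B] unfolding coboundaries_def by simp
  next
    assume i: "i < a - 1"
    show ?thesis unfolding t3[OF i] using hom_zero[OF mP mK] .
  qed
  have t: "t \<in> chain_map ?P ?K"
  proof (rule chain_mapI[OF cP cK th])
    fix i v assume v: "v \<in> carr (cmod ?P i)"
    note dv = hom_in[OF dh v]
    show "t (i + 1) (diff ?P i v) = diff ?K i (t i v)"
    proof (rule cases3[of i])
      assume i: "a \<le> i"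
      show ?thesis unfolding d(1)[OF i] t1[OF i v] using t1[of "i + 1" "diff ?P i v"] dv i by simp
    next
      assume i: "i = a - 1"
      then have "diff ?P i v \<in> ?B" using coboundariesI[of v ?P a] v by simp
      then show ?thesis using t1[of "i + 1" "diff ?P i v"] dv i unfolding i d(2) t2 by (simp add: restr0_def)
    next
      assume i: "i < a - 1"
      have "t (i + 1) (diff ?P i v) = 0"
      proof (cases "i + 1 = a - 1")
        case True
        show ?thesis using cx_dd[OF cP, of i v] unfolding True t2 .
      next
        case False
        then show ?thesis using t3[of "i + 1"] i by simp
      qed
      then show ?thesis unfolding d(3)[OF i] by simp
    qed
  qed
  have cbK: "coboundaries ?K i = coboundaries ?P i" if i: "a \<le> i" for i
  proof (cases "i = a")
    case True
    then show ?thesis unfolding coboundaries_def[of ?K] True d(2) c(2) by (auto simp: restr0_def image_iff)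
  next
    case False
    then show ?thesis unfolding coboundaries_def using i c(1)[of "i - 1"] d(1)[of "i - 1"] by simp
  qed
  have inj: "x \<in> coboundaries ?P i" if x: "x \<in> cocycles ?P i" "t i x \<in> coboundaries ?K i" for i x
  proof (cases "a \<le> i")
    case True
    then show ?thesis using x(2) t1[OF True cocyclesD(1)[OF x(1)]] cbK[OF True] by simp
  next
    case False
    then show ?thesis using exP[of i] x(1) unfolding exact_at_def by auto
  qed
  have sur: "\<exists>x \<in> cocycles ?P i. y - t i x \<in> coboundaries ?K i" if y: "y \<in> cocycles ?K i" for i y
  proof (cases "a \<le> i")
    case True
    have y': "y \<in> cocycles ?P i" using cocyclesD[OF y] unfolding c(1)[OF True] d(1)[OF True] by (rule cocyclesI)
    have "y - t i y = 0" using t1[OF True cocyclesD(1)[OF y']] by simp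
    then show ?thesis by (intro bexI[OF _ y']) (simp only: coboundary_0[OF cK])
  next
    case False
    have "y = 0"
    proof (cases "i = a - 1")
      case True
      then show ?thesis using cocyclesD[OF y] unfolding True c(2) d(2) by (simp add: restr0_def)
    next
      case F: False
      have "i < a - 1" using F False by simp
      then show ?thesis using cocyclesD(1)[OF y] c(3)[of i] carr_zero_module by simp
    qed
    then have "y - t i 0 = 0" using hom_0[OF th mP] by simp
    then show ?thesis by (intro bexI[OF _ coboundary_in_cocycles[OF cP coboundary_0[OF cP]]]) (simp only: coboundary_0[OF cK])
  qed
  have "quasi_iso ?P ?K t" unfolding quasi_iso_iff[OF cP cK] using t inj sur by blast
  then have "isomorphic D ?P ?K" unfolding isomorphic_def using Q_iso[OF _ cP cK] by blast
  then have "isomorphic D ?K W" using cx_isomorphic_trans[OF DC.iso_sym iso_res[OF W]] cK cP W by blast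
  moreover have "a - 1 \<le> i" if "carr (cmod ?K i) \<noteq> {0}" for i
  proof (rule ccontr)
    assume "\<not> a - 1 \<le> i"
    then show False using that c(3)[of i] carr_zero_module by simp
  qed
  ultimately show ?thesis using that pK by blast
qed

text \<open>
  Otherwise some indecomposable retract \<open>Z\<close> of the regular module in degree \<open>i + 1\<close> maps to \<open>\<tau>\<^sup>-\<^sup>1X\<close>,
  hence \<open>\<tau>Z\<close> maps to \<open>X\<close>. By Serre duality \<open>\<tau>Z\<close> has cohomology in degree \<open>i + 2\<close> only, so it is given
  by projectives in degrees at least \<open>i + 1\<close>, where \<open>X\<close> is exact.
\<close>

lemma AR_functor_exact:
  assumes t: "AR_translation sc \<tau>" and q: "quasi_inverse D \<tau> \<tau>' \<alpha> \<beta>" and F: "F = comp_func (shift_func 1) \<tau>'"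
    and X: "cx X" and e: "\<And>i. m \<le> i \<Longrightarrow> exact_at X i" and i: "m - 1 \<le> i"
  shows "exact_at (fobj F X) i"
proof (rule ccontr)
  have ob: "cx (fobj \<tau> Z)" "cx (fobj \<tau>' Z)" if "cx Z" for Z
    using DC.af_ob[OF DC.qi_af(1)[OF q]] DC.af_ob[OF DC.qi_af(2)[OF q]] that by simp_all
  note oX = ob(2)[OF X]
  have FX: "fobj F X = cshift 1 (fobj \<tau>' X)" unfolding F comp_func_def shift_func_simps by simp
  assume "\<not> exact_at (fobj F X) i"
  then have "DC.nz (regs i) (cshift 1 (fobj \<tau>' X))" unfolding FX exact_at_iff[OF cx_cshift[OF oX]] by blast
  then have "DC.nz (regs (i + 1)) (fobj \<tau>' X)"
    using nz_cshift[OF cx_regs oX, of 1 "i + 1"] unfolding cshift_regs by simp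
  then obtain Z where Z: "indecomposable D Z" "DC.nz Z (fobj \<tau>' X)" "\<And>V. \<lbrakk>cx V; DC.nz Z V\<rbrakk> \<Longrightarrow> DC.nz (regs (i + 1)) V"
    using ex_indecomposable_retract[OF oX] by blast
  have Zo: "cx Z" using Z(1) unfolding indecomposable_def by simp
  let ?W = "fobj \<tau> Z"
  note W = ob(1)[OF Zo]
  have "exact_at ?W n" if "n < i + 2" for n
  proof (rule ccontr)
    assume "\<not> exact_at ?W n"
    then have "DC.nz (regs (n - 1)) (cshift 1 ?W)"
      using nz_cshift[OF cx_regs W, of 1 n] unfolding cshift_regs exact_at_iff[OF W] by blast
    \<comment> \<open>Serre duality with \<open>regs (n - 1)\<close> as second object turns this
      into a nonzero morphism from \<open>Z\<close>, which extends to one from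
      \<open>regs (i + 1)\<close>. Stalks in different degrees admit none, so n would be i +
      2.\<close>
    then have "DC.nz (regs (i + 1)) (regs (n - 1))" using serre_duality[OF t Z(1) cx_regs] Z(3)[OF cx_regs] by blast
    from nz_regs[OF this] show False using that by simp
  qed
  then obtain P where P: "perf P" "isomorphic D P ?W" "\<And>n. carr (cmod P n) \<noteq> {0} \<Longrightarrow> i + 2 - 1 \<le> n"
    using truncation[OF W, of "i + 2"] by blast
  \<comment> \<open>The projectives sit in degrees at least i + 1, hence at least
    \<open>m\<close>.\<close>
  have "exact_at X n" if "carr (cmod P n) \<noteq> {0}" for n using e[of n] P(3)[OF that] i by simp
  from perf_nz_zero[OF P(1) X this] have "\<not> DC.nz ?W X"
    using DC.nz_iso1[OF DC.iso_sym[OF P(2)], of X] perf_cx[OF P(1)] W X unfolding D_simps(1) by blast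
  moreover have "DC.nz ?W X" using DC.qi_adj_nz[OF DC.qi_sym[OF q], of Z X] Z(2) Zo X by simp
  ultimately show False ..
qed

lemma exact_at_isomorphic: "\<lbrakk>isomorphic D X Y; cx X; cx Y\<rbrakk> \<Longrightarrow> exact_at X i \<longleftrightarrow> exact_at Y i"
  using DC.nz_iso[of "regs i" "regs i" X Y] DC.iso_refl[of "regs i"] cx_regs by (simp add: exact_at_iff)

lemma AR_functor_orbit:
  assumes t: "AR_translation sc \<tau>" and q: "quasi_inverse D \<tau> \<tau>' \<alpha> \<beta>" and F: "F = comp_func (shift_func 1) \<tau>'"
    and qF: "quasi_inverse D F F' \<eta> \<theta>"
  shows "orbit_free D F F' \<eta> \<theta>"
proof -
  interpret orbit D F F' \<eta> \<theta> by unfold_locales (rule qF)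
  have ob: "cx (fobj (npow F n) X)" if "cx X" for n X using DC.af_ob[OF af_npow[OF DC.qi_af(1)[OF qF]]] that by simp
  have it: "exact_at (fobj (npow F n) X) i" if "cx X" "\<And>i. m \<le> i \<Longrightarrow> exact_at X i" "m - int n \<le> i" for X m n i
    using that(3)
  proof (induction n arbitrary: i)
    case 0
    then show ?case using that(2) by (simp add: id_func_def)
  next
    case (Suc n)
    show ?case using AR_functor_exact[OF t q F ob[OF that(1)], of "m - int n" n i] Suc by (simp add: comp_func_def)
  qed
  have pos: "\<not> isomorphic D (fobj (npow F (Suc n)) X) X" if X: "indecomposable D X" for X n
  proof
    assume iso: "isomorphic D (fobj (npow F (Suc n)) X) X"
    have Xo: "cx X" using X unfolding indecomposable_def by simp
    obtain b where b: "\<And>i. b < \<bar>i\<bar> \<Longrightarrow> carr (cmod X i) = {0}" using cx_bound[OF Xo] by blast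
    \<comment> \<open>\<open>X\<close> is isomorphic to its image under a positive power of
      \<open>F\<close>, whose range of exactness reaches lower; an improvement by one degree is
      enough to repeat the argument indefinitely.\<close>
    have down: "exact_at X i" if "\<And>i. m \<le> i \<Longrightarrow> exact_at X i" "m - 1 \<le> i" for m i
      using it[OF Xo that(1), of m "Suc n" i] that(2) exact_at_isomorphic[OF iso ob[OF Xo] Xo, of i] by simp
    have all: "\<forall>i \<ge> \<bar>b\<bar> + 1 - int k. exact_at X i" for k
    proof (induction k)
      case 0
      then show ?case using exact_at_zero[OF Xo] b by simp
    next
      case (Suc k)
      show ?case using down[of "\<bar>b\<bar> + 1 - int k"] Suc by simp
    qed
    have "exact_at X i" for i using all[of "nat (\<bar>b\<bar> + 1 - i)"] by simp
    then have "zero_object D X" using acyclic_zero[OF Xo] by blast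
    then show False using X unfolding indecomposable_def by blast
  qed
  have free: "\<not> isomorphic D (fobj (ipow F F' k) X) X" if X: "indecomposable D X" and k: "k \<noteq> 0" for X k
  proof
    assume iso: "isomorphic D (fobj (ipow F F' k) X) X"
    have Xo: "X \<in> Ob D" using X unfolding indecomposable_def by blast
    have "isomorphic D (fobj (ipow F F' \<bar>k\<bar>) X) X" using iso pw_fix_neg[OF Xo iso] by (cases "0 \<le> k") simp_all
    moreover obtain n where "nat \<bar>k\<bar> = Suc n" using k by (cases "nat \<bar>k\<bar>") simp_all
    ultimately show False using pos[OF X, of n] unfolding ipow_def by simp
  qed
  show ?thesis by unfold_locales (use indecomposable_nil_or_iso free in blast)+
qed

lemma autoequivalence_orbit:
  assumes G: "triangle_autoequivalence sc G" and qG: "quasi_inverse D G G' \<eta> \<theta>"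
    and g1: "cond_g1 sc G G'" and g2: "cond_g2 sc G G'"
  shows "orbit_free D G G' \<eta> \<theta>"
proof -
  interpret orbit D G G' \<eta> \<theta> by unfold_locales (rule qG)
  have cG: "commutes_shift G" using G triangle_functor_commutes_shift unfolding triangle_autoequivalence_def by blast
  have free: "\<not> isomorphic D (fobj (ipow G G' k) X) X" if X: "indecomposable D X" and k: "k \<noteq> 0" for X k
  proof
    assume iso: "isomorphic D (fobj (ipow G G' k) X) X"
    have Xo: "X \<in> Ob D" using X unfolding indecomposable_def by blast
    obtain i n U where U: "indecomposable (mod_cat sc) U" "isomorphic D (fobj (ipow G G' i) X) (cshift n (stalk U))"
      using g2 X unfolding cond_g2_def by blast
    have "U \<in> Ob (mod_cat sc)" using U(1) unfolding indecomposable_def by blast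
    then have sU: "cx (stalk U)" using cx_stalk by (simp add: mod_cat_def)
    note sn = cx_cshift[OF sU, of n]
    note c = commutes_shift_ipow[OF cG qG, of k]
    note GU = commutes_shiftD[OF c sU]
    \<comment> \<open>Powers commute up to isomorphism, so being fixed passes from \<open>X\<close>
      to its i-th power and from there to the shifted module.\<close>
    have 1: "isomorphic D (fobj (ipow G G' k) (cshift n (stalk U))) (cshift n (stalk U))"
      using DC.iso_trans[OF DC.iso_trans[OF pw_isomorphic[OF DC.iso_sym[OF U(2)], of k] pw_fix[OF Xo iso, of i]] U(2)]
        pw_ob Xo sn by simp
    have "isomorphic D (cshift n (fobj (ipow G G' k) (stalk U))) (cshift n (stalk U))"
      using cx_isomorphic_trans[OF DC.iso_sym[OF GU(2)] 1] cx_cshift[OF GU(1)] pw_ob[of "cshift n (stalk U)" k] sn by simp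
    \<comment> \<open>\<open>G\<close> commutes with the shift, so the module itself, as a complex
      in degree 0, is fixed as well.\<close>
    from cshift_isomorphic[OF this, of "-n"] have "isomorphic D (fobj (ipow G G' k) (stalk U)) (stalk U)"
      using cx_cshift[OF GU(1)] sn unfolding cshift_cshift by (simp add: cshift_0)
    then have "isomorphic D (fobj (ipow G G' (int t * k)) (stalk U)) (stalk U)" for t using pw_fix_mult[of "stalk U"] sU by simp
    \<comment> \<open>All multiples of \<open>k\<close> occur among the exponents that (g1) declares
      finite in number, with \<open>U\<close> itself as the module reached.\<close>
    then have "range (\<lambda>t. int t * k) \<subseteq> {n. \<exists>V. indecomposable (mod_cat sc) V \<and> isomorphic D (fobj (ipow G G' n) (stalk U)) (stalk V)}"
      using U(1) by blast
    moreover have "finite \<dots>" using g1 U(1) unfolding cond_g1_def by blast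
    ultimately have "finite (range (\<lambda>t. int t * k))" by (rule finite_subset)
    moreover have "inj (\<lambda>t. int t * k)" using k by (intro injI) simp
    ultimately show False using finite_imageD infinite_UNIV_nat by blast
  qed
  show ?thesis by unfold_locales (use indecomposable_nil_or_iso free in blast)+
qed

end

theorem proposition2p2:
  fixes sc :: "'k::field \<Rightarrow> 'h::ring_1 \<Rightarrow> 'h"
  assumes "hereditary_algebra sc"
  shows
    "(\<forall>G G' \<eta> \<theta> T'.
        triangle_autoequivalence sc G \<and> quasi_inverse (Db sc) G G' \<eta> \<theta> \<and>
        cond_g1 sc G G' \<and> cond_g2 sc G G' \<and>
        ext_configuration (orbit_cat (Db sc) G G' \<eta> \<theta>) (cshift 1) T' \<longrightarrow>
        ext_configuration (Db sc) (cshift 1)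
          {iso_class (Db sc) X | X.
             indecomposable (Db sc) X \<and> iso_class (orbit_cat (Db sc) G G' \<eta> \<theta>) X \<in> T'})
     \<and>
     (\<forall>\<tau> \<tau>' \<alpha> \<beta> F F' \<eta> \<theta> T.
        AR_translation sc \<tau> \<and> quasi_inverse (Db sc) \<tau> \<tau>' \<alpha> \<beta> \<and>
        F = comp_func (shift_func 1) \<tau>' \<and> quasi_inverse (Db sc) F F' \<eta> \<theta> \<and>
        ext_configuration (Db sc) (cshift 1) T \<longrightarrow>
        ext_configuration (orbit_cat (Db sc) F F' \<eta> \<theta>) (cshift 1)
          {iso_class (orbit_cat (Db sc) F F' \<eta> \<theta>) X | X.
             X \<in> Ob (Db sc) \<and> iso_class (Db sc) X \<in> T})"
proof (intro conjI allI impI; elim conjE)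
  interpret hered sc by unfold_locales (rule assms)
  have s: "cshift 1 X \<in> Ob D" if "X \<in> Ob D" for X using that cx_cshift by simp
  {
    fix G G' :: "('h, 'k) Db_func" and \<eta> \<theta> T'
    assume G: "triangle_autoequivalence sc G" "quasi_inverse D G G' \<eta> \<theta>" "cond_g1 sc G G'" "cond_g2 sc G G'"
      and T: "ext_configuration (orbit_cat D G G' \<eta> \<theta>) (cshift 1) T'"
    interpret orbit_free D G G' \<eta> \<theta> using autoequivalence_orbit[OF G] .
    show "ext_configuration D (cshift 1) {iso_class D X | X. indecomposable D X \<and> iso_class (orbit_cat D G G' \<eta> \<theta>) X \<in> T'}"
      using ext_configuration_orbitD[OF s T] .
  next
    fix \<tau> \<tau>' F F' :: "('h, 'k) Db_func" and \<alpha> \<beta> \<eta> \<theta> T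
    assume t: "AR_translation sc \<tau>" "quasi_inverse D \<tau> \<tau>' \<alpha> \<beta>" and F: "F = comp_func (shift_func 1) \<tau>'"
      and qF: "quasi_inverse D F F' \<eta> \<theta>" and T: "ext_configuration D (cshift 1) T"
    interpret orbit_free D F F' \<eta> \<theta> using AR_functor_orbit[OF t F qF] .
    \<comment> \<open>Stability under one application of \<open>F\<close> and of \<open>F'\<close>;
      powers of either sign follow by iteration.\<close>
    note cl = ext_configuration_closed[OF t F qF T]
    have 1: "iso_class D (fobj (npow F n) X) \<in> T \<and> cx (fobj (npow F n) X)"
      "iso_class D (fobj (npow F' n) X) \<in> T \<and> cx (fobj (npow F' n) X)" if X: "X \<in> Ob D" "iso_class D X \<in> T" for X n
      using cl DC.af_ob[OF DC.qi_af(1)[OF qF]] DC.af_ob[OF DC.qi_af(2)[OF qF]] X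
      by (induction n) (simp_all add: id_func_def comp_func_def)
    have "iso_class D (fobj (ipow F F' k) X) \<in> T" if "X \<in> Ob D" "iso_class D X \<in> T" for X k
      using 1[OF that] unfolding ipow_def by simp
    from ext_configuration_orbitI[OF s T this]
    show "ext_configuration (orbit_cat D F F' \<eta> \<theta>) (cshift 1)
      {iso_class (orbit_cat D F F' \<eta> \<theta>) X | X. X \<in> Ob D \<and> iso_class D X \<in> T}" .
  }
qed

end
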